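(* Let $\omega\in\Omega$ be a finite real orbit with $B_\omega=\emptyset$, let $p=|\omega|$, and let $f=\alpha_0+\alpha_1x+\cdots+\alpha_dx^d\in P=\mathbb K_\omega[x,x^{-1};\tau]$, with $\alpha_0\ne0\ne\alpha_d$, be indecomposable. Let $V=V(\omega,f)$. Then $$V(\omega,f)^\sharp\simeq V(\omega,f^\sharp),\qquad f^\sharp=\sum_{k=0}^d\{k\}_\xi\cdot\tau^k(\overline{\alpha_{d-k}})\cdot x^k,$$ where $\{k\}_\xi=\xi\,\tau(\xi)\cdots\tau^{k-1}(\xi)$ for $k\ge0$ (with $\{0\}_\xi=1$) and $\xi=\big(\sigma(t)\sigma^2(t)\cdots\sigma^p(t)\big)_{\mathfrak m(\omega)}\in\mathbb K_\omega$. In particular, $V$ is pseudo-unitarizable if and only if $f$ is similar to $f^\sharp$ in $P$.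
   Context: Setup. $R$ is a commutative ring with $1$; $*:R\to R$ is a ring automorphism of order $1$ or $2$; $\sigma:R\to R$ is a ring automorphism commuting with $*$; $t\in R$ satisfies $t^*=t$. The generalized Weyl algebra $A=R(\sigma,t)$ is the ring generated by $R\cup\{X,Y\}$ such that $R$ is a subring and $YX=t$, $XY=\sigma(t)$, $Xr=\sigma(r)X$, $Yr=\sigma^{-1}(r)Y$ for all $r\in R$. It is $\mathbb Z$-graded with $\deg X=1$, $\deg Y=-1$, $\deg r=0$ for $r\in R$. The map $*$ extends to an involution of $A$ (additive, $(ab)^*=b^*a^*$, $a^{**}=a$) with $X^*=Y$, $Y^*=X$. $\Omega$ is the set of orbits of $\sigma$ acting on $\mathrm{Max}(R)$. An orbit $\omega$ is real if $\mathfrak m^*=\mathfrak m$ for all $\mathfrak m\in\omega$. $B_\omega=\{\mathfrak m\in\omega:t\in\mathfrak m\}$. $\mathbb K_{\mathfrak m}=R/\mathfrak m$, and $r_{\mathfrak m}=r+\mathfrak m$ for $r\in R$. For each orbit an element $\mathfrak m(\omega)\in\omega$ is fixed and $\mathbb K_\omega=\mathbb K_{\mathfrak m(\omega)}$. $\sigma$ induces isomorphisms $R/\mathfrak m\to R/\sigma(\mathfrak m)$, also denoted $\sigma$, and an additive map $\sigma:R_\omega\to R_\omega$ on $R_\omega=\bigoplus_{\mathfrak m\in\omega}R/\mathfrak m$. For $\omega$ real, conjugation $a\mapsto\overline a$ on $\mathbb K_\omega$ is the map induced by $*$. A weight module is an $A$-module $V=\bigoplus_{\mathfrak m\in\mathrm{Max}(R)}V_{\mathfrak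 m}$ with $V_{\mathfrak m}=\{v:\mathfrak m v=0\}$; $\mathrm{Supp}(V)=\{\mathfrak m:V_{\mathfrak m}\ne0\}$. For a weight module $V$ with $\mathrm{Supp}(V)\subseteq\omega$: an admissible form on $V$ is a map $F:V\times V\to R_\omega$, additive in each argument, with $F(rv,w)=rF(v,w)$ for $r\in R$ and $F(av,w)=\sigma^{\deg a}(F(v,a^*w))$ for homogeneous $a\in A$. It is non-degenerate if for any nonzero $v$ there are $w_1,w_2$ with $F(w_1,v)\ne0\ne F(v,w_2)$. $V$ is pseudo-unitarizable if it has a non-degenerate admissible form. The finitistic dual $V^\sharp$ is the set of additive maps $\varphi:V\to R_\omega$ with $\varphi(rv)=r^*\varphi(v)$ and $\varphi(V_{\mathfrak m})=0$ for all but finitely many $\mathfrak m\in\omega$, an $A$-module via $(r\varphi)(v)=\varphi(r^*v)$, $(X\varphi)(v)=\sigma(\varphi(Yv))$, $(Y\varphi)(v)=\sigma^{-1}(\varphi(Xv))$. With $|\omega|=p<\infty$, $\tau=\sigma^p:\mathbb K_\omega\to\mathbb K_\omega$, and $P=\mathbb K_\omega[x,x^{-1};\tau]$ is the skew Laurent polynomial ring with $xa=\tau(a)x$ for $a\in\mathbb K_\omega$. An element $f\in P$ is indecomposable if the left $P$-module $P/Pf$ is indecomposable; $f,g\in P$ are similar if $P/Pf\simeq P/Pg$ as left $P$-modules. For $|\omega|<\infty$, $B_\omega=\emptyset$ and $f=\alpha_0+\cdots+\alpha_dx^d\in P$ indecomposable with $\alpha_0\ne0\ne\alpha_d$, the module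 $V(\omega,f)=\bigoplus_{\mathfrak m\in\omega}(\mathbb K_{\mathfrak m})^d$ has the natural $R$-action and, for $v\in(\mathbb K_{\mathfrak m})^d$ (with $\sigma$ applied componentwise): $Xv=\sigma(t_{\mathfrak m}v)$ if $\mathfrak m\ne\mathfrak m(\omega)$, $Xv=\sigma(F_ft_{\mathfrak m}v)$ if $\mathfrak m=\mathfrak m(\omega)$; $Yv=\sigma^{-1}(v)$ if $\sigma^{-1}(\mathfrak m)\ne\mathfrak m(\omega)$, $Yv=F_f^{-1}\sigma^{-1}(v)$ if $\sigma^{-1}(\mathfrak m)=\mathfrak m(\omega)$. Here $F_f$ is the $d\times d$ companion matrix over $\mathbb K_\omega$ with $F_fe_i=e_{i+1}$ for $1\le i<d$ and $F_fe_d=-\sum_{k=0}^{d-1}(\alpha_k/\alpha_d)e_{k+1}$, where $e_1,\dots,e_d$ is the standard basis of column vectors. *)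

theory Defs
  imports "HOL-Algebra.Module" "HOL-Algebra.QuotRing"
begin

section \<open>Left modules over a not necessarily commutative ring\<close>

text \<open>The locale \<^locale>\<open>module\<close> requires a commutative base ring. Its record type is reused here;
  the fields \<^const>\<open>mult\<close> and \<^const>\<open>one\<close> of a module play no role.\<close>

locale left_module = A?: ring A + M?: abelian_group M
  for A :: "('a, 'c) ring_scheme" (structure) and M :: "('a, 'v, 'd) module_scheme" (structure) +
  assumes smult_closed: "\<lbrakk>a \<in> carrier A; x \<in> carrier M\<rbrakk> \<Longrightarrow> a \<odot>\<^bsub>M\<^esub> x \<in> carrier M"
    and smult_l_distr: "\<lbrakk>a \<in> carrier A; b \<in> carrier A; x \<in> carrier M\<rbrakk> \<Longrightarrow>
      (a \<oplus>\<^bsub>A\<^esub> b) \<odot>\<^bsub>M\<^esub> x = a \<odot>\<^bsub>M\<^esub> x \<oplus>\<^bsub>M\<^esub> b \<odot>\<^bsub>M\<^esub> x"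
    and smult_r_distr: "\<lbrakk>a \<in> carrier A; x \<in> carrier M; y \<in> carrier M\<rbrakk> \<Longrightarrow>
      a \<odot>\<^bsub>M\<^esub> (x \<oplus>\<^bsub>M\<^esub> y) = a \<odot>\<^bsub>M\<^esub> x \<oplus>\<^bsub>M\<^esub> a \<odot>\<^bsub>M\<^esub> y"
    and smult_assoc: "\<lbrakk>a \<in> carrier A; b \<in> carrier A; x \<in> carrier M\<rbrakk> \<Longrightarrow>
      (a \<otimes>\<^bsub>A\<^esub> b) \<odot>\<^bsub>M\<^esub> x = a \<odot>\<^bsub>M\<^esub> (b \<odot>\<^bsub>M\<^esub> x)"
    and smult_one: "x \<in> carrier M \<Longrightarrow> \<one>\<^bsub>A\<^esub> \<odot>\<^bsub>M\<^esub> x = x"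

definition module_isomorphic ::
    "('a, 'c) ring_scheme \<Rightarrow> ('a, 'u, 'd) module_scheme \<Rightarrow> ('a, 'v, 'e) module_scheme \<Rightarrow> bool" where
  "module_isomorphic A M N \<longleftrightarrow> left_module A M \<and> left_module A N \<and>
     (\<exists>h. bij_betw h (carrier M) (carrier N) \<and>
        (\<forall>u\<in>carrier M. \<forall>v\<in>carrier M. h (u \<oplus>\<^bsub>M\<^esub> v) = h u \<oplus>\<^bsub>N\<^esub> h v) \<and>
        (\<forall>a\<in>carrier A. \<forall>v\<in>carrier M. h (a \<odot>\<^bsub>M\<^esub> v) = a \<odot>\<^bsub>N\<^esub> h v))"

definition indecomposable_module :: "('a, 'c) ring_scheme \<Rightarrow> ('a, 'u, 'd) module_scheme \<Rightarrow> bool" where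
  "indecomposable_module A M \<longleftrightarrow> carrier M \<noteq> {\<zero>\<^bsub>M\<^esub>} \<and>
     (\<forall>N1 N2. submodule N1 A M \<and> submodule N2 A M \<and>
        N1 \<inter> N2 = {\<zero>\<^bsub>M\<^esub>} \<and> N1 <+>\<^bsub>M\<^esub> N2 = carrier M \<longrightarrow>
        N1 = {\<zero>\<^bsub>M\<^esub>} \<or> N2 = {\<zero>\<^bsub>M\<^esub>})"

definition direct_sum :: "'i set \<Rightarrow> ('i \<Rightarrow> ('a, 'u, 'd) module_scheme) \<Rightarrow> ('a, 'i \<Rightarrow> 'u) module" where
  "direct_sum I M =
     \<lparr>carrier = {u \<in> (\<Pi>\<^sub>E i\<in>I. carrier (M i)). finite {i \<in> I. u i \<noteq> \<zero>\<^bsub>M i\<^esub>}},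
      mult = undefined, one = undefined,
      zero = (\<lambda>i\<in>I. \<zero>\<^bsub>M i\<^esub>),
      add = (\<lambda>u v. \<lambda>i\<in>I. u i \<oplus>\<^bsub>M i\<^esub> v i),
      smult = (\<lambda>a u. \<lambda>i\<in>I. a \<odot>\<^bsub>M i\<^esub> u i)\<rparr>"

definition quotient_module :: "('a, 'c) ring_scheme \<Rightarrow> 'a set \<Rightarrow> ('a, 'a set) module" where
  "quotient_module A I =
     \<lparr>carrier = a_rcosets\<^bsub>A\<^esub> I, mult = undefined, one = undefined, zero = I, add = set_add A,
      smult = (\<lambda>a C. \<Union>c\<in>C. I +>\<^bsub>A\<^esub> (a \<otimes>\<^bsub>A\<^esub> c))\<rparr>"


section \<open>Powers of automorphisms, maximal ideals and orbits\<close>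

definition zpow :: "'a set \<Rightarrow> ('a \<Rightarrow> 'a) \<Rightarrow> int \<Rightarrow> 'a \<Rightarrow> 'a" where
  "zpow S \<phi> n = (if 0 \<le> n then \<phi> ^^ nat n else inv_into S \<phi> ^^ nat (- n))"

definition Max_spec :: "('a, 'c) ring_scheme \<Rightarrow> 'a set set" where
  "Max_spec R = {\<mm>. maximalideal \<mm> R}"

definition orbit_of :: "('a, 'c) ring_scheme \<Rightarrow> ('a \<Rightarrow> 'a) \<Rightarrow> 'a set \<Rightarrow> 'a set set" where
  "orbit_of R \<sigma> \<mm> = range (\<lambda>n::int. zpow (carrier R) \<sigma> n ` \<mm>)"

definition Orbits :: "('a, 'c) ring_scheme \<Rightarrow> ('a \<Rightarrow> 'a) \<Rightarrow> 'a set set set" where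
  "Orbits R \<sigma> = orbit_of R \<sigma> ` Max_spec R"

definition real_orbit :: "('a \<Rightarrow> 'a) \<Rightarrow> 'a set set \<Rightarrow> bool" where
  "real_orbit star \<omega> \<longleftrightarrow> (\<forall>\<mm>\<in>\<omega>. star ` \<mm> = \<mm>)"

definition breaks :: "'a \<Rightarrow> 'a set set \<Rightarrow> 'a set set" where
  "breaks t \<omega> = {\<mm> \<in> \<omega>. t \<in> \<mm>}"


section \<open>Residue fields\<close>

text \<open>The residue field \<open>\<K>\<^sub>\<mm>\<close> is \<^term>\<open>R Quot \<mm>\<close>, and \<open>r\<^sub>\<mm>\<close> is the coset \<^term>\<open>\<mm> +>\<^bsub>R\<^esub> r\<close>. An
  automorphism \<open>\<phi>\<close> of \<open>R\<close> induces \<open>R/\<mm> \<rightarrow> R/\<phi>(\<mm>)\<close>, and this induced map sends a coset \<open>c\<close> to the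
  image set \<open>\<phi> ` c\<close>. In particular \<open>\<sigma>\<close>, \<open>\<tau> = \<sigma>\<^sup>p\<close> and conjugation all act on cosets by images.\<close>

definition residue_module :: "('a, 'c) ring_scheme \<Rightarrow> 'a set \<Rightarrow> ('a, 'a set) module" where
  "residue_module R \<mm> =
     \<lparr>carrier = carrier (R Quot \<mm>), mult = undefined, one = undefined,
      zero = \<zero>\<^bsub>R Quot \<mm>\<^esub>, add = add (R Quot \<mm>),
      smult = (\<lambda>r c. (\<mm> +>\<^bsub>R\<^esub> r) \<otimes>\<^bsub>R Quot \<mm>\<^esub> c)\<rparr>"

definition R_omega :: "('a, 'c) ring_scheme \<Rightarrow> 'a set set \<Rightarrow> ('a, 'a set \<Rightarrow> 'a set) module" where
  "R_omega R \<omega> = direct_sum \<omega> (residue_module R)"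

text \<open>The \<open>n\<close>-th power of the additive map \<open>\<sigma> : R\<^sub>\<omega> \<rightarrow> R\<^sub>\<omega>\<close>.\<close>

definition sigma_omega ::
    "('a, 'c) ring_scheme \<Rightarrow> ('a \<Rightarrow> 'a) \<Rightarrow> 'a set set \<Rightarrow> int \<Rightarrow> ('a set \<Rightarrow> 'a set) \<Rightarrow> 'a set \<Rightarrow> 'a set" where
  "sigma_omega R \<sigma> \<omega> n u =
     (\<lambda>\<mm>\<in>\<omega>. zpow (carrier R) \<sigma> n ` u (zpow (carrier R) \<sigma> (- n) ` \<mm>))"


section \<open>The generalized Weyl algebra by generators and relations\<close>

text \<open>The ring generated by \<open>R \<union> {X, Y}\<close> subject to the operations of \<open>R\<close> and the defining relations:
  ring expressions in the generators modulo the least congruence that contains the ring axioms,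
  the operations of \<open>R\<close> and the relations. That \<open>R\<close> embeds as a subring is then a theorem (the algebra
  is free over \<open>R\<close> on \<open>1, X, Y, X\<^sup>2, Y\<^sup>2, \<dots>\<close>).\<close>

datatype (gwa_coeffs: 'a) gwa_term =
    Coeff 'a
  | GX
  | GY
  | Add "'a gwa_term" "'a gwa_term"
  | Neg "'a gwa_term"
  | Mul "'a gwa_term" "'a gwa_term"

definition gwa_terms :: "('a, 'c) ring_scheme \<Rightarrow> 'a gwa_term set" where
  "gwa_terms R = {e. gwa_coeffs e \<subseteq> carrier R}"

inductive gwa_eq :: "('a, 'c) ring_scheme \<Rightarrow> ('a \<Rightarrow> 'a) \<Rightarrow> 'a \<Rightarrow> 'a gwa_term \<Rightarrow> 'a gwa_term \<Rightarrow> bool"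
  for R :: "('a, 'c) ring_scheme" and \<sigma> :: "'a \<Rightarrow> 'a" and t :: 'a where
  refl: "a \<in> gwa_terms R \<Longrightarrow> gwa_eq R \<sigma> t a a"
| sym: "gwa_eq R \<sigma> t a b \<Longrightarrow> gwa_eq R \<sigma> t b a"
| trans: "gwa_eq R \<sigma> t a b \<Longrightarrow> gwa_eq R \<sigma> t b c \<Longrightarrow> gwa_eq R \<sigma> t a c"
| add_cong: "gwa_eq R \<sigma> t a a' \<Longrightarrow> gwa_eq R \<sigma> t b b' \<Longrightarrow> gwa_eq R \<sigma> t (Add a b) (Add a' b')"
| neg_cong: "gwa_eq R \<sigma> t a a' \<Longrightarrow> gwa_eq R \<sigma> t (Neg a) (Neg a')"
| mul_cong: "gwa_eq R \<sigma> t a a' \<Longrightarrow> gwa_eq R \<sigma> t b b' \<Longrightarrow> gwa_eq R \<sigma> t (Mul a b) (Mul a' b')"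
| add_assoc: "\<lbrakk>a \<in> gwa_terms R; b \<in> gwa_terms R; c \<in> gwa_terms R\<rbrakk> \<Longrightarrow>
    gwa_eq R \<sigma> t (Add (Add a b) c) (Add a (Add b c))"
| add_comm: "\<lbrakk>a \<in> gwa_terms R; b \<in> gwa_terms R\<rbrakk> \<Longrightarrow> gwa_eq R \<sigma> t (Add a b) (Add b a)"
| add_zero: "a \<in> gwa_terms R \<Longrightarrow> gwa_eq R \<sigma> t (Add (Coeff \<zero>\<^bsub>R\<^esub>) a) a"
| add_neg: "a \<in> gwa_terms R \<Longrightarrow> gwa_eq R \<sigma> t (Add (Neg a) a) (Coeff \<zero>\<^bsub>R\<^esub>)"
| mul_assoc: "\<lbrakk>a \<in> gwa_terms R; b \<in> gwa_terms R; c \<in> gwa_terms R\<rbrakk> \<Longrightarrow>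
    gwa_eq R \<sigma> t (Mul (Mul a b) c) (Mul a (Mul b c))"
| mul_one_left: "a \<in> gwa_terms R \<Longrightarrow> gwa_eq R \<sigma> t (Mul (Coeff \<one>\<^bsub>R\<^esub>) a) a"
| mul_one_right: "a \<in> gwa_terms R \<Longrightarrow> gwa_eq R \<sigma> t (Mul a (Coeff \<one>\<^bsub>R\<^esub>)) a"
| distrib_left: "\<lbrakk>a \<in> gwa_terms R; b \<in> gwa_terms R; c \<in> gwa_terms R\<rbrakk> \<Longrightarrow>
    gwa_eq R \<sigma> t (Mul a (Add b c)) (Add (Mul a b) (Mul a c))"
| distrib_right: "\<lbrakk>a \<in> gwa_terms R; b \<in> gwa_terms R; c \<in> gwa_terms R\<rbrakk> \<Longrightarrow>
    gwa_eq R \<sigma> t (Mul (Add a b) c) (Add (Mul a c) (Mul b c))"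
| coeff_add: "\<lbrakk>r \<in> carrier R; s \<in> carrier R\<rbrakk> \<Longrightarrow>
    gwa_eq R \<sigma> t (Coeff (r \<oplus>\<^bsub>R\<^esub> s)) (Add (Coeff r) (Coeff s))"
| coeff_mult: "\<lbrakk>r \<in> carrier R; s \<in> carrier R\<rbrakk> \<Longrightarrow>
    gwa_eq R \<sigma> t (Coeff (r \<otimes>\<^bsub>R\<^esub> s)) (Mul (Coeff r) (Coeff s))"
| YX: "gwa_eq R \<sigma> t (Mul GY GX) (Coeff t)"
| XY: "gwa_eq R \<sigma> t (Mul GX GY) (Coeff (\<sigma> t))"
| X_coeff: "r \<in> carrier R \<Longrightarrow> gwa_eq R \<sigma> t (Mul GX (Coeff r)) (Mul (Coeff (\<sigma> r)) GX)"
| Y_coeff: "r \<in> carrier R \<Longrightarrow>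
    gwa_eq R \<sigma> t (Mul GY (Coeff r)) (Mul (Coeff (inv_into (carrier R) \<sigma> r)) GY)"

definition gwa_class ::
    "('a, 'c) ring_scheme \<Rightarrow> ('a \<Rightarrow> 'a) \<Rightarrow> 'a \<Rightarrow> 'a gwa_term \<Rightarrow> 'a gwa_term set" where
  "gwa_class R \<sigma> t a = {b. gwa_eq R \<sigma> t a b}"

definition gwa :: "('a, 'c) ring_scheme \<Rightarrow> ('a \<Rightarrow> 'a) \<Rightarrow> 'a \<Rightarrow> 'a gwa_term set ring" where
  "gwa R \<sigma> t =
     \<lparr>carrier = gwa_class R \<sigma> t ` gwa_terms R,
      mult = (\<lambda>A B. \<Union>a\<in>A. \<Union>b\<in>B. gwa_class R \<sigma> t (Mul a b)),
      one = gwa_class R \<sigma> t (Coeff \<one>\<^bsub>R\<^esub>),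
      zero = gwa_class R \<sigma> t (Coeff \<zero>\<^bsub>R\<^esub>),
      add = (\<lambda>A B. \<Union>a\<in>A. \<Union>b\<in>B. gwa_class R \<sigma> t (Add a b))\<rparr>"

abbreviation gwa_coeff :: "('a, 'c) ring_scheme \<Rightarrow> ('a \<Rightarrow> 'a) \<Rightarrow> 'a \<Rightarrow> 'a \<Rightarrow> 'a gwa_term set" where
  "gwa_coeff R \<sigma> t r \<equiv> gwa_class R \<sigma> t (Coeff r)"

abbreviation gwa_X :: "('a, 'c) ring_scheme \<Rightarrow> ('a \<Rightarrow> 'a) \<Rightarrow> 'a \<Rightarrow> 'a gwa_term set" where
  "gwa_X R \<sigma> t \<equiv> gwa_class R \<sigma> t GX"

abbreviation gwa_Y :: "('a, 'c) ring_scheme \<Rightarrow> ('a \<Rightarrow> 'a) \<Rightarrow> 'a \<Rightarrow> 'a gwa_term set" where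
  "gwa_Y R \<sigma> t \<equiv> gwa_class R \<sigma> t GY"

primrec term_star :: "('a \<Rightarrow> 'a) \<Rightarrow> 'a gwa_term \<Rightarrow> 'a gwa_term" where
  "term_star star (Coeff r) = Coeff (star r)"
| "term_star star GX = GY"
| "term_star star GY = GX"
| "term_star star (Add a b) = Add (term_star star a) (term_star star b)"
| "term_star star (Neg a) = Neg (term_star star a)"
| "term_star star (Mul a b) = Mul (term_star star b) (term_star star a)"

definition gwa_star ::
    "('a, 'c) ring_scheme \<Rightarrow> ('a \<Rightarrow> 'a) \<Rightarrow> ('a \<Rightarrow> 'a) \<Rightarrow> 'a \<Rightarrow> 'a gwa_term set \<Rightarrow> 'a gwa_term set" where
  "gwa_star R star \<sigma> t A = (\<Union>a\<in>A. gwa_class R \<sigma> t (term_star star a))"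

text \<open>Expressions all of whose monomials have degree \<open>n\<close>. An element of the algebra is homogeneous of
  degree \<open>n\<close> if some such expression represents it.\<close>

inductive homogeneous_term :: "int \<Rightarrow> 'a gwa_term \<Rightarrow> bool" where
  "homogeneous_term 0 (Coeff r)"
| "homogeneous_term 1 GX"
| "homogeneous_term (- 1) GY"
| "homogeneous_term n a \<Longrightarrow> homogeneous_term n b \<Longrightarrow> homogeneous_term n (Add a b)"
| "homogeneous_term n a \<Longrightarrow> homogeneous_term n (Neg a)"
| "homogeneous_term m a \<Longrightarrow> homogeneous_term n b \<Longrightarrow> homogeneous_term (m + n) (Mul a b)"

definition gwa_degree :: "('a, 'c) ring_scheme \<Rightarrow> ('a \<Rightarrow> 'a) \<Rightarrow> 'a \<Rightarrow> int \<Rightarrow> 'a gwa_term set set" where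
  "gwa_degree R \<sigma> t n = gwa_class R \<sigma> t ` {e \<in> gwa_terms R. homogeneous_term n e}"

text \<open>The \<open>A\<close>-module given by an \<open>R\<close>-module together with the actions of \<open>X\<close> and \<open>Y\<close>. The choice of a
  representative is immaterial as soon as \<open>X\<close> and \<open>Y\<close> act additively and satisfy the defining
  relations.\<close>

primrec term_act ::
    "('a, 'v, 'd) module_scheme \<Rightarrow> ('v \<Rightarrow> 'v) \<Rightarrow> ('v \<Rightarrow> 'v) \<Rightarrow> 'a gwa_term \<Rightarrow> 'v \<Rightarrow> 'v" where
  "term_act M X Y (Coeff r) v = r \<odot>\<^bsub>M\<^esub> v"
| "term_act M X Y GX v = X v"
| "term_act M X Y GY v = Y v"
| "term_act M X Y (Add a b) v = term_act M X Y a v \<oplus>\<^bsub>M\<^esub> term_act M X Y b v"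
| "term_act M X Y (Neg a) v = \<ominus>\<^bsub>M\<^esub> term_act M X Y a v"
| "term_act M X Y (Mul a b) v = term_act M X Y a (term_act M X Y b v)"

definition gwa_module ::
    "('a, 'v, 'd) module_scheme \<Rightarrow> ('v \<Rightarrow> 'v) \<Rightarrow> ('v \<Rightarrow> 'v) \<Rightarrow> ('a gwa_term set, 'v) module" where
  "gwa_module M X Y =
     \<lparr>carrier = carrier M, mult = undefined, one = undefined, zero = \<zero>\<^bsub>M\<^esub>, add = add M,
      smult = (\<lambda>A v. term_act M X Y (SOME a. a \<in> A) v)\<rparr>"


section \<open>Weight modules, admissible forms and the finitistic dual\<close>

definition weight_space ::
    "('a, 'c) ring_scheme \<Rightarrow> ('a \<Rightarrow> 'a) \<Rightarrow> 'a \<Rightarrow> ('a gwa_term set, 'v, 'd) module_scheme \<Rightarrow> 'a set \<Rightarrow> 'v set"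
  where
  "weight_space R \<sigma> t V \<mm> = {v \<in> carrier V. \<forall>r\<in>\<mm>. gwa_coeff R \<sigma> t r \<odot>\<^bsub>V\<^esub> v = \<zero>\<^bsub>V\<^esub>}"

definition weight_module ::
    "('a, 'c) ring_scheme \<Rightarrow> ('a \<Rightarrow> 'a) \<Rightarrow> 'a \<Rightarrow> ('a gwa_term set, 'v, 'd) module_scheme \<Rightarrow> bool" where
  "weight_module R \<sigma> t V \<longleftrightarrow> left_module (gwa R \<sigma> t) V \<and>
     (\<forall>v\<in>carrier V. \<exists>!u. u \<in> (\<Pi>\<^sub>E \<mm>\<in>Max_spec R. weight_space R \<sigma> t V \<mm>) \<and>
        finite {\<mm> \<in> Max_spec R. u \<mm> \<noteq> \<zero>\<^bsub>V\<^esub>} \<and>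
        v = finsum V u {\<mm> \<in> Max_spec R. u \<mm> \<noteq> \<zero>\<^bsub>V\<^esub>})"

definition weight_support ::
    "('a, 'c) ring_scheme \<Rightarrow> ('a \<Rightarrow> 'a) \<Rightarrow> 'a \<Rightarrow> ('a gwa_term set, 'v, 'd) module_scheme \<Rightarrow> 'a set set"
  where
  "weight_support R \<sigma> t V = {\<mm> \<in> Max_spec R. weight_space R \<sigma> t V \<mm> \<noteq> {\<zero>\<^bsub>V\<^esub>}}"

definition admissible_form ::
    "('a, 'c) ring_scheme \<Rightarrow> ('a \<Rightarrow> 'a) \<Rightarrow> ('a \<Rightarrow> 'a) \<Rightarrow> 'a \<Rightarrow> 'a set set \<Rightarrow>
     ('a gwa_term set, 'v, 'd) module_scheme \<Rightarrow> ('v \<Rightarrow> 'v \<Rightarrow> 'a set \<Rightarrow> 'a set) \<Rightarrow> bool" where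
  "admissible_form R star \<sigma> t \<omega> V F \<longleftrightarrow>
     (\<forall>v\<in>carrier V. \<forall>w\<in>carrier V. F v w \<in> carrier (R_omega R \<omega>)) \<and>
     (\<forall>v\<in>carrier V. \<forall>v'\<in>carrier V. \<forall>w\<in>carrier V.
        F (v \<oplus>\<^bsub>V\<^esub> v') w = F v w \<oplus>\<^bsub>R_omega R \<omega>\<^esub> F v' w) \<and>
     (\<forall>v\<in>carrier V. \<forall>w\<in>carrier V. \<forall>w'\<in>carrier V.
        F v (w \<oplus>\<^bsub>V\<^esub> w') = F v w \<oplus>\<^bsub>R_omega R \<omega>\<^esub> F v w') \<and>
     (\<forall>r\<in>carrier R. \<forall>v\<in>carrier V. \<forall>w\<in>carrier V.
        F (gwa_coeff R \<sigma> t r \<odot>\<^bsub>V\<^esub> v) w = r \<odot>\<^bsub>R_omega R \<omega>\<^esub> F v w) \<and>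
     (\<forall>n. \<forall>a\<in>gwa_degree R \<sigma> t n. \<forall>v\<in>carrier V. \<forall>w\<in>carrier V.
        F (a \<odot>\<^bsub>V\<^esub> v) w = sigma_omega R \<sigma> \<omega> n (F v (gwa_star R star \<sigma> t a \<odot>\<^bsub>V\<^esub> w)))"

definition nondegenerate_form ::
    "('a, 'c) ring_scheme \<Rightarrow> 'a set set \<Rightarrow> ('b, 'v, 'd) module_scheme \<Rightarrow>
     ('v \<Rightarrow> 'v \<Rightarrow> 'a set \<Rightarrow> 'a set) \<Rightarrow> bool" where
  "nondegenerate_form R \<omega> V F \<longleftrightarrow>
     (\<forall>v\<in>carrier V. v \<noteq> \<zero>\<^bsub>V\<^esub> \<longrightarrow>
        (\<exists>w1\<in>carrier V. \<exists>w2\<in>carrier V.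
           F w1 v \<noteq> \<zero>\<^bsub>R_omega R \<omega>\<^esub> \<and> F v w2 \<noteq> \<zero>\<^bsub>R_omega R \<omega>\<^esub>))"

definition pseudo_unitarizable ::
    "('a, 'c) ring_scheme \<Rightarrow> ('a \<Rightarrow> 'a) \<Rightarrow> ('a \<Rightarrow> 'a) \<Rightarrow> 'a \<Rightarrow> 'a set set \<Rightarrow>
     ('a gwa_term set, 'v, 'd) module_scheme \<Rightarrow> bool" where
  "pseudo_unitarizable R star \<sigma> t \<omega> V \<longleftrightarrow>
     weight_module R \<sigma> t V \<and> weight_support R \<sigma> t V \<subseteq> \<omega> \<and>
     (\<exists>F. admissible_form R star \<sigma> t \<omega> V F \<and> nondegenerate_form R \<omega> V F)"

definition sharp_R_module ::
    "('a, 'c) ring_scheme \<Rightarrow> ('a \<Rightarrow> 'a) \<Rightarrow> ('a \<Rightarrow> 'a) \<Rightarrow> 'a \<Rightarrow> 'a set set \<Rightarrow>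
     ('a gwa_term set, 'v, 'd) module_scheme \<Rightarrow> ('a, 'v \<Rightarrow> 'a set \<Rightarrow> 'a set) module" where
  "sharp_R_module R star \<sigma> t \<omega> V =
     \<lparr>carrier = {\<phi> \<in> carrier V \<rightarrow>\<^sub>E carrier (R_omega R \<omega>).
        (\<forall>v\<in>carrier V. \<forall>w\<in>carrier V. \<phi> (v \<oplus>\<^bsub>V\<^esub> w) = \<phi> v \<oplus>\<^bsub>R_omega R \<omega>\<^esub> \<phi> w) \<and>
        (\<forall>r\<in>carrier R. \<forall>v\<in>carrier V.
           \<phi> (gwa_coeff R \<sigma> t r \<odot>\<^bsub>V\<^esub> v) = star r \<odot>\<^bsub>R_omega R \<omega>\<^esub> \<phi> v) \<and>
        finite {\<mm> \<in> \<omega>. \<exists>v\<in>weight_space R \<sigma> t V \<mm>. \<phi> v \<noteq> \<zero>\<^bsub>R_omega R \<omega>\<^esub>}},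
      mult = undefined, one = undefined,
      zero = (\<lambda>v\<in>carrier V. \<zero>\<^bsub>R_omega R \<omega>\<^esub>),
      add = (\<lambda>\<phi> \<psi>. \<lambda>v\<in>carrier V. \<phi> v \<oplus>\<^bsub>R_omega R \<omega>\<^esub> \<psi> v),
      smult = (\<lambda>r \<phi>. \<lambda>v\<in>carrier V. \<phi> (gwa_coeff R \<sigma> t (star r) \<odot>\<^bsub>V\<^esub> v))\<rparr>"

definition finitistic_dual ::
    "('a, 'c) ring_scheme \<Rightarrow> ('a \<Rightarrow> 'a) \<Rightarrow> ('a \<Rightarrow> 'a) \<Rightarrow> 'a \<Rightarrow> 'a set set \<Rightarrow>
     ('a gwa_term set, 'v, 'd) module_scheme \<Rightarrow>
     ('a gwa_term set, 'v \<Rightarrow> 'a set \<Rightarrow> 'a set) module" where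
  "finitistic_dual R star \<sigma> t \<omega> V =
     gwa_module (sharp_R_module R star \<sigma> t \<omega> V)
       (\<lambda>\<phi>. \<lambda>v\<in>carrier V. sigma_omega R \<sigma> \<omega> 1 (\<phi> (gwa_Y R \<sigma> t \<odot>\<^bsub>V\<^esub> v)))
       (\<lambda>\<phi>. \<lambda>v\<in>carrier V. sigma_omega R \<sigma> \<omega> (- 1) (\<phi> (gwa_X R \<sigma> t \<odot>\<^bsub>V\<^esub> v)))"


section \<open>Skew Laurent polynomials\<close>

text \<open>An element \<open>\<Sum>\<^sub>n f\<^sub>n x\<^sup>n\<close>, with coefficients on the left, is its coefficient function.\<close>

definition skew_laurent :: "('k, 'c) ring_scheme \<Rightarrow> ('k \<Rightarrow> 'k) \<Rightarrow> (int \<Rightarrow> 'k) ring" where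
  "skew_laurent K \<tau> =
     \<lparr>carrier = {f. (\<forall>n. f n \<in> carrier K) \<and> finite {n. f n \<noteq> \<zero>\<^bsub>K\<^esub>}},
      mult = (\<lambda>f g n. \<Oplus>\<^bsub>K\<^esub>i\<in>{i. f i \<noteq> \<zero>\<^bsub>K\<^esub>}. f i \<otimes>\<^bsub>K\<^esub> zpow (carrier K) \<tau> i (g (n - i))),
      one = (\<lambda>n. if n = 0 then \<one>\<^bsub>K\<^esub> else \<zero>\<^bsub>K\<^esub>),
      zero = (\<lambda>n. \<zero>\<^bsub>K\<^esub>),
      add = (\<lambda>f g n. f n \<oplus>\<^bsub>K\<^esub> g n)\<rparr>"

definition skew_poly :: "('k, 'c) ring_scheme \<Rightarrow> nat \<Rightarrow> (nat \<Rightarrow> 'k) \<Rightarrow> int \<Rightarrow> 'k" where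
  "skew_poly K d \<alpha> = (\<lambda>n. if 0 \<le> n \<and> n \<le> int d then \<alpha> (nat n) else \<zero>\<^bsub>K\<^esub>)"

text \<open>\<^term>\<open>PIdl\<^bsub>P\<^esub> f\<close> consists of the left multiples of \<open>f\<close>, i.e. it is the left ideal \<open>P f\<close>.\<close>

definition indecomposable_elem :: "('q, 'c) ring_scheme \<Rightarrow> 'q \<Rightarrow> bool" where
  "indecomposable_elem P f \<longleftrightarrow> indecomposable_module P (quotient_module P (PIdl\<^bsub>P\<^esub> f))"

definition similar :: "('q, 'c) ring_scheme \<Rightarrow> 'q \<Rightarrow> 'q \<Rightarrow> bool" where
  "similar P f g \<longleftrightarrow>
     module_isomorphic P (quotient_module P (PIdl\<^bsub>P\<^esub> f)) (quotient_module P (PIdl\<^bsub>P\<^esub> g))"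


section \<open>The modules \<open>V(\<omega>, f)\<close>\<close>

text \<open>Vectors and matrices are indexed by \<open>{1..d}\<close>, and \<open>i\<close> is the row index.\<close>

definition companion :: "('k, 'c) ring_scheme \<Rightarrow> nat \<Rightarrow> (nat \<Rightarrow> 'k) \<Rightarrow> nat \<Rightarrow> nat \<Rightarrow> 'k" where
  "companion K d \<alpha> i j =
     (if j < d then (if i = j + 1 then \<one>\<^bsub>K\<^esub> else \<zero>\<^bsub>K\<^esub>)
      else \<ominus>\<^bsub>K\<^esub> (\<alpha> (i - 1) \<otimes>\<^bsub>K\<^esub> inv\<^bsub>K\<^esub> \<alpha> d))"

definition mat_vec :: "('k, 'c) ring_scheme \<Rightarrow> nat \<Rightarrow> (nat \<Rightarrow> nat \<Rightarrow> 'k) \<Rightarrow> (nat \<Rightarrow> 'k) \<Rightarrow> nat \<Rightarrow> 'k" where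
  "mat_vec K d F v = (\<lambda>i\<in>{1..d}. \<Oplus>\<^bsub>K\<^esub>j\<in>{1..d}. F i j \<otimes>\<^bsub>K\<^esub> v j)"

text \<open>The action of the inverse matrix, i.e. the inverse of the bijection \<open>v \<mapsto> F v\<close> of \<open>K\<^sup>d\<close>. The
  companion matrix is invertible because \<open>\<alpha>\<^sub>0 \<noteq> 0\<close>.\<close>

definition mat_inv_vec :: "('k, 'c) ring_scheme \<Rightarrow> nat \<Rightarrow> (nat \<Rightarrow> nat \<Rightarrow> 'k) \<Rightarrow> (nat \<Rightarrow> 'k) \<Rightarrow> nat \<Rightarrow> 'k" where
  "mat_inv_vec K d F = inv_into ({1..d} \<rightarrow>\<^sub>E carrier K) (mat_vec K d F)"

definition V_R_module ::
    "('a, 'c) ring_scheme \<Rightarrow> 'a set set \<Rightarrow> nat \<Rightarrow> ('a, 'a set \<Rightarrow> nat \<Rightarrow> 'a set) module" where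
  "V_R_module R \<omega> d = direct_sum \<omega> (\<lambda>\<mm>. direct_sum {1..d} (\<lambda>_. residue_module R \<mm>))"

text \<open>The component of \<open>X v\<close> at \<open>\<mm>\<close> comes from the component \<open>v\<^sub>\<nn>\<close> with \<open>\<nn> = \<sigma>\<^sup>-\<^sup>1(\<mm>)\<close>, that of \<open>Y v\<close> from
  \<open>v\<^sub>\<nn>\<close> with \<open>\<nn> = \<sigma>(\<mm>)\<close>.\<close>

definition V_X ::
    "('a, 'c) ring_scheme \<Rightarrow> ('a \<Rightarrow> 'a) \<Rightarrow> 'a \<Rightarrow> 'a set set \<Rightarrow> 'a set \<Rightarrow> nat \<Rightarrow> (nat \<Rightarrow> 'a set) \<Rightarrow>
     ('a set \<Rightarrow> nat \<Rightarrow> 'a set) \<Rightarrow> 'a set \<Rightarrow> nat \<Rightarrow> 'a set" where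
  "V_X R \<sigma> t \<omega> \<mm>\<omega> d \<alpha> v =
     (\<lambda>\<mm>\<in>\<omega>.
        let \<nn> = inv_into (carrier R) \<sigma> ` \<mm>;
            tv = (\<lambda>i\<in>{1..d}. (\<nn> +>\<^bsub>R\<^esub> t) \<otimes>\<^bsub>R Quot \<nn>\<^esub> v \<nn> i);
            w = (if \<nn> = \<mm>\<omega> then mat_vec (R Quot \<mm>\<omega>) d (companion (R Quot \<mm>\<omega>) d \<alpha>) tv else tv)
        in (\<lambda>i\<in>{1..d}. \<sigma> ` w i))"

definition V_Y ::
    "('a, 'c) ring_scheme \<Rightarrow> ('a \<Rightarrow> 'a) \<Rightarrow> 'a set set \<Rightarrow> 'a set \<Rightarrow> nat \<Rightarrow> (nat \<Rightarrow> 'a set) \<Rightarrow>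
     ('a set \<Rightarrow> nat \<Rightarrow> 'a set) \<Rightarrow> 'a set \<Rightarrow> nat \<Rightarrow> 'a set" where
  "V_Y R \<sigma> \<omega> \<mm>\<omega> d \<alpha> v =
     (\<lambda>\<mm>\<in>\<omega>.
        let \<nn> = \<sigma> ` \<mm>;
            w = (\<lambda>i\<in>{1..d}. inv_into (carrier R) \<sigma> ` v \<nn> i)
        in if \<mm> = \<mm>\<omega> then mat_inv_vec (R Quot \<mm>\<omega>) d (companion (R Quot \<mm>\<omega>) d \<alpha>) w else w)"

text \<open>\<open>V(\<omega>, f)\<close> for \<open>f = \<alpha>\<^sub>0 + \<dots> + \<alpha>\<^sub>d x\<^sup>d\<close>, where \<open>\<mm>\<omega>\<close> is the fixed element \<open>\<mm>(\<omega>)\<close> of \<open>\<omega>\<close>.\<close>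

definition V_omega ::
    "('a, 'c) ring_scheme \<Rightarrow> ('a \<Rightarrow> 'a) \<Rightarrow> 'a \<Rightarrow> 'a set set \<Rightarrow> 'a set \<Rightarrow> nat \<Rightarrow> (nat \<Rightarrow> 'a set) \<Rightarrow>
     ('a gwa_term set, 'a set \<Rightarrow> nat \<Rightarrow> 'a set) module" where
  "V_omega R \<sigma> t \<omega> \<mm>\<omega> d \<alpha> =
     gwa_module (V_R_module R \<omega> d) (V_X R \<sigma> t \<omega> \<mm>\<omega> d \<alpha>) (V_Y R \<sigma> \<omega> \<mm>\<omega> d \<alpha>)"


section \<open>The coefficients of \<open>f\<^sup>\<sharp>\<close>\<close>

definition tau :: "('a \<Rightarrow> 'a) \<Rightarrow> 'a set set \<Rightarrow> 'a set \<Rightarrow> 'a set" where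
  "tau \<sigma> \<omega> c = (\<sigma> ^^ card \<omega>) ` c"

definition xi :: "('a, 'c) ring_scheme \<Rightarrow> ('a \<Rightarrow> 'a) \<Rightarrow> 'a \<Rightarrow> 'a set set \<Rightarrow> 'a set \<Rightarrow> 'a set" where
  "xi R \<sigma> t \<omega> \<mm>\<omega> = \<mm>\<omega> +>\<^bsub>R\<^esub> (\<Otimes>\<^bsub>R\<^esub>i\<in>{1..card \<omega>}. (\<sigma> ^^ i) t)"

definition twisted_power :: "('k, 'c) ring_scheme \<Rightarrow> ('k \<Rightarrow> 'k) \<Rightarrow> 'k \<Rightarrow> nat \<Rightarrow> 'k" where
  "twisted_power K \<tau> \<xi> k = (\<Otimes>\<^bsub>K\<^esub>i\<in>{..<k}. (\<tau> ^^ i) \<xi>)"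

definition sharp_coeff ::
    "('k, 'c) ring_scheme \<Rightarrow> ('k \<Rightarrow> 'k) \<Rightarrow> ('k \<Rightarrow> 'k) \<Rightarrow> 'k \<Rightarrow> nat \<Rightarrow> (nat \<Rightarrow> 'k) \<Rightarrow> nat \<Rightarrow> 'k" where
  "sharp_coeff K \<tau> bar \<xi> d \<alpha> k = twisted_power K \<tau> \<xi> k \<otimes>\<^bsub>K\<^esub> (\<tau> ^^ k) (bar (\<alpha> (d - k)))"

end

(* Since t is a unit modulo every point of the finite orbit, X and Y act bijectively on a module
   supported on the orbit, and such a module is determined by its fibre at m(omega) together with the
   semilinear map Y^p on it. For V(omega, f) the fibre is K^d with the inverse companion map, which is
   P/Pf with the action of x^-1. On the dual, X^p = xi Y^-p gives
   (Y^p phi)(v) = tau^-1 (xi phi(Y^-p v)); evaluating functionals at the vectors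
   w_k = sum_(i >= k) tau^k(alpha_(i-k)) e_i and rescaling by -{k}_xi turns this into the inverse
   companion map of f^sharp.

   A non-degenerate admissible form amounts to an isomorphism from V to its dual: the induced map is
   injective on the finite-dimensional fibre, hence bijective. So V is pseudo-unitarizable iff the
   fibres of V(omega, f) and V(omega, f^sharp) are isomorphic, i.e. iff P/Pf and P/Pf^sharp are. *)
theory Submission
  imports Defs
begin

section \<open>Representations of the generalized Weyl algebra\<close>

text \<open>The semilinear map on the fibre is taken from Y rather than X because the action of Y on
  V(omega, f) carries no factor t: going once round the orbit applies sigma^-p and one inverse
  companion matrix. All factors t are then collected in the single scalar of X^p Y^p, which enters
  only in the dual, where X and Y change places.

  The vectors w_k come from the multiples x^k f. Let x^i stand for the basis vector e_i of K^d. Then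
  w_k is x^k f cut off above x^d. Multiplying by x gives w_(k+1) plus the overflow
  tau^(k+1)(alpha_(d-k)) x^(d+1), and x f = w_1 + tau(alpha_d) x^(d+1) replaces the overflow by a
  multiple of w_1. So the w_k form a chain under x with one correction term: evaluated by a
  functional, this is the shape of a companion map, with the coefficients of f read backwards.

  Models are compared without splitting them into weight spaces: an element of R that is 1 at
  \<open>\<mm>\<omega>\<close> and 0 at the other points of the orbit serves as projection, and p
  coordinates along the powers of Y identify a model with p copies of its fibre.\<close>

locale gwa_ring = cring R for R (structure) +
  fixes \<sigma> :: "'a \<Rightarrow> 'a" and t :: 'a
  assumes sigma_iso: "\<sigma> \<in> ring_iso R R" and t_closed [simp]: "t \<in> carrier R"
begin

abbreviation sinv :: "'a \<Rightarrow> 'a" where "sinv \<equiv> inv_into (carrier R) \<sigma>"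

lemma sigma_bij: "bij_betw \<sigma> (carrier R) (carrier R)"
  using sigma_iso by (simp add: ring_iso_def)

lemma sigma_hom: "\<sigma> \<in> ring_hom R R"
  using sigma_iso by (simp add: ring_iso_def)

lemma sinv_iso: "sinv \<in> ring_iso R R"
  using ring_iso_set_sym[OF ring_axioms sigma_iso] .

lemma sinv_hom: "sinv \<in> ring_hom R R"
  using sinv_iso by (simp add: ring_iso_def)

lemma sigma_closed [simp]: "r \<in> carrier R \<Longrightarrow> \<sigma> r \<in> carrier R"
  using sigma_hom by (rule ring_hom_closed)

lemma sinv_closed [simp]: "r \<in> carrier R \<Longrightarrow> sinv r \<in> carrier R"
  using sinv_hom by (rule ring_hom_closed)

lemma sigma_sinv [simp]: "r \<in> carrier R \<Longrightarrow> \<sigma> (sinv r) = r"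
  using sigma_bij by (metis bij_betw_def f_inv_into_f)

lemma sinv_sigma [simp]: "r \<in> carrier R \<Longrightarrow> sinv (\<sigma> r) = r"
  using sigma_bij by (metis bij_betw_def inv_into_f_f)

abbreviation geq :: "'a gwa_term \<Rightarrow> 'a gwa_term \<Rightarrow> bool" where "geq \<equiv> gwa_eq R \<sigma> t"
abbreviation cls :: "'a gwa_term \<Rightarrow> 'a gwa_term set" where "cls \<equiv> gwa_class R \<sigma> t"
abbreviation T :: "'a gwa_term set" where "T \<equiv> gwa_terms R"

lemma gwa_terms_simps [simp]:
  "Coeff r \<in> T \<longleftrightarrow> r \<in> carrier R" "GX \<in> T" "GY \<in> T"
  "Add a b \<in> T \<longleftrightarrow> a \<in> T \<and> b \<in> T" "Neg a \<in> T \<longleftrightarrow> a \<in> T" "Mul a b \<in> T \<longleftrightarrow> a \<in> T \<and> b \<in> T"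
  by (auto simp: gwa_terms_def)

lemma gwa_eq_terms: "geq a b \<Longrightarrow> a \<in> T \<and> b \<in> T"
  by (induction rule: gwa_eq.induct) auto

lemma gwa_class_eqI: "geq a b \<Longrightarrow> cls a = cls b"
  unfolding gwa_class_def by (rule Collect_cong) (metis gwa_eq.sym gwa_eq.trans)

lemma gwa_class_mem: "a \<in> T \<Longrightarrow> a \<in> cls a"
  by (simp add: gwa_class_def gwa_eq.refl)

lemma gwa_carrier: "carrier (gwa R \<sigma> t) = cls ` T"
  by (simp add: gwa_def)

text \<open>The product is a union over all representatives. By congruence every member of the union
  is the same class, and reflexivity makes the union nonempty.\<close>

lemma gwa_mult:
  assumes "a \<in> T" "b \<in> T" shows "cls a \<otimes>\<^bsub>gwa R \<sigma> t\<^esub> cls b = cls (Mul a b)"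
proof -
  have "cls (Mul a' b') = cls (Mul a b)" if "a' \<in> cls a" "b' \<in> cls b" for a' b'
    using that by (intro gwa_class_eqI[OF gwa_eq.sym] gwa_eq.mul_cong) (simp_all add: gwa_class_def)
  then have "(\<Union>a'\<in>cls a. \<Union>b'\<in>cls b. cls (Mul a' b')) = (\<Union>a'\<in>cls a. \<Union>b'\<in>cls b. cls (Mul a b))"
    by (simp cong: SUP_cong)
  also have "\<dots> = cls (Mul a b)"
    using gwa_class_mem[OF assms(1)] gwa_class_mem[OF assms(2)] by (auto simp del: UN_simps)
  finally show ?thesis by (simp add: gwa_def)
qed

lemma gwa_add:
  assumes "a \<in> T" "b \<in> T" shows "cls a \<oplus>\<^bsub>gwa R \<sigma> t\<^esub> cls b = cls (Add a b)"
proof -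
  have "cls (Add a' b') = cls (Add a b)" if "a' \<in> cls a" "b' \<in> cls b" for a' b'
    using that by (intro gwa_class_eqI[OF gwa_eq.sym] gwa_eq.add_cong) (simp_all add: gwa_class_def)
  then have "(\<Union>a'\<in>cls a. \<Union>b'\<in>cls b. cls (Add a' b')) = (\<Union>a'\<in>cls a. \<Union>b'\<in>cls b. cls (Add a b))"
    by (simp cong: SUP_cong)
  also have "\<dots> = cls (Add a b)"
    using gwa_class_mem[OF assms(1)] gwa_class_mem[OF assms(2)] by (auto simp del: UN_simps)
  finally show ?thesis by (simp add: gwa_def)
qed

lemma gwa_zero: "\<zero>\<^bsub>gwa R \<sigma> t\<^esub> = cls (Coeff \<zero>)" and gwa_one: "\<one>\<^bsub>gwa R \<sigma> t\<^esub> = cls (Coeff \<one>)"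
  by (simp_all add: gwa_def)

lemma ring_gwa: "ring (gwa R \<sigma> t)"
proof (rule ringI)
  note simps = gwa_carrier gwa_add gwa_mult gwa_zero gwa_one
  note eqI = gwa_class_eqI[OF gwa_eq.add_assoc] gwa_class_eqI[OF gwa_eq.add_comm]
    gwa_class_eqI[OF gwa_eq.add_zero] gwa_class_eqI[OF gwa_eq.add_neg]
    gwa_class_eqI[OF gwa_eq.mul_assoc] gwa_class_eqI[OF gwa_eq.mul_one_left]
    gwa_class_eqI[OF gwa_eq.mul_one_right] gwa_class_eqI[OF gwa_eq.distrib_left]
    gwa_class_eqI[OF gwa_eq.distrib_right]
  show "abelian_group (gwa R \<sigma> t)"
  proof (rule abelian_groupI)
    fix A assume "A \<in> carrier (gwa R \<sigma> t)"
    then obtain a where a: "a \<in> T" "A = cls a" by (auto simp: simps)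
    then have "cls (Neg a) \<oplus>\<^bsub>gwa R \<sigma> t\<^esub> A = \<zero>\<^bsub>gwa R \<sigma> t\<^esub>"
      by (simp add: simps eqI(4))
    moreover have "cls (Neg a) \<in> carrier (gwa R \<sigma> t)" using a by (simp add: simps)
    ultimately show "\<exists>B\<in>carrier (gwa R \<sigma> t). B \<oplus>\<^bsub>gwa R \<sigma> t\<^esub> A = \<zero>\<^bsub>gwa R \<sigma> t\<^esub>" by blast
  next
    fix A B assume "A \<in> carrier (gwa R \<sigma> t)" "B \<in> carrier (gwa R \<sigma> t)"
    then obtain a b where "a \<in> T" "A = cls a" "b \<in> T" "B = cls b" by (auto simp: simps)
    then show "A \<oplus>\<^bsub>gwa R \<sigma> t\<^esub> B = B \<oplus>\<^bsub>gwa R \<sigma> t\<^esub> A"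
      by (simp add: simps eqI(2))
  qed (clarsimp simp: simps eqI(1,3))+
  show "monoid (gwa R \<sigma> t)"
    by (rule monoidI) (clarsimp simp: simps eqI(5-7))+
next
  fix A B C assume "A \<in> carrier (gwa R \<sigma> t)" "B \<in> carrier (gwa R \<sigma> t)" "C \<in> carrier (gwa R \<sigma> t)"
  then obtain a b c where *: "a \<in> T" "A = cls a" "b \<in> T" "B = cls b" "c \<in> T" "C = cls c"
    by (auto simp: gwa_carrier)
  show "(A \<oplus>\<^bsub>gwa R \<sigma> t\<^esub> B) \<otimes>\<^bsub>gwa R \<sigma> t\<^esub> C =
      A \<otimes>\<^bsub>gwa R \<sigma> t\<^esub> C \<oplus>\<^bsub>gwa R \<sigma> t\<^esub> B \<otimes>\<^bsub>gwa R \<sigma> t\<^esub> C"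
    using * gwa_class_eqI[OF gwa_eq.distrib_right, of a b c] by (simp add: gwa_add gwa_mult)
  show "C \<otimes>\<^bsub>gwa R \<sigma> t\<^esub> (A \<oplus>\<^bsub>gwa R \<sigma> t\<^esub> B) =
      C \<otimes>\<^bsub>gwa R \<sigma> t\<^esub> A \<oplus>\<^bsub>gwa R \<sigma> t\<^esub> C \<otimes>\<^bsub>gwa R \<sigma> t\<^esub> B"
    using * gwa_class_eqI[OF gwa_eq.distrib_left, of c a b] by (simp add: gwa_add gwa_mult)
qed

end

section \<open>Modules over the algebra given by an R-module with two operators\<close>

locale gwa_rep = gwa_ring R \<sigma> t + M?: module R M
  for R (structure) and \<sigma> t and M (structure) +
  fixes X Y :: "'c \<Rightarrow> 'c"
  assumes X_closed [simp]: "v \<in> carrier M \<Longrightarrow> X v \<in> carrier M"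
    and Y_closed [simp]: "v \<in> carrier M \<Longrightarrow> Y v \<in> carrier M"
    and X_add: "\<lbrakk>v \<in> carrier M; w \<in> carrier M\<rbrakk> \<Longrightarrow> X (v \<oplus>\<^bsub>M\<^esub> w) = X v \<oplus>\<^bsub>M\<^esub> X w"
    and Y_add: "\<lbrakk>v \<in> carrier M; w \<in> carrier M\<rbrakk> \<Longrightarrow> Y (v \<oplus>\<^bsub>M\<^esub> w) = Y v \<oplus>\<^bsub>M\<^esub> Y w"
    and X_smult: "\<lbrakk>r \<in> carrier R; v \<in> carrier M\<rbrakk> \<Longrightarrow> X (r \<odot>\<^bsub>M\<^esub> v) = \<sigma> r \<odot>\<^bsub>M\<^esub> X v"
    and Y_smult: "\<lbrakk>r \<in> carrier R; v \<in> carrier M\<rbrakk> \<Longrightarrow>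
      Y (r \<odot>\<^bsub>M\<^esub> v) = inv_into (carrier R) \<sigma> r \<odot>\<^bsub>M\<^esub> Y v"
    and Y_X: "v \<in> carrier M \<Longrightarrow> Y (X v) = t \<odot>\<^bsub>M\<^esub> v"
    and X_Y: "v \<in> carrier M \<Longrightarrow> X (Y v) = \<sigma> t \<odot>\<^bsub>M\<^esub> v"
begin

abbreviation act :: "'a gwa_term \<Rightarrow> 'c \<Rightarrow> 'c" where "act \<equiv> term_act M X Y"

lemma act_closed [simp]: "a \<in> T \<Longrightarrow> v \<in> carrier M \<Longrightarrow> act a v \<in> carrier M"
  by (induction a arbitrary: v) auto

lemma act_add:
  assumes "a \<in> T" "v \<in> carrier M" "w \<in> carrier M"
  shows "act a (v \<oplus>\<^bsub>M\<^esub> w) = act a v \<oplus>\<^bsub>M\<^esub> act a w"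
  using assms
proof (induction a arbitrary: v w)
  case (Coeff x)
  then show ?case by (simp add: smult_r_distr)
next
  case (Add a b)
  then have "a \<in> T" "b \<in> T" by simp_all
  note closed = this[THEN act_closed]
  show ?case
    using Add.prems by (simp add: Add.IH M.a_assoc closed M.a_lcomm[of "act a w" "act b v" "act b w"])
next
  case (Neg a)
  then show ?case by (simp add: M.minus_add)
next
  case (Mul a b)
  then show ?case by simp
qed (simp_all add: X_add Y_add)

text \<open>Each clause generating the congruence is an identity of operators: the ring clauses hold
  because terms act additively, the relations for X and Y are assumptions of \<open>gwa_rep\<close>.
  So a term acts through its class.\<close>

lemma act_gwa_eq: "geq a b \<Longrightarrow> v \<in> carrier M \<Longrightarrow> act a v = act b v"
proof (induction arbitrary: v rule: gwa_eq.induct)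
  case (sym a b)
  then show ?case by metis
next
  case (trans a b c)
  then show ?case by metis
next
  case (mul_cong a a' b b')
  \<comment> \<open>The hypothesis for \<open>a\<close> is applied to the vector
    \<open>act b' v\<close>, which must be known to lie in the carrier.\<close>
  then have "b' \<in> T" using gwa_eq_terms by blast
  then show ?case using mul_cong.prems by (simp add: mul_cong.IH)
next
  case (add_assoc a b c)
  then show ?case by (simp add: M.a_assoc)
next
  case (add_comm a b)
  then show ?case by (simp add: M.a_comm)
next
  case (distrib_left a b c)
  then show ?case by (simp add: act_add)
qed (simp_all add: M.r_neg M.l_neg smult_l_distr smult_assoc1 X_smult Y_smult Y_X X_Y)

text \<open>The representative picked by \<open>SOME\<close> is congruent to \<open>a\<close>, hence
  acts as \<open>a\<close> does.\<close>

lemma smult_gwa_module: "a \<in> T \<Longrightarrow> v \<in> carrier M \<Longrightarrow> cls a \<odot>\<^bsub>gwa_module M X Y\<^esub> v = act a v"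
proof -
  assume a: "a \<in> T" and v: "v \<in> carrier M"
  have "(SOME b. b \<in> cls a) \<in> cls a" using gwa_class_mem[OF a] by (rule someI)
  then have "geq a (SOME b. b \<in> cls a)" by (simp add: gwa_class_def)
  then show ?thesis using act_gwa_eq[OF _ v] by (simp add: gwa_module_def)
qed

lemma gwa_module_simps [simp]:
  "carrier (gwa_module M X Y) = carrier M" "\<zero>\<^bsub>gwa_module M X Y\<^esub> = \<zero>\<^bsub>M\<^esub>"
  "v \<oplus>\<^bsub>gwa_module M X Y\<^esub> w = v \<oplus>\<^bsub>M\<^esub> w"
  by (simp_all add: gwa_module_def)

lemma smult_gwa_gens [simp]:
  "v \<in> carrier M \<Longrightarrow> r \<in> carrier R \<Longrightarrow> gwa_coeff R \<sigma> t r \<odot>\<^bsub>gwa_module M X Y\<^esub> v = r \<odot>\<^bsub>M\<^esub> v"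
  "v \<in> carrier M \<Longrightarrow> gwa_X R \<sigma> t \<odot>\<^bsub>gwa_module M X Y\<^esub> v = X v"
  "v \<in> carrier M \<Longrightarrow> gwa_Y R \<sigma> t \<odot>\<^bsub>gwa_module M X Y\<^esub> v = Y v"
  by (simp_all add: smult_gwa_module)

lemma abelian_group_gwa_module: "abelian_group (gwa_module M X Y)"
proof (rule abelian_groupI)
  fix v assume "v \<in> carrier (gwa_module M X Y)"
  then show "\<exists>w\<in>carrier (gwa_module M X Y). w \<oplus>\<^bsub>gwa_module M X Y\<^esub> v = \<zero>\<^bsub>gwa_module M X Y\<^esub>"
    by (intro bexI[of _ "\<ominus>\<^bsub>M\<^esub> v"]) (simp_all add: M.l_neg)
qed (simp_all add: M.a_assoc M.a_comm[of _ "\<zero>\<^bsub>M\<^esub>"], simp add: M.a_comm)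

lemma left_module_gwa_module: "left_module (gwa R \<sigma> t) (gwa_module M X Y)"
proof (intro left_module.intro left_module_axioms.intro)
  show "ring (gwa R \<sigma> t)" by (rule ring_gwa)
  show "abelian_group (gwa_module M X Y)" by (rule abelian_group_gwa_module)
qed (clarsimp simp: gwa_carrier smult_gwa_module act_add gwa_add gwa_mult gwa_one)+

end

text \<open>Equivariance is asked for R, X and Y only; induction extends it to all terms, and so to
  the classes that make up the algebra.\<close>

lemma module_isomorphic_gwa_moduleI:
  assumes "gwa_rep R \<sigma> t M X Y" "gwa_rep R \<sigma> t N X' Y'"
    and bij: "bij_betw h (carrier M) (carrier N)"
    and add: "\<And>v w. \<lbrakk>v \<in> carrier M; w \<in> carrier M\<rbrakk> \<Longrightarrow> h (v \<oplus>\<^bsub>M\<^esub> w) = h v \<oplus>\<^bsub>N\<^esub> h w"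
    and smult: "\<And>r v. \<lbrakk>r \<in> carrier R; v \<in> carrier M\<rbrakk> \<Longrightarrow> h (r \<odot>\<^bsub>M\<^esub> v) = r \<odot>\<^bsub>N\<^esub> h v"
    and X: "\<And>v. v \<in> carrier M \<Longrightarrow> h (X v) = X' (h v)"
    and Y: "\<And>v. v \<in> carrier M \<Longrightarrow> h (Y v) = Y' (h v)"
  shows "module_isomorphic (gwa R \<sigma> t) (gwa_module M X Y) (gwa_module N X' Y')"
proof -
  interpret M: gwa_rep R \<sigma> t M X Y by fact
  interpret N: gwa_rep R \<sigma> t N X' Y' by fact
  have hc [simp]: "h v \<in> carrier N" if "v \<in> carrier M" for v
    using bij_betwE[OF bij] that by blast
  have h0: "h \<zero>\<^bsub>M\<^esub> = \<zero>\<^bsub>N\<^esub>"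
    using add[of "\<zero>\<^bsub>M\<^esub>" "\<zero>\<^bsub>M\<^esub>"] N.M.add.r_cancel_one'[of "h \<zero>\<^bsub>M\<^esub>" "h \<zero>\<^bsub>M\<^esub>"] by simp
  have neg: "h (\<ominus>\<^bsub>M\<^esub> v) = \<ominus>\<^bsub>N\<^esub> h v" if "v \<in> carrier M" for v
    using add[of "\<ominus>\<^bsub>M\<^esub> v" v] that h0 N.M.minus_equality[of "h (\<ominus>\<^bsub>M\<^esub> v)" "h v"]
    by (simp add: M.M.l_neg)
  have hom: "h (term_act M X Y a v) = term_act N X' Y' a (h v)"
    if "a \<in> gwa_terms R" "v \<in> carrier M" for a v
    using that by (induction a arbitrary: v) (simp_all add: add smult X Y neg)
  have "h (A \<odot>\<^bsub>gwa_module M X Y\<^esub> v) = A \<odot>\<^bsub>gwa_module N X' Y'\<^esub> h v"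
    if "A \<in> carrier (gwa R \<sigma> t)" "v \<in> carrier M" for A v
    using that by (auto simp: M.gwa_carrier M.smult_gwa_module N.smult_gwa_module hom)
  then show ?thesis
    unfolding module_isomorphic_def
    using M.left_module_gwa_module N.left_module_gwa_module bij
    by (intro conjI exI[of _ h]) (simp_all add: add)
qed

section \<open>Automorphisms and the orbit\<close>

lemma zpow_closed: "bij_betw \<phi> S S \<Longrightarrow> x \<in> S \<Longrightarrow> zpow S \<phi> n x \<in> S"
proof -
  assume bij: "bij_betw \<phi> S S" and x: "x \<in> S"
  have "(\<phi> ^^ k) x \<in> S" "(inv_into S \<phi> ^^ k) x \<in> S" for k
    using bij_betwE[OF bij] bij_betwE[OF bij_betw_inv_into[OF bij]] x
    by (induction k) auto
  then show ?thesis by (simp add: zpow_def)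
qed

lemma zpow_Suc:
  assumes "bij_betw \<phi> S S" "x \<in> S"
  shows "zpow S \<phi> (n + 1) x = \<phi> (zpow S \<phi> n x)"
proof (cases "0 \<le> n")
  case True
  then show ?thesis by (simp add: zpow_def nat_add_distrib)
next
  case False
  \<comment> \<open>For negative \<open>n\<close> the exponent \<open>n\<close> takes
    \<open>Suc k\<close> inverse steps and \<open>n + 1\<close> takes \<open>k\<close>. The value
    \<open>k = 0\<close> is split off because \<open>n + 1 = 0\<close> falls under the other branch
    of \<open>zpow\<close>.\<close>
  define k where "k = nat (- 1 - n)"
  have n: "n = - 1 - int k" using False by (simp add: k_def)
  have "- n = int (Suc k)" "- (n + 1) = int k" by (simp_all add: n)
  then have k: "nat (- n) = Suc k" "nat (- (n + 1)) = k" by (metis nat_int)+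
  have "zpow S \<phi> n x = (inv_into S \<phi> ^^ Suc k) x" using False by (simp only: zpow_def k if_False)
  moreover have "zpow S \<phi> (n + 1) x = (inv_into S \<phi> ^^ k) x"
  proof (cases "k = 0")
    case True
    then have "n + 1 = 0" by (simp add: n)
    then show ?thesis using True by (simp add: zpow_def)
  next
    case False
    then have "\<not> 0 \<le> n + 1" by (simp add: n)
    then show ?thesis by (simp only: zpow_def k if_False)
  qed
  ultimately have "zpow S \<phi> n x = inv_into S \<phi> (zpow S \<phi> (n + 1) x)" by simp
  moreover have "zpow S \<phi> (n + 1) x \<in> S" using assms by (rule zpow_closed)
  ultimately show ?thesis
    using bij_betw_inv_into_right[OF assms(1)] by simp
qed

text \<open>Induction on \<open>m\<close> in both directions; in the downward step
  \<open>\<phi>\<close> is applied to both sides and then cancelled by injectivity.\<close>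

lemma zpow_add:
  assumes "bij_betw \<phi> S S" "x \<in> S"
  shows "zpow S \<phi> (m + n) x = zpow S \<phi> m (zpow S \<phi> n x)"
proof (induction m rule: int_induct[where k = 0])
  case base
  show ?case by (simp add: zpow_def)
next
  case (step1 i)
  have "zpow S \<phi> (i + 1 + n) x = \<phi> (zpow S \<phi> (i + n) x)"
    using zpow_Suc[OF assms, of "i + n"] by (simp only: add.assoc add.commute[of n 1])
  also have "\<dots> = zpow S \<phi> (i + 1) (zpow S \<phi> n x)"
    using zpow_Suc[OF assms(1) zpow_closed[OF assms, of n], of i] step1.IH by metis
  finally show ?case .
next
  case (step2 i)
  have "\<phi> (zpow S \<phi> (i - 1 + n) x) = zpow S \<phi> (i + n) x"
    using zpow_Suc[OF assms, of "i - 1 + n"] by (simp only: diff_add_cancel diff_add_eq)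
  also have "\<dots> = \<phi> (zpow S \<phi> (i - 1) (zpow S \<phi> n x))"
    using zpow_Suc[OF assms(1) zpow_closed[OF assms, of n], of "i - 1"] step2.IH
    by (simp only: diff_add_cancel)
  finally show ?case
    by (rule inj_onD[OF bij_betw_imp_inj_on[OF assms(1)]]) (intro zpow_closed assms)+
qed

lemma zpow_0 [simp]: "zpow S \<phi> 0 = id" and zpow_1 [simp]: "zpow S \<phi> 1 = \<phi>"
  and zpow_minus_1 [simp]: "zpow S \<phi> (- 1) = inv_into S \<phi>"
  and zpow_of_nat: "zpow S \<phi> (int k) = \<phi> ^^ k"
  by (auto simp: zpow_def fun_eq_iff)

lemma ring_iso_id: "id \<in> ring_iso A A"
  by (auto simp: ring_iso_def ring_hom_def)

lemma ring_iso_funpow: "\<phi> \<in> ring_iso A A \<Longrightarrow> \<phi> ^^ k \<in> ring_iso A A"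
  by (induction k) (auto simp: ring_iso_id intro: ring_iso_set_trans)

lemma ring_iso_zpow:
  assumes "ring A" "\<phi> \<in> ring_iso A A" shows "zpow (carrier A) \<phi> n \<in> ring_iso A A"
  using ring_iso_funpow[OF assms(2)] ring_iso_funpow[OF ring_iso_set_sym[OF assms]]
  by (simp add: zpow_def)

section \<open>Automorphisms acting on ideals and on residue rings\<close>

context ring
begin

lemma image_coset:
  assumes "\<phi> \<in> ring_hom R R" "I \<subseteq> carrier R" "r \<in> carrier R"
  shows "\<phi> ` (I +> r) = \<phi> ` I +> \<phi> r"
proof -
  have "\<phi> ` (I +> r) = (\<lambda>x. \<phi> (x \<oplus> r)) ` I" unfolding a_r_coset_def' by blast
  also have "\<dots> = (\<lambda>x. \<phi> x \<oplus> \<phi> r) ` I"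
    using assms by (intro image_cong refl ring_hom_add[OF assms(1)]) auto
  also have "\<dots> = \<phi> ` I +> \<phi> r" unfolding a_r_coset_def' by blast
  finally show ?thesis .
qed

lemma image_ideal:
  assumes "\<phi> \<in> ring_iso R R" "ideal I R" shows "ideal (\<phi> ` I) R"
proof -
  have hom: "\<phi> \<in> ring_hom R R" and bij: "\<phi> ` carrier R = carrier R"
    using assms(1) by (auto simp: ring_iso_def bij_betw_def)
  interpret I: ideal I R by fact
  interpret h: ring_hom_ring R R \<phi> using hom ring_axioms by (simp add: ring_hom_ringI2)
  show ?thesis
  proof (rule idealI)
    show "ring R" by (rule ring_axioms)
    show "subgroup (\<phi> ` I) (add_monoid R)"
      using h.img_is_add_subgroup[OF I.a_subgroup] .
    fix a x assume a: "a \<in> \<phi> ` I" and x: "x \<in> carrier R"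
    then obtain b y where "a = \<phi> b" "b \<in> I" "x = \<phi> y" "y \<in> carrier R" using bij by blast
    then show "x \<otimes> a \<in> \<phi> ` I" "a \<otimes> x \<in> \<phi> ` I"
      using I.I_l_closed I.I_r_closed I.Icarr
      by (metis h.hom_mult image_eqI)+
  qed
qed

text \<open>An ideal above the image of \<open>I\<close> is pulled back by the inverse automorphism
  to an ideal above \<open>I\<close>.\<close>

lemma image_maximalideal:
  assumes "\<phi> \<in> ring_iso R R" "maximalideal I R" shows "maximalideal (\<phi> ` I) R"
proof -
  interpret I: maximalideal I R by fact
  define \<psi> where "\<psi> = inv_into (carrier R) \<phi>"
  have \<psi>: "\<psi> \<in> ring_iso R R" unfolding \<psi>_def using ring_iso_set_sym[OF ring_axioms assms(1)] .
  have bij: "bij_betw \<phi> (carrier R) (carrier R)" using assms(1) by (simp add: ring_iso_def)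
  have \<psi>\<phi>: "\<psi> ` \<phi> ` A = A" "\<phi> ` \<psi> ` A = A" if "A \<subseteq> carrier R" for A
  proof -
    have "\<psi> (\<phi> a) = a" "\<phi> (\<psi> a) = a" if "a \<in> A" for a
      using bij \<open>A \<subseteq> carrier R\<close> that unfolding \<psi>_def
      by (auto simp: bij_betw_inv_into_left bij_betw_inv_into_right)
    then show "\<psi> ` \<phi> ` A = A" "\<phi> ` \<psi> ` A = A" by (force simp: image_iff)+
  qed
  show ?thesis
  proof (rule maximalidealI)
    show "ideal (\<phi> ` I) R" using image_ideal assms(1) I.ideal_axioms by blast
    show "carrier R \<noteq> \<phi> ` I"
      using \<psi>\<phi>(1)[OF I.a_subset] \<psi>\<phi>(1)[of "carrier R"] bij I.I_notcarr by (metis bij_betw_def order_refl)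
    fix J assume J: "ideal J R" "\<phi> ` I \<subseteq> J" "J \<subseteq> carrier R"
    have "ideal (\<psi> ` J) R" using image_ideal \<psi> J(1) by blast
    moreover have "I \<subseteq> \<psi> ` J" using J(2) \<psi>\<phi>(1)[OF I.a_subset] by blast
    moreover have "\<psi> ` J \<subseteq> carrier R" using \<psi> J(3) by (auto simp: ring_iso_def dest: bij_betwE)
    ultimately have "\<psi> ` J = I \<or> \<psi> ` J = carrier R" using I.I_maximal by blast
    then show "J = \<phi> ` I \<or> J = carrier R"
      using \<psi>\<phi>(2)[OF J(3)] bij by (metis bij_betw_def)
  qed
qed

lemma image_Quot_hom:
  assumes "\<phi> \<in> ring_iso R R" "ideal I R"
  shows "(`) \<phi> \<in> ring_hom (R Quot I) (R Quot (\<phi> ` I))"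
proof -
  have hom: "\<phi> \<in> ring_hom R R" using assms(1) by (auto simp: ring_iso_def)
  interpret I: ideal I R by fact
  interpret J: ideal "\<phi> ` I" R using image_ideal assms by blast
  note [simp] = image_coset[OF hom I.a_subset] ring_hom_closed[OF hom] ring_hom_add[OF hom]
    ring_hom_mult[OF hom] ring_hom_one[OF hom]
  have repr: "\<exists>r\<in>carrier R. c = I +> r" if "c \<in> carrier (R Quot I)" for c
    using that by (auto simp: FactRing_def A_RCOSETS_def')
  show ?thesis
  proof (rule ring_hom_memI)
    fix x assume "x \<in> carrier (R Quot I)"
    then obtain r where "r \<in> carrier R" "x = I +> r" using repr by blast
    then show "\<phi> ` x \<in> carrier (R Quot \<phi> ` I)"
      by (auto simp: FactRing_def A_RCOSETS_def')
  next
    fix x y assume "x \<in> carrier (R Quot I)" "y \<in> carrier (R Quot I)"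
    then obtain r s where *: "r \<in> carrier R" "x = I +> r" "s \<in> carrier R" "y = I +> s" using repr by metis
    then show "\<phi> ` (x \<otimes>\<^bsub>R Quot I\<^esub> y) = \<phi> ` x \<otimes>\<^bsub>R Quot \<phi> ` I\<^esub> \<phi> ` y"
      by (simp add: FactRing_def I.rcoset_mult_add J.rcoset_mult_add)
    show "\<phi> ` (x \<oplus>\<^bsub>R Quot I\<^esub> y) = \<phi> ` x \<oplus>\<^bsub>R Quot \<phi> ` I\<^esub> \<phi> ` y"
      using * by (simp add: FactRing_def I.a_rcos_sum J.a_rcos_sum)
  next
    show "\<phi> ` \<one>\<^bsub>R Quot I\<^esub> = \<one>\<^bsub>R Quot \<phi> ` I\<^esub>"
      by (simp add: FactRing_def)
  qed
qed

end

text \<open>\<open>I + R a\<close> is an ideal properly containing \<open>I\<close>, hence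
  everything; the coefficient of \<open>a\<close> in a decomposition of 1 inverts \<open>a\<close>
  modulo \<open>I\<close>.\<close>

lemma (in cring) maximalideal_inverse:
  assumes "maximalideal I R" "a \<in> carrier R" "a \<notin> I"
  shows "\<exists>b\<in>carrier R. \<one> \<ominus> b \<otimes> a \<in> I"
proof -
  interpret I: maximalideal I R by fact
  have "ideal (PIdl a) R" using assms(2) by (rule cgenideal_ideal)
  then have J: "ideal (I <+> PIdl a) R" using add_ideals I.ideal_axioms by blast
  have sumI: "x \<oplus> y \<in> I <+> PIdl a" if "x \<in> I" "y \<in> PIdl a" for x y
    using that unfolding set_add_def' by blast
  have zero: "\<zero> \<in> PIdl a"
    using \<open>ideal (PIdl a) R\<close> by (simp add: additive_subgroup.zero_closed ideal.axioms(1))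
  have "I \<subseteq> I <+> PIdl a"
  proof
    fix x assume "x \<in> I"
    then show "x \<in> I <+> PIdl a" using sumI[OF _ zero] r_zero[OF I.Icarr] by metis
  qed
  moreover have "a \<in> I <+> PIdl a"
    using sumI[OF I.zero_closed cgenideal_self[OF assms(2)]] l_zero[OF assms(2)] by simp
  ultimately have "I <+> PIdl a = carrier R"
    using I.I_maximal[OF J] ideal.Icarr[OF J] assms(3) by blast
  then have "\<one> \<in> I <+> PIdl a" by simp
  then obtain i b where "i \<in> I" "b \<in> carrier R" "\<one> = i \<oplus> b \<otimes> a"
    unfolding set_add_def' cgenideal_def by blast
  then have "\<one> \<ominus> b \<otimes> a = i"
    using assms(2) I.Icarr by (simp add: a_minus_def a_assoc r_neg)
  then show ?thesis using \<open>i \<in> I\<close> \<open>b \<in> carrier R\<close> by blast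
qed

section \<open>Arithmetic of a finite real orbit without breaks\<close>

locale gwa_orbit = gwa_ring R \<sigma> t for R (structure) and \<sigma> t +
  fixes star :: "'a \<Rightarrow> 'a" and \<omega> :: "'a set set" and \<mm>\<omega> :: "'a set"
  assumes star_iso: "star \<in> ring_iso R R"
    and star_star [simp]: "r \<in> carrier R \<Longrightarrow> star (star r) = r"
    and sigma_star: "r \<in> carrier R \<Longrightarrow> \<sigma> (star r) = star (\<sigma> r)"
    and star_t [simp]: "star t = t"
    and orbit: "\<omega> \<in> Orbits R \<sigma>" and finite_orbit: "finite \<omega>"
    and real: "real_orbit star \<omega>" and no_breaks: "breaks t \<omega> = {}"
    and m\<omega>: "\<mm>\<omega> \<in> \<omega>"
begin

abbreviation sg :: "int \<Rightarrow> 'a \<Rightarrow> 'a" where "sg \<equiv> zpow (carrier R) \<sigma>"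
abbreviation p :: nat where "p \<equiv> card \<omega>"

lemma star_hom: "star \<in> ring_hom R R" using star_iso by (simp add: ring_iso_def)
lemma star_closed [simp]: "r \<in> carrier R \<Longrightarrow> star r \<in> carrier R"
  using star_hom by (rule ring_hom_closed)
lemma sg_iso: "sg n \<in> ring_iso R R" by (rule ring_iso_zpow[OF ring_axioms sigma_iso])
lemma sg_hom: "sg n \<in> ring_hom R R" using sg_iso[of n] by (simp add: ring_iso_def)
lemma sg_closed [simp]: "r \<in> carrier R \<Longrightarrow> sg n r \<in> carrier R"
  using sigma_bij by (rule zpow_closed)
lemma sg_add: "r \<in> carrier R \<Longrightarrow> sg (m + n) r = sg m (sg n r)"
  using sigma_bij by (rule zpow_add)
lemma sg_sg_minus [simp]: "r \<in> carrier R \<Longrightarrow> sg n (sg (- n) r) = r"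
  "r \<in> carrier R \<Longrightarrow> sg (- n) (sg n r) = r"
  using sg_add[of r n "- n"] sg_add[of r "- n" n] by simp_all

lemma sg_image_add: "c \<subseteq> carrier R \<Longrightarrow> sg (m + n) ` c = sg m ` sg n ` c"
  unfolding image_image by (rule image_cong[OF HOL.refl sg_add]) (rule subsetD)

lemma sg_image_minus: "c \<subseteq> carrier R \<Longrightarrow> sg n ` sg (- n) ` c = c"
  "c \<subseteq> carrier R \<Longrightarrow> sg (- n) ` sg n ` c = c"
  using sg_image_add[of c n "- n"] sg_image_add[of c "- n" n] by simp_all

lemma sinv_star: "r \<in> carrier R \<Longrightarrow> sinv (star r) = star (sinv r)"
  using sigma_star[of "sinv r"] sinv_sigma[of "star (sinv r)"] by simp

lemma sg_star: "r \<in> carrier R \<Longrightarrow> sg n (star r) = star (sg n r)"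
proof (induction n rule: int_induct[where k = 0])
  case (step1 i)
  then show ?case using sg_add[of r 1 i] sg_add[of "star r" 1 i] sigma_star by (simp add: add.commute)
next
  case (step2 i)
  then show ?case using sg_add[of r "- 1" i] sg_add[of "star r" "- 1" i] sinv_star by simp
qed simp

text \<open>\<open>Orbits\<close> presents the orbit from some unnamed point.
  \<open>\<mm>\<omega>\<close> is a translate of it by some \<open>k\<close>, and adding
  \<open>k\<close> permutes the exponents.\<close>

lemma orbit_eq: "\<omega> = range (\<lambda>n. sg n ` \<mm>\<omega>)" and max\<omega>: "maximalideal \<mm>\<omega> R"
proof -
  obtain \<mm> where \<mm>: "maximalideal \<mm> R" and \<omega>: "\<omega> = range (\<lambda>n. sg n ` \<mm>)"
    using orbit by (auto simp: Orbits_def Max_spec_def orbit_of_def)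
  interpret \<mm>: maximalideal \<mm> R by fact
  obtain k where k: "\<mm>\<omega> = sg k ` \<mm>" using m\<omega> \<omega> by blast
  have "sg n ` \<mm>\<omega> = sg (n + k) ` \<mm>" for n
    using sg_image_add[OF \<mm>.a_subset] k by simp
  then have "range (\<lambda>n. sg n ` \<mm>\<omega>) = (\<lambda>n. sg n ` \<mm>) ` range (\<lambda>n. n + k)" by (simp only: image_image)
  also have "range (\<lambda>n. n + k) = (UNIV :: int set)" by (rule surj_plus_right)
  finally show "\<omega> = range (\<lambda>n. sg n ` \<mm>\<omega>)" using \<omega> by simp
  show "maximalideal \<mm>\<omega> R" unfolding k using image_maximalideal sg_iso \<mm> by blast
qed

lemma orbit_max: "\<mm> \<in> \<omega> \<Longrightarrow> maximalideal \<mm> R"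
  using orbit_eq image_maximalideal[OF sg_iso max\<omega>] by blast

lemma orbit_subset: "\<mm> \<in> \<omega> \<Longrightarrow> \<mm> \<subseteq> carrier R"
  using ideal.Icarr[OF maximalideal.axioms(1)[OF orbit_max]] by blast

lemma orbit_sg [simp]: "\<mm> \<in> \<omega> \<Longrightarrow> sg n ` \<mm> \<in> \<omega>"
  by (auto simp: orbit_eq simp flip: sg_image_add[OF orbit_subset[OF m\<omega>]])

lemma orbit_sigma [simp]: "\<mm> \<in> \<omega> \<Longrightarrow> \<sigma> ` \<mm> \<in> \<omega>" "\<mm> \<in> \<omega> \<Longrightarrow> sinv ` \<mm> \<in> \<omega>"
  using orbit_sg[of \<mm> 1] orbit_sg[of \<mm> "- 1"] by simp_all

lemma star_image [simp]: "\<mm> \<in> \<omega> \<Longrightarrow> star ` \<mm> = \<mm>" using real by (simp add: real_orbit_def)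

lemma t_notin: "\<mm> \<in> \<omega> \<Longrightarrow> t \<notin> \<mm>" using no_breaks by (auto simp: breaks_def)

lemma sg_mem_image_iff: "\<mm> \<in> \<omega> \<Longrightarrow> r \<in> carrier R \<Longrightarrow> sg n r \<in> \<mm> \<longleftrightarrow> r \<in> sg (- n) ` \<mm>"
  using orbit_subset[of \<mm>] by (auto simp: image_iff) (metis sg_sg_minus(2))

lemma sg_t_notin: "\<mm> \<in> \<omega> \<Longrightarrow> sg n t \<notin> \<mm>"
  using sg_mem_image_iff[of \<mm> t n] t_notin[of "sg (- n) ` \<mm>"] by simp

text \<open>The exponents fixing \<open>\<mm>\<omega>\<close> form a subgroup of the integers,
  nonzero because the orbit is finite. Its least positive element \<open>k\<close> generates it, and
  the exponents below \<open>k\<close> enumerate the orbit without repetition, so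
  \<open>k = p\<close>.\<close>

lemma stabilizer: "sg n ` \<mm>\<omega> = \<mm>\<omega> \<longleftrightarrow> int p dvd n"
proof -
  let ?S = "{n. sg n ` \<mm>\<omega> = \<mm>\<omega>}"
  note sub = orbit_subset[OF m\<omega>]
  have add: "a + b \<in> ?S" if "a \<in> ?S" "b \<in> ?S" for a b using that by (simp add: sg_image_add[OF sub])
  have neg: "- a \<in> ?S" if "a \<in> ?S" for a using that sg_image_minus(2)[OF sub, of a] by simp
  have mult: "a * int k \<in> ?S" if "a \<in> ?S" for a k
  proof (induction k)
    case (Suc k)
    have "a * int (Suc k) = a * int k + a" by (simp add: algebra_simps)
    then show ?case using add[OF Suc that] by simp
  qed simp
  have mult': "a * b \<in> ?S" if "a \<in> ?S" for a b
    using mult[OF that, of "nat b"] neg[OF mult[OF that, of "nat (- b)"]] by (cases "0 \<le> b") simp_all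
  have eq: "sg a ` \<mm>\<omega> = sg b ` \<mm>\<omega> \<longleftrightarrow> a - b \<in> ?S" for a b
  proof
    assume "sg a ` \<mm>\<omega> = sg b ` \<mm>\<omega>"
    then have "sg (- b) ` sg a ` \<mm>\<omega> = \<mm>\<omega>" using sg_image_minus(2)[OF sub, of b] by simp
    then show "a - b \<in> ?S" using sg_image_add[OF sub, of "- b" a] by simp
  next
    assume "a - b \<in> ?S"
    then show "sg a ` \<mm>\<omega> = sg b ` \<mm>\<omega>" using sg_image_add[OF sub, of b "a - b"] by simp
  qed
  \<comment> \<open>Two distinct exponents give the same point; their difference or its negative is
    a positive element of the subgroup.\<close>
  have "\<not> inj (\<lambda>n. sg n ` \<mm>\<omega>)"
    using finite_orbit unfolding orbit_eq by (metis finite_imageD infinite_UNIV_int)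
  then obtain a b where "a \<noteq> b" "sg a ` \<mm>\<omega> = sg b ` \<mm>\<omega>" unfolding inj_def by blast
  then have ab: "a - b \<in> ?S" "b - a \<in> ?S" using eq by metis+
  have "\<exists>k. 0 < k \<and> int k \<in> ?S"
    using ab \<open>a \<noteq> b\<close> by (intro exI[of _ "nat \<bar>a - b\<bar>"]) (simp add: abs_if)
  then obtain k where k: "0 < k" "int k \<in> ?S" and least: "\<And>j. 0 < j \<Longrightarrow> int j \<in> ?S \<Longrightarrow> k \<le> j"
    using exists_least_iff[of "\<lambda>k. 0 < k \<and> int k \<in> ?S"] not_le by metis
  have dvd: "n \<in> ?S \<longleftrightarrow> int k dvd n" for n
  proof
    assume n: "n \<in> ?S"
    \<comment> \<open>The remainder of \<open>n\<close> is again in the subgroup and below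
      \<open>k\<close>, so minimality makes it 0.\<close>
    have "n + - (int k * (n div int k)) \<in> ?S" by (rule add[OF n neg[OF mult'[OF k(2)]]])
    moreover have "n + - (int k * (n div int k)) = n mod int k" by (simp add: minus_mult_div_eq_mod)
    moreover have "0 \<le> n mod int k" "n mod int k < int k" using k(1) by simp_all
    ultimately have "n mod int k = 0" using least[of "nat (n mod int k)"] by fastforce
    then show "int k dvd n" by (simp only: dvd_eq_mod_eq_0)
  next
    assume "int k dvd n"
    then obtain m where "n = int k * m" by (rule dvdE)
    then show "n \<in> ?S" using mult'[OF k(2)] by (simp only:)
  qed
  have "\<omega> = (\<lambda>j. sg (int j) ` \<mm>\<omega>) ` {..<k}"
  proof
    show "\<omega> \<subseteq> (\<lambda>j. sg (int j) ` \<mm>\<omega>) ` {..<k}"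
    proof
      fix \<mm> assume "\<mm> \<in> \<omega>"
      then obtain n where n: "\<mm> = sg n ` \<mm>\<omega>" unfolding orbit_eq by blast
      have "int k dvd n - n mod int k" by simp
      then have "\<mm> = sg (int (nat (n mod int k))) ` \<mm>\<omega>" using eq dvd n k(1) by simp
      moreover have "nat (n mod int k) \<in> {..<k}" using k(1) by (simp add: nat_less_iff)
      ultimately show "\<mm> \<in> (\<lambda>j. sg (int j) ` \<mm>\<omega>) ` {..<k}" by (rule image_eqI)
    qed
    show "(\<lambda>j. sg (int j) ` \<mm>\<omega>) ` {..<k} \<subseteq> \<omega>" by (rule image_subsetI) (rule orbit_sg[OF m\<omega>])
  qed
  moreover have "inj_on (\<lambda>j. sg (int j) ` \<mm>\<omega>) {..<k}"
  proof (rule inj_onI)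
    fix i j assume ij: "i \<in> {..<k}" "j \<in> {..<k}" "sg (int i) ` \<mm>\<omega> = sg (int j) ` \<mm>\<omega>"
    then have "int i - int j \<in> ?S" by (simp only: eq)
    then have "int k dvd int i - int j" by (simp only: dvd)
    then show "i = j" using ij(1,2) zdvd_not_zless[of "\<bar>int i - int j\<bar>" "int k"] by fastforce
  qed
  ultimately have "p = k" by (metis card_image card_lessThan)
  then show ?thesis using dvd by simp
qed

lemma sg_p [simp]: "sg (int p) ` \<mm>\<omega> = \<mm>\<omega>" "sg (- int p) ` \<mm>\<omega> = \<mm>\<omega>"
  by (simp_all add: stabilizer)

lemma p_pos: "0 < p" using m\<omega> finite_orbit card_gt_0_iff by blast

lemma orbit_repr:
  assumes "\<mm> \<in> \<omega>" obtains k where "k < p" "\<mm> = sg (int k) ` \<mm>\<omega>"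
proof -
  obtain n where n: "\<mm> = sg n ` \<mm>\<omega>" using assms unfolding orbit_eq by blast
  have "n = n mod int p + int p * (n div int p)" by simp
  then have "\<mm> = sg (n mod int p) ` sg (int p * (n div int p)) ` \<mm>\<omega>"
    using n sg_image_add[OF orbit_subset[OF m\<omega>]] by metis
  then have "\<mm> = sg (int (nat (n mod int p))) ` \<mm>\<omega>"
    using stabilizer[of "int p * (n div int p)"] p_pos by simp
  moreover have "nat (n mod int p) < p" using p_pos by (simp add: nat_less_iff)
  ultimately show ?thesis using that by blast
qed

text \<open>If \<open>b\<close> inverts \<open>a\<close> modulo some points and \<open>c\<close>
  modulo one more, then 1 - (b + c - b c a) a = (1 - b a)(1 - c a) lies in all of them. An inverse
  modulo the whole orbit is thus assembled without the Chinese remainder theorem.\<close>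

lemma orbit_inverse:
  assumes "finite \<Omega>" "\<Omega> \<subseteq> \<omega>" "a \<in> carrier R" "\<And>\<mm>. \<mm> \<in> \<Omega> \<Longrightarrow> a \<notin> \<mm>"
  shows "\<exists>b\<in>carrier R. \<forall>\<mm>\<in>\<Omega>. \<one> \<ominus> b \<otimes> a \<in> \<mm>"
  using assms
proof (induction \<Omega> rule: finite_induct)
  case (insert \<mm> \<Omega>)
  then obtain b where b: "b \<in> carrier R" "\<forall>\<nn>\<in>\<Omega>. \<one> \<ominus> b \<otimes> a \<in> \<nn>" by auto
  obtain c where c: "c \<in> carrier R" "\<one> \<ominus> c \<otimes> a \<in> \<mm>"
    using insert.prems maximalideal_inverse[OF orbit_max, of \<mm> a] by auto
  have eq: "\<one> \<ominus> (b \<oplus> c \<ominus> b \<otimes> c \<otimes> a) \<otimes> a = (\<one> \<ominus> b \<otimes> a) \<otimes> (\<one> \<ominus> c \<otimes> a)"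
    using b(1) c(1) insert.prems by algebra
  have "\<one> \<ominus> (b \<oplus> c \<ominus> b \<otimes> c \<otimes> a) \<otimes> a \<in> \<nn>" if "\<nn> \<in> insert \<mm> \<Omega>" for \<nn>
  proof -
    have "maximalideal \<nn> R" using that insert.prems orbit_max by blast
    then interpret maximalideal \<nn> R .
    have car: "\<one> \<ominus> b \<otimes> a \<in> carrier R" "\<one> \<ominus> c \<otimes> a \<in> carrier R" using b(1) c(1) insert.prems by simp_all
    show ?thesis
    proof (cases "\<nn> = \<mm>")
      case True then show ?thesis unfolding eq using c(2) car I_l_closed by simp
    next
      case False then show ?thesis unfolding eq using b(2) that car I_r_closed by simp
    qed
  qed
  then show ?case using b(1) c(1) insert.prems by (intro bexI[of _ "b \<oplus> c \<ominus> b \<otimes> c \<otimes> a"]) simp_all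
qed (use one_closed in blast)

text \<open>Distinct maximal ideals are not nested. An element of \<open>\<nn>\<close> outside
  \<open>\<mm>\<close>, multiplied by its inverse modulo \<open>\<mm>\<close>, is
  \<open>e\<close>.\<close>

lemma orbit_comaximal:
  assumes "\<mm> \<in> \<omega>" "\<nn> \<in> \<omega>" "\<mm> \<noteq> \<nn>"
  shows "\<exists>e\<in>carrier R. \<one> \<ominus> e \<in> \<mm> \<and> e \<in> \<nn>"
proof -
  interpret m: maximalideal \<mm> R using assms orbit_max by blast
  interpret n: maximalideal \<nn> R using assms orbit_max by blast
  have "\<not> \<nn> \<subseteq> \<mm>"
    using n.I_maximal[OF m.ideal_axioms] m.a_subset assms(3) m.I_notcarr by blast
  then obtain a where a: "a \<in> \<nn>" "a \<notin> \<mm>" by blast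
  then obtain b where "b \<in> carrier R" "\<one> \<ominus> b \<otimes> a \<in> \<mm>"
    using maximalideal_inverse[OF m.maximalideal_axioms n.Icarr] by blast
  then show ?thesis using a n.I_l_closed n.Icarr by (intro bexI[of _ "b \<otimes> a"]) simp_all
qed

text \<open>The product of elements separating \<open>\<mm>\<omega>\<close> from each other point.
  On a module killed by the intersection of the orbit it acts as the projection to the weight space
  of \<open>\<mm>\<omega>\<close>.\<close>

lemma orbit_idempotent:
  obtains e where "e \<in> carrier R" "\<one> \<ominus> e \<in> \<mm>\<omega>" "\<And>\<nn>. \<nn> \<in> \<omega> \<Longrightarrow> \<nn> \<noteq> \<mm>\<omega> \<Longrightarrow> e \<in> \<nn>"
proof -
  interpret m: maximalideal \<mm>\<omega> R by (rule max\<omega>)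
  have "\<exists>e\<in>carrier R. \<one> \<ominus> e \<in> \<mm>\<omega> \<and> (\<forall>\<nn>\<in>\<Omega>. e \<in> \<nn>)" if "finite \<Omega>" "\<Omega> \<subseteq> \<omega> - {\<mm>\<omega>}" for \<Omega>
    using that
  proof (induction \<Omega> rule: finite_induct)
    case empty
    have "\<one> \<ominus> \<one> = \<zero>" by (simp add: a_minus_def r_neg)
    then show ?case by (intro bexI[of _ \<one>]) simp_all
  next
    case (insert \<nn> \<Omega>)
    then obtain e where e: "e \<in> carrier R" "\<one> \<ominus> e \<in> \<mm>\<omega>" "\<forall>\<nn>\<in>\<Omega>. e \<in> \<nn>" by auto
    obtain f where f: "f \<in> carrier R" "\<one> \<ominus> f \<in> \<mm>\<omega>" "f \<in> \<nn>"
      using orbit_comaximal[OF m\<omega>, of \<nn>] insert.prems by auto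
    have eq: "\<one> \<ominus> e \<otimes> f = (\<one> \<ominus> e) \<oplus> e \<otimes> (\<one> \<ominus> f)" using e(1) f(1) by algebra
    have "e \<otimes> f \<in> \<nn>'" if "\<nn>' \<in> insert \<nn> \<Omega>" for \<nn>'
    proof -
      interpret n: maximalideal \<nn>' R using that insert.prems orbit_max by blast
      show ?thesis using that e f n.I_l_closed n.I_r_closed by (cases "\<nn>' = \<nn>") auto
    qed
    moreover have "\<one> \<ominus> e \<otimes> f \<in> \<mm>\<omega>" unfolding eq using e f m.a_closed m.I_l_closed by simp
    ultimately show ?case using e(1) f(1) by (intro bexI[of _ "e \<otimes> f"]) simp_all
  qed
  from this[of "\<omega> - {\<mm>\<omega>}"] show ?thesis using that finite_orbit by auto
qed

end

section \<open>Reduction to the fibre over one point\<close>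

lemma (in ring) one_minus_add: "r \<in> carrier R \<Longrightarrow> (\<one> \<ominus> r) \<oplus> r = \<one>"
  by (simp add: a_minus_def a_assoc l_neg)

lemma (in ring) add_one_minus: "r \<in> carrier R \<Longrightarrow> r \<oplus> (\<one> \<ominus> r) = \<one>"
  using one_minus_add[of r] by (simp add: a_comm)

lemma (in gwa_orbit) sg_one_minus: "r \<in> carrier R \<Longrightarrow> sg n (\<one> \<ominus> r) = \<one> \<ominus> sg n r"
proof -
  assume r: "r \<in> carrier R"
  interpret h: ring_hom_ring R R "sg n" using sg_hom ring_axioms by (simp add: ring_hom_ringI2)
  show ?thesis using r by (simp add: a_minus_def)
qed

text \<open>\<open>annihilated\<close> expresses support on the orbit without a weight
  decomposition: the intersection of the points acts as zero, so \<open>M\<close> is a module over a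
  finite product of residue fields.\<close>

locale gwa_orbit_rep = gwa_orbit R \<sigma> t star \<omega> \<mm>\<omega> + gwa_rep R \<sigma> t M X Y
  for R (structure) and \<sigma> t star \<omega> \<mm>\<omega> and M (structure) and X Y +
  assumes annihilated:
    "\<lbrakk>r \<in> carrier R; \<And>\<mm>. \<mm> \<in> \<omega> \<Longrightarrow> r \<in> \<mm>; v \<in> carrier M\<rbrakk> \<Longrightarrow> r \<odot>\<^bsub>M\<^esub> v = \<zero>\<^bsub>M\<^esub>"
begin

text \<open>\<open>b\<close> inverts \<open>sg n t\<close> modulo every point of the orbit, which is
  where the absence of breaks enters; so 1 - b (sg n t) acts as zero.\<close>

lemma t_inverse:
  obtains b where "b \<in> carrier R" "\<And>v. v \<in> carrier M \<Longrightarrow> b \<odot>\<^bsub>M\<^esub> (sg n t \<odot>\<^bsub>M\<^esub> v) = v"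
    "\<And>v. v \<in> carrier M \<Longrightarrow> sg n t \<odot>\<^bsub>M\<^esub> (b \<odot>\<^bsub>M\<^esub> v) = v"
proof -
  obtain b where b: "b \<in> carrier R" "\<forall>\<mm>\<in>\<omega>. \<one> \<ominus> b \<otimes> sg n t \<in> \<mm>"
    using orbit_inverse[OF finite_orbit order_refl, of "sg n t"] sg_t_notin by auto
  have 1: "b \<odot>\<^bsub>M\<^esub> (sg n t \<odot>\<^bsub>M\<^esub> v) = v" if v: "v \<in> carrier M" for v
  proof -
    have "(\<one> \<ominus> b \<otimes> sg n t) \<oplus> b \<otimes> sg n t = \<one>" using b(1) by (intro one_minus_add) simp
    then have "v = ((\<one> \<ominus> b \<otimes> sg n t) \<oplus> b \<otimes> sg n t) \<odot>\<^bsub>M\<^esub> v" using smult_one[OF v] by simp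
    also have "\<dots> = (\<one> \<ominus> b \<otimes> sg n t) \<odot>\<^bsub>M\<^esub> v \<oplus>\<^bsub>M\<^esub> (b \<otimes> sg n t) \<odot>\<^bsub>M\<^esub> v"
      using b(1) v by (simp add: smult_l_distr)
    also have "(\<one> \<ominus> b \<otimes> sg n t) \<odot>\<^bsub>M\<^esub> v = \<zero>\<^bsub>M\<^esub>" using b v by (intro annihilated) auto
    finally show ?thesis using b(1) v by (simp add: smult_assoc1)
  qed
  have "sg n t \<odot>\<^bsub>M\<^esub> (b \<odot>\<^bsub>M\<^esub> v) = v" if v: "v \<in> carrier M" for v
    using 1[OF v] v b(1) smult_assoc1[of "sg n t" b v] smult_assoc1[of b "sg n t" v]
    by (simp add: m_comm)
  with b(1) 1 show ?thesis using that by blast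
qed

lemma Y_zero [simp]: "Y \<zero>\<^bsub>M\<^esub> = \<zero>\<^bsub>M\<^esub>"
  using Y_add[of "\<zero>\<^bsub>M\<^esub>" "\<zero>\<^bsub>M\<^esub>"] M.add.r_cancel_one'[of "Y \<zero>\<^bsub>M\<^esub>" "Y \<zero>\<^bsub>M\<^esub>"] by simp

text \<open>X Y is multiplication by \<open>\<sigma> t\<close>, which acts invertibly.\<close>

lemma Y_inj: "\<lbrakk>v \<in> carrier M; w \<in> carrier M; Y v = Y w\<rbrakk> \<Longrightarrow> v = w"
proof -
  assume v: "v \<in> carrier M" and w: "w \<in> carrier M" and eq: "Y v = Y w"
  obtain b where b: "\<And>v. v \<in> carrier M \<Longrightarrow> b \<odot>\<^bsub>M\<^esub> (sg 1 t \<odot>\<^bsub>M\<^esub> v) = v" by (rule t_inverse[of 1]) blast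
  have "sg 1 t \<odot>\<^bsub>M\<^esub> v = sg 1 t \<odot>\<^bsub>M\<^esub> w" using eq X_Y[OF v] X_Y[OF w] by simp
  then show ?thesis using b[OF v] b[OF w] by metis
qed

text \<open>Y X is multiplication by \<open>t\<close>; dividing \<open>v\<close> by \<open>t\<close>
  and applying \<open>X\<close> gives the preimage.\<close>

lemma Y_surj:
  assumes "v \<in> carrier M" obtains w where "w \<in> carrier M" "Y w = v"
proof -
  obtain b where b: "b \<in> carrier R" "\<And>v. v \<in> carrier M \<Longrightarrow> sg 0 t \<odot>\<^bsub>M\<^esub> (b \<odot>\<^bsub>M\<^esub> v) = v"
    by (rule t_inverse[of 0]) blast
  have "Y (X (b \<odot>\<^bsub>M\<^esub> v)) = v" using b assms Y_X[of "b \<odot>\<^bsub>M\<^esub> v"] by simp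
  then show ?thesis using that[of "X (b \<odot>\<^bsub>M\<^esub> v)"] b(1) assms by simp
qed

lemma Y_pow_closed [simp]: "v \<in> carrier M \<Longrightarrow> (Y ^^ k) v \<in> carrier M"
  by (induction k) simp_all

lemma X_pow_closed [simp]: "v \<in> carrier M \<Longrightarrow> (X ^^ k) v \<in> carrier M"
  by (induction k) simp_all

lemma Y_pow_zero [simp]: "(Y ^^ k) \<zero>\<^bsub>M\<^esub> = \<zero>\<^bsub>M\<^esub>"
  by (induction k) simp_all

lemma Y_pow_add: "\<lbrakk>v \<in> carrier M; w \<in> carrier M\<rbrakk> \<Longrightarrow> (Y ^^ k) (v \<oplus>\<^bsub>M\<^esub> w) = (Y ^^ k) v \<oplus>\<^bsub>M\<^esub> (Y ^^ k) w"
  by (induction k) (simp_all add: Y_add)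

lemma Y_pow_minus:
  assumes "v \<in> carrier M" "w \<in> carrier M" shows "(Y ^^ k) (v \<ominus>\<^bsub>M\<^esub> w) = (Y ^^ k) v \<ominus>\<^bsub>M\<^esub> (Y ^^ k) w"
  using Y_pow_add[of "\<ominus>\<^bsub>M\<^esub> w" w k] Y_pow_add[of v "\<ominus>\<^bsub>M\<^esub> w" k] assms
    M.minus_equality[of "(Y ^^ k) (\<ominus>\<^bsub>M\<^esub> w)" "(Y ^^ k) w"]
  by (simp add: a_minus_def M.l_neg)

lemma Y_pow_smult:
  "\<lbrakk>r \<in> carrier R; v \<in> carrier M\<rbrakk> \<Longrightarrow> (Y ^^ k) (r \<odot>\<^bsub>M\<^esub> v) = sg (- int k) r \<odot>\<^bsub>M\<^esub> (Y ^^ k) v"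
proof (induction k)
  case (Suc k)
  have "- int (Suc k) = - 1 + - int k" by simp
  then have "sg (- int (Suc k)) r = sinv (sg (- int k) r)" using sg_add[of r "- 1" "- int k"] Suc.prems by simp
  then show ?case using Suc by (simp add: Y_smult)
qed simp

lemma Y_pow_inj: "\<lbrakk>v \<in> carrier M; w \<in> carrier M; (Y ^^ k) v = (Y ^^ k) w\<rbrakk> \<Longrightarrow> v = w"
  by (induction k) (auto dest: Y_inj[rotated 2])

lemma Y_pow_surj: "v \<in> carrier M \<Longrightarrow> \<exists>w\<in>carrier M. (Y ^^ k) w = v"
proof (induction k arbitrary: v)
  case (Suc k)
  then obtain u where u: "u \<in> carrier M" "Y u = v" using Y_surj by blast
  then show ?case using Suc.IH[OF u(1)] by auto
qed auto

text \<open>Taking the outermost \<open>X\<close> and the innermost \<open>Y\<close> off, the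
  hypothesis gives a scalar in between. Moving \<open>X\<close> past it applies
  \<open>\<sigma>\<close> to each factor, and the remaining X Y contributes
  \<open>\<sigma> t\<close>. For \<open>k = p\<close> the class of the scalar at
  \<open>\<mm>\<omega>\<close> is \<open>\<xi>\<close>.\<close>

lemma X_pow_Y_pow:
  "v \<in> carrier M \<Longrightarrow> (X ^^ k) ((Y ^^ k) v) = (\<Otimes>i\<in>{1..k}. (\<sigma> ^^ i) t) \<odot>\<^bsub>M\<^esub> v"
proof (induction k arbitrary: v)
  case (Suc k)
  have cl: "(\<sigma> ^^ i) t \<in> carrier R" for i using sg_closed[of t "int i"] by (simp add: zpow_of_nat)
  have P: "(\<Otimes>i\<in>A. (\<sigma> ^^ i) t) \<in> carrier R" for A using cl by simp
  have hom: "\<sigma> (\<Otimes>i\<in>{1..k}. (\<sigma> ^^ i) t) = (\<Otimes>i\<in>{2..Suc k}. (\<sigma> ^^ i) t)"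
  proof (induction k)
    case 0
    then show ?case using ring_hom_one[OF sigma_hom] by simp
  next
    case (Suc k)
    have "{1..Suc k} = insert (Suc k) {1..k}" "{2..Suc (Suc k)} = insert (Suc (Suc k)) {2..Suc k}" by auto
    then show ?case using Suc cl by (simp add: ring_hom_mult[OF sigma_hom] Pi_def del: One_nat_def)
  qed
  have "(X ^^ Suc k) ((Y ^^ Suc k) v) = X ((X ^^ k) ((Y ^^ k) (Y v)))"
    by (simp add: funpow_swap1)
  also have "\<dots> = X ((\<Otimes>i\<in>{1..k}. (\<sigma> ^^ i) t) \<odot>\<^bsub>M\<^esub> Y v)" using Suc by simp
  also have "\<dots> = (\<Otimes>i\<in>{2..Suc k}. (\<sigma> ^^ i) t) \<odot>\<^bsub>M\<^esub> (\<sigma> t \<odot>\<^bsub>M\<^esub> v)"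
    using Suc.prems P[of "{1..k}"] by (simp only: X_smult Y_closed hom X_Y)
  also have "\<dots> = (\<sigma> t \<otimes> (\<Otimes>i\<in>{2..Suc k}. (\<sigma> ^^ i) t)) \<odot>\<^bsub>M\<^esub> v"
    using Suc.prems P[of "{2..Suc k}"] by (simp add: smult_assoc1 m_comm[of "\<sigma> t"])
  also have "\<sigma> t \<otimes> (\<Otimes>i\<in>{2..Suc k}. (\<sigma> ^^ i) t) = (\<Otimes>i\<in>insert 1 {2..Suc k}. (\<sigma> ^^ i) t)"
    using cl by simp
  also have "insert 1 {2..Suc k} = {1..Suc k}" by auto
  finally show ?case .
qed simp

end

text \<open>The pair \<open>(U, \<eta>)\<close> is the fibre of \<open>M\<close> at \<open>\<mm>\<omega>\<close> with the semilinear map induced by \<open>Y\<^sup>p\<close>. It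
  determines \<open>M\<close> because \<open>v \<mapsto> (\<kappa> (Y\<^sup>k v))\<^sub>k\<^sub><\<^sub>p\<close> is a bijection onto \<open>U\<^sup>p\<close>: applying \<open>Y\<^sup>k\<close> moves each of
  the \<open>p\<close> weight spaces to \<open>\<mm>\<omega>\<close> for exactly one \<open>k\<close>.\<close>

locale gwa_orbit_model = gwa_orbit_rep R \<sigma> t star \<omega> \<mm>\<omega> M X Y + U: module R U
  for R :: "('a, 'b) ring_scheme" (structure) and \<sigma> t star \<omega> \<mm>\<omega>
    and M :: "('a, 'v, 'w) module_scheme" (structure) and X Y
    and U :: "('a, 'u, 'z) module_scheme" (structure) +
  fixes \<kappa> :: "'v \<Rightarrow> 'u" and \<eta> :: "'u \<Rightarrow> 'u"
  assumes kappa_closed [simp]: "v \<in> carrier M \<Longrightarrow> \<kappa> v \<in> carrier U"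
    and kappa_add: "\<lbrakk>v \<in> carrier M; w \<in> carrier M\<rbrakk> \<Longrightarrow> \<kappa> (v \<oplus>\<^bsub>M\<^esub> w) = \<kappa> v \<oplus>\<^bsub>U\<^esub> \<kappa> w"
    and kappa_smult: "\<lbrakk>r \<in> carrier R; v \<in> carrier M\<rbrakk> \<Longrightarrow> \<kappa> (r \<odot>\<^bsub>M\<^esub> v) = r \<odot>\<^bsub>U\<^esub> \<kappa> v"
    and kappa_ker: "\<lbrakk>v \<in> carrier M; \<And>r. r \<in> \<mm>\<omega> \<Longrightarrow> r \<odot>\<^bsub>M\<^esub> v = \<zero>\<^bsub>M\<^esub>; \<kappa> v = \<zero>\<^bsub>U\<^esub>\<rbrakk> \<Longrightarrow> v = \<zero>\<^bsub>M\<^esub>"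
    and kappa_surj: "u \<in> carrier U \<Longrightarrow> \<exists>v\<in>carrier M. (\<forall>r\<in>\<mm>\<omega>. r \<odot>\<^bsub>M\<^esub> v = \<zero>\<^bsub>M\<^esub>) \<and> \<kappa> v = u"
    and kappa_Y: "v \<in> carrier M \<Longrightarrow> \<kappa> ((Y ^^ p) v) = \<eta> (\<kappa> v)"
begin

lemma kappa_zero [simp]: "\<kappa> \<zero>\<^bsub>M\<^esub> = \<zero>\<^bsub>U\<^esub>"
  using kappa_add[of "\<zero>\<^bsub>M\<^esub>" "\<zero>\<^bsub>M\<^esub>"] U.M.add.r_cancel_one'[of "\<kappa> \<zero>\<^bsub>M\<^esub>" "\<kappa> \<zero>\<^bsub>M\<^esub>"] by simp

lemma U_annihilated: "r \<in> \<mm>\<omega> \<Longrightarrow> u \<in> carrier U \<Longrightarrow> r \<odot>\<^bsub>U\<^esub> u = \<zero>\<^bsub>U\<^esub>"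
  using kappa_surj[of u] kappa_smult[of r] orbit_subset[OF m\<omega>] by (metis kappa_zero subsetD)

lemma U_one_mod: "e \<in> carrier R \<Longrightarrow> \<one> \<ominus> e \<in> \<mm>\<omega> \<Longrightarrow> u \<in> carrier U \<Longrightarrow> e \<odot>\<^bsub>U\<^esub> u = u"
proof -
  assume e: "e \<in> carrier R" "\<one> \<ominus> e \<in> \<mm>\<omega>" and u: "u \<in> carrier U"
  have "(\<one> \<ominus> e) \<oplus> e = \<one>" using e(1) by (rule one_minus_add)
  then have "u = ((\<one> \<ominus> e) \<oplus> e) \<odot>\<^bsub>U\<^esub> u" using U.smult_one[OF u] by simp
  also have "\<dots> = (\<one> \<ominus> e) \<odot>\<^bsub>U\<^esub> u \<oplus>\<^bsub>U\<^esub> e \<odot>\<^bsub>U\<^esub> u" using e(1) u by (simp add: U.smult_l_distr)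
  finally show ?thesis using U_annihilated[OF e(2) u] e(1) u by simp
qed

text \<open>With \<open>e\<close> the projection to \<open>\<mm>\<omega>\<close>, the translate
  \<open>sg k e\<close> is the projection to the k-th point. Y^k carries that part of
  \<open>v\<close> to \<open>\<mm>\<omega>\<close>, where \<open>\<kappa>\<close> sees it. So all
  the projections kill \<open>v\<close>, and then \<open>v\<close> itself is zero.\<close>

lemma Y_orbit_ker:
  assumes v: "v \<in> carrier M" and ker: "\<And>k. k < p \<Longrightarrow> \<kappa> ((Y ^^ k) v) = \<zero>\<^bsub>U\<^esub>"
  shows "v = \<zero>\<^bsub>M\<^esub>"
proof -
  obtain e where e: "e \<in> carrier R" "\<one> \<ominus> e \<in> \<mm>\<omega>" "\<And>\<nn>. \<nn> \<in> \<omega> \<Longrightarrow> \<nn> \<noteq> \<mm>\<omega> \<Longrightarrow> e \<in> \<nn>"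
    by (rule orbit_idempotent) blast
  \<comment> \<open>Y^k turns the projected vector into \<open>e\<close> times Y^k v. This has
    weight \<open>\<mm>\<omega>\<close>, since \<open>r e\<close> lies in every point for
    \<open>r\<close> in \<open>\<mm>\<omega>\<close>, so \<open>kappa_ker\<close> applies; Y^k is
    injective.\<close>
  have e_kill: "sg (int k) e \<odot>\<^bsub>M\<^esub> v = \<zero>\<^bsub>M\<^esub>" if k: "k < p" for k
  proof -
    have "e \<odot>\<^bsub>M\<^esub> (Y ^^ k) v = \<zero>\<^bsub>M\<^esub>"
    proof (rule kappa_ker)
      show "\<kappa> (e \<odot>\<^bsub>M\<^esub> (Y ^^ k) v) = \<zero>\<^bsub>U\<^esub>" using e(1) v ker[OF k] by (simp add: kappa_smult)
      fix r assume r: "r \<in> \<mm>\<omega>"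
      then have rc: "r \<in> carrier R" using orbit_subset[OF m\<omega>] by blast
      have "(r \<otimes> e) \<odot>\<^bsub>M\<^esub> (Y ^^ k) v = \<zero>\<^bsub>M\<^esub>"
      proof (rule annihilated)
        fix \<mm> assume \<mm>: "\<mm> \<in> \<omega>"
        then interpret maximalideal \<mm> R by (rule orbit_max)
        show "r \<otimes> e \<in> \<mm>"
          using e(1,3) \<mm> r rc I_l_closed I_r_closed by (cases "\<mm> = \<mm>\<omega>") auto
      qed (use e(1) rc v in simp_all)
      then show "r \<odot>\<^bsub>M\<^esub> (e \<odot>\<^bsub>M\<^esub> (Y ^^ k) v) = \<zero>\<^bsub>M\<^esub>" using rc e(1) v by (simp add: M.smult_assoc1)
    qed (use e(1) v in simp)
    then have "(Y ^^ k) (sg (int k) e \<odot>\<^bsub>M\<^esub> v) = (Y ^^ k) \<zero>\<^bsub>M\<^esub>"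
      using e(1) v by (simp add: Y_pow_smult)
    then show ?thesis using Y_pow_inj e(1) v by simp
  qed
  \<comment> \<open>As each \<open>sg k e\<close> kills \<open>v\<close>, each factor 1 - sg k e
    fixes it. The product of these factors over the orbit fixes \<open>v\<close> but lies in every
    point, hence also kills \<open>v\<close>.\<close>
  have "\<exists>r\<in>carrier R. (\<forall>\<mm>\<in>\<Omega>. r \<in> \<mm>) \<and> r \<odot>\<^bsub>M\<^esub> v = v" if "finite \<Omega>" "\<Omega> \<subseteq> \<omega>" for \<Omega>
    using that
  proof (induction \<Omega> rule: finite_induct)
    case empty
    show ?case using v by (intro bexI[of _ \<one>]) simp_all
  next
    case (insert \<mm> \<Omega>)
    then obtain r where r: "r \<in> carrier R" "\<forall>\<mm>\<in>\<Omega>. r \<in> \<mm>" "r \<odot>\<^bsub>M\<^esub> v = v" by auto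
    obtain k where k: "k < p" "\<mm> = sg (int k) ` \<mm>\<omega>" using insert.prems orbit_repr by blast
    define f where "f = \<one> \<ominus> sg (int k) e"
    have f: "f \<in> carrier R" using e(1) by (simp add: f_def)
    have "f = sg (int k) (\<one> \<ominus> e)"
      using e(1) by (simp add: f_def sg_one_minus)
    then have "f \<in> \<mm>" using e(2) k(2) by simp
    have "sg (int k) e \<odot>\<^bsub>M\<^esub> v \<oplus>\<^bsub>M\<^esub> f \<odot>\<^bsub>M\<^esub> v = v"
    proof -
      have "sg (int k) e \<oplus> f = \<one>" using add_one_minus e(1) unfolding f_def by simp
      then show ?thesis using M.smult_l_distr[OF sg_closed[OF e(1)] f v, of "int k"] v by simp
    qed
    then have fv: "f \<odot>\<^bsub>M\<^esub> v = v" using e_kill[OF k(1)] f v by simp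
    have "f \<otimes> r \<in> \<mm>'" if "\<mm>' \<in> insert \<mm> \<Omega>" for \<mm>'
    proof -
      have "\<mm>' \<in> \<omega>" using that insert.prems by blast
      then interpret maximalideal \<mm>' R by (rule orbit_max)
      show ?thesis using that r f \<open>f \<in> \<mm>\<close> I_l_closed I_r_closed by auto
    qed
    then show ?case using r f fv v by (intro bexI[of _ "f \<otimes> r"]) (simp_all add: M.smult_assoc1)
  qed
  from this[of \<omega>] obtain r where "r \<in> carrier R" "\<And>\<mm>. \<mm> \<in> \<omega> \<Longrightarrow> r \<in> \<mm>" "r \<odot>\<^bsub>M\<^esub> v = v"
    using finite_orbit by auto
  then show ?thesis using annihilated v by metis
qed

text \<open>Take \<open>v\<close> with Y^k v a lift of \<open>u\<close> and project it by
  \<open>sg k e\<close>. Applying Y^j turns the scalar into \<open>sg (k - j) e\<close>, which is 1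
  modulo \<open>\<mm>\<omega>\<close> for \<open>j = k\<close> and 0 otherwise, because
  \<open>j - k\<close> is then not a multiple of \<open>p\<close>.\<close>

lemma Y_orbit_surj_single:
  assumes k: "k < p" and u: "u \<in> carrier U"
  shows "\<exists>v\<in>carrier M. \<forall>j<p. \<kappa> ((Y ^^ j) v) = (if j = k then u else \<zero>\<^bsub>U\<^esub>)"
proof -
  obtain e where e: "e \<in> carrier R" "\<one> \<ominus> e \<in> \<mm>\<omega>" "\<And>\<nn>. \<nn> \<in> \<omega> \<Longrightarrow> \<nn> \<noteq> \<mm>\<omega> \<Longrightarrow> e \<in> \<nn>"
    by (rule orbit_idempotent) blast
  obtain w where w: "w \<in> carrier M" "\<kappa> w = u" using kappa_surj[OF u] by blast
  obtain v where v: "v \<in> carrier M" "(Y ^^ k) v = w" using Y_pow_surj[OF w(1)] by blast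
  have "\<kappa> ((Y ^^ j) (sg (int k) e \<odot>\<^bsub>M\<^esub> v)) = (if j = k then u else \<zero>\<^bsub>U\<^esub>)" if j: "j < p" for j
  proof -
    have "\<kappa> ((Y ^^ j) (sg (int k) e \<odot>\<^bsub>M\<^esub> v)) = sg (- int j) (sg (int k) e) \<odot>\<^bsub>U\<^esub> \<kappa> ((Y ^^ j) v)"
      using e(1) v by (simp add: Y_pow_smult kappa_smult)
    also have "sg (- int j) (sg (int k) e) = sg (int k - int j) e"
      using sg_add[OF e(1), of "- int j" "int k"] by simp
    finally have *: "\<kappa> ((Y ^^ j) (sg (int k) e \<odot>\<^bsub>M\<^esub> v)) = sg (int k - int j) e \<odot>\<^bsub>U\<^esub> \<kappa> ((Y ^^ j) v)" .
    show ?thesis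
    proof (cases "j = k")
      case True
      then show ?thesis using * v w e u by (simp add: U_one_mod)
    next
      case False
      have "sg (int j - int k) ` \<mm>\<omega> \<noteq> \<mm>\<omega>"
        using False j k zdvd_not_zless[of "\<bar>int j - int k\<bar>" "int p"] by (auto simp: stabilizer)
      then have "e \<in> sg (int j - int k) ` \<mm>\<omega>" using e(3) m\<omega> by simp
      then have "sg (int k - int j) e \<in> \<mm>\<omega>" using sg_mem_image_iff[OF m\<omega> e(1), of "int k - int j"] by simp
      then show ?thesis using * False v by (simp add: U_annihilated)
    qed
  qed
  then show ?thesis using e(1) v(1) by (intro bexI[of _ "sg (int k) e \<odot>\<^bsub>M\<^esub> v"]) simp_all
qed

text \<open>Sum of the solutions with a single nonzero coordinate, one index at a time.\<close>

lemma Y_orbit_surj: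
  assumes c: "\<And>k. k < p \<Longrightarrow> c k \<in> carrier U"
  shows "\<exists>v\<in>carrier M. \<forall>k<p. \<kappa> ((Y ^^ k) v) = c k"
proof -
  have "\<exists>v\<in>carrier M. \<forall>k<p. \<kappa> ((Y ^^ k) v) = (if k < n then c k else \<zero>\<^bsub>U\<^esub>)" if "n \<le> p" for n
    using that
  proof (induction n)
    case 0
    show ?case by (intro bexI[of _ "\<zero>\<^bsub>M\<^esub>"]) simp_all
  next
    case (Suc n)
    then obtain v where v: "v \<in> carrier M" "\<forall>k<p. \<kappa> ((Y ^^ k) v) = (if k < n then c k else \<zero>\<^bsub>U\<^esub>)" by auto
    obtain w where w: "w \<in> carrier M" "\<forall>k<p. \<kappa> ((Y ^^ k) w) = (if k = n then c n else \<zero>\<^bsub>U\<^esub>)"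
      using Y_orbit_surj_single[of n "c n"] c Suc.prems by auto
    have "\<kappa> ((Y ^^ k) (v \<oplus>\<^bsub>M\<^esub> w)) = (if k < Suc n then c k else \<zero>\<^bsub>U\<^esub>)" if k: "k < p" for k
      using v w k c[OF k] U.M.zero_closed by (auto simp: Y_pow_add kappa_add less_Suc_eq)
    then show ?case using v(1) w(1) by (intro bexI[of _ "v \<oplus>\<^bsub>M\<^esub> w"]) simp_all
  qed
  from this[of p] show ?thesis by auto
qed

lemma kappa_minus:
  assumes "v \<in> carrier M" "w \<in> carrier M" shows "\<kappa> (v \<ominus>\<^bsub>M\<^esub> w) = \<kappa> v \<ominus>\<^bsub>U\<^esub> \<kappa> w"
  using kappa_add[of "\<ominus>\<^bsub>M\<^esub> w" w] kappa_add[of v "\<ominus>\<^bsub>M\<^esub> w"] assms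
    U.M.minus_equality[of "\<kappa> (\<ominus>\<^bsub>M\<^esub> w)" "\<kappa> w"]
  by (simp add: a_minus_def M.l_neg)

lemma Y_orbit_inj:
  assumes v: "v \<in> carrier M" and w: "w \<in> carrier M"
    and eq: "\<And>k. k < p \<Longrightarrow> \<kappa> ((Y ^^ k) v) = \<kappa> ((Y ^^ k) w)"
  shows "v = w"
proof -
  have "v \<ominus>\<^bsub>M\<^esub> w = \<zero>\<^bsub>M\<^esub>"
    using v w eq by (intro Y_orbit_ker) (simp_all add: kappa_minus Y_pow_minus U.M.minus_eq U.M.r_neg)
  then show ?thesis
    using v w M.minus_equality[of v "\<ominus>\<^bsub>M\<^esub> w"] by (simp add: a_minus_def)
qed

end

text \<open>\<open>h\<close> matches the p coordinates taken along the powers of Y. Since these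
  determine an element, every property of \<open>h\<close> is checked on them.\<close>

lemma gwa_orbit_model_isomorphic:
  assumes M: "gwa_orbit_model R \<sigma> t star \<omega> \<mm>\<omega> M X Y U \<kappa> \<eta>"
    and N: "gwa_orbit_model R \<sigma> t star \<omega> \<mm>\<omega> N X' Y' U \<kappa>' \<eta>"
  obtains h where "bij_betw h (carrier M) (carrier N)"
    "\<And>v w. \<lbrakk>v \<in> carrier M; w \<in> carrier M\<rbrakk> \<Longrightarrow> h (v \<oplus>\<^bsub>M\<^esub> w) = h v \<oplus>\<^bsub>N\<^esub> h w"
    "\<And>r v. \<lbrakk>r \<in> carrier R; v \<in> carrier M\<rbrakk> \<Longrightarrow> h (r \<odot>\<^bsub>M\<^esub> v) = r \<odot>\<^bsub>N\<^esub> h v"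
    "\<And>v. v \<in> carrier M \<Longrightarrow> h (X v) = X' (h v)" "\<And>v. v \<in> carrier M \<Longrightarrow> h (Y v) = Y' (h v)"
proof -
  interpret M: gwa_orbit_model R \<sigma> t star \<omega> \<mm>\<omega> M X Y U \<kappa> \<eta> by fact
  interpret N: gwa_orbit_model R \<sigma> t star \<omega> \<mm>\<omega> N X' Y' U \<kappa>' \<eta> by fact
  have "\<exists>w\<in>carrier N. \<forall>k<card \<omega>. \<kappa>' ((Y' ^^ k) w) = \<kappa> ((Y ^^ k) v)" if "v \<in> carrier M" for v
    by (rule N.Y_orbit_surj) (simp add: that)
  then obtain h where h [simp]: "\<And>v. v \<in> carrier M \<Longrightarrow> h v \<in> carrier N"
    and h_eq: "\<And>v k. v \<in> carrier M \<Longrightarrow> k < card \<omega> \<Longrightarrow> \<kappa>' ((Y' ^^ k) (h v)) = \<kappa> ((Y ^^ k) v)"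
    by metis
  have add: "h (v \<oplus>\<^bsub>M\<^esub> w) = h v \<oplus>\<^bsub>N\<^esub> h w" if "v \<in> carrier M" "w \<in> carrier M" for v w
    using that by (intro N.Y_orbit_inj)
      (simp_all add: h_eq M.Y_pow_add M.kappa_add N.Y_pow_add N.kappa_add)
  have smult: "h (r \<odot>\<^bsub>M\<^esub> v) = r \<odot>\<^bsub>N\<^esub> h v" if "r \<in> carrier R" "v \<in> carrier M" for r v
    using that by (intro N.Y_orbit_inj)
      (simp_all add: h_eq M.Y_pow_smult M.kappa_smult N.Y_pow_smult N.kappa_smult)
  have Y: "h (Y v) = Y' (h v)" if v: "v \<in> carrier M" for v
  proof (rule N.Y_orbit_inj)
    fix k assume k: "k < card \<omega>"
    have "\<kappa>' ((Y' ^^ k) (h (Y v))) = \<kappa> ((Y ^^ Suc k) v)"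
      using v k by (simp add: h_eq funpow_swap1)
    also have "\<dots> = \<kappa>' ((Y' ^^ Suc k) (h v))"
    \<comment> \<open>At the end of the round the coordinate of index \<open>p\<close> is not among
      those matched by \<open>h\<close>; on both sides it is \<open>\<eta>\<close> of the coordinate
      of index 0.\<close>
    proof (cases "Suc k = card \<omega>")
      case True
      have "\<kappa> ((Y ^^ card \<omega>) v) = \<kappa>' ((Y' ^^ card \<omega>) (h v))"
        using v h_eq[OF v M.p_pos] by (simp only: M.kappa_Y N.kappa_Y h funpow_0)
      then show ?thesis by (simp only: True)
    next
      case False
      then have "Suc k < card \<omega>" using k by simp
      then show ?thesis by (simp only: h_eq[OF v])
    qed
    also have "\<dots> = \<kappa>' ((Y' ^^ k) (Y' (h v)))" by (simp add: funpow_swap1)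
    finally show "\<kappa>' ((Y' ^^ k) (h (Y v))) = \<kappa>' ((Y' ^^ k) (Y' (h v)))" .
  qed (use v in simp_all)
  \<comment> \<open>Y' is injective and Y X is multiplication by \<open>t\<close> on both sides, so
    X follows from R and Y.\<close>
  have X: "h (X v) = X' (h v)" if v: "v \<in> carrier M" for v
  proof (rule N.Y_inj)
    show "Y' (h (X v)) = Y' (X' (h v))"
      using v by (simp add: smult M.Y_X N.Y_X flip: Y)
  qed (use v in simp_all)
  have "bij_betw h (carrier M) (carrier N)"
  proof (rule bij_betwI')
    fix v w assume v: "v \<in> carrier M" and w: "w \<in> carrier M"
    show "h v = h w \<longleftrightarrow> v = w"
    proof
      assume "h v = h w"
      then show "v = w" using v w h_eq by (intro M.Y_orbit_inj) metis+
    qed simp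
  next
    fix w assume w: "w \<in> carrier N"
    have "\<exists>v\<in>carrier M. \<forall>k<card \<omega>. \<kappa> ((Y ^^ k) v) = \<kappa>' ((Y' ^^ k) w)"
      by (rule M.Y_orbit_surj) (simp add: w)
    then obtain v where "v \<in> carrier M" "\<And>k. k < card \<omega> \<Longrightarrow> \<kappa> ((Y ^^ k) v) = \<kappa>' ((Y' ^^ k) w)" by blast
    then show "\<exists>v\<in>carrier M. w = h v"
      using w h_eq by (intro bexI[of _ v] N.Y_orbit_inj) simp_all
  qed simp
  with add smult X Y show ?thesis using that by blast
qed

text \<open>With an isomorphism \<open>S\<close> of fibre data, a module becomes a model for the
  data of another one, so that \<open>gwa_orbit_model_isomorphic\<close> can compare the
  two.\<close>

lemma gwa_orbit_model_transfer:
  assumes "gwa_orbit_model R \<sigma> t star \<omega> \<mm>\<omega> M X Y U \<kappa> \<eta>" and "module R U'"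
    and bij: "bij_betw S (carrier U) (carrier U')"
    and add: "\<And>u v. \<lbrakk>u \<in> carrier U; v \<in> carrier U\<rbrakk> \<Longrightarrow> S (u \<oplus>\<^bsub>U\<^esub> v) = S u \<oplus>\<^bsub>U'\<^esub> S v"
    and smult: "\<And>r u. \<lbrakk>r \<in> carrier R; u \<in> carrier U\<rbrakk> \<Longrightarrow> S (r \<odot>\<^bsub>U\<^esub> u) = r \<odot>\<^bsub>U'\<^esub> S u"
    and \<eta>: "\<And>u. u \<in> carrier U \<Longrightarrow> S (\<eta> u) = \<eta>' (S u)"
  shows "gwa_orbit_model R \<sigma> t star \<omega> \<mm>\<omega> M X Y U' (S \<circ> \<kappa>) \<eta>'"
proof -
  interpret M: gwa_orbit_model R \<sigma> t star \<omega> \<mm>\<omega> M X Y U \<kappa> \<eta> by fact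
  interpret U': module R U' by fact
  have S [simp]: "S u \<in> carrier U'" if "u \<in> carrier U" for u using bij_betwE[OF bij] that by blast
  have S0: "S \<zero>\<^bsub>U\<^esub> = \<zero>\<^bsub>U'\<^esub>"
    using add[of "\<zero>\<^bsub>U\<^esub>" "\<zero>\<^bsub>U\<^esub>"] U'.M.add.r_cancel_one'[of "S \<zero>\<^bsub>U\<^esub>" "S \<zero>\<^bsub>U\<^esub>"] by simp
  show ?thesis
  proof unfold_locales
    fix v assume v: "v \<in> carrier M" and wt: "\<And>r. r \<in> \<mm>\<omega> \<Longrightarrow> r \<odot>\<^bsub>M\<^esub> v = \<zero>\<^bsub>M\<^esub>"
      and "(S \<circ> \<kappa>) v = \<zero>\<^bsub>U'\<^esub>"
    then have "S (\<kappa> v) = S \<zero>\<^bsub>U\<^esub>" by (simp add: S0)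
    then have "\<kappa> v = \<zero>\<^bsub>U\<^esub>" by (rule inj_onD[OF bij_betw_imp_inj_on[OF bij]]) (use v in simp_all)
    then show "v = \<zero>\<^bsub>M\<^esub>" using M.kappa_ker v wt by blast
  next
    fix u assume "u \<in> carrier U'"
    then obtain u0 where "u0 \<in> carrier U" "S u0 = u" using bij by (metis bij_betw_def imageE)
    then show "\<exists>v\<in>carrier M. (\<forall>r\<in>\<mm>\<omega>. r \<odot>\<^bsub>M\<^esub> v = \<zero>\<^bsub>M\<^esub>) \<and> (S \<circ> \<kappa>) v = u"
      using M.kappa_surj by fastforce
  qed (simp_all add: M.kappa_add M.kappa_smult M.kappa_Y add smult \<eta>)
qed

section \<open>Direct sums and residue fields\<close>

lemma direct_sum_simps:
  assumes "finite I"
  shows "carrier (direct_sum I M) = (\<Pi>\<^sub>E i\<in>I. carrier (M i))"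
    "\<zero>\<^bsub>direct_sum I M\<^esub> = (\<lambda>i\<in>I. \<zero>\<^bsub>M i\<^esub>)"
    "u \<oplus>\<^bsub>direct_sum I M\<^esub> v = (\<lambda>i\<in>I. u i \<oplus>\<^bsub>M i\<^esub> v i)"
    "a \<odot>\<^bsub>direct_sum I M\<^esub> u = (\<lambda>i\<in>I. a \<odot>\<^bsub>M i\<^esub> u i)"
  using assms by (auto simp: direct_sum_def)

lemma (in cring) module_direct_sum:
  assumes "finite I" and mod: "\<And>i. i \<in> I \<Longrightarrow> module R (M i)"
  shows "module R (direct_sum I M)"
proof (rule moduleI)
  note [simp] = direct_sum_simps[OF assms(1)]
  note ag = module.axioms(2)[OF mod]
  show "cring R" by (rule is_cring)
  show "abelian_group (direct_sum I M)"
  proof (rule abelian_groupI)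
    fix u assume u: "u \<in> carrier (direct_sum I M)"
    show "\<exists>v\<in>carrier (direct_sum I M). v \<oplus>\<^bsub>direct_sum I M\<^esub> u = \<zero>\<^bsub>direct_sum I M\<^esub>"
    proof (rule bexI[of _ "\<lambda>i\<in>I. \<ominus>\<^bsub>M i\<^esub> u i"])
      show "(\<lambda>i\<in>I. \<ominus>\<^bsub>M i\<^esub> u i) \<oplus>\<^bsub>direct_sum I M\<^esub> u = \<zero>\<^bsub>direct_sum I M\<^esub>"
        using u by (auto intro!: restrict_ext abelian_group.l_neg[OF ag])
      show "(\<lambda>i\<in>I. \<ominus>\<^bsub>M i\<^esub> u i) \<in> carrier (direct_sum I M)"
        using u by (auto intro!: abelian_group.a_inv_closed[OF ag])
    qed
  next
    fix u v w assume u: "u \<in> carrier (direct_sum I M)" and v: "v \<in> carrier (direct_sum I M)"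
    show "u \<oplus>\<^bsub>direct_sum I M\<^esub> v \<in> carrier (direct_sum I M)"
      using u v by (auto intro!: abelian_monoid.a_closed[OF abelian_group.axioms(1)[OF ag]])
    show "u \<oplus>\<^bsub>direct_sum I M\<^esub> v = v \<oplus>\<^bsub>direct_sum I M\<^esub> u"
      using u v by (auto intro!: restrict_ext abelian_monoid.a_comm[OF abelian_group.axioms(1)[OF ag]])
    assume w: "w \<in> carrier (direct_sum I M)"
    show "u \<oplus>\<^bsub>direct_sum I M\<^esub> v \<oplus>\<^bsub>direct_sum I M\<^esub> w = u \<oplus>\<^bsub>direct_sum I M\<^esub> (v \<oplus>\<^bsub>direct_sum I M\<^esub> w)"
      using u v w by (auto intro!: restrict_ext abelian_monoid.a_assoc[OF abelian_group.axioms(1)[OF ag]])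
  next
    show "\<zero>\<^bsub>direct_sum I M\<^esub> \<in> carrier (direct_sum I M)"
      by (auto intro!: abelian_monoid.zero_closed[OF abelian_group.axioms(1)[OF ag]])
    fix u assume u: "u \<in> carrier (direct_sum I M)"
    then show "\<zero>\<^bsub>direct_sum I M\<^esub> \<oplus>\<^bsub>direct_sum I M\<^esub> u = u"
      by (auto simp: PiE_iff fun_eq_iff extensional_def
          intro!: abelian_monoid.l_zero[OF abelian_group.axioms(1)[OF ag]])
  qed
  fix a u assume a: "a \<in> carrier R" and u: "u \<in> carrier (direct_sum I M)"
  show "a \<odot>\<^bsub>direct_sum I M\<^esub> u \<in> carrier (direct_sum I M)"
    using a u by (auto intro!: module.smult_closed[OF mod])
  fix b assume b: "b \<in> carrier R"
  show "(a \<oplus> b) \<odot>\<^bsub>direct_sum I M\<^esub> u = a \<odot>\<^bsub>direct_sum I M\<^esub> u \<oplus>\<^bsub>direct_sum I M\<^esub> b \<odot>\<^bsub>direct_sum I M\<^esub> u"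
    using a b u by (auto intro!: restrict_ext module.smult_l_distr[OF mod])
  show "(a \<otimes> b) \<odot>\<^bsub>direct_sum I M\<^esub> u = a \<odot>\<^bsub>direct_sum I M\<^esub> (b \<odot>\<^bsub>direct_sum I M\<^esub> u)"
    using a b u by (auto intro!: restrict_ext module.smult_assoc1[OF mod])
next
  note [simp] = direct_sum_simps[OF assms(1)]
  fix a u v assume a: "a \<in> carrier R" and u: "u \<in> carrier (direct_sum I M)" and v: "v \<in> carrier (direct_sum I M)"
  show "a \<odot>\<^bsub>direct_sum I M\<^esub> (u \<oplus>\<^bsub>direct_sum I M\<^esub> v) =
      a \<odot>\<^bsub>direct_sum I M\<^esub> u \<oplus>\<^bsub>direct_sum I M\<^esub> a \<odot>\<^bsub>direct_sum I M\<^esub> v"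
    using a u v by (auto intro!: restrict_ext module.smult_r_distr[OF mod])
next
  note [simp] = direct_sum_simps[OF assms(1)]
  fix u assume u: "u \<in> carrier (direct_sum I M)"
  then show "\<one> \<odot>\<^bsub>direct_sum I M\<^esub> u = u"
    by (auto simp: PiE_iff fun_eq_iff extensional_def intro!: module.smult_one[OF mod])
qed

lemma residue_module_simps:
  "carrier (residue_module R \<mm>) = carrier (R Quot \<mm>)"
  "\<zero>\<^bsub>residue_module R \<mm>\<^esub> = \<zero>\<^bsub>R Quot \<mm>\<^esub>"
  "u \<oplus>\<^bsub>residue_module R \<mm>\<^esub> v = u \<oplus>\<^bsub>R Quot \<mm>\<^esub> v"
  "r \<odot>\<^bsub>residue_module R \<mm>\<^esub> u = (\<mm> +>\<^bsub>R\<^esub> r) \<otimes>\<^bsub>R Quot \<mm>\<^esub> u"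
  by (simp_all add: residue_module_def)

lemma (in cring) module_residue_module:
  assumes "ideal \<mm> R" shows "module R (residue_module R \<mm>)"
proof -
  interpret \<mm>: ideal \<mm> R by fact
  interpret K: cring "R Quot \<mm>" using \<mm>.quotient_is_cring is_cring by blast
  interpret q: ring_hom_ring R "R Quot \<mm>" "(+>) \<mm>" by (rule \<mm>.rcos_ring_hom_ring)
  show ?thesis
  proof (rule moduleI)
    show "abelian_group (residue_module R \<mm>)"
    proof (rule abelian_groupI)
      fix u assume "u \<in> carrier (residue_module R \<mm>)"
      then show "\<exists>v\<in>carrier (residue_module R \<mm>). v \<oplus>\<^bsub>residue_module R \<mm>\<^esub> u = \<zero>\<^bsub>residue_module R \<mm>\<^esub>"
        by (intro bexI[of _ "\<ominus>\<^bsub>R Quot \<mm>\<^esub> u"]) (simp_all add: residue_module_simps K.l_neg)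
    qed (simp_all add: residue_module_simps K.a_assoc, rule K.a_comm)
  qed (simp_all add: residue_module_simps is_cring K.l_distr K.r_distr K.m_assoc)
qed

section \<open>Residue fields along the orbit\<close>

context gwa_orbit
begin

abbreviation Km :: "'a set \<Rightarrow> 'a set ring" where "Km \<mm> \<equiv> R Quot \<mm>"

lemma Km_field: "\<mm> \<in> \<omega> \<Longrightarrow> field (Km \<mm>)"
  using maximalideal.quotient_is_field[OF orbit_max] is_cring by blast

lemma Km_repr: "c \<in> carrier (Km \<mm>) \<Longrightarrow> \<exists>r\<in>carrier R. c = \<mm> +> r"
  by (auto simp: FactRing_def A_RCOSETS_def')

lemma orbit_ideal: "\<mm> \<in> \<omega> \<Longrightarrow> ideal \<mm> R"
  using orbit_max maximalideal.axioms(1) by blast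

lemma coset_closed: "\<mm> \<in> \<omega> \<Longrightarrow> r \<in> carrier R \<Longrightarrow> \<mm> +> r \<in> carrier (Km \<mm>)"
  by (auto simp: FactRing_def A_RCOSETS_def')

lemma Km_subset: "\<mm> \<in> \<omega> \<Longrightarrow> c \<in> carrier (Km \<mm>) \<Longrightarrow> c \<subseteq> carrier R"
  using Km_repr[of c \<mm>] orbit_subset[of \<mm>] by (auto simp: a_r_coset_def')

lemma sg_coset: "\<mm> \<in> \<omega> \<Longrightarrow> r \<in> carrier R \<Longrightarrow> sg n ` (\<mm> +> r) = sg n ` \<mm> +> sg n r"
  using image_coset[OF sg_hom orbit_subset] by blast

lemma sg_Km_hom: "\<mm> \<in> \<omega> \<Longrightarrow> (`) (sg n) \<in> ring_hom (Km \<mm>) (Km (sg n ` \<mm>))"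
  using image_Quot_hom[OF sg_iso orbit_ideal] by blast

lemma star_Km_hom: "\<mm> \<in> \<omega> \<Longrightarrow> (`) star \<in> ring_hom (Km \<mm>) (Km \<mm>)"
  using image_Quot_hom[OF star_iso orbit_ideal, of \<mm>] by simp

lemma coset_zero: "\<mm> \<in> \<omega> \<Longrightarrow> r \<in> \<mm> \<Longrightarrow> \<mm> +> r = \<zero>\<^bsub>Km \<mm>\<^esub>"
  using ideal.rcos_const_imp_mem[OF orbit_ideal]
    abelian_subgroup.a_rcos_const[OF abelian_subgroupI3] orbit_ideal
  by (metis FactRing_def ring.simps(1) ideal.axioms(1) is_abelian_group)

lemma coset_eq_zero_iff: "\<mm> \<in> \<omega> \<Longrightarrow> r \<in> carrier R \<Longrightarrow> \<mm> +> r = \<zero>\<^bsub>Km \<mm>\<^esub> \<longleftrightarrow> r \<in> \<mm>"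
  using coset_zero[of \<mm> r] ideal.rcos_const_imp_mem[OF orbit_ideal, of \<mm> r] by (auto simp: FactRing_def)

end

section \<open>The companion map and its inverse\<close>

text \<open>Otherwise the index set \<open>{1..d}\<close> is rewritten to \<open>{Suc 0..d}\<close>.\<close>

declare One_nat_def [simp del]

text \<open>The product of the companion matrix with \<open>v\<close> written out: the ones below
  the diagonal shift the entries, the last column adds a multiple of \<open>v d\<close>.\<close>

definition companion_mul ::
    "('k, 'c) ring_scheme \<Rightarrow> nat \<Rightarrow> (nat \<Rightarrow> 'k) \<Rightarrow> (nat \<Rightarrow> 'k) \<Rightarrow> nat \<Rightarrow> 'k" where
  "companion_mul K d \<alpha> v = (\<lambda>i\<in>{1..d}.
     (if i = 1 then \<zero>\<^bsub>K\<^esub> else v (i - 1)) \<ominus>\<^bsub>K\<^esub> (\<alpha> (i - 1) \<otimes>\<^bsub>K\<^esub> inv\<^bsub>K\<^esub> \<alpha> d) \<otimes>\<^bsub>K\<^esub> v d)"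

text \<open>The solution u of F u = v: the first row gives u_d = - (alpha_d / alpha_0) v_1, and row
  i + 1 then gives entry i.\<close>

definition companion_div ::
    "('k, 'c) ring_scheme \<Rightarrow> nat \<Rightarrow> (nat \<Rightarrow> 'k) \<Rightarrow> (nat \<Rightarrow> 'k) \<Rightarrow> nat \<Rightarrow> 'k" where
  "companion_div K d \<alpha> v = (\<lambda>i\<in>{1..d}.
     (if i = d then \<zero>\<^bsub>K\<^esub> else v (Suc i)) \<ominus>\<^bsub>K\<^esub> (\<alpha> i \<otimes>\<^bsub>K\<^esub> inv\<^bsub>K\<^esub> \<alpha> 0) \<otimes>\<^bsub>K\<^esub> v 1)"

locale companion_field = field K for K (structure) +
  fixes d :: nat and \<alpha> :: "nat \<Rightarrow> 'a"
  assumes alpha_closed [simp]: "k \<le> d \<Longrightarrow> \<alpha> k \<in> carrier K"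
    and alpha_0: "\<alpha> 0 \<noteq> \<zero>" and alpha_d: "\<alpha> d \<noteq> \<zero>"
begin

abbreviation Kd :: "(nat \<Rightarrow> 'a) set" where "Kd \<equiv> {1..d} \<rightarrow>\<^sub>E carrier K"

lemma Kd_nth [simp]: "v \<in> Kd \<Longrightarrow> 1 \<le> i \<Longrightarrow> i \<le> d \<Longrightarrow> v i \<in> carrier K"
  by auto

lemma alpha_0_unit: "\<alpha> 0 \<in> Units K" and alpha_d_unit: "\<alpha> d \<in> Units K"
  using alpha_0 alpha_d by (simp_all add: field_Units)

lemma inv_alpha [simp]: "inv (\<alpha> 0) \<in> carrier K" "inv (\<alpha> d) \<in> carrier K"
  using alpha_0_unit alpha_d_unit by simp_all

lemma cancel_alpha_0 [simp]: "x \<in> carrier K \<Longrightarrow> inv (\<alpha> 0) \<otimes> (\<alpha> 0 \<otimes> x) = x" "inv (\<alpha> 0) \<otimes> \<alpha> 0 = \<one>"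
  using alpha_0_unit Units_l_inv[OF alpha_0_unit] by (simp_all add: m_assoc[symmetric])

lemma cancel_alpha_d [simp]: "x \<in> carrier K \<Longrightarrow> inv (\<alpha> d) \<otimes> (\<alpha> d \<otimes> x) = x" "inv (\<alpha> d) \<otimes> \<alpha> d = \<one>"
  using alpha_d_unit Units_l_inv[OF alpha_d_unit] by (simp_all add: m_assoc[symmetric])

text \<open>Among the columns below \<open>d\<close> only column \<open>i - 1\<close> has a nonzero
  entry in row \<open>i\<close>, and none has for \<open>i = 1\<close>; column \<open>d\<close>
  supplies the other term.\<close>

lemma mat_vec_companion:
  assumes v: "v \<in> Kd" shows "mat_vec K d (companion K d \<alpha>) v = companion_mul K d \<alpha> v"
  unfolding mat_vec_def companion_mul_def
proof (rule restrict_ext)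
  fix i assume i: "i \<in> {1..d}"
  let ?f = "\<lambda>j. companion K d \<alpha> i j \<otimes> v j"
  have f: "?f \<in> {1..d} \<rightarrow> carrier K" using i v by (auto simp: companion_def)
  have "(\<Oplus>j\<in>{1..<d}. ?f j) = (if i = 1 then \<zero> else v (i - 1))"
  proof (cases "i = 1")
    case True
    have "(\<Oplus>j\<in>{1..<d}. ?f j) = (\<Oplus>j\<in>{1..<d}. \<zero>)"
      using v True by (intro finsum_cong') (auto simp: companion_def)
    then show ?thesis using True by simp
  next
    case False
    have "(\<Oplus>j\<in>{1..<d}. ?f j) = (\<Oplus>j\<in>{1..<d}. if i - 1 = j then v j else \<zero>)"
      using v False i by (intro finsum_cong') (auto simp: companion_def)
    also have "\<dots> = v (i - 1)"
      using v False i by (intro add.finprod_singleton) auto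
    finally show ?thesis using False by simp
  qed
  moreover have "(\<Oplus>j\<in>{1..d}. ?f j) = ?f d \<oplus> (\<Oplus>j\<in>{1..<d}. ?f j)"
  proof -
    have "{1..d} = insert d {1..<d}" using i by auto
    then show ?thesis using f by (simp add: Pi_def)
  qed
  moreover have "?f d = \<ominus> ((\<alpha> (i - 1) \<otimes> inv (\<alpha> d)) \<otimes> v d)"
  proof -
    have "v d \<in> carrier K" "\<alpha> (i - 1) \<in> carrier K" using i Kd_nth[OF v, of d] by auto
    then show ?thesis by (simp add: companion_def l_minus)
  qed
  moreover have "(if i = 1 then \<zero> else v (i - 1)) \<in> carrier K" "(\<alpha> (i - 1) \<otimes> inv (\<alpha> d)) \<otimes> v d \<in> carrier K"
    using i v by auto
  ultimately show "(\<Oplus>j\<in>{1..d}. ?f j) = (if i = 1 then \<zero> else v (i - 1)) \<ominus> (\<alpha> (i - 1) \<otimes> inv (\<alpha> d)) \<otimes> v d"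
    by (simp add: a_minus_def a_comm)
qed

lemma companion_mul_closed [simp]: "v \<in> Kd \<Longrightarrow> companion_mul K d \<alpha> v \<in> Kd"
  by (auto simp: companion_mul_def)

lemma companion_div_closed [simp]: "v \<in> Kd \<Longrightarrow> companion_div K d \<alpha> v \<in> Kd"
  by (auto simp: companion_div_def)

lemma Kd_eqI: "\<lbrakk>v \<in> Kd; w \<in> Kd; \<And>i. 1 \<le> i \<Longrightarrow> i \<le> d \<Longrightarrow> v i = w i\<rbrakk> \<Longrightarrow> v = w"
  by (rule PiE_ext) auto

text \<open>The first entry of F v is - (alpha_0 / alpha_d) v_d, so the correction made by
  \<open>companion_div\<close> cancels exactly what the last column contributed to entry i +
  1.\<close>

lemma companion_div_mul [simp]:
  assumes v: "v \<in> Kd" shows "companion_div K d \<alpha> (companion_mul K d \<alpha> v) = v"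
proof (rule Kd_eqI)
  fix i assume i: "1 \<le> i" "i \<le> d"
  have cl: "\<alpha> i \<in> carrier K" "v d \<in> carrier K" "v i \<in> carrier K" using i v by auto
  have 1: "companion_mul K d \<alpha> v 1 = \<ominus> ((\<alpha> 0 \<otimes> inv (\<alpha> d)) \<otimes> v d)"
    using i v by (simp add: companion_mul_def a_minus_def)
  have "(\<alpha> i \<otimes> inv (\<alpha> 0)) \<otimes> companion_mul K d \<alpha> v 1 = \<ominus> (\<alpha> i \<otimes> (inv (\<alpha> 0) \<otimes> (\<alpha> 0 \<otimes> (inv (\<alpha> d) \<otimes> v d))))"
    unfolding 1 using cl by (simp add: r_minus m_assoc del: cancel_alpha_0)
  also have "\<dots> = \<ominus> (\<alpha> i \<otimes> (inv (\<alpha> d) \<otimes> v d))" using cl by simp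
  finally have 2: "(\<alpha> i \<otimes> inv (\<alpha> 0)) \<otimes> companion_mul K d \<alpha> v 1 = \<ominus> (\<alpha> i \<otimes> (inv (\<alpha> d) \<otimes> v d))" .
  show "companion_div K d \<alpha> (companion_mul K d \<alpha> v) i = v i"
  proof (cases "i = d")
    case True
    have "\<alpha> d \<otimes> (inv (\<alpha> d) \<otimes> v d) = v d"
      using cl by (simp add: m_lcomm[of "\<alpha> d" "inv (\<alpha> d)"])
    then show ?thesis using True i 2 cl
      by (simp add: companion_div_def a_minus_def)
  next
    case False
    then have "companion_mul K d \<alpha> v (Suc i) = v i \<ominus> \<alpha> i \<otimes> (inv (\<alpha> d) \<otimes> v d)"
      using i cl by (simp add: companion_mul_def m_assoc)
    then show ?thesis using False i 2 cl
      by (simp add: companion_div_def a_minus_def a_assoc l_neg)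
  qed
qed (use v in simp_all)

lemma companion_mul_div [simp]:
  assumes v: "v \<in> Kd" shows "companion_mul K d \<alpha> (companion_div K d \<alpha> v) = v"
proof (rule Kd_eqI)
  fix i assume i: "1 \<le> i" "i \<le> d"
  have cl: "\<alpha> (i - 1) \<in> carrier K" "v 1 \<in> carrier K" "v i \<in> carrier K" using i v by auto
  have 1: "companion_div K d \<alpha> v d = \<ominus> ((\<alpha> d \<otimes> inv (\<alpha> 0)) \<otimes> v 1)"
    using i v by (simp add: companion_div_def a_minus_def)
  have "(\<alpha> (i - 1) \<otimes> inv (\<alpha> d)) \<otimes> companion_div K d \<alpha> v d =
      \<ominus> (\<alpha> (i - 1) \<otimes> (inv (\<alpha> d) \<otimes> (\<alpha> d \<otimes> (inv (\<alpha> 0) \<otimes> v 1))))"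
    unfolding 1 using cl by (simp add: r_minus m_assoc del: cancel_alpha_d)
  also have "\<dots> = \<ominus> (\<alpha> (i - 1) \<otimes> (inv (\<alpha> 0) \<otimes> v 1))" using cl by simp
  finally have 2: "(\<alpha> (i - 1) \<otimes> inv (\<alpha> d)) \<otimes> companion_div K d \<alpha> v d = \<ominus> (\<alpha> (i - 1) \<otimes> (inv (\<alpha> 0) \<otimes> v 1))" .
  show "companion_mul K d \<alpha> (companion_div K d \<alpha> v) i = v i"
  proof (cases "i = 1")
    case True
    have "\<alpha> 0 \<otimes> (inv (\<alpha> 0) \<otimes> v 1) = v 1"
      using cl by (simp add: m_lcomm[of "\<alpha> 0" "inv (\<alpha> 0)"])
    then show ?thesis using True i 2 cl
      by (simp add: companion_mul_def a_minus_def)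
  next
    case False
    then have "companion_div K d \<alpha> v (i - 1) = v i \<ominus> \<alpha> (i - 1) \<otimes> (inv (\<alpha> 0) \<otimes> v 1)"
      using i cl by (auto simp: companion_div_def m_assoc)
    then show ?thesis using False i 2 cl
      by (simp add: companion_mul_def a_minus_def a_assoc l_neg)
  qed
qed (use v in simp_all)

text \<open>The left inverse gives injectivity, so \<open>inv_into\<close> must return the explicit
  solution.\<close>

lemma mat_inv_vec_companion:
  assumes v: "v \<in> Kd" shows "mat_inv_vec K d (companion K d \<alpha>) v = companion_div K d \<alpha> v"
proof -
  have "inj_on (mat_vec K d (companion K d \<alpha>)) Kd"
    by (rule inj_on_inverseI[of _ "companion_div K d \<alpha>"]) (simp add: mat_vec_companion)
  then have "inv_into Kd (mat_vec K d (companion K d \<alpha>)) (mat_vec K d (companion K d \<alpha>) (companion_div K d \<alpha> v))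
      = companion_div K d \<alpha> v"
    by (rule inv_into_f_f) (use v in simp)
  then show ?thesis using v by (simp add: mat_inv_vec_def mat_vec_companion)
qed

lemma companion_mul_add:
  assumes "v \<in> Kd" "w \<in> Kd"
  shows "companion_mul K d \<alpha> (\<lambda>i\<in>{1..d}. v i \<oplus> w i) =
    (\<lambda>i\<in>{1..d}. companion_mul K d \<alpha> v i \<oplus> companion_mul K d \<alpha> w i)"
proof (rule Kd_eqI)
  fix i assume i: "1 \<le> i" "i \<le> d"
  have cl: "\<alpha> (i - 1) \<in> carrier K" "v d \<in> carrier K" "w d \<in> carrier K" using i assms by auto
  have cl': "v (i - 1) \<in> carrier K" "w (i - 1) \<in> carrier K" if "i \<noteq> 1" using i assms that by auto
  show "companion_mul K d \<alpha> (\<lambda>i\<in>{1..d}. v i \<oplus> w i) i =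
      (\<lambda>i\<in>{1..d}. companion_mul K d \<alpha> v i \<oplus> companion_mul K d \<alpha> w i) i"
    using i cl cl' by (cases "i = 1")
      (auto simp: companion_mul_def a_minus_def r_distr minus_add a_ac)
qed (use assms in \<open>auto intro!: a_closed Kd_nth\<close>)

lemma companion_mul_smult:
  assumes "v \<in> Kd" "a \<in> carrier K"
  shows "companion_mul K d \<alpha> (\<lambda>i\<in>{1..d}. a \<otimes> v i) = (\<lambda>i\<in>{1..d}. a \<otimes> companion_mul K d \<alpha> v i)"
proof (rule Kd_eqI)
  fix i assume i: "1 \<le> i" "i \<le> d"
  have cl: "\<alpha> (i - 1) \<in> carrier K" "v d \<in> carrier K" using i assms by auto
  have cl': "v (i - 1) \<in> carrier K" if "i \<noteq> 1" using i assms that by auto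
  show "companion_mul K d \<alpha> (\<lambda>i\<in>{1..d}. a \<otimes> v i) i = (\<lambda>i\<in>{1..d}. a \<otimes> companion_mul K d \<alpha> v i) i"
    using i cl cl' assms(2) by (cases "i = 1")
      (auto simp: companion_mul_def a_minus_def r_distr r_minus m_ac)
qed (use assms in \<open>auto intro!: m_closed Kd_nth\<close>)

text \<open>Additivity passes from a bijection to its inverse: the sum is rewritten as the image of
  a sum under \<open>companion_mul\<close>.\<close>

lemma companion_div_add:
  assumes "v \<in> Kd" "w \<in> Kd"
  shows "companion_div K d \<alpha> (\<lambda>i\<in>{1..d}. v i \<oplus> w i) =
    (\<lambda>i\<in>{1..d}. companion_div K d \<alpha> v i \<oplus> companion_div K d \<alpha> w i)"
proof -
  have sum: "(\<lambda>i\<in>{1..d}. a i \<oplus> b i) \<in> Kd" if "a \<in> Kd" "b \<in> Kd" for a b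
    using that by (auto intro!: a_closed Kd_nth)
  have "companion_div K d \<alpha> (\<lambda>i\<in>{1..d}. v i \<oplus> w i) = companion_div K d \<alpha> (companion_mul K d \<alpha>
      (\<lambda>i\<in>{1..d}. companion_div K d \<alpha> v i \<oplus> companion_div K d \<alpha> w i))"
    using assms by (simp add: companion_mul_add)
  also have "\<dots> = (\<lambda>i\<in>{1..d}. companion_div K d \<alpha> v i \<oplus> companion_div K d \<alpha> w i)"
    using assms by (intro companion_div_mul sum companion_div_closed)
  finally show ?thesis .
qed

lemma companion_div_smult:
  assumes "v \<in> Kd" "a \<in> carrier K"
  shows "companion_div K d \<alpha> (\<lambda>i\<in>{1..d}. a \<otimes> v i) = (\<lambda>i\<in>{1..d}. a \<otimes> companion_div K d \<alpha> v i)"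
proof -
  have prod: "(\<lambda>i\<in>{1..d}. a \<otimes> b i) \<in> Kd" if "b \<in> Kd" for b
    using that assms(2) by (auto intro!: m_closed Kd_nth)
  have "companion_div K d \<alpha> (\<lambda>i\<in>{1..d}. a \<otimes> v i) = companion_div K d \<alpha> (companion_mul K d \<alpha>
      (\<lambda>i\<in>{1..d}. a \<otimes> companion_div K d \<alpha> v i))"
    using assms by (simp add: companion_mul_smult)
  also have "\<dots> = (\<lambda>i\<in>{1..d}. a \<otimes> companion_div K d \<alpha> v i)"
    using assms by (intro companion_div_mul prod companion_div_closed)
  finally show ?thesis .
qed

end

section \<open>The module of a skew polynomial\<close>

text \<open>The operators have the shape X = L C t and Y = D L', with \<open>L\<close>,
  \<open>L'\<close> mutually inverse semilinear transports between neighbouring fibres and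
  \<open>C\<close>, \<open>D\<close> mutually inverse linear maps of one fibre. Y X therefore
  collapses to \<open>t\<close>, and X Y to \<open>t\<close> moved through \<open>L\<close>, which
  is \<open>\<sigma> t\<close>.\<close>

lemma (in gwa_orbit) gwa_rep_direct_sum:
  fixes W :: "'a set \<Rightarrow> ('a, 'w, 'z) module_scheme" and C D L L' :: "'a set \<Rightarrow> 'w \<Rightarrow> 'w"
  assumes W: "\<And>\<mm>. \<mm> \<in> \<omega> \<Longrightarrow> module R (W \<mm>)"
    and C: "\<And>\<mm> u. \<lbrakk>\<mm> \<in> \<omega>; u \<in> carrier (W \<mm>)\<rbrakk> \<Longrightarrow> C \<mm> u \<in> carrier (W \<mm>)"
      "\<And>\<mm> u v. \<lbrakk>\<mm> \<in> \<omega>; u \<in> carrier (W \<mm>); v \<in> carrier (W \<mm>)\<rbrakk> \<Longrightarrow> C \<mm> (u \<oplus>\<^bsub>W \<mm>\<^esub> v) = C \<mm> u \<oplus>\<^bsub>W \<mm>\<^esub> C \<mm> v"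
      "\<And>\<mm> r u. \<lbrakk>\<mm> \<in> \<omega>; r \<in> carrier R; u \<in> carrier (W \<mm>)\<rbrakk> \<Longrightarrow> C \<mm> (r \<odot>\<^bsub>W \<mm>\<^esub> u) = r \<odot>\<^bsub>W \<mm>\<^esub> C \<mm> u"
    and D: "\<And>\<mm> u. \<lbrakk>\<mm> \<in> \<omega>; u \<in> carrier (W \<mm>)\<rbrakk> \<Longrightarrow> D \<mm> u \<in> carrier (W \<mm>)"
      "\<And>\<mm> u v. \<lbrakk>\<mm> \<in> \<omega>; u \<in> carrier (W \<mm>); v \<in> carrier (W \<mm>)\<rbrakk> \<Longrightarrow> D \<mm> (u \<oplus>\<^bsub>W \<mm>\<^esub> v) = D \<mm> u \<oplus>\<^bsub>W \<mm>\<^esub> D \<mm> v"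
      "\<And>\<mm> r u. \<lbrakk>\<mm> \<in> \<omega>; r \<in> carrier R; u \<in> carrier (W \<mm>)\<rbrakk> \<Longrightarrow> D \<mm> (r \<odot>\<^bsub>W \<mm>\<^esub> u) = r \<odot>\<^bsub>W \<mm>\<^esub> D \<mm> u"
    and CD: "\<And>\<mm> u. \<lbrakk>\<mm> \<in> \<omega>; u \<in> carrier (W \<mm>)\<rbrakk> \<Longrightarrow> C \<mm> (D \<mm> u) = u"
      "\<And>\<mm> u. \<lbrakk>\<mm> \<in> \<omega>; u \<in> carrier (W \<mm>)\<rbrakk> \<Longrightarrow> D \<mm> (C \<mm> u) = u"
    and L: "\<And>\<mm> u. \<lbrakk>\<mm> \<in> \<omega>; u \<in> carrier (W \<mm>)\<rbrakk> \<Longrightarrow> L \<mm> u \<in> carrier (W (\<sigma> ` \<mm>))"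
      "\<And>\<mm> u v. \<lbrakk>\<mm> \<in> \<omega>; u \<in> carrier (W \<mm>); v \<in> carrier (W \<mm>)\<rbrakk> \<Longrightarrow> L \<mm> (u \<oplus>\<^bsub>W \<mm>\<^esub> v) = L \<mm> u \<oplus>\<^bsub>W (\<sigma> ` \<mm>)\<^esub> L \<mm> v"
      "\<And>\<mm> r u. \<lbrakk>\<mm> \<in> \<omega>; r \<in> carrier R; u \<in> carrier (W \<mm>)\<rbrakk> \<Longrightarrow> L \<mm> (r \<odot>\<^bsub>W \<mm>\<^esub> u) = \<sigma> r \<odot>\<^bsub>W (\<sigma> ` \<mm>)\<^esub> L \<mm> u"
    and L': "\<And>\<mm> u. \<lbrakk>\<mm> \<in> \<omega>; u \<in> carrier (W (\<sigma> ` \<mm>))\<rbrakk> \<Longrightarrow> L' \<mm> u \<in> carrier (W \<mm>)"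
      "\<And>\<mm> u v. \<lbrakk>\<mm> \<in> \<omega>; u \<in> carrier (W (\<sigma> ` \<mm>)); v \<in> carrier (W (\<sigma> ` \<mm>))\<rbrakk> \<Longrightarrow>
        L' \<mm> (u \<oplus>\<^bsub>W (\<sigma> ` \<mm>)\<^esub> v) = L' \<mm> u \<oplus>\<^bsub>W \<mm>\<^esub> L' \<mm> v"
      "\<And>\<mm> r u. \<lbrakk>\<mm> \<in> \<omega>; r \<in> carrier R; u \<in> carrier (W (\<sigma> ` \<mm>))\<rbrakk> \<Longrightarrow>
        L' \<mm> (r \<odot>\<^bsub>W (\<sigma> ` \<mm>)\<^esub> u) = sinv r \<odot>\<^bsub>W \<mm>\<^esub> L' \<mm> u"
    and LL': "\<And>\<mm> u. \<lbrakk>\<mm> \<in> \<omega>; u \<in> carrier (W \<mm>)\<rbrakk> \<Longrightarrow> L' \<mm> (L \<mm> u) = u"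
      "\<And>\<mm> u. \<lbrakk>\<mm> \<in> \<omega>; u \<in> carrier (W (\<sigma> ` \<mm>))\<rbrakk> \<Longrightarrow> L \<mm> (L' \<mm> u) = u"
    and X: "\<And>v. v \<in> carrier (direct_sum \<omega> W) \<Longrightarrow>
      X v = (\<lambda>\<mm>\<in>\<omega>. L (sinv ` \<mm>) (C (sinv ` \<mm>) (t \<odot>\<^bsub>W (sinv ` \<mm>)\<^esub> v (sinv ` \<mm>))))"
    and Y: "\<And>v. v \<in> carrier (direct_sum \<omega> W) \<Longrightarrow> Y v = (\<lambda>\<mm>\<in>\<omega>. D \<mm> (L' \<mm> (v (\<sigma> ` \<mm>))))"
  shows "gwa_rep R \<sigma> t (direct_sum \<omega> W) X Y"
proof -
  interpret M: module R "direct_sum \<omega> W" using module_direct_sum[OF finite_orbit W] .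
  note ds = direct_sum_simps[OF finite_orbit, of W]
  have nth: "v \<mm> \<in> carrier (W \<mm>)" if "v \<in> carrier (direct_sum \<omega> W)" "\<mm> \<in> \<omega>" for v \<mm>
    using that by (auto simp: ds)
  have st: "\<sigma> ` sinv ` \<mm> = \<mm>" "sinv ` \<sigma> ` \<mm> = \<mm>" if "\<mm> \<in> \<omega>" for \<mm>
    using sg_image_minus[OF orbit_subset[OF that], of 1] by simp_all
  have memI: "(\<lambda>\<mm>\<in>\<omega>. f \<mm>) \<in> carrier (direct_sum \<omega> W)" if "\<And>\<mm>. \<mm> \<in> \<omega> \<Longrightarrow> f \<mm> \<in> carrier (W \<mm>)" for f
    using that by (simp add: ds)
  have eqI: "u = v" if "u \<in> carrier (direct_sum \<omega> W)" "v \<in> carrier (direct_sum \<omega> W)"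
    "\<And>\<mm>. \<mm> \<in> \<omega> \<Longrightarrow> u \<mm> = v \<mm>" for u v
    using that unfolding ds by (rule PiE_ext)
  have Lc: "L (sinv ` \<mm>) u \<in> carrier (W \<mm>)" if "\<mm> \<in> \<omega>" "u \<in> carrier (W (sinv ` \<mm>))" for \<mm> u
    using L(1)[of "sinv ` \<mm>" u] that st by simp
  have sm: "r \<odot>\<^bsub>W \<mm>\<^esub> u \<in> carrier (W \<mm>)" if "\<mm> \<in> \<omega>" "r \<in> carrier R" "u \<in> carrier (W \<mm>)" for \<mm> r u
    using module.smult_closed[OF W] that by blast
  have Xc: "X v \<in> carrier (direct_sum \<omega> W)" if "v \<in> carrier (direct_sum \<omega> W)" for v
    unfolding X[OF that] using that by (intro memI Lc C(1) sm nth) simp_all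
  have Yc: "Y v \<in> carrier (direct_sum \<omega> W)" if "v \<in> carrier (direct_sum \<omega> W)" for v
    unfolding Y[OF that] using that by (intro memI D(1) L'(1) nth) simp_all
  have Xn: "X v \<mm> = L (sinv ` \<mm>) (C (sinv ` \<mm>) (t \<odot>\<^bsub>W (sinv ` \<mm>)\<^esub> v (sinv ` \<mm>)))"
    if "v \<in> carrier (direct_sum \<omega> W)" "\<mm> \<in> \<omega>" for v \<mm> using X that by simp
  have Yn: "Y v \<mm> = D \<mm> (L' \<mm> (v (\<sigma> ` \<mm>)))"
    if "v \<in> carrier (direct_sum \<omega> W)" "\<mm> \<in> \<omega>" for v \<mm> using Y that by simp
  have an: "(v \<oplus>\<^bsub>direct_sum \<omega> W\<^esub> w) \<mm> = v \<mm> \<oplus>\<^bsub>W \<mm>\<^esub> w \<mm>" if "\<mm> \<in> \<omega>" for v w \<mm>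
    using that by (simp add: ds)
  have sn: "(r \<odot>\<^bsub>direct_sum \<omega> W\<^esub> v) \<mm> = r \<odot>\<^bsub>W \<mm>\<^esub> v \<mm>" if "\<mm> \<in> \<omega>" for r v \<mm>
    using that by (simp add: ds)
  show ?thesis
  proof unfold_locales
    fix v assume v: "v \<in> carrier (direct_sum \<omega> W)"
    show "X v \<in> carrier (direct_sum \<omega> W)" "Y v \<in> carrier (direct_sum \<omega> W)" using v Xc Yc by simp_all
    show "Y (X v) = t \<odot>\<^bsub>direct_sum \<omega> W\<^esub> v"
    proof (rule eqI)
      fix \<mm> assume \<mm>: "\<mm> \<in> \<omega>"
      show "Y (X v) \<mm> = (t \<odot>\<^bsub>direct_sum \<omega> W\<^esub> v) \<mm>"
        using v \<mm> by (simp add: Xn Yn sn Xc st LL' CD C D nth sm)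
    qed (use v Xc Yc in simp_all)
    show "X (Y v) = \<sigma> t \<odot>\<^bsub>direct_sum \<omega> W\<^esub> v"
    proof (rule eqI)
      fix \<mm> assume \<mm>: "\<mm> \<in> \<omega>"
      then have \<nn>: "sinv ` \<mm> \<in> \<omega>" by simp
      have vm: "v \<mm> \<in> carrier (W (\<sigma> ` sinv ` \<mm>))" using nth[OF v \<mm>] st[OF \<mm>] by simp
      have "X (Y v) \<mm> = L (sinv ` \<mm>) (C (sinv ` \<mm>) (t \<odot>\<^bsub>W (sinv ` \<mm>)\<^esub> D (sinv ` \<mm>) (L' (sinv ` \<mm>) (v \<mm>))))"
        using \<mm> \<nn> v st[OF \<mm>] by (simp add: Xn Yn Yc)
      also have "\<dots> = \<sigma> t \<odot>\<^bsub>W (\<sigma> ` sinv ` \<mm>)\<^esub> v \<mm>"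
        using vm \<nn> by (simp add: C D CD L L' LL')
      finally show "X (Y v) \<mm> = (\<sigma> t \<odot>\<^bsub>direct_sum \<omega> W\<^esub> v) \<mm>" using \<mm> st[OF \<mm>] by (simp add: sn)
    qed (use v Xc Yc in simp_all)
    fix w assume w: "w \<in> carrier (direct_sum \<omega> W)"
    show "X (v \<oplus>\<^bsub>direct_sum \<omega> W\<^esub> w) = X v \<oplus>\<^bsub>direct_sum \<omega> W\<^esub> X w"
    proof (rule eqI)
      fix \<mm> assume \<mm>: "\<mm> \<in> \<omega>"
      then have \<nn>: "sinv ` \<mm> \<in> \<omega>" by simp
      show "X (v \<oplus>\<^bsub>direct_sum \<omega> W\<^esub> w) \<mm> = (X v \<oplus>\<^bsub>direct_sum \<omega> W\<^esub> X w) \<mm>"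
        using \<mm> \<nn> v w st[OF \<mm>] L(2)[OF \<nn>]
        by (simp add: Xn an module.smult_r_distr[OF W] C sm nth)
    qed (use v w Xc in simp_all)
    show "Y (v \<oplus>\<^bsub>direct_sum \<omega> W\<^esub> w) = Y v \<oplus>\<^bsub>direct_sum \<omega> W\<^esub> Y w"
    proof (rule eqI)
      fix \<mm> assume \<mm>: "\<mm> \<in> \<omega>"
      show "Y (v \<oplus>\<^bsub>direct_sum \<omega> W\<^esub> w) \<mm> = (Y v \<oplus>\<^bsub>direct_sum \<omega> W\<^esub> Y w) \<mm>"
        using \<mm> v w by (simp add: Yn an D L' nth)
    qed (use v w Yc in simp_all)
  next
    fix r v assume r: "r \<in> carrier R" and v: "v \<in> carrier (direct_sum \<omega> W)"
    show "X (r \<odot>\<^bsub>direct_sum \<omega> W\<^esub> v) = \<sigma> r \<odot>\<^bsub>direct_sum \<omega> W\<^esub> X v"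
    proof (rule eqI)
      fix \<mm> assume \<mm>: "\<mm> \<in> \<omega>"
      then have \<nn>: "sinv ` \<mm> \<in> \<omega>" by simp
      have "t \<odot>\<^bsub>W (sinv ` \<mm>)\<^esub> (r \<odot>\<^bsub>W (sinv ` \<mm>)\<^esub> u) = r \<odot>\<^bsub>W (sinv ` \<mm>)\<^esub> (t \<odot>\<^bsub>W (sinv ` \<mm>)\<^esub> u)"
        if "u \<in> carrier (W (sinv ` \<mm>))" for u
        using module.smult_assoc1[OF W[OF \<nn>], of r t u] module.smult_assoc1[OF W[OF \<nn>], of t r u] r that
        by (simp add: m_comm)
      then show "X (r \<odot>\<^bsub>direct_sum \<omega> W\<^esub> v) \<mm> = (\<sigma> r \<odot>\<^bsub>direct_sum \<omega> W\<^esub> X v) \<mm>"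
        using \<mm> \<nn> v r st[OF \<mm>] L(3)[OF \<nn>]
        by (simp add: Xn sn C sm nth)
    qed (use v r Xc in simp_all)
    show "Y (r \<odot>\<^bsub>direct_sum \<omega> W\<^esub> v) = sinv r \<odot>\<^bsub>direct_sum \<omega> W\<^esub> Y v"
    proof (rule eqI)
      fix \<mm> assume \<mm>: "\<mm> \<in> \<omega>"
      show "Y (r \<odot>\<^bsub>direct_sum \<omega> W\<^esub> v) \<mm> = (sinv r \<odot>\<^bsub>direct_sum \<omega> W\<^esub> Y v) \<mm>"
        using \<mm> v r by (simp add: Yn sn D L' nth)
    qed (use v r Yc in simp_all)
  qed
qed

context gwa_orbit
begin

abbreviation Wd :: "nat \<Rightarrow> 'a set \<Rightarrow> ('a, nat \<Rightarrow> 'a set) module" where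
  "Wd d \<mm> \<equiv> direct_sum {1..d} (\<lambda>_. residue_module R \<mm>)"

lemma Wd_simps:
  "carrier (Wd d \<mm>) = {1..d} \<rightarrow>\<^sub>E carrier (Km \<mm>)"
  "\<zero>\<^bsub>Wd d \<mm>\<^esub> = (\<lambda>i\<in>{1..d}. \<zero>\<^bsub>Km \<mm>\<^esub>)"
  "u \<oplus>\<^bsub>Wd d \<mm>\<^esub> v = (\<lambda>i\<in>{1..d}. u i \<oplus>\<^bsub>Km \<mm>\<^esub> v i)"
  "r \<odot>\<^bsub>Wd d \<mm>\<^esub> u = (\<lambda>i\<in>{1..d}. (\<mm> +> r) \<otimes>\<^bsub>Km \<mm>\<^esub> u i)"
  by (simp_all add: direct_sum_simps residue_module_simps)

lemma module_Wd: "\<mm> \<in> \<omega> \<Longrightarrow> module R (Wd d \<mm>)"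
  by (rule module_direct_sum) (simp_all add: module_residue_module orbit_ideal)

definition sg_vec :: "nat \<Rightarrow> int \<Rightarrow> (nat \<Rightarrow> 'a set) \<Rightarrow> nat \<Rightarrow> 'a set" where
  "sg_vec d n u = (\<lambda>i\<in>{1..d}. sg n ` u i)"

lemma sg_Km_closed: "\<mm> \<in> \<omega> \<Longrightarrow> c \<in> carrier (Km \<mm>) \<Longrightarrow> sg n ` c \<in> carrier (Km (sg n ` \<mm>))"
  using ring_hom_closed[OF sg_Km_hom] by blast

lemma sg_Km_image_add: "\<mm> \<in> \<omega> \<Longrightarrow> c \<in> carrier (Km \<mm>) \<Longrightarrow> sg (m + n) ` c = sg m ` sg n ` c"
  using sg_image_add[OF Km_subset] by blast

lemma sg_vec_closed: "\<mm> \<in> \<omega> \<Longrightarrow> u \<in> carrier (Wd d \<mm>) \<Longrightarrow> sg_vec d n u \<in> carrier (Wd d (sg n ` \<mm>))"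
  unfolding Wd_simps sg_vec_def by (auto simp del: image_eqI intro!: sg_Km_closed)

lemma sg_vec_add: "\<lbrakk>\<mm> \<in> \<omega>; u \<in> carrier (Wd d \<mm>); v \<in> carrier (Wd d \<mm>)\<rbrakk> \<Longrightarrow>
    sg_vec d n (u \<oplus>\<^bsub>Wd d \<mm>\<^esub> v) = sg_vec d n u \<oplus>\<^bsub>Wd d (sg n ` \<mm>)\<^esub> sg_vec d n v"
  unfolding Wd_simps sg_vec_def by (rule restrict_ext) (simp add: ring_hom_add[OF sg_Km_hom] PiE_iff)

lemma sg_vec_smult: "\<lbrakk>\<mm> \<in> \<omega>; r \<in> carrier R; u \<in> carrier (Wd d \<mm>)\<rbrakk> \<Longrightarrow>
    sg_vec d n (r \<odot>\<^bsub>Wd d \<mm>\<^esub> u) = sg n r \<odot>\<^bsub>Wd d (sg n ` \<mm>)\<^esub> sg_vec d n u"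
  unfolding Wd_simps sg_vec_def
  by (rule restrict_ext) (simp add: ring_hom_mult[OF sg_Km_hom] coset_closed sg_coset PiE_iff)

lemma sg_vec_plus: "\<lbrakk>\<mm> \<in> \<omega>; u \<in> carrier (Wd d \<mm>)\<rbrakk> \<Longrightarrow> sg_vec d (m + n) u = sg_vec d m (sg_vec d n u)"
  unfolding Wd_simps sg_vec_def by (rule restrict_ext) (simp add: sg_Km_image_add[of \<mm>] PiE_iff)

lemma sg_vec_0: "u \<in> carrier (Wd d \<mm>) \<Longrightarrow> sg_vec d 0 u = u"
  unfolding Wd_simps sg_vec_def by (rule ext) (simp add: PiE_iff extensional_def)

end

section \<open>The module V(omega, f) and its fibre at the base point\<close>

locale gwa_V = gwa_orbit R \<sigma> t star \<omega> \<mm>\<omega>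
  for R (structure) and \<sigma> t star \<omega> \<mm>\<omega> +
  fixes d :: nat and \<alpha> :: "nat \<Rightarrow> 'a set"
  assumes alpha_closed: "k \<le> d \<Longrightarrow> \<alpha> k \<in> carrier (R Quot \<mm>\<omega>)"
    and alpha_0: "\<alpha> 0 \<noteq> \<zero>\<^bsub>R Quot \<mm>\<omega>\<^esub>" and alpha_d: "\<alpha> d \<noteq> \<zero>\<^bsub>R Quot \<mm>\<omega>\<^esub>"
begin

sublocale K: companion_field "R Quot \<mm>\<omega>" d \<alpha>
  using Km_field[OF m\<omega>] alpha_closed alpha_0 alpha_d
  by (simp add: companion_field_def companion_field_axioms_def)

abbreviation VM :: "('a, 'a set \<Rightarrow> nat \<Rightarrow> 'a set) module" where "VM \<equiv> V_R_module R \<omega> d"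
abbreviation VX :: "('a set \<Rightarrow> nat \<Rightarrow> 'a set) \<Rightarrow> 'a set \<Rightarrow> nat \<Rightarrow> 'a set" where
  "VX \<equiv> V_X R \<sigma> t \<omega> \<mm>\<omega> d \<alpha>"
abbreviation VY :: "('a set \<Rightarrow> nat \<Rightarrow> 'a set) \<Rightarrow> 'a set \<Rightarrow> nat \<Rightarrow> 'a set" where
  "VY \<equiv> V_Y R \<sigma> \<omega> \<mm>\<omega> d \<alpha>"
abbreviation cmul :: "(nat \<Rightarrow> 'a set) \<Rightarrow> nat \<Rightarrow> 'a set" where "cmul \<equiv> companion_mul (R Quot \<mm>\<omega>) d \<alpha>"
abbreviation cdiv :: "(nat \<Rightarrow> 'a set) \<Rightarrow> nat \<Rightarrow> 'a set" where "cdiv \<equiv> companion_div (R Quot \<mm>\<omega>) d \<alpha>"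

lemma VM_eq: "VM = direct_sum \<omega> (Wd d)" by (simp add: V_R_module_def)

lemma cmul_Wd:
  "u \<in> carrier (Wd d \<mm>\<omega>) \<Longrightarrow> cmul u \<in> carrier (Wd d \<mm>\<omega>)"
  "\<lbrakk>u \<in> carrier (Wd d \<mm>\<omega>); v \<in> carrier (Wd d \<mm>\<omega>)\<rbrakk> \<Longrightarrow> cmul (u \<oplus>\<^bsub>Wd d \<mm>\<omega>\<^esub> v) = cmul u \<oplus>\<^bsub>Wd d \<mm>\<omega>\<^esub> cmul v"
  "\<lbrakk>r \<in> carrier R; u \<in> carrier (Wd d \<mm>\<omega>)\<rbrakk> \<Longrightarrow> cmul (r \<odot>\<^bsub>Wd d \<mm>\<omega>\<^esub> u) = r \<odot>\<^bsub>Wd d \<mm>\<omega>\<^esub> cmul u"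
  unfolding Wd_simps
  by (simp_all only: K.companion_mul_closed K.companion_mul_add K.companion_mul_smult coset_closed[OF m\<omega>])

lemma cdiv_Wd:
  "u \<in> carrier (Wd d \<mm>\<omega>) \<Longrightarrow> cdiv u \<in> carrier (Wd d \<mm>\<omega>)"
  "\<lbrakk>u \<in> carrier (Wd d \<mm>\<omega>); v \<in> carrier (Wd d \<mm>\<omega>)\<rbrakk> \<Longrightarrow> cdiv (u \<oplus>\<^bsub>Wd d \<mm>\<omega>\<^esub> v) = cdiv u \<oplus>\<^bsub>Wd d \<mm>\<omega>\<^esub> cdiv v"
  "\<lbrakk>r \<in> carrier R; u \<in> carrier (Wd d \<mm>\<omega>)\<rbrakk> \<Longrightarrow> cdiv (r \<odot>\<^bsub>Wd d \<mm>\<omega>\<^esub> u) = r \<odot>\<^bsub>Wd d \<mm>\<omega>\<^esub> cdiv u"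
  unfolding Wd_simps
  by (simp_all only: K.companion_div_closed K.companion_div_add K.companion_div_smult coset_closed[OF m\<omega>])

lemma cmul_cdiv:
  "u \<in> carrier (Wd d \<mm>\<omega>) \<Longrightarrow> cmul (cdiv u) = u" "u \<in> carrier (Wd d \<mm>\<omega>) \<Longrightarrow> cdiv (cmul u) = u"
  unfolding Wd_simps by (simp_all only: K.companion_mul_div K.companion_div_mul)

lemma VM_nth: "v \<in> carrier VM \<Longrightarrow> \<mm> \<in> \<omega> \<Longrightarrow> v \<mm> \<in> carrier (Wd d \<mm>)"
  unfolding VM_eq direct_sum_simps[OF finite_orbit] by (rule PiE_mem)

lemma VX_nth:
  assumes v: "v \<in> carrier VM" and \<mm>: "\<mm> \<in> \<omega>"
  shows "VX v \<mm> = sg_vec d 1 ((if sinv ` \<mm> = \<mm>\<omega> then cmul else id) (t \<odot>\<^bsub>Wd d (sinv ` \<mm>)\<^esub> v (sinv ` \<mm>)))"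
proof -
  have "t \<odot>\<^bsub>Wd d (sinv ` \<mm>)\<^esub> v (sinv ` \<mm>) \<in> carrier (Wd d (sinv ` \<mm>))"
    using module.smult_closed[OF module_Wd] VM_nth[OF v] \<mm> by simp
  then have "mat_vec (R Quot \<mm>\<omega>) d (companion (R Quot \<mm>\<omega>) d \<alpha>) (t \<odot>\<^bsub>Wd d (sinv ` \<mm>)\<^esub> v (sinv ` \<mm>))
      = cmul (t \<odot>\<^bsub>Wd d (sinv ` \<mm>)\<^esub> v (sinv ` \<mm>))" if "sinv ` \<mm> = \<mm>\<omega>"
    using that K.mat_vec_companion unfolding Wd_simps(1) by metis
  then show ?thesis using \<mm> by (simp add: V_X_def Let_def sg_vec_def Wd_simps(4))
qed

lemma VY_nth:
  assumes v: "v \<in> carrier VM" and \<mm>: "\<mm> \<in> \<omega>"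
  shows "VY v \<mm> = (if \<mm> = \<mm>\<omega> then cdiv else id) (sg_vec d (- 1) (v (\<sigma> ` \<mm>)))"
proof -
  have ret: "sg (- 1) ` \<sigma> ` \<mm> = \<mm>" using sg_image_minus[OF orbit_subset[OF \<mm>], of 1] by simp
  have "sg_vec d (- 1) (v (\<sigma> ` \<mm>)) \<in> carrier (Wd d \<mm>)"
    using sg_vec_closed[OF orbit_sigma(1)[OF \<mm>] VM_nth[OF v orbit_sigma(1)[OF \<mm>]], of "- 1"]
    unfolding ret .
  then have "mat_inv_vec (R Quot \<mm>\<omega>) d (companion (R Quot \<mm>\<omega>) d \<alpha>) (sg_vec d (- 1) (v (\<sigma> ` \<mm>)))
      = cdiv (sg_vec d (- 1) (v (\<sigma> ` \<mm>)))" if "\<mm> = \<mm>\<omega>"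
    using that K.mat_inv_vec_companion unfolding Wd_simps(1) by metis
  then show ?thesis using \<mm> by (simp add: V_Y_def Let_def sg_vec_def)
qed

lemma V_extensional: "VX v \<in> extensional \<omega>" "VY v \<in> extensional \<omega>"
  by (simp_all add: V_X_def V_Y_def)

lemma gwa_rep_V: "gwa_rep R \<sigma> t VM VX VY"
  unfolding VM_eq
proof (rule gwa_rep_direct_sum[where W = "Wd d" and C = "\<lambda>\<mm>. if \<mm> = \<mm>\<omega> then cmul else id"
      and D = "\<lambda>\<mm>. if \<mm> = \<mm>\<omega> then cdiv else id" and L = "\<lambda>_. sg_vec d 1" and L' = "\<lambda>_. sg_vec d (- 1)"])
  fix v assume v: "v \<in> carrier (direct_sum \<omega> (Wd d))"
  then have v': "v \<in> carrier VM" by (simp add: VM_eq)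
  show "VX v = (\<lambda>\<mm>\<in>\<omega>. sg_vec d 1 ((if sinv ` \<mm> = \<mm>\<omega> then cmul else id) (t \<odot>\<^bsub>Wd d (sinv ` \<mm>)\<^esub> v (sinv ` \<mm>))))"
    by (rule extensionalityI[of _ \<omega>]) (simp_all only: VX_nth[OF v'] V_extensional restrict_extensional restrict_apply')
  show "VY v = (\<lambda>\<mm>\<in>\<omega>. (if \<mm> = \<mm>\<omega> then cdiv else id) (sg_vec d (- 1) (v (\<sigma> ` \<mm>))))"
    by (rule extensionalityI[of _ \<omega>]) (simp_all only: VY_nth[OF v'] V_extensional restrict_extensional restrict_apply')
next
  fix \<mm> u assume \<mm>: "\<mm> \<in> \<omega>" and u: "u \<in> carrier (Wd d (\<sigma> ` \<mm>))"
  have ret: "sg (- 1) ` \<sigma> ` \<mm> = \<mm>" using sg_image_minus[OF orbit_subset[OF \<mm>], of 1] by simp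
  note \<sigma>m = orbit_sigma(1)[OF \<mm>]
  show "sg_vec d (- 1) u \<in> carrier (Wd d \<mm>)" using sg_vec_closed[OF \<sigma>m u, of "- 1"] unfolding ret .
  show "sg_vec d 1 (sg_vec d (- 1) u) = u"
    using sg_vec_plus[OF \<sigma>m u, of 1 "- 1"] sg_vec_0[OF u] by simp
  fix v assume v: "v \<in> carrier (Wd d (\<sigma> ` \<mm>))"
  show "sg_vec d (- 1) (u \<oplus>\<^bsub>Wd d (\<sigma> ` \<mm>)\<^esub> v) = sg_vec d (- 1) u \<oplus>\<^bsub>Wd d \<mm>\<^esub> sg_vec d (- 1) v"
    using sg_vec_add[OF \<sigma>m u v, of "- 1"] unfolding ret .
next
  fix \<mm> r u assume \<mm>: "\<mm> \<in> \<omega>" and r: "r \<in> carrier R" and u: "u \<in> carrier (Wd d (\<sigma> ` \<mm>))"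
  have ret: "sg (- 1) ` \<sigma> ` \<mm> = \<mm>" using sg_image_minus[OF orbit_subset[OF \<mm>], of 1] by simp
  show "sg_vec d (- 1) (r \<odot>\<^bsub>Wd d (\<sigma> ` \<mm>)\<^esub> u) = sinv r \<odot>\<^bsub>Wd d \<mm>\<^esub> sg_vec d (- 1) u"
    using sg_vec_smult[OF orbit_sigma(1)[OF \<mm>] r u, of "- 1"] unfolding ret by simp
next
  fix \<mm> u assume \<mm>: "\<mm> \<in> \<omega>" and u: "u \<in> carrier (Wd d \<mm>)"
  show "sg_vec d 1 u \<in> carrier (Wd d (\<sigma> ` \<mm>))" using sg_vec_closed[OF \<mm> u, of 1] by simp
  show "sg_vec d (- 1) (sg_vec d 1 u) = u"
    using sg_vec_plus[OF \<mm> u, of "- 1" 1] sg_vec_0[OF u] by simp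
  fix v assume v: "v \<in> carrier (Wd d \<mm>)"
  show "sg_vec d 1 (u \<oplus>\<^bsub>Wd d \<mm>\<^esub> v) = sg_vec d 1 u \<oplus>\<^bsub>Wd d (\<sigma> ` \<mm>)\<^esub> sg_vec d 1 v"
    using sg_vec_add[OF \<mm> u v, of 1] by simp
next
  fix \<mm> r u assume \<mm>: "\<mm> \<in> \<omega>" and r: "r \<in> carrier R" and u: "u \<in> carrier (Wd d \<mm>)"
  show "sg_vec d 1 (r \<odot>\<^bsub>Wd d \<mm>\<^esub> u) = \<sigma> r \<odot>\<^bsub>Wd d (\<sigma> ` \<mm>)\<^esub> sg_vec d 1 u"
    using sg_vec_smult[OF \<mm> r u, of 1] by simp
qed (clarsimp simp: module_Wd cmul_Wd cdiv_Wd cmul_cdiv)+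

text \<open>What Y^p does to the component at \<open>\<mm>\<omega>\<close>: the inverse of
  \<open>\<sigma>\<close> is applied \<open>p\<close> times, the inverse companion matrix once, on
  arrival.\<close>

definition eta :: "(nat \<Rightarrow> 'a set) \<Rightarrow> nat \<Rightarrow> 'a set" where
  "eta u = cdiv (sg_vec d (- int p) u)"

text \<open>The targets of the \<open>i\<close> steps are the translates by j + 1, ..., j + i, all
  below \<open>p\<close>, so none is \<open>\<mm>\<omega>\<close> and the inverse companion matrix
  is never applied. Equality in the bound is allowed: the source may be
  \<open>\<mm>\<omega>\<close>.\<close>

lemma VY_pow_nth:
  assumes v: "v \<in> carrier VM"
  shows "i + Suc j \<le> p \<Longrightarrow>
    (VY ^^ i) v (sg (int (Suc j)) ` \<mm>\<omega>) = sg_vec d (- int i) (v (sg (int (i + Suc j)) ` \<mm>\<omega>))"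
proof (induction i arbitrary: j)
  case 0
  show ?case using sg_vec_0[OF VM_nth[OF v orbit_sg[OF m\<omega>]]] by simp
next
  case (Suc i)
  interpret V: gwa_rep R \<sigma> t VM VX VY by (rule gwa_rep_V)
  have cl: "(VY ^^ i) v \<in> carrier VM" using v by (induction i) simp_all
  let ?m = "sg (int (Suc j)) ` \<mm>\<omega>"
  have "?m \<noteq> \<mm>\<omega>" using Suc.prems zdvd_not_zless[of "int (Suc j)" "int p"] by (simp add: stabilizer)
  moreover have "\<sigma> ` ?m = sg (int (Suc (Suc j))) ` \<mm>\<omega>"
    using sg_image_add[OF orbit_subset[OF m\<omega>], of 1 "int (Suc j)"] by simp
  ultimately have "(VY ^^ Suc i) v ?m = sg_vec d (- 1) ((VY ^^ i) v (sg (int (Suc (Suc j))) ` \<mm>\<omega>))"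
    using VY_nth[OF cl orbit_sg[OF m\<omega>], of "int (Suc j)"] by simp
  also have "\<dots> = sg_vec d (- 1) (sg_vec d (- int i) (v (sg (int (i + Suc (Suc j))) ` \<mm>\<omega>)))"
    using Suc.IH[of "Suc j"] Suc.prems by simp
  also have "\<dots> = sg_vec d (- 1 + - int i) (v (sg (int (i + Suc (Suc j))) ` \<mm>\<omega>))"
    by (rule sg_vec_plus[OF orbit_sg[OF m\<omega>] VM_nth[OF v orbit_sg[OF m\<omega>]], symmetric])
  finally show ?case by simp
qed

text \<open>Only the last of the \<open>p\<close> steps lands on \<open>\<mm>\<omega>\<close>. The
  first one starts there as well, because \<open>sg p\<close> fixes
  \<open>\<mm>\<omega>\<close>.\<close>

lemma VY_pow_p: assumes v: "v \<in> carrier VM" shows "(VY ^^ p) v \<mm>\<omega> = eta (v \<mm>\<omega>)"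
proof -
  interpret V: gwa_rep R \<sigma> t VM VX VY by (rule gwa_rep_V)
  have cl: "(VY ^^ i) v \<in> carrier VM" for i using v by (induction i) simp_all
  obtain q where q: "p = Suc q" using p_pos by (cases p) simp_all
  have pq: "- 1 + - int q = - int p" by (simp add: q)
  have "(VY ^^ p) v \<mm>\<omega> = cdiv (sg_vec d (- 1) ((VY ^^ q) v (sg (int (Suc 0)) ` \<mm>\<omega>)))"
    using VY_nth[OF cl m\<omega>, of q] by (simp add: q)
  also have "(VY ^^ q) v (sg (int (Suc 0)) ` \<mm>\<omega>) = sg_vec d (- int q) (v \<mm>\<omega>)"
    using VY_pow_nth[OF v, of q 0] sg_p(1) q by simp
  also have "sg_vec d (- 1) (sg_vec d (- int q) (v \<mm>\<omega>)) = sg_vec d (- int p) (v \<mm>\<omega>)"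
    using sg_vec_plus[OF m\<omega> VM_nth[OF v m\<omega>], of "- 1" "- int q"] pq by simp
  finally show ?thesis by (simp add: eta_def)
qed

lemma smult_VM_nth: "\<mm> \<in> \<omega> \<Longrightarrow> (r \<odot>\<^bsub>VM\<^esub> v) \<mm> = r \<odot>\<^bsub>Wd d \<mm>\<^esub> v \<mm>"
  and add_VM_nth: "\<mm> \<in> \<omega> \<Longrightarrow> (v \<oplus>\<^bsub>VM\<^esub> w) \<mm> = v \<mm> \<oplus>\<^bsub>Wd d \<mm>\<^esub> w \<mm>"
  and zero_VM_nth: "\<mm> \<in> \<omega> \<Longrightarrow> \<zero>\<^bsub>VM\<^esub> \<mm> = \<zero>\<^bsub>Wd d \<mm>\<^esub>"
  unfolding VM_eq direct_sum_simps[OF finite_orbit] by simp_all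

lemma VM_eqI: "\<lbrakk>v \<in> carrier VM; w \<in> carrier VM; \<And>\<mm>. \<mm> \<in> \<omega> \<Longrightarrow> v \<mm> = w \<mm>\<rbrakk> \<Longrightarrow> v = w"
  unfolding VM_eq direct_sum_simps[OF finite_orbit] by (rule PiE_ext)

lemma Wd_kill:
  assumes "\<mm> \<in> \<omega>" "r \<in> \<mm>" "u \<in> carrier (Wd d \<mm>)" shows "r \<odot>\<^bsub>Wd d \<mm>\<^esub> u = \<zero>\<^bsub>Wd d \<mm>\<^esub>"
proof -
  interpret F: field "Km \<mm>" using assms(1) by (rule Km_field)
  have "(\<mm> +> r) \<otimes>\<^bsub>Km \<mm>\<^esub> u i = \<zero>\<^bsub>Km \<mm>\<^esub>" if "i \<in> {1..d}" for i
    using assms that coset_zero by (simp add: Wd_simps(1) PiE_iff)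
  then show ?thesis unfolding Wd_simps by (intro restrict_ext)
qed

lemma Wd_smult_eq_zero:
  assumes "\<mm> \<in> \<omega>" "r \<in> carrier R" "r \<notin> \<mm>" "u \<in> carrier (Wd d \<mm>)" "r \<odot>\<^bsub>Wd d \<mm>\<^esub> u = \<zero>\<^bsub>Wd d \<mm>\<^esub>"
  shows "u = \<zero>\<^bsub>Wd d \<mm>\<^esub>"
proof -
  interpret F: field "Km \<mm>" using assms(1) by (rule Km_field)
  interpret W: module R "Wd d \<mm>" using assms(1) by (rule module_Wd)
  have "u i = \<zero>\<^bsub>Km \<mm>\<^esub>" if i: "i \<in> {1..d}" for i
  proof -
    have "(\<mm> +> r) \<otimes>\<^bsub>Km \<mm>\<^esub> u i = \<zero>\<^bsub>Km \<mm>\<^esub>"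
      using fun_cong[OF assms(5), of i] i unfolding Wd_simps by simp
    then show ?thesis
      using F.integral coset_closed[OF assms(1,2)] assms(4) i coset_eq_zero_iff[OF assms(1,2)] assms(3)
      unfolding Wd_simps by blast
  qed
  moreover have "u \<in> {1..d} \<rightarrow>\<^sub>E carrier (Km \<mm>)" using assms(4) by (simp only: Wd_simps)
  ultimately show ?thesis unfolding Wd_simps(2) by (auto simp: fun_eq_iff PiE_iff extensional_def)
qed

text \<open>For \<open>\<mm>\<close> outside the orbit this is the zero vector, so weight spaces at
  arbitrary maximal ideals are treated uniformly.\<close>

definition single :: "'a set \<Rightarrow> (nat \<Rightarrow> 'a set) \<Rightarrow> 'a set \<Rightarrow> nat \<Rightarrow> 'a set" where
  "single \<mm> u = (\<lambda>\<nn>\<in>\<omega>. if \<nn> = \<mm> then u else \<zero>\<^bsub>Wd d \<nn>\<^esub>)"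

lemma single_closed: "\<mm> \<in> \<omega> \<Longrightarrow> u \<in> carrier (Wd d \<mm>) \<Longrightarrow> single \<mm> u \<in> carrier VM"
  unfolding VM_eq direct_sum_simps[OF finite_orbit] single_def
  using abelian_monoid.zero_closed[OF abelian_group.axioms(1)[OF module.axioms(2)[OF module_Wd]]]
  by auto

lemma single_nth: "\<nn> \<in> \<omega> \<Longrightarrow> single \<mm> u \<nn> = (if \<nn> = \<mm> then u else \<zero>\<^bsub>Wd d \<nn>\<^esub>)"
  by (simp add: single_def)

text \<open>An element of \<open>\<mm>\<close> outside \<open>\<nn>\<close> is a unit in the residue
  field at \<open>\<nn>\<close>, so it kills a vector only if the component there is zero. The ideal
  \<open>\<mm>\<close> may lie outside the orbit.\<close>

lemma weight_vector_iff:
  assumes v: "v \<in> carrier VM" and \<mm>: "maximalideal \<mm> R"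
  shows "(\<forall>r\<in>\<mm>. r \<odot>\<^bsub>VM\<^esub> v = \<zero>\<^bsub>VM\<^esub>) \<longleftrightarrow> (\<forall>\<nn>\<in>\<omega>. \<nn> \<noteq> \<mm> \<longrightarrow> v \<nn> = \<zero>\<^bsub>Wd d \<nn>\<^esub>)"
proof
  interpret m: maximalideal \<mm> R by fact
  assume *: "\<forall>r\<in>\<mm>. r \<odot>\<^bsub>VM\<^esub> v = \<zero>\<^bsub>VM\<^esub>"
  show "\<forall>\<nn>\<in>\<omega>. \<nn> \<noteq> \<mm> \<longrightarrow> v \<nn> = \<zero>\<^bsub>Wd d \<nn>\<^esub>"
  proof (intro ballI impI)
    fix \<nn> assume \<nn>: "\<nn> \<in> \<omega>" "\<nn> \<noteq> \<mm>"
    interpret n: maximalideal \<nn> R using \<nn>(1) by (rule orbit_max)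
    have "\<not> \<mm> \<subseteq> \<nn>" using m.I_maximal[OF n.ideal_axioms] n.a_subset \<nn>(2) n.I_notcarr by blast
    then obtain r where r: "r \<in> \<mm>" "r \<notin> \<nn>" by blast
    have "r \<odot>\<^bsub>Wd d \<nn>\<^esub> v \<nn> = \<zero>\<^bsub>Wd d \<nn>\<^esub>"
      using * r(1) smult_VM_nth[OF \<nn>(1)] zero_VM_nth[OF \<nn>(1)] by metis
    then show "v \<nn> = \<zero>\<^bsub>Wd d \<nn>\<^esub>"
      using Wd_smult_eq_zero[OF \<nn>(1) m.Icarr[OF r(1)] r(2) VM_nth[OF v \<nn>(1)]] by blast
  qed
next
  interpret V: gwa_rep R \<sigma> t VM VX VY by (rule gwa_rep_V)
  interpret m: maximalideal \<mm> R by fact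
  assume *: "\<forall>\<nn>\<in>\<omega>. \<nn> \<noteq> \<mm> \<longrightarrow> v \<nn> = \<zero>\<^bsub>Wd d \<nn>\<^esub>"
  show "\<forall>r\<in>\<mm>. r \<odot>\<^bsub>VM\<^esub> v = \<zero>\<^bsub>VM\<^esub>"
  proof
    fix r assume r: "r \<in> \<mm>"
    show "r \<odot>\<^bsub>VM\<^esub> v = \<zero>\<^bsub>VM\<^esub>"
    proof (rule VM_eqI)
      fix \<nn> assume \<nn>: "\<nn> \<in> \<omega>"
      interpret W: module R "Wd d \<nn>" using \<nn> by (rule module_Wd)
      show "(r \<odot>\<^bsub>VM\<^esub> v) \<nn> = \<zero>\<^bsub>VM\<^esub> \<nn>"
        using * r \<nn> Wd_kill[OF \<nn> _ VM_nth[OF v \<nn>]] W.smult_r_null[OF m.Icarr[OF r]]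
        by (cases "\<nn> = \<mm>") (simp_all add: smult_VM_nth zero_VM_nth)
    qed (use v m.Icarr[OF r] in simp_all)
  qed
qed

lemma gwa_orbit_rep_V: "gwa_orbit_rep R \<sigma> t star \<omega> \<mm>\<omega> VM VX VY"
proof (intro gwa_orbit_rep.intro gwa_orbit_rep_axioms.intro)
  show "gwa_orbit R \<sigma> t star \<omega> \<mm>\<omega>" by (rule gwa_orbit_axioms)
  show "gwa_rep R \<sigma> t VM VX VY" by (rule gwa_rep_V)
  interpret V: gwa_rep R \<sigma> t VM VX VY by (rule gwa_rep_V)
  fix r v assume "r \<in> carrier R" "\<And>\<mm>. \<mm> \<in> \<omega> \<Longrightarrow> r \<in> \<mm>" "v \<in> carrier VM"
  then show "r \<odot>\<^bsub>VM\<^esub> v = \<zero>\<^bsub>VM\<^esub>"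
    by (intro VM_eqI) (simp_all add: smult_VM_nth zero_VM_nth Wd_kill VM_nth)
qed

lemma gwa_orbit_model_V: "gwa_orbit_model R \<sigma> t star \<omega> \<mm>\<omega> VM VX VY (Wd d \<mm>\<omega>) (\<lambda>v. v \<mm>\<omega>) eta"
proof (intro gwa_orbit_model.intro gwa_orbit_model_axioms.intro)
  show "gwa_orbit_rep R \<sigma> t star \<omega> \<mm>\<omega> VM VX VY" by (rule gwa_orbit_rep_V)
  show "module R (Wd d \<mm>\<omega>)" using m\<omega> by (rule module_Wd)
  interpret V: gwa_rep R \<sigma> t VM VX VY by (rule gwa_rep_V)
  fix v assume v: "v \<in> carrier VM"
  show "v \<mm>\<omega> \<in> carrier (Wd d \<mm>\<omega>)" using v m\<omega> by (rule VM_nth)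
  show "(VY ^^ p) v \<mm>\<omega> = eta (v \<mm>\<omega>)" using v by (rule VY_pow_p)
  fix w assume w: "w \<in> carrier VM"
  show "(v \<oplus>\<^bsub>VM\<^esub> w) \<mm>\<omega> = v \<mm>\<omega> \<oplus>\<^bsub>Wd d \<mm>\<omega>\<^esub> w \<mm>\<omega>" using m\<omega> by (rule add_VM_nth)
next
  fix r v show "(r \<odot>\<^bsub>VM\<^esub> v) \<mm>\<omega> = r \<odot>\<^bsub>Wd d \<mm>\<omega>\<^esub> v \<mm>\<omega>" using m\<omega> by (rule smult_VM_nth)
next
  interpret V: gwa_rep R \<sigma> t VM VX VY by (rule gwa_rep_V)
  fix v assume v: "v \<in> carrier VM" and wt: "\<And>r. r \<in> \<mm>\<omega> \<Longrightarrow> r \<odot>\<^bsub>VM\<^esub> v = \<zero>\<^bsub>VM\<^esub>" and 0: "v \<mm>\<omega> = \<zero>\<^bsub>Wd d \<mm>\<omega>\<^esub>"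
  have "\<forall>\<nn>\<in>\<omega>. \<nn> \<noteq> \<mm>\<omega> \<longrightarrow> v \<nn> = \<zero>\<^bsub>Wd d \<nn>\<^esub>" using weight_vector_iff[OF v max\<omega>] wt by blast
  then show "v = \<zero>\<^bsub>VM\<^esub>" using v 0 by (intro VM_eqI) (auto simp: zero_VM_nth)
next
  fix u assume u: "u \<in> carrier (Wd d \<mm>\<omega>)"
  have "\<forall>r\<in>\<mm>\<omega>. r \<odot>\<^bsub>VM\<^esub> single \<mm>\<omega> u = \<zero>\<^bsub>VM\<^esub>"
    using weight_vector_iff[OF single_closed[OF m\<omega> u] max\<omega>] by (simp add: single_nth)
  then show "\<exists>v\<in>carrier VM. (\<forall>r\<in>\<mm>\<omega>. r \<odot>\<^bsub>VM\<^esub> v = \<zero>\<^bsub>VM\<^esub>) \<and> v \<mm>\<omega> = u"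
    using single_closed[OF m\<omega> u] single_nth[OF m\<omega>] by (intro bexI[of _ "single \<mm>\<omega> u"]) simp_all
qed

end

section \<open>Conjugate-linear functionals on a companion module\<close>

text \<open>The instance in view is the residue field at \<open>\<mm>\<omega>\<close>, with the
  automorphism induced by the p-th power of \<open>\<sigma>\<close>, the conjugation, and the scalar
  of X^p Y^p.\<close>

locale skew_companion = companion_field K d \<alpha> for K (structure) and d \<alpha> +
  fixes \<tau> bar :: "'a \<Rightarrow> 'a" and \<xi> :: 'a
  assumes tau_iso: "\<tau> \<in> ring_iso K K" and bar_hom: "bar \<in> ring_hom K K"
    and bar_bar [simp]: "a \<in> carrier K \<Longrightarrow> bar (bar a) = a"
    and bar_tau: "a \<in> carrier K \<Longrightarrow> bar (\<tau> a) = \<tau> (bar a)"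
    and xi_closed [simp]: "\<xi> \<in> carrier K" and xi_nonzero: "\<xi> \<noteq> \<zero>" and bar_xi: "bar \<xi> = \<xi>"
begin

abbreviation taui :: "'a \<Rightarrow> 'a" where "taui \<equiv> inv_into (carrier K) \<tau>"
abbreviation tp :: "nat \<Rightarrow> 'a" where "tp \<equiv> twisted_power K \<tau> \<xi>"
abbreviation \<alpha>s :: "nat \<Rightarrow> 'a" where "\<alpha>s \<equiv> sharp_coeff K \<tau> bar \<xi> d \<alpha>"

lemma tau_bij: "bij_betw \<tau> (carrier K) (carrier K)" using tau_iso by (simp add: ring_iso_def)

sublocale tau: ring_hom_ring K K \<tau>
  using tau_iso ring_axioms by (simp add: ring_iso_def ring_hom_ringI2)

sublocale taui: ring_hom_ring K K taui
  using ring_iso_set_sym[OF ring_axioms tau_iso] ring_axioms by (simp add: ring_iso_def ring_hom_ringI2)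

sublocale bar: ring_hom_ring K K bar
  using bar_hom ring_axioms by (simp add: ring_hom_ringI2)

sublocale taupow: ring_hom_ring K K "\<tau> ^^ k" for k
  using ring_iso_funpow[OF tau_iso] ring_axioms by (simp add: ring_iso_def ring_hom_ringI2)

lemma taui_tau [simp]: "a \<in> carrier K \<Longrightarrow> taui (\<tau> a) = a"
  and tau_taui [simp]: "a \<in> carrier K \<Longrightarrow> \<tau> (taui a) = a"
  using bij_betw_inv_into_left[OF tau_bij] bij_betw_inv_into_right[OF tau_bij] by simp_all

lemma bar_taui: "a \<in> carrier K \<Longrightarrow> bar (taui a) = taui (bar a)"
  using bar_tau[of "taui a"] taui_tau[of "bar (taui a)"] by simp

lemma bar_tau_pow: "a \<in> carrier K \<Longrightarrow> bar ((\<tau> ^^ k) a) = (\<tau> ^^ k) (bar a)"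
  by (induction k) (simp_all add: bar_tau)

lemma hom_nonzero:
  assumes "ring_hom_ring K K h" "a \<in> carrier K" "a \<noteq> \<zero>" shows "h a \<noteq> \<zero>"
proof
  interpret h: ring_hom_ring K K h by fact
  assume "h a = \<zero>"
  have a: "a \<in> Units K" using assms by (simp add: field_Units)
  have "h (inv a \<otimes> a) = \<zero>" using a assms(2) \<open>h a = \<zero>\<close> by (simp del: Units_l_inv)
  then show False using a by simp
qed

lemma hom_inv:
  assumes "ring_hom_ring K K h" "a \<in> carrier K" "a \<noteq> \<zero>" shows "h (inv a) = inv (h a)"
proof -
  interpret h: ring_hom_ring K K h by fact
  have a: "a \<in> Units K" "h a \<in> Units K"
    using assms hom_nonzero[OF assms] by (simp_all add: field_Units)
  have "h (inv a) \<otimes> h a = \<one>" using a(1) assms(2) by (simp flip: h.hom_mult)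
  then show ?thesis using a assms(2) by (metis Units_inv_closed h.hom_closed inv_char m_comm)
qed

lemma bar_nonzero: "\<lbrakk>a \<in> carrier K; a \<noteq> \<zero>\<rbrakk> \<Longrightarrow> bar a \<noteq> \<zero>"
  using hom_nonzero[OF bar.ring_hom_ring_axioms] .

lemma tau_pow_nonzero: "\<lbrakk>a \<in> carrier K; a \<noteq> \<zero>\<rbrakk> \<Longrightarrow> (\<tau> ^^ k) a \<noteq> \<zero>"
  using hom_nonzero[OF taupow.ring_hom_ring_axioms] .

lemma tp_closed [simp]: "tp k \<in> carrier K" by (simp add: twisted_power_def)

lemma tp_0: "tp 0 = \<one>" by (simp add: twisted_power_def)

lemma tp_Suc_right: "tp (Suc k) = tp k \<otimes> (\<tau> ^^ k) \<xi>"
  by (simp add: twisted_power_def lessThan_Suc m_comm)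

text \<open>Adding the factor at the low end is the recursion that fits \<open>taui\<close>: it
  turns \<open>tp (Suc k)\<close> into \<open>taui \<xi>\<close> times \<open>tp k\<close>.\<close>

lemma tp_Suc: "tp (Suc k) = \<xi> \<otimes> \<tau> (tp k)"
proof (induction k)
  case 0 then show ?case by (simp add: tp_Suc_right tp_0)
next
  case (Suc k)
  have "tp (Suc (Suc k)) = tp (Suc k) \<otimes> (\<tau> ^^ Suc k) \<xi>" by (rule tp_Suc_right)
  also have "\<dots> = \<xi> \<otimes> (\<tau> (tp k) \<otimes> \<tau> ((\<tau> ^^ k) \<xi>))" by (simp add: Suc m_assoc)
  also have "\<tau> (tp k) \<otimes> \<tau> ((\<tau> ^^ k) \<xi>) = \<tau> (tp (Suc k))" by (simp add: tp_Suc_right)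
  finally show ?case .
qed

lemma tp_nonzero: "tp k \<noteq> \<zero>"
  by (induction k) (simp_all add: tp_0 tp_Suc_right integral_iff xi_nonzero tau_pow_nonzero)

lemma sharp_alpha_closed [simp]: "k \<le> d \<Longrightarrow> \<alpha>s k \<in> carrier K"
  by (simp add: sharp_coeff_def)

lemma sharp_alpha_0: "\<alpha>s 0 = bar (\<alpha> d)" by (simp add: sharp_coeff_def tp_0)

lemma sharp_alpha_nonzero: "\<alpha>s 0 \<noteq> \<zero>" "\<alpha>s d \<noteq> \<zero>"
  using alpha_0 alpha_d
  by (simp_all add: sharp_coeff_def tp_0 integral_iff tp_nonzero bar_nonzero tau_pow_nonzero)

definition vadd :: "(nat \<Rightarrow> 'a) \<Rightarrow> (nat \<Rightarrow> 'a) \<Rightarrow> nat \<Rightarrow> 'a" where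
  "vadd u v = (\<lambda>i\<in>{1..d}. u i \<oplus> v i)"

definition vscale :: "'a \<Rightarrow> (nat \<Rightarrow> 'a) \<Rightarrow> nat \<Rightarrow> 'a" where
  "vscale a u = (\<lambda>i\<in>{1..d}. a \<otimes> u i)"

lemma vadd_closed [simp]: "u \<in> Kd \<Longrightarrow> v \<in> Kd \<Longrightarrow> vadd u v \<in> Kd"
  by (auto simp: vadd_def)

lemma vscale_closed [simp]: "a \<in> carrier K \<Longrightarrow> u \<in> Kd \<Longrightarrow> vscale a u \<in> Kd"
  by (auto simp: vscale_def)

lemma vadd_nth: "1 \<le> i \<Longrightarrow> i \<le> d \<Longrightarrow> vadd u v i = u i \<oplus> v i"
  and vscale_nth: "1 \<le> i \<Longrightarrow> i \<le> d \<Longrightarrow> vscale a u i = a \<otimes> u i"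
  by (simp_all add: vadd_def vscale_def)

definition conj_functional :: "((nat \<Rightarrow> 'a) \<Rightarrow> 'a) \<Rightarrow> bool" where
  "conj_functional \<phi> \<longleftrightarrow> (\<forall>u\<in>Kd. \<phi> u \<in> carrier K) \<and>
     (\<forall>u\<in>Kd. \<forall>v\<in>Kd. \<phi> (vadd u v) = \<phi> u \<oplus> \<phi> v) \<and>
     (\<forall>a\<in>carrier K. \<forall>u\<in>Kd. \<phi> (vscale a u) = bar a \<otimes> \<phi> u)"

lemma conj_functionalD:
  assumes "conj_functional \<phi>"
  shows "u \<in> Kd \<Longrightarrow> \<phi> u \<in> carrier K"
    and "u \<in> Kd \<Longrightarrow> v \<in> Kd \<Longrightarrow> \<phi> (vadd u v) = \<phi> u \<oplus> \<phi> v"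
    and "a \<in> carrier K \<Longrightarrow> u \<in> Kd \<Longrightarrow> \<phi> (vscale a u) = bar a \<otimes> \<phi> u"
  using assms by (simp_all add: conj_functional_def)

text \<open>The functional coordinates in which the dual of a companion map is again a companion map are
  evaluations at the vectors \<open>wvec k\<close>, with entries \<open>\<tau>\<^sup>k (\<alpha> (i - k))\<close>, \<open>i \<ge> k\<close>. They are triangular with
  nonzero diagonal, and the inverse semilinear companion map sends \<open>zvec k\<close>, a combination of
  \<open>wvec (k + 1)\<close> and \<open>wvec 1\<close>, to \<open>wvec k\<close>. The scaling by \<open>- {k}\<^sub>\<xi>\<close> in \<open>sharp_coords\<close> absorbs the
  factor \<open>\<xi>\<close> of \<open>X\<^sup>p = \<xi> Y\<^sup>-\<^sup>p\<close>.\<close>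

definition wvec :: "nat \<Rightarrow> nat \<Rightarrow> 'a" where
  "wvec k = (\<lambda>i\<in>{1..d}. if k \<le> i then (\<tau> ^^ k) (\<alpha> (i - k)) else \<zero>)"

lemma wvec_closed [simp]: "wvec k \<in> Kd" by (auto simp: wvec_def)

lemma wvec_nth: "1 \<le> i \<Longrightarrow> i \<le> d \<Longrightarrow> wvec k i = (if k \<le> i then (\<tau> ^^ k) (\<alpha> (i - k)) else \<zero>)"
  by (simp add: wvec_def)

text \<open>The overflow of x times \<open>wvec k\<close> at x^(d+1), divided by the leading
  coefficient \<open>\<tau> (\<alpha> d)\<close> of x f. Subtracting this multiple of
  \<open>wvec 1\<close> reduces the product modulo f, and the result is
  \<open>zvec k\<close>.\<close>

definition zcoeff :: "nat \<Rightarrow> 'a" where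
  "zcoeff k = (\<tau> ^^ Suc k) (\<alpha> (d - k)) \<otimes> inv (\<tau> (\<alpha> d))"

definition zvec :: "nat \<Rightarrow> nat \<Rightarrow> 'a" where
  "zvec k = vadd (wvec (Suc k)) (vscale (\<ominus> zcoeff k) (wvec 1))"

lemma tau_alpha_d: "inv (\<tau> (\<alpha> d)) = \<tau> (inv (\<alpha> d))"
  using hom_inv[OF tau.ring_hom_ring_axioms _ alpha_d] by simp

lemma zcoeff_closed [simp]: "zcoeff k \<in> carrier K"
  by (simp add: zcoeff_def tau_alpha_d)

lemma taui_zcoeff: "taui (zcoeff k) = (\<tau> ^^ k) (\<alpha> (d - k)) \<otimes> inv (\<alpha> d)"
  by (simp add: zcoeff_def tau_alpha_d)

lemma zvec_closed [simp]: "zvec k \<in> Kd" by (simp add: zvec_def)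

lemma taui_zvec_nth:
  assumes "1 \<le> i" "i \<le> d"
  shows "taui (zvec k i) = (if Suc k \<le> i then (\<tau> ^^ k) (\<alpha> (i - Suc k)) else \<zero>)
    \<ominus> ((\<tau> ^^ k) (\<alpha> (d - k)) \<otimes> inv (\<alpha> d)) \<otimes> \<alpha> (i - 1)"
proof -
  have w: "taui (wvec (Suc k) i) = (if Suc k \<le> i then (\<tau> ^^ k) (\<alpha> (i - Suc k)) else \<zero>)"
    using assms by (simp add: wvec_nth)
  have w1: "taui (wvec 1 i) = \<alpha> (i - 1)" using assms by (simp add: wvec_nth One_nat_def)
  have cl: "wvec j i \<in> carrier K" for j using assms Kd_nth[OF wvec_closed] by simp
  have "taui (zvec k i) = taui (wvec (Suc k) i) \<oplus> \<ominus> (taui (zcoeff k) \<otimes> taui (wvec 1 i))"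
    using assms cl by (simp add: zvec_def vadd_nth vscale_nth l_minus)
  then show ?thesis unfolding w w1 taui_zcoeff by (simp add: a_minus_def)
qed

text \<open>The semilinear map undoes multiplication by x modulo f, and \<open>zvec k\<close> is x
  times \<open>wvec k\<close> reduced. In coordinates: the first entry - c alpha_0 makes
  \<open>companion_div\<close> add back the term c alpha_i that \<open>zvec\<close>
  subtracts.\<close>

lemma companion_div_zvec:
  assumes k: "1 \<le> k" "k \<le> d"
  shows "companion_div K d \<alpha> (\<lambda>i\<in>{1..d}. taui (zvec k i)) = wvec k"
proof (rule Kd_eqI)
  let ?z = "\<lambda>i\<in>{1..d}. taui (zvec k i)"
  have zcl: "?z \<in> Kd" using Kd_nth[OF zvec_closed] by auto
  then show "companion_div K d \<alpha> ?z \<in> Kd" by simp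
  show "wvec k \<in> Kd" by simp
  let ?c = "(\<tau> ^^ k) (\<alpha> (d - k)) \<otimes> inv (\<alpha> d)"
  have c: "?c \<in> carrier K" by simp
  fix i assume i: "1 \<le> i" "i \<le> d"
  have ai: "\<alpha> i \<in> carrier K" using i by simp
  have "taui (zvec k 1) = \<ominus> (?c \<otimes> \<alpha> 0)"
    using k by (simp add: taui_zvec_nth a_minus_def)
  then have 1: "(\<alpha> i \<otimes> inv (\<alpha> 0)) \<otimes> ?z 1 = \<ominus> (?c \<otimes> \<alpha> i)"
  proof -
    assume *: "taui (zvec k 1) = \<ominus> (?c \<otimes> \<alpha> 0)"
    have "(\<alpha> i \<otimes> inv (\<alpha> 0)) \<otimes> (?c \<otimes> \<alpha> 0) = (?c \<otimes> \<alpha> i) \<otimes> (inv (\<alpha> 0) \<otimes> \<alpha> 0)"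
      using c ai by (simp only: m_ac m_closed inv_alpha alpha_closed[of 0] le0)
    then show ?thesis using * k c ai by (simp add: r_minus)
  qed
  show "companion_div K d \<alpha> ?z i = wvec k i"
  proof (cases "i = d")
    case True
    have "?c \<otimes> \<alpha> d = (\<tau> ^^ k) (\<alpha> (d - k))" by (simp add: m_assoc)
    then show ?thesis using True i k 1 c ai
      by (simp add: companion_div_def a_minus_def wvec_nth)
  next
    case False
    then have "?z (Suc i) = (if k \<le> i then (\<tau> ^^ k) (\<alpha> (i - k)) else \<zero>) \<ominus> ?c \<otimes> \<alpha> i"
      using i by (simp add: taui_zvec_nth)
    then have "companion_div K d \<alpha> ?z i = (wvec k i \<ominus> ?c \<otimes> \<alpha> i) \<ominus> \<ominus> (?c \<otimes> \<alpha> i)"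
      using i 1 False by (simp only: companion_div_def restrict_apply' atLeastAtMost_iff simp_thms if_False wvec_nth)
    moreover have "(A \<ominus> B) \<ominus> \<ominus> B = A" if "A \<in> carrier K" "B \<in> carrier K" for A B
      using that by (simp add: a_minus_def a_assoc l_neg)
    ultimately show ?thesis using Kd_nth[OF wvec_closed i] c ai by simp
  qed
qed

definition sharp_coords :: "((nat \<Rightarrow> 'a) \<Rightarrow> 'a) \<Rightarrow> nat \<Rightarrow> 'a" where
  "sharp_coords \<phi> = (\<lambda>k\<in>{1..d}. \<ominus> (tp k \<otimes> \<phi> (wvec k)))"

lemma conj_functional_zero:
  assumes "conj_functional \<phi>" "u \<in> Kd" "\<And>i. 1 \<le> i \<Longrightarrow> i \<le> d \<Longrightarrow> u i = \<zero>"
  shows "\<phi> u = \<zero>"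
proof -
  have "vscale \<zero> u = u" using assms by (intro Kd_eqI) (simp_all add: vscale_nth)
  then show ?thesis using conj_functionalD(3)[OF assms(1) zero_closed assms(2)] conj_functionalD(1)[OF assms(1,2)]
    by simp
qed

text \<open>Evaluation at \<open>zvec k\<close> splits into values at \<open>wvec (Suc k)\<close>
  and \<open>wvec 1\<close>. The scale \<open>tp\<close> absorbs \<open>\<xi>\<close> through
  \<open>tp_Suc\<close>, and the coefficient left at the first coordinate must be
  \<open>\<alpha>s k\<close> divided by \<open>\<alpha>s 0\<close>. This is where the formula for
  the sharp coefficients comes from.\<close>

lemma sharp_coords_shift:
  assumes \<phi>: "conj_functional \<phi>" and \<psi>: "\<And>k. 1 \<le> k \<Longrightarrow> k \<le> d \<Longrightarrow> \<psi> (wvec k) = taui (\<xi> \<otimes> \<phi> (zvec k))"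
  shows "sharp_coords \<psi> = companion_div K d \<alpha>s (\<lambda>i\<in>{1..d}. taui (sharp_coords \<phi> i))"
proof (rule ext)
  fix k
  show "sharp_coords \<psi> k = companion_div K d \<alpha>s (\<lambda>i\<in>{1..d}. taui (sharp_coords \<phi> i)) k"
  proof (cases "k \<in> {1..d}")
    case False
    then show ?thesis by (auto simp: sharp_coords_def companion_div_def)
  next
    case True
    then have k: "1 \<le> k" "k \<le> d" by auto
    note cl = conj_functionalD(1)[OF \<phi> wvec_closed]
    let ?T = "\<lambda>j. taui (\<phi> (wvec j))"
    let ?q = "taui \<xi>"
    let ?c = "(\<tau> ^^ k) (bar (\<alpha> (d - k))) \<otimes> inv (bar (\<alpha> d))"
    have barad: "bar (inv (\<alpha> d)) = inv (bar (\<alpha> d))" "bar (\<alpha> d) \<noteq> \<zero>"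
      using hom_inv[OF bar.ring_hom_ring_axioms _ alpha_d] bar_nonzero[OF _ alpha_d] by simp_all
    have icl: "inv (bar (\<alpha> d)) \<in> carrier K" unfolding barad(1)[symmetric] by simp
    have tc: "taui (bar (zcoeff k)) = ?c"
      using k by (simp add: bar_taui[symmetric] taui_zcoeff bar_tau_pow barad)
    have "\<phi> (zvec k) = \<phi> (wvec (Suc k)) \<oplus> \<ominus> (bar (zcoeff k) \<otimes> \<phi> (wvec 1))"
      using cl by (simp add: zvec_def conj_functionalD[OF \<phi>] l_minus)
    then have "\<psi> (wvec k) = ?q \<otimes> (?T (Suc k) \<oplus> \<ominus> (?c \<otimes> ?T 1))"
      using \<psi>[OF k] cl tc by simp
    then have L: "sharp_coords \<psi> k = \<ominus> (tp k \<otimes> (?q \<otimes> (?T (Suc k) \<oplus> \<ominus> (?c \<otimes> ?T 1))))"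
      using k by (simp add: sharp_coords_def)
    have s: "taui (sharp_coords \<phi> j) = \<ominus> (taui (tp j) \<otimes> ?T j)" if "1 \<le> j" "j \<le> d" for j
      using that cl by (simp add: sharp_coords_def)
    have tpS: "taui (tp (Suc j)) = ?q \<otimes> tp j" for j by (simp add: tp_Suc)
    have s1: "taui (sharp_coords \<phi> 1) = \<ominus> (?q \<otimes> ?T 1)"
      using s[of 1] k tpS[of 0] by (simp add: tp_0 flip: One_nat_def)
    \<comment> \<open>For \<open>k = d\<close> all entries of \<open>wvec (Suc k)\<close> are zero,
      which matches the missing last entry in \<open>companion_div\<close>.\<close>
    have sS: "(if k = d then \<zero> else (\<lambda>i\<in>{1..d}. taui (sharp_coords \<phi> i)) (Suc k)) = \<ominus> ((?q \<otimes> tp k) \<otimes> ?T (Suc k))"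
    proof (cases "k = d")
      case True
      have "\<phi> (wvec (Suc k)) = \<zero>" using True by (intro conj_functional_zero[OF \<phi>]) (simp_all add: wvec_nth)
      then show ?thesis using True by simp
    next
      case False
      then show ?thesis using s[of "Suc k"] k tpS by simp
    qed
    \<comment> \<open>\<open>\<alpha>s 0\<close> is the conjugate of \<open>\<alpha> d\<close>, so
      the division reproduces the conjugated and untwisted \<open>zcoeff k\<close>.\<close>
    have quot: "\<alpha>s k \<otimes> inv (\<alpha>s 0) = tp k \<otimes> ?c"
      using k icl unfolding sharp_alpha_0 by (simp add: sharp_coeff_def m_assoc)
    have "companion_div K d \<alpha>s (\<lambda>i\<in>{1..d}. taui (sharp_coords \<phi> i)) k =
        \<ominus> ((?q \<otimes> tp k) \<otimes> ?T (Suc k)) \<ominus> (tp k \<otimes> ?c) \<otimes> \<ominus> (?q \<otimes> ?T 1)"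
      using k unfolding companion_div_def by (simp only: True restrict_apply' sS quot) (simp add: s1)
    moreover have "\<ominus> (tp k \<otimes> (?q \<otimes> (A \<oplus> \<ominus> (C \<otimes> B)))) =
        \<ominus> ((?q \<otimes> tp k) \<otimes> A) \<ominus> (tp k \<otimes> C) \<otimes> \<ominus> (?q \<otimes> B)"
      if "A \<in> carrier K" "B \<in> carrier K" "C \<in> carrier K" for A B C
      using that by (simp add: a_minus_def r_distr r_minus l_minus minus_add m_ac)
    ultimately show ?thesis unfolding L using cl k icl by simp
  qed
qed

lemma wvec_diag_nonzero: "1 \<le> k \<Longrightarrow> k \<le> d \<Longrightarrow> wvec k k \<noteq> \<zero>"
  using tau_pow_nonzero[OF _ alpha_0] by (simp add: wvec_nth)

text \<open>Elimination from the first entry on: \<open>wvec k\<close> has zeros before entry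
  \<open>k\<close> and a nonzero entry there, so a multiple of it clears the first possibly nonzero
  entry of \<open>u\<close>. The number \<open>n\<close> counts the entries not yet cleared.\<close>

lemma conj_functional_determined:
  assumes \<phi>: "conj_functional \<phi>" and 0: "\<And>k. 1 \<le> k \<Longrightarrow> k \<le> d \<Longrightarrow> \<phi> (wvec k) = \<zero>" and u: "u \<in> Kd"
  shows "\<phi> u = \<zero>"
proof -
  have "\<phi> u = \<zero>" if "u \<in> Kd" "n \<le> d" "\<And>i. 1 \<le> i \<Longrightarrow> i \<le> d - n \<Longrightarrow> u i = \<zero>" for u n
    using that
  proof (induction n arbitrary: u)
    case 0
    then show ?case by (intro conj_functional_zero[OF \<phi>]) simp_all
  next
    case (Suc n)
    let ?k = "d - n"
    have k: "1 \<le> ?k" "?k \<le> d" using Suc.prems by auto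
    have cl: "wvec ?k ?k \<in> carrier K" "u ?k \<in> carrier K"
      using Kd_nth[OF wvec_closed k] Kd_nth[OF Suc.prems(1) k] .
    have U: "wvec ?k ?k \<in> Units K" using cl wvec_diag_nonzero[OF k] by (simp add: field_Units)
    let ?a = "\<ominus> (u ?k \<otimes> inv (wvec ?k ?k))"
    have a: "?a \<in> carrier K" using cl U by simp
    have "\<phi> (vadd u (vscale ?a (wvec ?k))) = \<zero>"
    proof (rule Suc.IH)
      show "vadd u (vscale ?a (wvec ?k)) \<in> Kd" using Suc.prems(1) a by simp
      show "n \<le> d" using Suc.prems by simp
      fix i assume i: "1 \<le> i" "i \<le> d - n"
      then have nth: "vadd u (vscale ?a (wvec ?k)) i = u i \<oplus> ?a \<otimes> wvec ?k i" by (simp add: vadd_nth vscale_nth)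
      show "vadd u (vscale ?a (wvec ?k)) i = \<zero>"
      proof (cases "i = ?k")
        case True
        have "u ?k \<otimes> inv (wvec ?k ?k) \<otimes> wvec ?k ?k = u ?k" using cl U by (simp add: m_assoc)
        then show ?thesis using True cl U unfolding nth by (simp add: l_minus r_neg)
      next
        case False
        then have "u i = \<zero>" "wvec ?k i = \<zero>" using Suc.prems(3)[of i] i by (auto simp: wvec_nth)
        then show ?thesis using a unfolding nth by simp
      qed
    qed
    then show ?case
      using conj_functionalD[OF \<phi>] Suc.prems(1) a 0[OF k] by simp
  qed
  from this[of u d] u show ?thesis by simp
qed

lemma sharp_coords_ker:
  assumes \<phi>: "conj_functional \<phi>" and 0: "sharp_coords \<phi> = (\<lambda>i\<in>{1..d}. \<zero>)" and u: "u \<in> Kd"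
  shows "\<phi> u = \<zero>"
proof (rule conj_functional_determined[OF \<phi> _ u])
  fix k assume k: "1 \<le> k" "k \<le> d"
  note cl = conj_functionalD(1)[OF \<phi> wvec_closed]
  have "\<ominus> (tp k \<otimes> \<phi> (wvec k)) = \<zero>"
    using fun_cong[OF 0, of k] k by (simp add: sharp_coords_def)
  then have "\<ominus> (\<ominus> (tp k \<otimes> \<phi> (wvec k))) = \<zero>" by simp
  then have "tp k \<otimes> \<phi> (wvec k) = \<zero>" using cl by simp
  then show "\<phi> (wvec k) = \<zero>" using integral_iff[OF tp_closed cl] tp_nonzero by blast
qed

text \<open>Values are prescribed from \<open>k = d\<close> downwards. Adding a multiple of the
  conjugate of entry \<open>j\<close> corrects the value at \<open>wvec j\<close> and leaves the
  later ones alone, since \<open>wvec k\<close> has entry 0 at \<open>j\<close> for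
  \<open>k > j\<close>.\<close>

lemma conj_functional_exists:
  assumes c: "\<And>k. 1 \<le> k \<Longrightarrow> k \<le> d \<Longrightarrow> c k \<in> carrier K"
  shows "\<exists>\<phi>. conj_functional \<phi> \<and> (\<forall>k\<in>{1..d}. \<phi> (wvec k) = c k)"
proof -
  have "\<exists>\<phi>. conj_functional \<phi> \<and> (\<forall>k\<in>{1..d}. d - n < k \<longrightarrow> \<phi> (wvec k) = c k)" if "n \<le> d" for n
    using that
  proof (induction n)
    case 0
    have "conj_functional (\<lambda>_. \<zero>)" by (simp add: conj_functional_def)
    then show ?case by auto
  next
    case (Suc n)
    then obtain \<phi> where \<phi>: "conj_functional \<phi>" "\<forall>k\<in>{1..d}. d - n < k \<longrightarrow> \<phi> (wvec k) = c k" by auto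
    let ?j = "d - n"
    have j: "1 \<le> ?j" "?j \<le> d" using Suc.prems by auto
    have cl: "bar (wvec ?j ?j) \<in> carrier K" "c ?j \<in> carrier K" "\<phi> (wvec ?j) \<in> carrier K"
      using Kd_nth[OF wvec_closed j] c[OF j] conj_functionalD(1)[OF \<phi>(1)] by simp_all
    have U: "bar (wvec ?j ?j) \<in> Units K"
      using Kd_nth[OF wvec_closed j] bar_nonzero wvec_diag_nonzero[OF j] by (simp add: field_Units)
    define a where "a = (c ?j \<ominus> \<phi> (wvec ?j)) \<otimes> inv (bar (wvec ?j ?j))"
    have a: "a \<in> carrier K" using cl U by (simp add: a_def)
    let ?\<psi> = "\<lambda>u. \<phi> u \<oplus> a \<otimes> bar (u ?j)"
    have nth: "u ?j \<in> carrier K" if "u \<in> Kd" for u using Kd_nth[OF that j] .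
    have "conj_functional ?\<psi>"
      unfolding conj_functional_def
      using a j nth by (simp add: conj_functionalD[OF \<phi>(1)] vadd_nth vscale_nth r_distr a_ac m_ac)
    moreover have "?\<psi> (wvec k) = c k" if "k \<in> {1..d}" "d - Suc n < k" for k
    proof (cases "k = ?j")
      case True
      have "a \<otimes> bar (wvec ?j ?j) = c ?j \<ominus> \<phi> (wvec ?j)" using cl U by (simp add: a_def m_assoc)
      then show ?thesis using True cl by (simp add: a_minus_def a_lcomm[of "\<phi> (wvec ?j)"] r_neg)
    next
      case False
      then have "d - n < k" using that Suc.prems by simp
      moreover from this have "wvec k ?j = \<zero>" using j by (simp add: wvec_nth)
      ultimately show ?thesis using \<phi>(2) that(1) a c by simp
    qed
    ultimately show ?case by blast
  qed
  from this[of d] show ?thesis by simp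
qed

end

section \<open>The finitistic dual\<close>

context gwa_orbit
begin

abbreviation R\<omega> :: "('a, 'a set \<Rightarrow> 'a set) module" where "R\<omega> \<equiv> R_omega R \<omega>"
abbreviation so :: "int \<Rightarrow> ('a set \<Rightarrow> 'a set) \<Rightarrow> 'a set \<Rightarrow> 'a set" where "so \<equiv> sigma_omega R \<sigma> \<omega>"

lemma module_R_omega: "module R R\<omega>"
  unfolding R_omega_def by (intro module_direct_sum finite_orbit module_residue_module orbit_ideal)

lemma R_omega_simps:
  "carrier R\<omega> = (\<Pi>\<^sub>E \<mm>\<in>\<omega>. carrier (Km \<mm>))"
  "\<zero>\<^bsub>R\<omega>\<^esub> = (\<lambda>\<mm>\<in>\<omega>. \<zero>\<^bsub>Km \<mm>\<^esub>)"
  "u \<oplus>\<^bsub>R\<omega>\<^esub> v = (\<lambda>\<mm>\<in>\<omega>. u \<mm> \<oplus>\<^bsub>Km \<mm>\<^esub> v \<mm>)"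
  "r \<odot>\<^bsub>R\<omega>\<^esub> u = (\<lambda>\<mm>\<in>\<omega>. (\<mm> +> r) \<otimes>\<^bsub>Km \<mm>\<^esub> u \<mm>)"
  by (simp_all add: R_omega_def direct_sum_simps finite_orbit residue_module_simps)

lemma R_omega_nth: "u \<in> carrier R\<omega> \<Longrightarrow> \<mm> \<in> \<omega> \<Longrightarrow> u \<mm> \<in> carrier (Km \<mm>)"
  unfolding R_omega_simps by (rule PiE_mem)

lemma R_omega_eqI: "\<lbrakk>u \<in> carrier R\<omega>; v \<in> carrier R\<omega>; \<And>\<mm>. \<mm> \<in> \<omega> \<Longrightarrow> u \<mm> = v \<mm>\<rbrakk> \<Longrightarrow> u = v"
  unfolding R_omega_simps by (rule PiE_ext)

lemma so_nth: "\<mm> \<in> \<omega> \<Longrightarrow> so n u \<mm> = sg n ` u (sg (- n) ` \<mm>)"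
  by (simp add: sigma_omega_def)

lemma so_closed [simp]: "u \<in> carrier R\<omega> \<Longrightarrow> so n u \<in> carrier R\<omega>"
proof -
  assume u: "u \<in> carrier R\<omega>"
  have "sg n ` u (sg (- n) ` \<mm>) \<in> carrier (Km \<mm>)" if \<mm>: "\<mm> \<in> \<omega>" for \<mm>
    using sg_Km_closed[OF orbit_sg[OF \<mm>, of "- n"] R_omega_nth[OF u orbit_sg[OF \<mm>]], of n]
    unfolding sg_image_minus[OF orbit_subset[OF \<mm>]] .
  then show ?thesis unfolding R_omega_simps sigma_omega_def by simp
qed

lemma so_add:
  assumes u: "u \<in> carrier R\<omega>" and v: "v \<in> carrier R\<omega>"
  shows "so n (u \<oplus>\<^bsub>R\<omega>\<^esub> v) = so n u \<oplus>\<^bsub>R\<omega>\<^esub> so n v"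
proof -
  interpret R\<omega>: module R R\<omega> by (rule module_R_omega)
  show ?thesis
  proof (rule R_omega_eqI)
    fix \<mm> assume \<mm>: "\<mm> \<in> \<omega>"
    have "sg n ` (u (sg (- n) ` \<mm>) \<oplus>\<^bsub>Km (sg (- n) ` \<mm>)\<^esub> v (sg (- n) ` \<mm>)) =
        sg n ` u (sg (- n) ` \<mm>) \<oplus>\<^bsub>Km (sg n ` sg (- n) ` \<mm>)\<^esub> sg n ` v (sg (- n) ` \<mm>)"
      using ring_hom_add[OF sg_Km_hom[OF orbit_sg[OF \<mm>]]] R_omega_nth[OF u] R_omega_nth[OF v] \<mm> by simp
    then show "so n (u \<oplus>\<^bsub>R\<omega>\<^esub> v) \<mm> = (so n u \<oplus>\<^bsub>R\<omega>\<^esub> so n v) \<mm>"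
      using \<mm> unfolding sg_image_minus[OF orbit_subset[OF \<mm>]] by (simp add: so_nth R_omega_simps(3))
  qed (use u v in simp_all)
qed

lemma so_smult:
  assumes r: "r \<in> carrier R" and u: "u \<in> carrier R\<omega>"
  shows "so n (r \<odot>\<^bsub>R\<omega>\<^esub> u) = sg n r \<odot>\<^bsub>R\<omega>\<^esub> so n u"
proof -
  interpret R\<omega>: module R R\<omega> by (rule module_R_omega)
  show ?thesis
  proof (rule R_omega_eqI)
    fix \<mm> assume \<mm>: "\<mm> \<in> \<omega>"
    have "sg n ` ((sg (- n) ` \<mm> +> r) \<otimes>\<^bsub>Km (sg (- n) ` \<mm>)\<^esub> u (sg (- n) ` \<mm>)) =
        (sg n ` sg (- n) ` \<mm> +> sg n r) \<otimes>\<^bsub>Km (sg n ` sg (- n) ` \<mm>)\<^esub> sg n ` u (sg (- n) ` \<mm>)"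
      using ring_hom_mult[OF sg_Km_hom[OF orbit_sg[OF \<mm>]]] R_omega_nth[OF u] \<mm> r
      by (simp add: coset_closed sg_coset)
    then show "so n (r \<odot>\<^bsub>R\<omega>\<^esub> u) \<mm> = (sg n r \<odot>\<^bsub>R\<omega>\<^esub> so n u) \<mm>"
      using \<mm> unfolding sg_image_minus[OF orbit_subset[OF \<mm>]] by (simp add: so_nth R_omega_simps(4))
  qed (use r u in simp_all)
qed

lemma so_plus:
  assumes u: "u \<in> carrier R\<omega>" shows "so (m + n) u = so m (so n u)"
proof (rule R_omega_eqI)
  fix \<mm> assume \<mm>: "\<mm> \<in> \<omega>"
  have "- (m + n) = - n + - m" by simp
  then have "sg (- (m + n)) ` \<mm> = sg (- n) ` sg (- m) ` \<mm>"
    using sg_image_add[OF orbit_subset[OF \<mm>], of "- n" "- m"] by metis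
  then show "so (m + n) u \<mm> = so m (so n u) \<mm>"
    using \<mm> sg_Km_image_add[OF orbit_sg[OF orbit_sg[OF \<mm>]] R_omega_nth[OF u orbit_sg[OF orbit_sg[OF \<mm>]]]]
    by (simp add: so_nth)
qed (use u in simp_all)

lemma so_0: "u \<in> carrier R\<omega> \<Longrightarrow> so 0 u = u"
  by (rule R_omega_eqI) (simp_all add: so_nth)

end

section \<open>The dual of a representation on the orbit\<close>

context gwa_orbit_rep
begin

abbreviation VV where "VV \<equiv> gwa_module M X Y"
abbreviation DM where "DM \<equiv> sharp_R_module R star \<sigma> t \<omega> VV"
abbreviation DX where
  "DX \<equiv> (\<lambda>\<phi>. \<lambda>v\<in>carrier VV. sigma_omega R \<sigma> \<omega> 1 (\<phi> (gwa_Y R \<sigma> t \<odot>\<^bsub>VV\<^esub> v)))"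
abbreviation DY where
  "DY \<equiv> (\<lambda>\<phi>. \<lambda>v\<in>carrier VV. sigma_omega R \<sigma> \<omega> (- 1) (\<phi> (gwa_X R \<sigma> t \<odot>\<^bsub>VV\<^esub> v)))"

lemma finitistic_dual_eq: "finitistic_dual R star \<sigma> t \<omega> VV = gwa_module DM DX DY"
  by (simp add: finitistic_dual_def)

lemma DM_carrier: "\<phi> \<in> carrier DM \<longleftrightarrow> \<phi> \<in> carrier M \<rightarrow>\<^sub>E carrier R\<omega> \<and>
    (\<forall>v\<in>carrier M. \<forall>w\<in>carrier M. \<phi> (v \<oplus>\<^bsub>M\<^esub> w) = \<phi> v \<oplus>\<^bsub>R\<omega>\<^esub> \<phi> w) \<and>
    (\<forall>r\<in>carrier R. \<forall>v\<in>carrier M. \<phi> (r \<odot>\<^bsub>M\<^esub> v) = star r \<odot>\<^bsub>R\<omega>\<^esub> \<phi> v)"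
proof -
  have "(\<forall>r\<in>carrier R. \<forall>v\<in>carrier M. \<phi> (gwa_coeff R \<sigma> t r \<odot>\<^bsub>VV\<^esub> v) = star r \<odot>\<^bsub>R\<omega>\<^esub> \<phi> v) \<longleftrightarrow>
    (\<forall>r\<in>carrier R. \<forall>v\<in>carrier M. \<phi> (r \<odot>\<^bsub>M\<^esub> v) = star r \<odot>\<^bsub>R\<omega>\<^esub> \<phi> v)"
    by (intro ball_cong HOL.refl) simp
  then show ?thesis by (simp only: sharp_R_module_def partial_object.simps mem_Collect_eq gwa_module_simps)
      (simp add: finite_orbit)
qed

lemma DM_I:
  assumes "\<And>v. v \<in> carrier M \<Longrightarrow> f v \<in> carrier R\<omega>"
    and "\<And>v w. v \<in> carrier M \<Longrightarrow> w \<in> carrier M \<Longrightarrow> f (v \<oplus>\<^bsub>M\<^esub> w) = f v \<oplus>\<^bsub>R\<omega>\<^esub> f w"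
    and "\<And>r v. r \<in> carrier R \<Longrightarrow> v \<in> carrier M \<Longrightarrow> f (r \<odot>\<^bsub>M\<^esub> v) = star r \<odot>\<^bsub>R\<omega>\<^esub> f v"
  shows "(\<lambda>v\<in>carrier M. f v) \<in> carrier DM"
  unfolding DM_carrier using assms by simp

lemma DM_D:
  assumes "\<phi> \<in> carrier DM"
  shows "v \<in> carrier M \<Longrightarrow> \<phi> v \<in> carrier R\<omega>"
    and "v \<in> carrier M \<Longrightarrow> w \<in> carrier M \<Longrightarrow> \<phi> (v \<oplus>\<^bsub>M\<^esub> w) = \<phi> v \<oplus>\<^bsub>R\<omega>\<^esub> \<phi> w"
    and "r \<in> carrier R \<Longrightarrow> v \<in> carrier M \<Longrightarrow> \<phi> (r \<odot>\<^bsub>M\<^esub> v) = star r \<odot>\<^bsub>R\<omega>\<^esub> \<phi> v"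
  using assms unfolding DM_carrier by (simp_all add: PiE_iff)

lemma DM_eqI: "\<lbrakk>\<phi> \<in> carrier DM; \<psi> \<in> carrier DM; \<And>v. v \<in> carrier M \<Longrightarrow> \<phi> v = \<psi> v\<rbrakk> \<Longrightarrow> \<phi> = \<psi>"
  unfolding DM_carrier by (rule PiE_ext) auto

text \<open>The scalar action on the dual puts \<open>star r\<close> on the argument;
  conjugate-linearity and \<open>star (star r) = r\<close> make it pointwise multiplication by
  \<open>r\<close>.\<close>

lemma DM_ops:
  assumes v: "v \<in> carrier M"
  shows "(\<phi> \<oplus>\<^bsub>DM\<^esub> \<psi>) v = \<phi> v \<oplus>\<^bsub>R\<omega>\<^esub> \<psi> v" "\<zero>\<^bsub>DM\<^esub> v = \<zero>\<^bsub>R\<omega>\<^esub>"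
    "r \<in> carrier R \<Longrightarrow> \<phi> \<in> carrier DM \<Longrightarrow> (r \<odot>\<^bsub>DM\<^esub> \<phi>) v = r \<odot>\<^bsub>R\<omega>\<^esub> \<phi> v"
    "DX \<phi> v = so 1 (\<phi> (Y v))" "DY \<phi> v = so (- 1) (\<phi> (X v))"
  using v by (simp_all add: sharp_R_module_def DM_D(3)[unfolded sharp_R_module_def, simplified])

lemma DM_closed:
  assumes \<phi>: "\<phi> \<in> carrier DM"
  shows "\<psi> \<in> carrier DM \<Longrightarrow> \<phi> \<oplus>\<^bsub>DM\<^esub> \<psi> \<in> carrier DM" "\<zero>\<^bsub>DM\<^esub> \<in> carrier DM"
    "r \<in> carrier R \<Longrightarrow> r \<odot>\<^bsub>DM\<^esub> \<phi> \<in> carrier DM" "DX \<phi> \<in> carrier DM" "DY \<phi> \<in> carrier DM"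
proof -
  interpret O: module R R\<omega> by (rule module_R_omega)
  note D = DM_D[OF \<phi>]
  show "\<phi> \<oplus>\<^bsub>DM\<^esub> \<psi> \<in> carrier DM" if "\<psi> \<in> carrier DM"
  proof -
    have "(\<lambda>v\<in>carrier M. \<phi> v \<oplus>\<^bsub>R\<omega>\<^esub> \<psi> v) \<in> carrier DM"
      using D DM_D[OF that] by (intro DM_I) (simp_all add: O.smult_r_distr O.M.a_ac)
    then show ?thesis by (simp add: sharp_R_module_def)
  qed
  have "(\<lambda>v\<in>carrier M. \<zero>\<^bsub>R\<omega>\<^esub>) \<in> carrier DM" by (intro DM_I) simp_all
  then show "\<zero>\<^bsub>DM\<^esub> \<in> carrier DM" by (simp add: sharp_R_module_def)
  show "r \<odot>\<^bsub>DM\<^esub> \<phi> \<in> carrier DM" if r: "r \<in> carrier R"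
  proof -
    have "r \<odot>\<^bsub>R\<omega>\<^esub> (s \<odot>\<^bsub>R\<omega>\<^esub> u) = s \<odot>\<^bsub>R\<omega>\<^esub> (r \<odot>\<^bsub>R\<omega>\<^esub> u)" if "s \<in> carrier R" "u \<in> carrier R\<omega>" for s u
      using O.smult_assoc1[of r s u] O.smult_assoc1[of s r u] that r by (simp add: m_comm)
    then have "(\<lambda>v\<in>carrier M. r \<odot>\<^bsub>R\<omega>\<^esub> \<phi> v) \<in> carrier DM"
      using D r by (intro DM_I) (simp_all add: O.smult_r_distr)
    moreover have "r \<odot>\<^bsub>DM\<^esub> \<phi> = (\<lambda>v\<in>carrier M. r \<odot>\<^bsub>R\<omega>\<^esub> \<phi> v)"
      using D(3)[of "star r"] r by (auto simp: sharp_R_module_def fun_eq_iff)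
    ultimately show ?thesis by simp
  qed
  have "(\<lambda>v\<in>carrier M. so 1 (\<phi> (Y v))) \<in> carrier DM"
    using D by (intro DM_I) (simp_all add: Y_add Y_smult so_add so_smult sinv_star sg_star flip: sinv_star)
  moreover have "DX \<phi> = (\<lambda>v\<in>carrier M. so 1 (\<phi> (Y v)))" by (auto simp: fun_eq_iff)
  ultimately show "DX \<phi> \<in> carrier DM" by simp
  have "(\<lambda>v\<in>carrier M. so (- 1) (\<phi> (X v))) \<in> carrier DM"
    using D by (intro DM_I) (simp_all add: X_add X_smult so_add so_smult flip: sigma_star)
  moreover have "DY \<phi> = (\<lambda>v\<in>carrier M. so (- 1) (\<phi> (X v)))" by (auto simp: fun_eq_iff)
  ultimately show "DY \<phi> \<in> carrier DM" by simp
qed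

lemma module_DM: "module R DM"
proof (rule moduleI)
  interpret O: module R R\<omega> by (rule module_R_omega)
  have zc: "\<zero>\<^bsub>DM\<^esub> \<in> carrier DM"
  proof -
    have "(\<lambda>v\<in>carrier M. \<zero>\<^bsub>R\<omega>\<^esub>) \<in> carrier DM" by (intro DM_I) simp_all
    then show ?thesis by (simp add: sharp_R_module_def)
  qed
  show "cring R" by (rule is_cring)
  show "abelian_group DM"
  proof (rule abelian_groupI)
    show "\<zero>\<^bsub>DM\<^esub> \<in> carrier DM" by (rule zc)
    fix \<phi> assume \<phi>: "\<phi> \<in> carrier DM"
    show "\<zero>\<^bsub>DM\<^esub> \<oplus>\<^bsub>DM\<^esub> \<phi> = \<phi>"
      using \<phi> zc by (intro DM_eqI DM_closed) (simp_all add: DM_ops DM_D)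
    have "\<ominus>\<one> \<in> carrier R" by simp
    moreover have "(\<ominus>\<one>) \<odot>\<^bsub>DM\<^esub> \<phi> \<oplus>\<^bsub>DM\<^esub> \<phi> = \<zero>\<^bsub>DM\<^esub>"
      using \<phi> zc by (intro DM_eqI DM_closed) (simp_all add: DM_ops DM_D O.smult_l_minus O.M.l_neg)
    ultimately show "\<exists>\<psi>\<in>carrier DM. \<psi> \<oplus>\<^bsub>DM\<^esub> \<phi> = \<zero>\<^bsub>DM\<^esub>" using DM_closed(3)[OF \<phi>] by blast
    fix \<psi> assume \<psi>: "\<psi> \<in> carrier DM"
    show "\<phi> \<oplus>\<^bsub>DM\<^esub> \<psi> \<in> carrier DM" using \<phi> \<psi> by (rule DM_closed)
    show "\<phi> \<oplus>\<^bsub>DM\<^esub> \<psi> = \<psi> \<oplus>\<^bsub>DM\<^esub> \<phi>"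
      using \<phi> \<psi> by (intro DM_eqI DM_closed) (simp_all add: DM_ops DM_D O.M.a_comm)
    fix \<chi> assume \<chi>: "\<chi> \<in> carrier DM"
    show "\<phi> \<oplus>\<^bsub>DM\<^esub> \<psi> \<oplus>\<^bsub>DM\<^esub> \<chi> = \<phi> \<oplus>\<^bsub>DM\<^esub> (\<psi> \<oplus>\<^bsub>DM\<^esub> \<chi>)"
      using \<phi> \<psi> \<chi> by (intro DM_eqI DM_closed) (simp_all add: DM_ops DM_D O.M.a_assoc)
  qed
  fix r \<phi> assume r: "r \<in> carrier R" and \<phi>: "\<phi> \<in> carrier DM"
  show "r \<odot>\<^bsub>DM\<^esub> \<phi> \<in> carrier DM" using \<phi> r by (rule DM_closed)
  show "(r \<oplus> s) \<odot>\<^bsub>DM\<^esub> \<phi> = r \<odot>\<^bsub>DM\<^esub> \<phi> \<oplus>\<^bsub>DM\<^esub> s \<odot>\<^bsub>DM\<^esub> \<phi>" if s: "s \<in> carrier R" for s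
    using \<phi> r s by (intro DM_eqI DM_closed) (simp_all add: DM_ops DM_D O.smult_l_distr)
  show "(r \<otimes> s) \<odot>\<^bsub>DM\<^esub> \<phi> = r \<odot>\<^bsub>DM\<^esub> (s \<odot>\<^bsub>DM\<^esub> \<phi>)" if s: "s \<in> carrier R" for s
    using \<phi> r s by (intro DM_eqI DM_closed) (simp_all add: DM_ops DM_D DM_closed O.smult_assoc1)
  fix \<psi> assume \<psi>: "\<psi> \<in> carrier DM"
  show "r \<odot>\<^bsub>DM\<^esub> (\<phi> \<oplus>\<^bsub>DM\<^esub> \<psi>) = r \<odot>\<^bsub>DM\<^esub> \<phi> \<oplus>\<^bsub>DM\<^esub> r \<odot>\<^bsub>DM\<^esub> \<psi>"
    using \<phi> r \<psi> by (intro DM_eqI DM_closed) (simp_all add: DM_ops DM_D DM_closed O.smult_r_distr)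
next
  interpret O: module R R\<omega> by (rule module_R_omega)
  fix \<phi> assume \<phi>: "\<phi> \<in> carrier DM"
  show "\<one> \<odot>\<^bsub>DM\<^esub> \<phi> = \<phi>" using \<phi> by (intro DM_eqI DM_closed) (simp_all add: DM_ops DM_D)
qed

text \<open>X and Y change places and the two shifts cancel, so Y X sends a functional to its
  composition with Y X, which is multiplication by \<open>star t = t\<close>.\<close>

lemma gwa_rep_dual: "gwa_rep R \<sigma> t DM DX DY"
proof (intro gwa_rep.intro gwa_rep_axioms.intro)
  interpret O: module R R\<omega> by (rule module_R_omega)
  show "gwa_ring R \<sigma> t" by (rule gwa_ring_axioms)
  show "module R DM" by (rule module_DM)
  fix \<phi> assume \<phi>: "\<phi> \<in> carrier DM"
  show "DX \<phi> \<in> carrier DM" "DY \<phi> \<in> carrier DM" using DM_closed[OF \<phi>] by simp_all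
  show "DY (DX \<phi>) = t \<odot>\<^bsub>DM\<^esub> \<phi>"
  proof (rule DM_eqI)
    fix v assume v: "v \<in> carrier M"
    have "DY (DX \<phi>) v = so (- 1) (so 1 (\<phi> (Y (X v))))" using v by (simp only: DM_ops X_closed)
    also have "\<dots> = \<phi> (Y (X v))"
      using DM_D(1)[OF \<phi>] v so_plus[of "\<phi> (Y (X v))" "- 1" 1] so_0 by simp
    also have "\<dots> = (t \<odot>\<^bsub>DM\<^esub> \<phi>) v" using v \<phi> by (simp add: DM_ops DM_D Y_X)
    finally show "DY (DX \<phi>) v = (t \<odot>\<^bsub>DM\<^esub> \<phi>) v" .
  qed (use \<phi> in \<open>simp_all only: DM_closed t_closed\<close>)
  show "DX (DY \<phi>) = \<sigma> t \<odot>\<^bsub>DM\<^esub> \<phi>"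
  proof (rule DM_eqI)
    fix v assume v: "v \<in> carrier M"
    have "DX (DY \<phi>) v = so 1 (so (- 1) (\<phi> (X (Y v))))" using v by (simp only: DM_ops Y_closed)
    also have "\<dots> = \<phi> (X (Y v))"
      using DM_D(1)[OF \<phi>] v so_plus[of "\<phi> (X (Y v))" 1 "- 1"] so_0 by simp
    also have "\<dots> = (\<sigma> t \<odot>\<^bsub>DM\<^esub> \<phi>) v" using v \<phi> sigma_star[of t] by (simp add: DM_ops DM_D X_Y)
    finally show "DX (DY \<phi>) v = (\<sigma> t \<odot>\<^bsub>DM\<^esub> \<phi>) v" .
  qed (use \<phi> in \<open>simp_all only: DM_closed t_closed sigma_closed\<close>)
  fix \<psi> assume \<psi>: "\<psi> \<in> carrier DM"
  show "DX (\<phi> \<oplus>\<^bsub>DM\<^esub> \<psi>) = DX \<phi> \<oplus>\<^bsub>DM\<^esub> DX \<psi>"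
  proof (rule DM_eqI)
    fix v assume v: "v \<in> carrier M"
    then show "DX (\<phi> \<oplus>\<^bsub>DM\<^esub> \<psi>) v = (DX \<phi> \<oplus>\<^bsub>DM\<^esub> DX \<psi>) v"
      by (simp only: DM_ops Y_closed so_add DM_D[OF \<phi>] DM_D[OF \<psi>])
  qed (use \<phi> \<psi> in \<open>simp_all only: DM_closed\<close>)
  show "DY (\<phi> \<oplus>\<^bsub>DM\<^esub> \<psi>) = DY \<phi> \<oplus>\<^bsub>DM\<^esub> DY \<psi>"
  proof (rule DM_eqI)
    fix v assume v: "v \<in> carrier M"
    then show "DY (\<phi> \<oplus>\<^bsub>DM\<^esub> \<psi>) v = (DY \<phi> \<oplus>\<^bsub>DM\<^esub> DY \<psi>) v"
      by (simp only: DM_ops X_closed so_add DM_D[OF \<phi>] DM_D[OF \<psi>])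
  qed (use \<phi> \<psi> in \<open>simp_all only: DM_closed\<close>)
next
  fix r \<phi> assume r: "r \<in> carrier R" and \<phi>: "\<phi> \<in> carrier DM"
  show "DX (r \<odot>\<^bsub>DM\<^esub> \<phi>) = \<sigma> r \<odot>\<^bsub>DM\<^esub> DX \<phi>"
  proof (rule DM_eqI)
    fix v assume v: "v \<in> carrier M"
    then show "DX (r \<odot>\<^bsub>DM\<^esub> \<phi>) v = (\<sigma> r \<odot>\<^bsub>DM\<^esub> DX \<phi>) v"
      using r \<phi> by (simp only: DM_ops Y_closed so_smult DM_D DM_closed sigma_closed zpow_1)
  qed (use r \<phi> in \<open>simp_all only: DM_closed sigma_closed\<close>)
  show "DY (r \<odot>\<^bsub>DM\<^esub> \<phi>) = sinv r \<odot>\<^bsub>DM\<^esub> DY \<phi>"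
  proof (rule DM_eqI)
    fix v assume v: "v \<in> carrier M"
    then show "DY (r \<odot>\<^bsub>DM\<^esub> \<phi>) v = (sinv r \<odot>\<^bsub>DM\<^esub> DY \<phi>) v"
      using r \<phi> by (simp only: DM_ops X_closed so_smult DM_D DM_closed sinv_closed zpow_minus_1)
  qed (use r \<phi> in \<open>simp_all only: DM_closed sinv_closed\<close>)
qed

text \<open>The intersection of the orbit already kills the values in
  \<open>R_omega\<close>.\<close>

lemma gwa_orbit_rep_dual: "gwa_orbit_rep R \<sigma> t star \<omega> \<mm>\<omega> DM DX DY"
proof (intro gwa_orbit_rep.intro gwa_orbit_rep_axioms.intro)
  interpret O: module R R\<omega> by (rule module_R_omega)
  show "gwa_orbit R \<sigma> t star \<omega> \<mm>\<omega>" by (rule gwa_orbit_axioms)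
  show "gwa_rep R \<sigma> t DM DX DY" by (rule gwa_rep_dual)
  fix r \<phi> assume r: "r \<in> carrier R" "\<And>\<mm>. \<mm> \<in> \<omega> \<Longrightarrow> r \<in> \<mm>" and \<phi>: "\<phi> \<in> carrier DM"
  have "r \<odot>\<^bsub>R\<omega>\<^esub> u = \<zero>\<^bsub>R\<omega>\<^esub>" if u: "u \<in> carrier R\<omega>" for u
  proof (rule R_omega_eqI)
    fix \<mm> assume \<mm>: "\<mm> \<in> \<omega>"
    interpret F: field "Km \<mm>" using \<mm> by (rule Km_field)
    show "(r \<odot>\<^bsub>R\<omega>\<^esub> u) \<mm> = \<zero>\<^bsub>R\<omega>\<^esub> \<mm>"
      using \<mm> r coset_zero[OF \<mm>] R_omega_nth[OF u \<mm>] by (simp add: R_omega_simps)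
  qed (use r u in simp_all)
  then show "r \<odot>\<^bsub>DM\<^esub> \<phi> = \<zero>\<^bsub>DM\<^esub>"
    using r(1) \<phi> by (intro DM_eqI DM_closed) (simp_all add: DM_ops DM_D)
qed

lemma DY_pow_nth: "\<phi> \<in> carrier DM \<Longrightarrow> v \<in> carrier M \<Longrightarrow> (DY ^^ k) \<phi> v = so (- int k) (\<phi> ((X ^^ k) v))"
proof (induction k arbitrary: v)
  case 0
  then show ?case using so_0 DM_D(1) by simp
next
  case (Suc k)
  have "(DY ^^ Suc k) \<phi> v = so (- 1) ((DY ^^ k) \<phi> (X v))"
    using Suc.prems(2) by (simp only: funpow.simps comp_apply DM_ops)
  also have "\<dots> = so (- 1) (so (- int k) (\<phi> ((X ^^ k) (X v))))"
    by (simp only: Suc.IH[OF Suc.prems(1) X_closed[OF Suc.prems(2)]])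
  also have "\<dots> = so (- 1 + - int k) (\<phi> ((X ^^ k) (X v)))"
    using Suc.prems by (intro so_plus[symmetric] DM_D) simp_all
  also have "- 1 + - int k = - int (Suc k)" by simp
  also have "(X ^^ k) (X v) = (X ^^ Suc k) v" by (simp add: funpow_swap1)
  finally show ?case .
qed

end

section \<open>The automorphism tau and the scalar xi of the residue field\<close>

context gwa_orbit
begin

lemma tau_eq: "tau \<sigma> \<omega> = (`) (sg (int p))"
  by (simp add: tau_def zpow_of_nat fun_eq_iff)

lemma tau_hom: "tau \<sigma> \<omega> \<in> ring_hom (Km \<mm>\<omega>) (Km \<mm>\<omega>)"
  using sg_Km_hom[OF m\<omega>, of "int p"] by (simp add: tau_eq)

lemma sg_p_tau: "c \<in> carrier (Km \<mm>\<omega>) \<Longrightarrow> sg (- int p) ` tau \<sigma> \<omega> c = c"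
  "c \<in> carrier (Km \<mm>\<omega>) \<Longrightarrow> tau \<sigma> \<omega> (sg (- int p) ` c) = c"
  using sg_image_minus[OF Km_subset[OF m\<omega>], of c "int p"] by (simp_all add: tau_eq)

lemma tau_ring_iso: "tau \<sigma> \<omega> \<in> ring_iso (Km \<mm>\<omega>) (Km \<mm>\<omega>)"
proof -
  have "bij_betw (tau \<sigma> \<omega>) (carrier (Km \<mm>\<omega>)) (carrier (Km \<mm>\<omega>))"
  proof (rule bij_betwI[where g = "\<lambda>c. sg (- int p) ` c"])
    show "tau \<sigma> \<omega> \<in> carrier (Km \<mm>\<omega>) \<rightarrow> carrier (Km \<mm>\<omega>)" using ring_hom_closed[OF tau_hom] by blast
    show "(\<lambda>c. sg (- int p) ` c) \<in> carrier (Km \<mm>\<omega>) \<rightarrow> carrier (Km \<mm>\<omega>)"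
      using sg_Km_closed[OF m\<omega>, of _ "- int p"] by simp
  qed (simp_all add: sg_p_tau)
  then show ?thesis using tau_hom by (simp add: ring_iso_def)
qed

lemma inv_tau: "c \<in> carrier (Km \<mm>\<omega>) \<Longrightarrow> inv_into (carrier (Km \<mm>\<omega>)) (tau \<sigma> \<omega>) c = sg (- int p) ` c"
  using tau_ring_iso sg_p_tau(2)[of c] sg_Km_closed[OF m\<omega>, of c "- int p"]
  by (intro inv_into_f_eq) (simp_all add: ring_iso_def bij_betw_def)

abbreviation \<xi>0 :: 'a where "\<xi>0 \<equiv> (\<Otimes>i\<in>{1..p}. (\<sigma> ^^ i) t)"

lemma sigma_pow_t_closed: "(\<sigma> ^^ i) t \<in> carrier R"
  using sg_closed[of t "int i"] by (simp add: zpow_of_nat)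

lemma xi0_closed: "\<xi>0 \<in> carrier R" using sigma_pow_t_closed by simp

lemma xi_eq: "xi R \<sigma> t \<omega> \<mm>\<omega> = \<mm>\<omega> +> \<xi>0" by (simp add: xi_def)

lemma star_xi0: "star \<xi>0 = \<xi>0"
proof -
  interpret h: ring_hom_cring R R star
    using is_cring star_hom by (simp add: ring_hom_cring_def ring_hom_cring_axioms_def)
  have "star ((\<sigma> ^^ i) t) = (\<sigma> ^^ i) t" for i
    using sg_star[of t "int i"] by (simp add: zpow_of_nat)
  then have "(\<Otimes>i\<in>{1..k}. star ((\<sigma> ^^ i) t)) = (\<Otimes>i\<in>{1..k}. (\<sigma> ^^ i) t)" for k by simp
  moreover have "star (\<Otimes>i\<in>{1..p}. (\<sigma> ^^ i) t) = (\<Otimes>i\<in>{1..p}. star ((\<sigma> ^^ i) t))"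
    using h.hom_finprod[of "\<lambda>i. (\<sigma> ^^ i) t" "{1..p}"] sigma_pow_t_closed by (simp add: comp_def)
  ultimately show ?thesis by simp
qed

text \<open>No translate of \<open>t\<close> lies in \<open>\<mm>\<omega>\<close>, as there are no
  breaks, and \<open>\<mm>\<omega>\<close> is prime.\<close>

lemma xi0_notin: "\<xi>0 \<notin> \<mm>\<omega>"
proof -
  interpret m: primeideal \<mm>\<omega> R using maximalideal_prime[OF max\<omega>] .
  have "(\<Otimes>i\<in>{1..k}. (\<sigma> ^^ i) t) \<notin> \<mm>\<omega>" for k
  proof (induction k)
    case 0
    then show ?case using m.one_imp_carrier m.I_notcarr by auto
  next
    case (Suc k)
    have "{1..Suc k} = insert (Suc k) {1..k}" by auto
    then have "(\<Otimes>i\<in>{1..Suc k}. (\<sigma> ^^ i) t) = (\<sigma> ^^ Suc k) t \<otimes> (\<Otimes>i\<in>{1..k}. (\<sigma> ^^ i) t)"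
      using sigma_pow_t_closed by (simp del: funpow.simps)
    moreover have "(\<sigma> ^^ Suc k) t \<notin> \<mm>\<omega>" using sg_t_notin[OF m\<omega>, of "int (Suc k)"] unfolding zpow_of_nat .
    ultimately show ?case
      using Suc m.I_prime[of "(\<sigma> ^^ Suc k) t"] sigma_pow_t_closed[of "Suc k"] sigma_pow_t_closed
      by (metis (no_types, lifting) Pi_I finprod_closed)
  qed
  then show ?thesis .
qed

lemma star_coset: "\<mm> \<in> \<omega> \<Longrightarrow> r \<in> carrier R \<Longrightarrow> star ` (\<mm> +> r) = \<mm> +> star r"
  using image_coset[OF star_hom orbit_subset] by simp

end

section \<open>The fibre of the dual of V(omega, f)\<close>

context gwa_V
begin

sublocale S: skew_companion "R Quot \<mm>\<omega>" d \<alpha> "tau \<sigma> \<omega>" "(`) star" "xi R \<sigma> t \<omega> \<mm>\<omega>"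
proof (intro skew_companion.intro skew_companion_axioms.intro)
  show "companion_field (R Quot \<mm>\<omega>) d \<alpha>" by (rule K.companion_field_axioms)
  show "tau \<sigma> \<omega> \<in> ring_iso (R Quot \<mm>\<omega>) (R Quot \<mm>\<omega>)" by (rule tau_ring_iso)
  show "(`) star \<in> ring_hom (R Quot \<mm>\<omega>) (R Quot \<mm>\<omega>)" by (rule star_Km_hom[OF m\<omega>])
  show "xi R \<sigma> t \<omega> \<mm>\<omega> \<in> carrier (R Quot \<mm>\<omega>)" unfolding xi_eq by (rule coset_closed[OF m\<omega> xi0_closed])
  show "xi R \<sigma> t \<omega> \<mm>\<omega> \<noteq> \<zero>\<^bsub>R Quot \<mm>\<omega>\<^esub>"
    unfolding xi_eq using coset_eq_zero_iff[OF m\<omega> xi0_closed] xi0_notin by blast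
  show "star ` xi R \<sigma> t \<omega> \<mm>\<omega> = xi R \<sigma> t \<omega> \<mm>\<omega>"
    unfolding xi_eq by (simp add: star_coset[OF m\<omega> xi0_closed] star_xi0)
  fix c assume c: "c \<in> carrier (R Quot \<mm>\<omega>)"
  have sub: "c \<subseteq> carrier R" using c by (rule Km_subset[OF m\<omega>])
  have "(\<lambda>x. star (star x)) ` c = (\<lambda>x. x) ` c" using sub by (intro image_cong) auto
  then show "star ` star ` c = c" by (simp add: image_image)
  have "(\<lambda>x. star (sg (int p) x)) ` c = (\<lambda>x. sg (int p) (star x)) ` c"
    using sub by (intro image_cong) (auto simp: sg_star)
  then show "star ` tau \<sigma> \<omega> c = tau \<sigma> \<omega> (star ` c)" by (simp add: tau_eq image_image)
qed

abbreviation \<alpha>\<^sub>s :: "nat \<Rightarrow> 'a set" where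
  "\<alpha>\<^sub>s \<equiv> sharp_coeff (R Quot \<mm>\<omega>) (tau \<sigma> \<omega>) ((`) star) (xi R \<sigma> t \<omega> \<mm>\<omega>) d \<alpha>"

lemma gwa_V_sharp: "gwa_V R \<sigma> t star \<omega> \<mm>\<omega> d \<alpha>\<^sub>s"
  using gwa_orbit_axioms S.sharp_alpha_closed S.sharp_alpha_nonzero
  by (simp add: gwa_V_def gwa_V_axioms_def)

sublocale VR: gwa_orbit_rep R \<sigma> t star \<omega> \<mm>\<omega> VM VX VY by (rule gwa_orbit_rep_V)

lemma eta_eq: "u \<in> K.Kd \<Longrightarrow> eta u = cdiv (\<lambda>i\<in>{1..d}. S.taui (u i))"
  unfolding eta_def sg_vec_def by (intro arg_cong[of _ _ cdiv] restrict_ext) (auto simp: inv_tau PiE_iff)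

lemma single_mem: "u \<in> K.Kd \<Longrightarrow> single \<mm>\<omega> u \<in> carrier VM"
  using single_closed[OF m\<omega>] by (simp only: Wd_simps)

lemma single_weight: "u \<in> K.Kd \<Longrightarrow> r \<in> \<mm>\<omega> \<Longrightarrow> r \<odot>\<^bsub>VM\<^esub> single \<mm>\<omega> u = \<zero>\<^bsub>VM\<^esub>"
  using weight_vector_iff[OF single_mem max\<omega>, of u] by (simp add: single_nth)

lemma weight_single:
  assumes v: "v \<in> carrier VM" and wt: "\<And>r. r \<in> \<mm>\<omega> \<Longrightarrow> r \<odot>\<^bsub>VM\<^esub> v = \<zero>\<^bsub>VM\<^esub>"
  shows "v = single \<mm>\<omega> (v \<mm>\<omega>)"
proof (rule VM_eqI)
  show "single \<mm>\<omega> (v \<mm>\<omega>) \<in> carrier VM" using single_closed[OF m\<omega> VM_nth[OF v m\<omega>]] .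
  fix \<mm> assume \<mm>: "\<mm> \<in> \<omega>"
  show "v \<mm> = single \<mm>\<omega> (v \<mm>\<omega>) \<mm>"
    using weight_vector_iff[OF v max\<omega>] wt \<mm> by (simp add: single_nth)
qed fact

lemma single_add: "single \<mm>\<omega> (S.vadd u v) = single \<mm>\<omega> u \<oplus>\<^bsub>VM\<^esub> single \<mm>\<omega> v" if "u \<in> K.Kd" "v \<in> K.Kd"
proof (rule VM_eqI)
  show "single \<mm>\<omega> (S.vadd u v) \<in> carrier VM" using that by (intro single_mem S.vadd_closed)
  show "single \<mm>\<omega> u \<oplus>\<^bsub>VM\<^esub> single \<mm>\<omega> v \<in> carrier VM" using that single_mem by simp
  fix \<mm> assume \<mm>: "\<mm> \<in> \<omega>"
  interpret W: module R "Wd d \<mm>" using \<mm> by (rule module_Wd)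
  show "single \<mm>\<omega> (S.vadd u v) \<mm> = (single \<mm>\<omega> u \<oplus>\<^bsub>VM\<^esub> single \<mm>\<omega> v) \<mm>"
  proof (cases "\<mm> = \<mm>\<omega>")
    case True
    then show ?thesis using \<mm> by (simp add: add_VM_nth single_nth S.vadd_def Wd_simps(3))
  next
    case False
    then show ?thesis
      using W.M.l_zero[OF W.M.zero_closed] by (simp only: add_VM_nth[OF \<mm>] single_nth[OF \<mm>] if_False)
  qed
qed

lemma smult_eq_vscale: "r \<odot>\<^bsub>Wd d \<mm>\<omega>\<^esub> u = S.vscale (\<mm>\<omega> +> r) u"
  by (simp add: S.vscale_def Wd_simps(4))

lemma single_smult: "single \<mm>\<omega> (S.vscale (\<mm>\<omega> +> r) u) = r \<odot>\<^bsub>VM\<^esub> single \<mm>\<omega> u" if "u \<in> K.Kd" "r \<in> carrier R"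
proof (rule VM_eqI)
  show "single \<mm>\<omega> (S.vscale (\<mm>\<omega> +> r) u) \<in> carrier VM"
    using that by (intro single_mem S.vscale_closed coset_closed[OF m\<omega>])
  show "r \<odot>\<^bsub>VM\<^esub> single \<mm>\<omega> u \<in> carrier VM" using that single_mem by simp
  fix \<mm> assume \<mm>: "\<mm> \<in> \<omega>"
  interpret W: module R "Wd d \<mm>" using \<mm> by (rule module_Wd)
  show "single \<mm>\<omega> (S.vscale (\<mm>\<omega> +> r) u) \<mm> = (r \<odot>\<^bsub>VM\<^esub> single \<mm>\<omega> u) \<mm>"
    using \<mm> that W.smult_r_null[of r] by (cases "\<mm> = \<mm>\<omega>") (simp_all add: smult_VM_nth single_nth smult_eq_vscale)
qed

text \<open>\<open>sg p\<close> fixes \<open>\<mm>\<omega>\<close>, so Y^p preserves the weight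
  space there, and a vector of that weight is known from one component.\<close>

lemma VY_pow_single:
  assumes u: "u \<in> K.Kd" shows "(VY ^^ p) (single \<mm>\<omega> u) = single \<mm>\<omega> (eta u)"
proof -
  have "(VY ^^ p) (single \<mm>\<omega> u) = single \<mm>\<omega> ((VY ^^ p) (single \<mm>\<omega> u) \<mm>\<omega>)"
  proof (rule weight_single)
    show "(VY ^^ p) (single \<mm>\<omega> u) \<in> carrier VM" using single_mem[OF u] by simp
    fix r assume r: "r \<in> \<mm>\<omega>"
    then have rc: "r \<in> carrier R" using orbit_subset[OF m\<omega>] by blast
    have "sg (int p) r \<in> \<mm>\<omega>" using sg_p(1) r by blast
    then have "(VY ^^ p) (sg (int p) r \<odot>\<^bsub>VM\<^esub> single \<mm>\<omega> u) = \<zero>\<^bsub>VM\<^esub>" using single_weight[OF u] by simp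
    then show "r \<odot>\<^bsub>VM\<^esub> (VY ^^ p) (single \<mm>\<omega> u) = \<zero>\<^bsub>VM\<^esub>"
      using rc single_mem[OF u] by (simp add: VR.Y_pow_smult)
  qed
  also have "(VY ^^ p) (single \<mm>\<omega> u) \<mm>\<omega> = eta u"
    using VY_pow_p[OF single_mem[OF u]] single_nth[OF m\<omega>] by simp
  finally show ?thesis .
qed

definition fiber_form :: "((('a set \<Rightarrow> nat \<Rightarrow> 'a set)) \<Rightarrow> 'a set \<Rightarrow> 'a set) \<Rightarrow> (nat \<Rightarrow> 'a set) \<Rightarrow> 'a set" where
  "fiber_form \<phi> u = \<phi> (single \<mm>\<omega> u) \<mm>\<omega>"

lemma fiber_form_conj:
  assumes \<phi>: "\<phi> \<in> carrier VR.DM" shows "S.conj_functional (fiber_form \<phi>)"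
  unfolding S.conj_functional_def
proof (intro conjI ballI)
  note D = VR.DM_D[OF \<phi>]
  fix u assume u: "u \<in> K.Kd"
  show "fiber_form \<phi> u \<in> carrier (R Quot \<mm>\<omega>)"
    unfolding fiber_form_def using R_omega_nth[OF D(1)[OF single_mem[OF u]] m\<omega>] .
  show "fiber_form \<phi> (S.vadd u v) = fiber_form \<phi> u \<oplus>\<^bsub>R Quot \<mm>\<omega>\<^esub> fiber_form \<phi> v" if v: "v \<in> K.Kd" for v
    unfolding fiber_form_def single_add[OF u v] D(2)[OF single_mem[OF u] single_mem[OF v]]
    using m\<omega> by (simp add: R_omega_simps)
next
  note D = VR.DM_D[OF \<phi>]
  fix a u assume a: "a \<in> carrier (R Quot \<mm>\<omega>)" and u: "u \<in> K.Kd"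
  obtain r where r: "r \<in> carrier R" "a = \<mm>\<omega> +> r" using Km_repr[OF a] by blast
  show "fiber_form \<phi> (S.vscale a u) = star ` a \<otimes>\<^bsub>R Quot \<mm>\<omega>\<^esub> fiber_form \<phi> u"
    unfolding fiber_form_def r(2) single_smult[OF u r(1)] D(3)[OF r(1) single_mem[OF u]] star_coset[OF m\<omega> r(1)]
    using m\<omega> by (simp add: R_omega_simps)
qed

text \<open>A functional of weight \<open>\<mm>\<omega>\<close> is fixed by \<open>e\<close>, so its
  values live in the component at \<open>\<mm>\<omega>\<close>; moving \<open>e\<close> to the
  argument as \<open>star e\<close> replaces \<open>v\<close> by its component there. That
  \<open>star e\<close> still lies in the other points is the reality of the orbit.\<close>

lemma dual_single_support:
  assumes \<phi>: "\<phi> \<in> carrier VR.DM" and wt: "\<And>r. r \<in> \<mm>\<omega> \<Longrightarrow> r \<odot>\<^bsub>VR.DM\<^esub> \<phi> = \<zero>\<^bsub>VR.DM\<^esub>"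
    and 0: "\<And>u. u \<in> K.Kd \<Longrightarrow> fiber_form \<phi> u = \<zero>\<^bsub>R Quot \<mm>\<omega>\<^esub>"
  shows "\<phi> = \<zero>\<^bsub>VR.DM\<^esub>"
proof (rule VR.DM_eqI)
  interpret O: module R R\<omega> by (rule module_R_omega)
  note D = VR.DM_D[OF \<phi>]
  obtain e where e: "e \<in> carrier R" "\<one> \<ominus> e \<in> \<mm>\<omega>" "\<And>\<nn>. \<nn> \<in> \<omega> \<Longrightarrow> \<nn> \<noteq> \<mm>\<omega> \<Longrightarrow> e \<in> \<nn>"
    by (rule orbit_idempotent) blast
  show "\<zero>\<^bsub>VR.DM\<^esub> \<in> carrier VR.DM" using VR.DM_closed[OF \<phi>] by simp
  fix v assume v: "v \<in> carrier VM"
  have "\<phi> v = e \<odot>\<^bsub>R\<omega>\<^esub> \<phi> v"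
  proof -
    have "(\<one> \<ominus> e) \<odot>\<^bsub>R\<omega>\<^esub> \<phi> v = \<zero>\<^bsub>R\<omega>\<^esub>"
      using VR.DM_ops(3)[OF v _ \<phi>, of "\<one> \<ominus> e"] VR.DM_ops(2)[OF v] wt[OF e(2)] e(1) by simp
    moreover have "\<phi> v = ((\<one> \<ominus> e) \<oplus> e) \<odot>\<^bsub>R\<omega>\<^esub> \<phi> v" using one_minus_add[OF e(1)] D(1)[OF v] by simp
    ultimately show ?thesis using O.smult_l_distr[of "\<one> \<ominus> e" e "\<phi> v"] e(1) D(1)[OF v] by simp
  qed
  also have "\<dots> = \<zero>\<^bsub>R\<omega>\<^esub>"
  proof (rule R_omega_eqI)
    fix \<mm> assume \<mm>: "\<mm> \<in> \<omega>"
    interpret F: field "Km \<mm>" using \<mm> by (rule Km_field)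
    show "(e \<odot>\<^bsub>R\<omega>\<^esub> \<phi> v) \<mm> = \<zero>\<^bsub>R\<omega>\<^esub> \<mm>"
    proof (cases "\<mm> = \<mm>\<omega>")
      case False
      then show ?thesis
        using \<mm> coset_zero[OF \<mm> e(3)[OF \<mm>]] R_omega_nth[OF D(1)[OF v] \<mm>] by (simp add: R_omega_simps)
    next
      case True
      have vm: "v \<mm>\<omega> \<in> K.Kd" using VM_nth[OF v m\<omega>] by (simp only: Wd_simps)
      have "star e \<odot>\<^bsub>VM\<^esub> v = star e \<odot>\<^bsub>VM\<^esub> single \<mm>\<omega> (v \<mm>\<omega>)"
      proof (rule VM_eqI)
        fix \<nn> assume \<nn>: "\<nn> \<in> \<omega>"
        show "(star e \<odot>\<^bsub>VM\<^esub> v) \<nn> = (star e \<odot>\<^bsub>VM\<^esub> single \<mm>\<omega> (v \<mm>\<omega>)) \<nn>"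
        proof (cases "\<nn> = \<mm>\<omega>")
          case True
          then show ?thesis using \<nn> by (simp add: smult_VM_nth single_nth)
        next
          case False
          have "star e \<in> star ` \<nn>" using e(3)[OF \<nn> False] by blast
          then have "star e \<in> \<nn>" using \<nn> by simp
          then show ?thesis
            using Wd_kill[OF \<nn>] VM_nth[OF v \<nn>] VM_nth[OF single_mem[OF vm] \<nn>] \<nn> by (simp add: smult_VM_nth)
        qed
      qed (use v e(1) single_mem[OF vm] in simp_all)
      then have "\<phi> (star e \<odot>\<^bsub>VM\<^esub> v) = \<phi> (star e \<odot>\<^bsub>VM\<^esub> single \<mm>\<omega> (v \<mm>\<omega>))" by simp
      then have "e \<odot>\<^bsub>R\<omega>\<^esub> \<phi> v = e \<odot>\<^bsub>R\<omega>\<^esub> \<phi> (single \<mm>\<omega> (v \<mm>\<omega>))"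
        using D(3)[OF star_closed[OF e(1)]] v single_mem[OF vm] e(1) by simp
      then show ?thesis
        using True \<mm> 0[OF vm] coset_closed[OF \<mm> e(1)] by (simp add: fiber_form_def R_omega_simps)
    qed
  qed (use e(1) D(1)[OF v] in simp_all)
  finally show "\<phi> v = \<zero>\<^bsub>VR.DM\<^esub> v" using VR.DM_ops(2)[OF v] by simp
qed fact

text \<open>\<open>f\<close> is applied to the component of the argument at
  \<open>\<mm>\<omega>\<close>, and the value is extended by zero to the rest of
  \<open>R_omega\<close>.\<close>

lemma fiber_form_exists:
  assumes f: "S.conj_functional f"
  shows "\<exists>\<phi>\<in>carrier VR.DM. (\<forall>r\<in>\<mm>\<omega>. r \<odot>\<^bsub>VR.DM\<^esub> \<phi> = \<zero>\<^bsub>VR.DM\<^esub>) \<and> (\<forall>u\<in>K.Kd. fiber_form \<phi> u = f u)"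
proof -
  note f = S.conj_functionalD[OF f]
  interpret O: module R R\<omega> by (rule module_R_omega)
  have zc: "\<zero>\<^bsub>Km \<mm>\<^esub> \<in> carrier (Km \<mm>)" if "\<mm> \<in> \<omega>" for \<mm>
    using R_omega_nth[OF O.M.zero_closed that] that by (simp add: R_omega_simps)
  define g where "g v = (\<lambda>\<mm>\<in>\<omega>. if \<mm> = \<mm>\<omega> then f (v \<mm>\<omega>) else \<zero>\<^bsub>Km \<mm>\<^esub>)" for v :: "'a set \<Rightarrow> nat \<Rightarrow> 'a set"
  have nth: "v \<mm>\<omega> \<in> K.Kd" if "v \<in> carrier VM" for v
    using VM_nth[OF that m\<omega>] by (simp only: Wd_simps)
  have gc: "g v \<in> carrier R\<omega>" if "v \<in> carrier VM" for v
    using f(1)[OF nth[OF that]] zc by (simp add: g_def R_omega_simps(1))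
  have mem: "(\<lambda>v\<in>carrier VM. g v) \<in> carrier VR.DM"
  proof (rule VR.DM_I)
    fix v w assume v: "v \<in> carrier VM" and w: "w \<in> carrier VM"
    have "(v \<oplus>\<^bsub>VM\<^esub> w) \<mm>\<omega> = S.vadd (v \<mm>\<omega>) (w \<mm>\<omega>)"
      using add_VM_nth[OF m\<omega>] by (simp add: S.vadd_def Wd_simps(3))
    then show "g (v \<oplus>\<^bsub>VM\<^esub> w) = g v \<oplus>\<^bsub>R\<omega>\<^esub> g w"
      using v w gc[of v] gc[of w] f(2)[OF nth[OF v] nth[OF w]]
        abelian_monoid.l_zero[OF abelian_group.axioms(1)[OF ring.is_abelian_group[OF cring.axioms(1)[OF field.axioms(1)[OF Km_field, THEN domain.axioms(1)]]]] zc]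
      by (intro R_omega_eqI) (simp_all add: gc, simp add: g_def R_omega_simps(3))
  next
    fix r v assume r: "r \<in> carrier R" and v: "v \<in> carrier VM"
    have "(r \<odot>\<^bsub>VM\<^esub> v) \<mm>\<omega> = S.vscale (\<mm>\<omega> +> r) (v \<mm>\<omega>)"
      using smult_VM_nth[OF m\<omega>] by (simp add: smult_eq_vscale)
    then have "f ((r \<odot>\<^bsub>VM\<^esub> v) \<mm>\<omega>) = (\<mm>\<omega> +> star r) \<otimes>\<^bsub>Km \<mm>\<omega>\<^esub> f (v \<mm>\<omega>)"
      using f(3)[OF coset_closed[OF m\<omega> r] nth[OF v]] star_coset[OF m\<omega> r] by simp
    moreover have "(\<mm> +> star r) \<otimes>\<^bsub>Km \<mm>\<^esub> \<zero>\<^bsub>Km \<mm>\<^esub> = \<zero>\<^bsub>Km \<mm>\<^esub>" if \<mm>: "\<mm> \<in> \<omega>" for \<mm>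
    proof -
      interpret F: field "Km \<mm>" using \<mm> by (rule Km_field)
      show ?thesis using coset_closed[OF \<mm>, of "star r"] r by simp
    qed
    ultimately show "g (r \<odot>\<^bsub>VM\<^esub> v) = star r \<odot>\<^bsub>R\<omega>\<^esub> g v"
      using r v gc by (intro R_omega_eqI) (simp_all, simp add: g_def R_omega_simps(4))
  qed (rule gc)
  have "r \<odot>\<^bsub>VR.DM\<^esub> (\<lambda>v\<in>carrier VM. g v) = \<zero>\<^bsub>VR.DM\<^esub>" if r: "r \<in> \<mm>\<omega>" for r
  proof (rule VR.DM_eqI)
    have rc: "r \<in> carrier R" using r orbit_subset[OF m\<omega>] by blast
    show "r \<odot>\<^bsub>VR.DM\<^esub> (\<lambda>v\<in>carrier VM. g v) \<in> carrier VR.DM" "\<zero>\<^bsub>VR.DM\<^esub> \<in> carrier VR.DM"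
      using VR.DM_closed[OF mem] rc by simp_all
    fix v assume v: "v \<in> carrier VM"
    have "r \<odot>\<^bsub>R\<omega>\<^esub> g v = \<zero>\<^bsub>R\<omega>\<^esub>"
    proof (rule R_omega_eqI)
      fix \<mm> assume \<mm>: "\<mm> \<in> \<omega>"
      interpret F: field "Km \<mm>" using \<mm> by (rule Km_field)
      show "(r \<odot>\<^bsub>R\<omega>\<^esub> g v) \<mm> = \<zero>\<^bsub>R\<omega>\<^esub> \<mm>"
        using \<mm> coset_zero[OF m\<omega> r] f(1)[OF nth[OF v]] coset_closed[OF \<mm> rc]
        by (cases "\<mm> = \<mm>\<omega>") (simp_all add: R_omega_simps g_def)
    qed (use rc gc[OF v] in simp_all)
    then show "(r \<odot>\<^bsub>VR.DM\<^esub> (\<lambda>v\<in>carrier VM. g v)) v = \<zero>\<^bsub>VR.DM\<^esub> v"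
      using VR.DM_ops(3)[OF v rc mem] VR.DM_ops(2)[OF v] v by simp
  qed
  moreover have "fiber_form (\<lambda>v\<in>carrier VM. g v) u = f u" if u: "u \<in> K.Kd" for u
    using single_mem[OF u] m\<omega> by (simp add: fiber_form_def g_def single_nth)
  ultimately show ?thesis using mem by blast
qed

definition kappa_sharp :: "(('a set \<Rightarrow> nat \<Rightarrow> 'a set) \<Rightarrow> 'a set \<Rightarrow> 'a set) \<Rightarrow> nat \<Rightarrow> 'a set" where
  "kappa_sharp \<phi> = S.sharp_coords (fiber_form \<phi>)"

abbreviation eta_sharp :: "(nat \<Rightarrow> 'a set) \<Rightarrow> nat \<Rightarrow> 'a set" where
  "eta_sharp \<equiv> gwa_V.eta R \<sigma> \<omega> \<mm>\<omega> d \<alpha>\<^sub>s"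

text \<open>\<open>wvec k\<close> is Y^p of \<open>zvec k\<close>, and the p-th power of Y on the
  dual puts X^p on the argument. So X^p Y^p appears: the scalar \<open>\<xi>0\<close>, which
  \<open>star\<close> fixes.\<close>

lemma fiber_form_DY:
  assumes \<phi>: "\<phi> \<in> carrier VR.DM" and k: "1 \<le> k" "k \<le> d"
  shows "fiber_form ((VR.DY ^^ p) \<phi>) (S.wvec k) =
    S.taui (xi R \<sigma> t \<omega> \<mm>\<omega> \<otimes>\<^bsub>R Quot \<mm>\<omega>\<^esub> fiber_form \<phi> (S.zvec k))"
proof -
  let ?z = "single \<mm>\<omega> (S.zvec k)"
  have z: "?z \<in> carrier VM" by (intro single_mem S.zvec_closed)
  have w: "single \<mm>\<omega> (S.wvec k) = (VY ^^ p) ?z"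
    unfolding VY_pow_single[OF S.zvec_closed] eta_eq[OF S.zvec_closed] S.companion_div_zvec[OF k] ..
  have xc: "xi R \<sigma> t \<omega> \<mm>\<omega> \<otimes>\<^bsub>R Quot \<mm>\<omega>\<^esub> fiber_form \<phi> (S.zvec k) \<in> carrier (R Quot \<mm>\<omega>)"
    using S.conj_functionalD(1)[OF fiber_form_conj[OF \<phi>] S.zvec_closed] S.xi_closed by (intro K.m_closed)
  have "fiber_form ((VR.DY ^^ p) \<phi>) (S.wvec k) = so (- int p) (\<phi> ((VX ^^ p) ((VY ^^ p) ?z))) \<mm>\<omega>"
    unfolding fiber_form_def w by (subst VR.DY_pow_nth[OF \<phi>]) (use z in simp_all)
  also have "\<dots> = sg (- int p) ` (\<phi> ((VX ^^ p) ((VY ^^ p) ?z)) \<mm>\<omega>)"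
    using so_nth[OF m\<omega>, of "- int p"] by simp
  also have "(VX ^^ p) ((VY ^^ p) ?z) = \<xi>0 \<odot>\<^bsub>VM\<^esub> ?z" by (rule VR.X_pow_Y_pow[OF z])
  also have "\<phi> (\<xi>0 \<odot>\<^bsub>VM\<^esub> ?z) = \<xi>0 \<odot>\<^bsub>R\<omega>\<^esub> \<phi> ?z"
    using VR.DM_D(3)[OF \<phi> xi0_closed z] by (simp only: star_xi0)
  also have "(\<xi>0 \<odot>\<^bsub>R\<omega>\<^esub> \<phi> ?z) \<mm>\<omega> = xi R \<sigma> t \<omega> \<mm>\<omega> \<otimes>\<^bsub>R Quot \<mm>\<omega>\<^esub> fiber_form \<phi> (S.zvec k)"
    using m\<omega> by (simp add: R_omega_simps(4) fiber_form_def xi_eq)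
  finally show ?thesis unfolding inv_tau[OF xc] .
qed

lemma sharp_coords_closed:
  assumes "S.conj_functional f" shows "S.sharp_coords f \<in> K.Kd"
  using S.conj_functionalD(1)[OF assms S.wvec_closed] by (auto simp: S.sharp_coords_def)

lemma gwa_orbit_model_dual:
  "gwa_orbit_model R \<sigma> t star \<omega> \<mm>\<omega> VR.DM VR.DX VR.DY (Wd d \<mm>\<omega>) kappa_sharp eta_sharp"
proof (intro gwa_orbit_model.intro gwa_orbit_model_axioms.intro)
  interpret V': gwa_V R \<sigma> t star \<omega> \<mm>\<omega> d \<alpha>\<^sub>s by (rule gwa_V_sharp)
  show "gwa_orbit_rep R \<sigma> t star \<omega> \<mm>\<omega> VR.DM VR.DX VR.DY" by (rule VR.gwa_orbit_rep_dual)
  show "module R (Wd d \<mm>\<omega>)" using m\<omega> by (rule module_Wd)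
  fix \<phi> assume \<phi>: "\<phi> \<in> carrier VR.DM"
  note conj = fiber_form_conj[OF \<phi>]
  note cl = S.conj_functionalD(1)[OF conj S.wvec_closed]
  show "kappa_sharp \<phi> \<in> carrier (Wd d \<mm>\<omega>)"
    unfolding kappa_sharp_def Wd_simps using sharp_coords_closed[OF conj] .
  show "kappa_sharp ((VR.DY ^^ p) \<phi>) = eta_sharp (kappa_sharp \<phi>)"
    unfolding kappa_sharp_def V'.eta_eq[OF sharp_coords_closed[OF conj]]
    by (rule S.sharp_coords_shift[OF conj fiber_form_DY[OF \<phi>]])
  show "kappa_sharp (\<phi> \<oplus>\<^bsub>VR.DM\<^esub> \<psi>) = kappa_sharp \<phi> \<oplus>\<^bsub>Wd d \<mm>\<omega>\<^esub> kappa_sharp \<psi>"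
    if \<psi>: "\<psi> \<in> carrier VR.DM" for \<psi>
  proof -
    have "fiber_form (\<phi> \<oplus>\<^bsub>VR.DM\<^esub> \<psi>) (S.wvec k) = fiber_form \<phi> (S.wvec k) \<oplus>\<^bsub>R Quot \<mm>\<omega>\<^esub> fiber_form \<psi> (S.wvec k)" for k
      unfolding fiber_form_def VR.DM_ops(1)[OF single_mem[OF S.wvec_closed]] using m\<omega> by (simp add: R_omega_simps(3))
    then show ?thesis
      using cl S.conj_functionalD(1)[OF fiber_form_conj[OF \<psi>] S.wvec_closed]
      by (auto simp: kappa_sharp_def S.sharp_coords_def Wd_simps(3) K.r_distr K.minus_add intro!: restrict_ext)
  qed
next
  fix r \<phi> assume r: "r \<in> carrier R" and \<phi>: "\<phi> \<in> carrier VR.DM"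
  note cl = S.conj_functionalD(1)[OF fiber_form_conj[OF \<phi>] S.wvec_closed]
  have "fiber_form (r \<odot>\<^bsub>VR.DM\<^esub> \<phi>) (S.wvec k) = (\<mm>\<omega> +> r) \<otimes>\<^bsub>R Quot \<mm>\<omega>\<^esub> fiber_form \<phi> (S.wvec k)" for k
    unfolding fiber_form_def VR.DM_ops(3)[OF single_mem[OF S.wvec_closed] r \<phi>] using m\<omega> by (simp add: R_omega_simps(4))
  then show "kappa_sharp (r \<odot>\<^bsub>VR.DM\<^esub> \<phi>) = r \<odot>\<^bsub>Wd d \<mm>\<omega>\<^esub> kappa_sharp \<phi>"
    using cl coset_closed[OF m\<omega> r]
    by (auto simp: kappa_sharp_def S.sharp_coords_def Wd_simps(4) K.r_minus K.m_lcomm intro!: restrict_ext)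
next
  fix \<phi> assume \<phi>: "\<phi> \<in> carrier VR.DM" and wt: "\<And>r. r \<in> \<mm>\<omega> \<Longrightarrow> r \<odot>\<^bsub>VR.DM\<^esub> \<phi> = \<zero>\<^bsub>VR.DM\<^esub>"
    and 0: "kappa_sharp \<phi> = \<zero>\<^bsub>Wd d \<mm>\<omega>\<^esub>"
  note conj = fiber_form_conj[OF \<phi>]
  have ker: "S.sharp_coords (fiber_form \<phi>) = (\<lambda>i\<in>{1..d}. \<zero>\<^bsub>R Quot \<mm>\<omega>\<^esub>)"
    using 0 unfolding kappa_sharp_def Wd_simps(2) .
  show "\<phi> = \<zero>\<^bsub>VR.DM\<^esub>"
    by (rule dual_single_support[OF \<phi> wt S.sharp_coords_ker[OF conj ker]])
next
  fix u assume "u \<in> carrier (Wd d \<mm>\<omega>)"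
  then have u: "u \<in> K.Kd" by (simp only: Wd_simps)
  have U: "S.tp k \<in> Units (R Quot \<mm>\<omega>)" for k using S.tp_closed S.tp_nonzero by (simp add: K.field_Units)
  \<comment> \<open>The values at \<open>wvec k\<close> that the scaling by minus
    \<open>tp k\<close> in \<open>sharp_coords\<close> turns into \<open>u k\<close>.\<close>
  define c where "c k = \<ominus>\<^bsub>R Quot \<mm>\<omega>\<^esub> (inv\<^bsub>R Quot \<mm>\<omega>\<^esub> (S.tp k) \<otimes>\<^bsub>R Quot \<mm>\<omega>\<^esub> u k)" for k
  have c: "c k \<in> carrier (R Quot \<mm>\<omega>)" if "1 \<le> k" "k \<le> d" for k
    using K.Kd_nth[OF u that] U by (simp add: c_def)
  obtain f where f: "S.conj_functional f" "\<forall>k\<in>{1..d}. f (S.wvec k) = c k"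
    using S.conj_functional_exists[of c] c by blast
  obtain \<phi> where \<phi>: "\<phi> \<in> carrier VR.DM" "\<forall>r\<in>\<mm>\<omega>. r \<odot>\<^bsub>VR.DM\<^esub> \<phi> = \<zero>\<^bsub>VR.DM\<^esub>" "\<forall>u\<in>K.Kd. fiber_form \<phi> u = f u"
    using fiber_form_exists[OF f(1)] by blast
  have "kappa_sharp \<phi> = u"
    unfolding kappa_sharp_def
  proof (rule K.Kd_eqI[OF sharp_coords_closed[OF fiber_form_conj[OF \<phi>(1)]] u])
    fix k assume k: "1 \<le> k" "k \<le> d"
    have "S.sharp_coords (fiber_form \<phi>) k = \<ominus>\<^bsub>R Quot \<mm>\<omega>\<^esub> (S.tp k \<otimes>\<^bsub>R Quot \<mm>\<omega>\<^esub> c k)"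
      using k f(2) \<phi>(3) S.wvec_closed by (simp add: S.sharp_coords_def)
    also have "\<dots> = u k"
      using K.Kd_nth[OF u k] U by (simp add: c_def K.r_minus K.m_assoc[symmetric])
    finally show "S.sharp_coords (fiber_form \<phi>) k = u k" .
  qed
  then show "\<exists>\<phi>\<in>carrier VR.DM. (\<forall>r\<in>\<mm>\<omega>. r \<odot>\<^bsub>VR.DM\<^esub> \<phi> = \<zero>\<^bsub>VR.DM\<^esub>) \<and> kappa_sharp \<phi> = u"
    using \<phi> by blast
qed

lemma V_omega_eq: "V_omega R \<sigma> t \<omega> \<mm>\<omega> d \<alpha> = VR.VV" by (simp add: V_omega_def)

text \<open>Both modules are models with fibre K^d and the inverse companion map of the sharp
  coefficients, and this pair determines a model.\<close>

theorem dual_isomorphic: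
  "module_isomorphic (gwa R \<sigma> t) (finitistic_dual R star \<sigma> t \<omega> VR.VV) (V_omega R \<sigma> t \<omega> \<mm>\<omega> d \<alpha>\<^sub>s)"
proof -
  interpret V': gwa_V R \<sigma> t star \<omega> \<mm>\<omega> d \<alpha>\<^sub>s by (rule gwa_V_sharp)
  obtain h where "bij_betw h (carrier VR.DM) (carrier V'.VM)"
    "\<And>v w. \<lbrakk>v \<in> carrier VR.DM; w \<in> carrier VR.DM\<rbrakk> \<Longrightarrow> h (v \<oplus>\<^bsub>VR.DM\<^esub> w) = h v \<oplus>\<^bsub>V'.VM\<^esub> h w"
    "\<And>r v. \<lbrakk>r \<in> carrier R; v \<in> carrier VR.DM\<rbrakk> \<Longrightarrow> h (r \<odot>\<^bsub>VR.DM\<^esub> v) = r \<odot>\<^bsub>V'.VM\<^esub> h v"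
    "\<And>v. v \<in> carrier VR.DM \<Longrightarrow> h (VR.DX v) = V'.VX (h v)" "\<And>v. v \<in> carrier VR.DM \<Longrightarrow> h (VR.DY v) = V'.VY (h v)"
    using gwa_orbit_model_isomorphic[OF gwa_orbit_model_dual V'.gwa_orbit_model_V] by blast
  then show ?thesis
    unfolding VR.finitistic_dual_eq V'.V_omega_eq
    by (rule module_isomorphic_gwa_moduleI[OF VR.gwa_rep_dual V'.gwa_rep_V])
qed

end

section \<open>Skew Laurent polynomials\<close>

locale skew_laurent_field = field K for K (structure) +
  fixes \<tau> :: "'a \<Rightarrow> 'a"
  assumes tau_iso: "\<tau> \<in> ring_iso K K"
begin

abbreviation P :: "(int \<Rightarrow> 'a) ring" where "P \<equiv> skew_laurent K \<tau>"
abbreviation z :: "int \<Rightarrow> 'a \<Rightarrow> 'a" where "z \<equiv> zpow (carrier K) \<tau>"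

sublocale z: ring_hom_cring K K "z n" for n
  using ring_iso_zpow[OF ring_axioms tau_iso, of n] is_cring
  by (simp add: ring_iso_def ring_hom_cring_def ring_hom_cring_axioms_def)

lemma z_add: "a \<in> carrier K \<Longrightarrow> z (m + n) a = z m (z n a)"
  using tau_iso by (intro zpow_add) (simp_all add: ring_iso_def)

definition supp :: "(int \<Rightarrow> 'a) \<Rightarrow> int set" where "supp f = {n. f n \<noteq> \<zero>}"

definition monom :: "'a \<Rightarrow> int \<Rightarrow> int \<Rightarrow> 'a" where "monom a k = (\<lambda>n. if n = k then a else \<zero>)"

lemma P_carrier: "f \<in> carrier P \<longleftrightarrow> (\<forall>n. f n \<in> carrier K) \<and> finite (supp f)"
  by (simp add: skew_laurent_def supp_def)

lemma P_nth [simp]: "f \<in> carrier P \<Longrightarrow> f n \<in> carrier K"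
  and P_supp [simp]: "f \<in> carrier P \<Longrightarrow> finite (supp f)"
  by (simp_all add: P_carrier)

lemma P_ops: "\<zero>\<^bsub>P\<^esub> = (\<lambda>n. \<zero>)" "\<one>\<^bsub>P\<^esub> = monom \<one> 0" "f \<oplus>\<^bsub>P\<^esub> g = (\<lambda>n. f n \<oplus> g n)"
  by (simp_all only: skew_laurent_def monom_def monoid.simps ring.simps)

text \<open>The product sums over the support of the left factor. Allowing any finite superset lets
  sums for different factors share one index set.\<close>

lemma P_mult:
  assumes f: "f \<in> carrier P" and g: "g \<in> carrier P" and A: "finite A" "supp f \<subseteq> A"
  shows "(f \<otimes>\<^bsub>P\<^esub> g) n = (\<Oplus>i\<in>A. f i \<otimes> z i (g (n - i)))"
proof -
  have "(\<Oplus>i\<in>supp f. f i \<otimes> z i (g (n - i))) = (\<Oplus>i\<in>A. f i \<otimes> z i (g (n - i)))"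
    using f g A by (intro add.finprod_mono_neutral_cong_left) (auto simp: supp_def)
  then show ?thesis by (simp only: skew_laurent_def supp_def monoid.simps)
qed

lemma monom_closed [simp]: "a \<in> carrier K \<Longrightarrow> monom a k \<in> carrier P"
proof -
  assume "a \<in> carrier K"
  moreover have "supp (monom a k) \<subseteq> {k}" by (auto simp: supp_def monom_def)
  ultimately show ?thesis using finite_subset[of _ "{k}"] by (auto simp: P_carrier monom_def)
qed

lemma monom_mult:
  assumes a: "a \<in> carrier K" and g: "g \<in> carrier P"
  shows "(monom a k \<otimes>\<^bsub>P\<^esub> g) n = a \<otimes> z k (g (n - k))"
proof -
  have "supp (monom a k) \<subseteq> {k}" by (auto simp: supp_def monom_def)
  then show ?thesis using P_mult[OF monom_closed[OF a] g, of "{k}"] a g by (simp add: monom_def)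
qed

lemma P_zero_closed: "\<zero>\<^bsub>P\<^esub> \<in> carrier P" unfolding P_carrier P_ops by (simp add: supp_def)

lemma P_add_closed: "f \<in> carrier P \<Longrightarrow> g \<in> carrier P \<Longrightarrow> f \<oplus>\<^bsub>P\<^esub> g \<in> carrier P"
proof -
  assume f: "f \<in> carrier P" and g: "g \<in> carrier P"
  have "supp (\<lambda>n. f n \<oplus> g n) \<subseteq> supp f \<union> supp g" by (auto simp: supp_def)
  then have "finite (supp (\<lambda>n. f n \<oplus> g n))" by (rule finite_subset) (simp add: f g)
  then show ?thesis using f g unfolding P_carrier P_ops by simp
qed

lemma P_mult_closed:
  assumes f: "f \<in> carrier P" and g: "g \<in> carrier P" shows "f \<otimes>\<^bsub>P\<^esub> g \<in> carrier P"
proof -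
  note eq = P_mult[OF f g P_supp[OF f] order_refl]
  have "supp (f \<otimes>\<^bsub>P\<^esub> g) \<subseteq> (\<lambda>(i, j). i + j) ` (supp f \<times> supp g)"
  proof
    fix n assume n: "n \<in> supp (f \<otimes>\<^bsub>P\<^esub> g)"
    have "\<exists>i\<in>supp f. n - i \<in> supp g"
    proof (rule ccontr)
      assume "\<not> (\<exists>i\<in>supp f. n - i \<in> supp g)"
      then have "(\<Oplus>i\<in>supp f. f i \<otimes> z i (g (n - i))) = (\<Oplus>i\<in>supp f. \<zero>)"
        using f by (intro finsum_cong') (auto simp: supp_def)
      then show False using n eq by (simp add: supp_def)
    qed
    then show "n \<in> (\<lambda>(i, j). i + j) ` (supp f \<times> supp g)" by force
  qed
  then have "finite (supp (f \<otimes>\<^bsub>P\<^esub> g))" using f g by (meson P_supp finite_SigmaI finite_imageI finite_subset)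
  then show ?thesis using f g by (auto simp: P_carrier[of "f \<otimes>\<^bsub>P\<^esub> g"] eq)
qed

text \<open>Induction on the support, taking off one monomial at a time. Statements additive in the
  left factor then only concern monomials, whose products involve no sum.\<close>

lemma P_induct [consumes 1, case_names zero monom]:
  assumes f: "f \<in> carrier P" and "Q \<zero>\<^bsub>P\<^esub>"
    and step: "\<And>a k f. a \<in> carrier K \<Longrightarrow> f \<in> carrier P \<Longrightarrow> Q f \<Longrightarrow> Q (monom a k \<oplus>\<^bsub>P\<^esub> f)"
  shows "Q f"
proof -
  have "Q f" if "finite A" "f \<in> carrier P" "supp f = A" for A f
    using that
  proof (induction A arbitrary: f rule: finite_induct)
    case empty
    then have "f = \<zero>\<^bsub>P\<^esub>" by (auto simp: supp_def P_ops)
    then show ?case using assms(2) by simp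
  next
    case (insert k A)
    have s: "supp (f(k := \<zero>)) = A" using insert.hyps insert.prems by (auto simp: supp_def)
    have g: "f(k := \<zero>) \<in> carrier P" using insert.prems(1) s insert.hyps unfolding P_carrier by simp
    have "f = monom (f k) k \<oplus>\<^bsub>P\<^esub> f(k := \<zero>)"
      using insert.prems(1) by (auto simp: P_ops monom_def fun_eq_iff)
    then show ?case using step[OF P_nth[OF insert.prems(1)] g insert.IH[OF g s]] by metis
  qed
  from this[OF P_supp[OF f] f HOL.refl] show ?thesis .
qed

lemma P_l_distr:
  assumes f: "f \<in> carrier P" and g: "g \<in> carrier P" and h: "h \<in> carrier P"
  shows "(f \<oplus>\<^bsub>P\<^esub> g) \<otimes>\<^bsub>P\<^esub> h = f \<otimes>\<^bsub>P\<^esub> h \<oplus>\<^bsub>P\<^esub> g \<otimes>\<^bsub>P\<^esub> h"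
proof
  fix n
  let ?A = "supp f \<union> supp g"
  have A: "finite ?A" "supp f \<subseteq> ?A" "supp g \<subseteq> ?A" using f g by auto
  have s: "supp (f \<oplus>\<^bsub>P\<^esub> g) \<subseteq> ?A" by (auto simp: supp_def P_ops)
  have "((f \<oplus>\<^bsub>P\<^esub> g) \<otimes>\<^bsub>P\<^esub> h) n = (\<Oplus>i\<in>?A. f i \<otimes> z i (h (n - i)) \<oplus> g i \<otimes> z i (h (n - i)))"
    unfolding P_mult[OF P_add_closed[OF f g] h A(1) s]
    using f g h by (intro finsum_cong') (auto simp: P_ops l_distr)
  also have "\<dots> = (\<Oplus>i\<in>?A. f i \<otimes> z i (h (n - i))) \<oplus> (\<Oplus>i\<in>?A. g i \<otimes> z i (h (n - i)))"
    using f g h by (intro finsum_addf) auto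
  also have "\<dots> = (f \<otimes>\<^bsub>P\<^esub> h \<oplus>\<^bsub>P\<^esub> g \<otimes>\<^bsub>P\<^esub> h) n"
    by (simp only: P_mult[OF f h A(1,2)] P_mult[OF g h A(1,3)] P_ops(3))
  finally show "((f \<oplus>\<^bsub>P\<^esub> g) \<otimes>\<^bsub>P\<^esub> h) n = (f \<otimes>\<^bsub>P\<^esub> h \<oplus>\<^bsub>P\<^esub> g \<otimes>\<^bsub>P\<^esub> h) n" .
qed

lemma P_r_distr:
  assumes f: "f \<in> carrier P" and g: "g \<in> carrier P" and h: "h \<in> carrier P"
  shows "h \<otimes>\<^bsub>P\<^esub> (f \<oplus>\<^bsub>P\<^esub> g) = h \<otimes>\<^bsub>P\<^esub> f \<oplus>\<^bsub>P\<^esub> h \<otimes>\<^bsub>P\<^esub> g"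
proof
  fix n
  note eq = P_mult[OF h _ P_supp[OF h] order_refl]
  have "(h \<otimes>\<^bsub>P\<^esub> (f \<oplus>\<^bsub>P\<^esub> g)) n = (\<Oplus>i\<in>supp h. h i \<otimes> z i (f (n - i)) \<oplus> h i \<otimes> z i (g (n - i)))"
    unfolding eq[OF P_add_closed[OF f g]]
    using f g h by (intro finsum_cong') (auto simp: P_ops r_distr)
  also have "\<dots> = (\<Oplus>i\<in>supp h. h i \<otimes> z i (f (n - i))) \<oplus> (\<Oplus>i\<in>supp h. h i \<otimes> z i (g (n - i)))"
    using f g h by (intro finsum_addf) auto
  also have "\<dots> = (h \<otimes>\<^bsub>P\<^esub> f \<oplus>\<^bsub>P\<^esub> h \<otimes>\<^bsub>P\<^esub> g) n"
    by (simp only: eq[OF f] eq[OF g] P_ops(3))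
  finally show "(h \<otimes>\<^bsub>P\<^esub> (f \<oplus>\<^bsub>P\<^esub> g)) n = (h \<otimes>\<^bsub>P\<^esub> f \<oplus>\<^bsub>P\<^esub> h \<otimes>\<^bsub>P\<^esub> g) n" .
qed

lemma P_zero_mult: "h \<in> carrier P \<Longrightarrow> \<zero>\<^bsub>P\<^esub> \<otimes>\<^bsub>P\<^esub> h = \<zero>\<^bsub>P\<^esub>"
  using P_mult[OF P_zero_closed, of h "{}"] by (auto simp: supp_def P_ops fun_eq_iff)

text \<open>The left sum is reindexed by \<open>k\<close>, the twist by \<open>i + k\<close> is
  split into twists by \<open>i\<close> and by \<open>k\<close>, and \<open>z k\<close> is pulled
  out of the sum as a ring homomorphism.\<close>

lemma monom_mult_assoc:
  assumes a: "a \<in> carrier K" and g: "g \<in> carrier P" and h: "h \<in> carrier P"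
  shows "(monom a k \<otimes>\<^bsub>P\<^esub> g) \<otimes>\<^bsub>P\<^esub> h = monom a k \<otimes>\<^bsub>P\<^esub> (g \<otimes>\<^bsub>P\<^esub> h)"
proof
  fix n
  let ?A = "(\<lambda>i. i + k) ` supp g"
  have A: "finite ?A" using g by simp
  have s: "supp (monom a k \<otimes>\<^bsub>P\<^esub> g) \<subseteq> ?A"
  proof
    fix i assume "i \<in> supp (monom a k \<otimes>\<^bsub>P\<^esub> g)"
    then have "i - k \<in> supp g" using a g by (auto simp: supp_def monom_mult)
    then show "i \<in> ?A" by (intro image_eqI[of _ _ "i - k"]) auto
  qed
  have "((monom a k \<otimes>\<^bsub>P\<^esub> g) \<otimes>\<^bsub>P\<^esub> h) n = (\<Oplus>i\<in>?A. (monom a k \<otimes>\<^bsub>P\<^esub> g) i \<otimes> z i (h (n - i)))"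
    by (rule P_mult[OF P_mult_closed[OF monom_closed[OF a] g] h A s])
  also have "\<dots> = (\<Oplus>i\<in>supp g. (monom a k \<otimes>\<^bsub>P\<^esub> g) (i + k) \<otimes> z (i + k) (h (n - (i + k))))"
    using a g h P_nth[OF P_mult_closed[OF monom_closed[OF a] g]] by (intro add.finprod_reindex) (auto simp: inj_on_def)
  also have "\<dots> = (\<Oplus>i\<in>supp g. a \<otimes> z k (g i \<otimes> z i (h (n - k - i))))"
  proof (rule finsum_cong')
    fix i
    have "z (i + k) (h (n - (i + k))) = z k (z i (h (n - k - i)))"
      using z_add[of "h (n - k - i)" k i] h by (simp add: algebra_simps)
    then show "(monom a k \<otimes>\<^bsub>P\<^esub> g) (i + k) \<otimes> z (i + k) (h (n - (i + k))) = a \<otimes> z k (g i \<otimes> z i (h (n - k - i)))"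
      using a g h by (simp add: monom_mult m_assoc)
  qed (use a g h in auto)
  also have "\<dots> = a \<otimes> z k (\<Oplus>i\<in>supp g. g i \<otimes> z i (h (n - k - i)))"
  proof -
    have f: "(\<lambda>i. g i \<otimes> z i (h (n - k - i))) \<in> supp g \<rightarrow> carrier K" using g h by auto
    show ?thesis
      using z.hom_finsum[OF f, of k] f a g
      by (simp add: comp_def finsum_rdistr[of "supp g"] Pi_iff)
  qed
  also have "\<dots> = (monom a k \<otimes>\<^bsub>P\<^esub> (g \<otimes>\<^bsub>P\<^esub> h)) n"
    by (simp only: monom_mult[OF a P_mult_closed[OF g h]] P_mult[OF g h P_supp[OF g] order_refl])
  finally show "((monom a k \<otimes>\<^bsub>P\<^esub> g) \<otimes>\<^bsub>P\<^esub> h) n = (monom a k \<otimes>\<^bsub>P\<^esub> (g \<otimes>\<^bsub>P\<^esub> h)) n" .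
qed

lemma P_mult_assoc:
  assumes f: "f \<in> carrier P" and g: "g \<in> carrier P" and h: "h \<in> carrier P"
  shows "(f \<otimes>\<^bsub>P\<^esub> g) \<otimes>\<^bsub>P\<^esub> h = f \<otimes>\<^bsub>P\<^esub> (g \<otimes>\<^bsub>P\<^esub> h)"
  using f
proof (induction f rule: P_induct)
  case zero
  then show ?case using g h by (simp add: P_zero_mult P_mult_closed)
next
  case (monom a k f)
  then show ?case using g h
    by (simp add: P_l_distr P_mult_closed monom_mult_assoc)
qed

lemma P_one_mult: "g \<in> carrier P \<Longrightarrow> \<one>\<^bsub>P\<^esub> \<otimes>\<^bsub>P\<^esub> g = g"
  by (auto simp: P_ops monom_mult fun_eq_iff)

lemma P_mult_one:
  assumes f: "f \<in> carrier P" shows "f \<otimes>\<^bsub>P\<^esub> \<one>\<^bsub>P\<^esub> = f"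
  using f
proof (induction f rule: P_induct)
  case zero
  then show ?case unfolding P_ops(2) by (simp add: P_zero_mult)
next
  case (monom a k f)
  have "monom a k \<otimes>\<^bsub>P\<^esub> \<one>\<^bsub>P\<^esub> = monom a k"
    using monom(1) by (auto simp: P_ops monom_mult fun_eq_iff) (auto simp: monom_def)
  then show ?case using monom P_ops(2) by (simp add: P_l_distr)
qed

lemma ring_P: "ring P"
proof (rule ringI)
  show "abelian_group P"
  proof (rule abelian_groupI)
    fix f assume f: "f \<in> carrier P"
    have "supp (\<lambda>n. \<ominus> f n) = supp f" using f by (auto simp: supp_def)
    then have "(\<lambda>n. \<ominus> f n) \<in> carrier P" using f unfolding P_carrier by simp
    moreover have "(\<lambda>n. \<ominus> f n) \<oplus>\<^bsub>P\<^esub> f = \<zero>\<^bsub>P\<^esub>" using f by (simp add: P_ops l_neg)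
    ultimately show "\<exists>g\<in>carrier P. g \<oplus>\<^bsub>P\<^esub> f = \<zero>\<^bsub>P\<^esub>" by blast
    show "\<zero>\<^bsub>P\<^esub> \<oplus>\<^bsub>P\<^esub> f = f" using f by (simp add: P_ops)
    fix g assume g: "g \<in> carrier P"
    show "f \<oplus>\<^bsub>P\<^esub> g = g \<oplus>\<^bsub>P\<^esub> f" using f g by (auto simp: P_ops fun_eq_iff a_comm)
    fix h assume h: "h \<in> carrier P"
    show "f \<oplus>\<^bsub>P\<^esub> g \<oplus>\<^bsub>P\<^esub> h = f \<oplus>\<^bsub>P\<^esub> (g \<oplus>\<^bsub>P\<^esub> h)" using f g h by (simp add: P_ops a_assoc)
  qed (simp_all add: P_add_closed P_zero_closed)
  show "monoid P"
    by (rule monoidI) (simp_all add: P_mult_closed P_mult_assoc P_one_mult P_mult_one, simp add: P_ops)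
qed (simp_all add: P_l_distr P_r_distr)

end

section \<open>Quotients by a principal left ideal\<close>

context ring
begin

text \<open>The left ideal P f is in general not two-sided, so the quotient is built from an
  additive subgroup, with \<open>PIdl_l_closed\<close> for the scalars.\<close>

lemma PIdl_additive_subgroup:
  assumes f: "f \<in> carrier R" shows "additive_subgroup (PIdl f) R"
proof (rule additive_subgroup.intro, rule group.subgroupI)
  show "group (add_monoid R)" by (rule a_group)
  show "PIdl f \<subseteq> carrier (add_monoid R)" using f by (auto simp: cgenideal_def)
  show "PIdl f \<noteq> {}" by (auto simp: cgenideal_def)
  fix a assume a: "a \<in> PIdl f"
  then obtain x where x: "x \<in> carrier R" "a = x \<otimes> f" by (auto simp: cgenideal_def)
  have "\<ominus> a = (\<ominus> x) \<otimes> f" using x f by (simp add: l_minus)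
  then show "inv\<^bsub>add_monoid R\<^esub> a \<in> PIdl f" using x(1) unfolding a_inv_def[symmetric] cgenideal_def by blast
  fix b assume "b \<in> PIdl f"
  then obtain y where y: "y \<in> carrier R" "b = y \<otimes> f" by (auto simp: cgenideal_def)
  have "a \<oplus> b = (x \<oplus> y) \<otimes> f" using x y f by (simp add: l_distr)
  then show "a \<otimes>\<^bsub>add_monoid R\<^esub> b \<in> PIdl f" using x(1) y(1) unfolding cgenideal_def by auto
qed

lemma PIdl_l_closed: "\<lbrakk>f \<in> carrier R; a \<in> carrier R; x \<in> PIdl f\<rbrakk> \<Longrightarrow> a \<otimes> x \<in> PIdl f"
  unfolding cgenideal_def by (auto simp flip: m_assoc)

lemma quotient_module_ops:
  assumes f: "f \<in> carrier R"
  shows "carrier (quotient_module R (PIdl f)) = (\<lambda>x. PIdl f +> x) ` carrier R"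
    and "\<lbrakk>x \<in> carrier R; y \<in> carrier R\<rbrakk> \<Longrightarrow>
      (PIdl f +> x) \<oplus>\<^bsub>quotient_module R (PIdl f)\<^esub> (PIdl f +> y) = PIdl f +> (x \<oplus> y)"
    and "\<lbrakk>a \<in> carrier R; x \<in> carrier R\<rbrakk> \<Longrightarrow>
      a \<odot>\<^bsub>quotient_module R (PIdl f)\<^esub> (PIdl f +> x) = PIdl f +> (a \<otimes> x)"
    and "\<lbrakk>x \<in> carrier R; y \<in> carrier R\<rbrakk> \<Longrightarrow> PIdl f +> x = PIdl f +> y \<longleftrightarrow> x \<ominus> y \<in> PIdl f"
    and "\<zero>\<^bsub>quotient_module R (PIdl f)\<^esub> = PIdl f +> \<zero>"
proof -
  interpret I: additive_subgroup "PIdl f" R using f by (rule PIdl_additive_subgroup)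
  interpret I: abelian_subgroup "PIdl f" R
    using I.additive_subgroup_axioms is_abelian_group by (rule abelian_subgroupI3)
  show "carrier (quotient_module R (PIdl f)) = (\<lambda>x. PIdl f +> x) ` carrier R"
    by (auto simp: quotient_module_def A_RCOSETS_def')
  show "(PIdl f +> x) \<oplus>\<^bsub>quotient_module R (PIdl f)\<^esub> (PIdl f +> y) = PIdl f +> (x \<oplus> y)"
    if "x \<in> carrier R" "y \<in> carrier R"
    using I.a_rcos_sum[OF that] by (simp add: quotient_module_def)
  show eq: "PIdl f +> x = PIdl f +> y \<longleftrightarrow> x \<ominus> y \<in> PIdl f" if xy: "x \<in> carrier R" "y \<in> carrier R" for x y
  proof
    assume "PIdl f +> x = PIdl f +> y"
    then have "x \<in> PIdl f +> y" using I.a_rcos_self[OF xy(1)] by simp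
    then show "x \<ominus> y \<in> PIdl f" using I.a_rcos_module_minus[OF ring_axioms xy(2,1)] by blast
  next
    assume "x \<ominus> y \<in> PIdl f"
    then have "x \<in> PIdl f +> y" using I.a_rcos_module_minus[OF ring_axioms xy(2,1)] by blast
    then show "PIdl f +> x = PIdl f +> y" using I.a_repr_independence'[OF _ xy(2)] by metis
  qed
  show "a \<odot>\<^bsub>quotient_module R (PIdl f)\<^esub> (PIdl f +> x) = PIdl f +> (a \<otimes> x)"
    if a: "a \<in> carrier R" and x: "x \<in> carrier R"
  proof -
    \<comment> \<open>All members of the union defining the scalar action coincide, since
      \<open>a\<close> times the difference of two representatives stays in the left ideal.\<close>
    have c: "PIdl f +> (a \<otimes> c) = PIdl f +> (a \<otimes> x)" if c: "c \<in> PIdl f +> x" for c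
    proof -
      have cc: "c \<in> carrier R" using c x a_r_coset_subset_G[OF I.a_subset x] by blast
      have "a \<otimes> (c \<ominus> x) \<in> PIdl f"
        using PIdl_l_closed[OF f a] c I.a_rcos_module_minus[OF ring_axioms x cc] by blast
      then have "a \<otimes> c \<ominus> a \<otimes> x \<in> PIdl f" using a cc x by (simp add: a_minus_def r_distr r_minus)
      then show ?thesis using eq a cc x by simp
    qed
    have "x \<in> PIdl f +> x" using I.a_rcos_self[OF x] .
    then have "(\<Union>c\<in>PIdl f +> x. PIdl f +> (a \<otimes> c)) = PIdl f +> (a \<otimes> x)" using c by blast
    then show ?thesis by (simp add: quotient_module_def)
  qed
  show "\<zero>\<^bsub>quotient_module R (PIdl f)\<^esub> = PIdl f +> \<zero>"
    using a_coset_add_zero[OF I.a_subset] by (simp add: quotient_module_def)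
qed

lemma left_module_quotient_module:
  assumes f: "f \<in> carrier R" shows "left_module R (quotient_module R (PIdl f))"
proof (intro left_module.intro left_module_axioms.intro)
  note ops = quotient_module_ops[OF f]
  let ?Q = "quotient_module R (PIdl f)"
  have repr: "\<exists>x\<in>carrier R. u = PIdl f +> x" if "u \<in> carrier ?Q" for u using that ops(1) by blast
  have mem: "PIdl f +> x \<in> carrier ?Q" if "x \<in> carrier R" for x using that ops(1) by blast
  show "ring R" by (rule ring_axioms)
  show "abelian_group ?Q"
  proof (rule abelian_groupI)
    show "\<zero>\<^bsub>?Q\<^esub> \<in> carrier ?Q" unfolding ops(5) by (rule mem) simp
    fix u assume "u \<in> carrier ?Q"
    then obtain x where x: "x \<in> carrier R" "u = PIdl f +> x" using repr by blast
    show "\<zero>\<^bsub>?Q\<^esub> \<oplus>\<^bsub>?Q\<^esub> u = u" unfolding ops(5) using x by (simp add: ops(2))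
    have "(PIdl f +> (\<ominus> x)) \<oplus>\<^bsub>?Q\<^esub> u = \<zero>\<^bsub>?Q\<^esub>" unfolding ops(5) using x by (simp add: ops(2) l_neg)
    then show "\<exists>v\<in>carrier ?Q. v \<oplus>\<^bsub>?Q\<^esub> u = \<zero>\<^bsub>?Q\<^esub>" using mem[of "\<ominus> x"] x by blast
    fix v assume "v \<in> carrier ?Q"
    then obtain y where y: "y \<in> carrier R" "v = PIdl f +> y" using repr by blast
    show "u \<oplus>\<^bsub>?Q\<^esub> v \<in> carrier ?Q" using x y mem by (simp add: ops(2))
    show "u \<oplus>\<^bsub>?Q\<^esub> v = v \<oplus>\<^bsub>?Q\<^esub> u" using x y by (simp add: ops(2) a_comm)
    fix w assume "w \<in> carrier ?Q"
    then obtain y' where "y' \<in> carrier R" "w = PIdl f +> y'" using repr by blast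
    then show "u \<oplus>\<^bsub>?Q\<^esub> v \<oplus>\<^bsub>?Q\<^esub> w = u \<oplus>\<^bsub>?Q\<^esub> (v \<oplus>\<^bsub>?Q\<^esub> w)" using x y by (simp add: ops(2) a_assoc)
  qed
  fix u assume "u \<in> carrier ?Q"
  then obtain x where x: "x \<in> carrier R" "u = PIdl f +> x" using repr by blast
  show "\<one> \<odot>\<^bsub>?Q\<^esub> u = u" using x by (simp add: ops(3))
  fix a assume a: "a \<in> carrier R"
  show "a \<odot>\<^bsub>?Q\<^esub> u \<in> carrier ?Q" using a x mem by (simp add: ops(3))
  show "a \<odot>\<^bsub>?Q\<^esub> (u \<oplus>\<^bsub>?Q\<^esub> v) = a \<odot>\<^bsub>?Q\<^esub> u \<oplus>\<^bsub>?Q\<^esub> a \<odot>\<^bsub>?Q\<^esub> v" if v: "v \<in> carrier ?Q" for v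
  proof -
    obtain y where "y \<in> carrier R" "v = PIdl f +> y" using repr[OF v] by blast
    then show ?thesis using a x by (simp add: ops(2,3) r_distr)
  qed
  fix b assume b: "b \<in> carrier R"
  show "(a \<oplus> b) \<odot>\<^bsub>?Q\<^esub> u = a \<odot>\<^bsub>?Q\<^esub> u \<oplus>\<^bsub>?Q\<^esub> b \<odot>\<^bsub>?Q\<^esub> u" using a b x by (simp add: ops(2,3) l_distr)
  show "(a \<otimes> b) \<odot>\<^bsub>?Q\<^esub> u = a \<odot>\<^bsub>?Q\<^esub> (b \<odot>\<^bsub>?Q\<^esub> u)" using a b x by (simp add: ops(3) m_assoc)
qed

end

context skew_laurent_field
begin

sublocale PR: ring P by (rule ring_P)

lemma P_minus_nth:
  assumes "f \<in> carrier P" "g \<in> carrier P" shows "(f \<ominus>\<^bsub>P\<^esub> g) n = f n \<ominus> g n"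
proof -
  have cl: "(\<lambda>n. \<ominus> g n) \<in> carrier P"
  proof -
    have "supp (\<lambda>n. \<ominus> g n) = supp g" using assms(2) by (auto simp: supp_def)
    then show ?thesis using assms(2) unfolding P_carrier by simp
  qed
  have "(\<lambda>n. \<ominus> g n) \<oplus>\<^bsub>P\<^esub> g = \<zero>\<^bsub>P\<^esub>" using assms(2) by (simp add: P_ops(1,3) l_neg)
  then have "\<ominus>\<^bsub>P\<^esub> g = (\<lambda>n. \<ominus> g n)" by (rule PR.minus_equality[OF _ assms(2) cl])
  then show ?thesis by (simp add: a_minus_def P_ops(3))
qed

lemma monom_monom:
  "\<lbrakk>a \<in> carrier K; b \<in> carrier K\<rbrakk> \<Longrightarrow> monom a k \<otimes>\<^bsub>P\<^esub> monom b l = monom (a \<otimes> z k b) (k + l)"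
  by (rule ext) (simp add: monom_mult, auto simp: monom_def)

text \<open>The ring is generated by the constants, x^-1 and x. A map commuting with x^-1 also
  commutes with x, because x^-1 acts invertibly on both modules.\<close>

lemma P_linear_extension:
  assumes "left_module P M" "left_module P N"
    and closed: "\<And>u. u \<in> carrier M \<Longrightarrow> h u \<in> carrier N"
    and add: "\<And>u v. \<lbrakk>u \<in> carrier M; v \<in> carrier M\<rbrakk> \<Longrightarrow> h (u \<oplus>\<^bsub>M\<^esub> v) = h u \<oplus>\<^bsub>N\<^esub> h v"
    and const: "\<And>a u. \<lbrakk>a \<in> carrier K; u \<in> carrier M\<rbrakk> \<Longrightarrow> h (monom a 0 \<odot>\<^bsub>M\<^esub> u) = monom a 0 \<odot>\<^bsub>N\<^esub> h u"
    and x: "\<And>u. u \<in> carrier M \<Longrightarrow> h (monom \<one> (- 1) \<odot>\<^bsub>M\<^esub> u) = monom \<one> (- 1) \<odot>\<^bsub>N\<^esub> h u"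
    and q: "q \<in> carrier P" and u: "u \<in> carrier M"
  shows "h (q \<odot>\<^bsub>M\<^esub> u) = q \<odot>\<^bsub>N\<^esub> h u"
proof -
  interpret M: left_module P M by fact
  interpret N: left_module P N by fact
  have mm: "monom \<one> k \<otimes>\<^bsub>P\<^esub> monom \<one> l = monom \<one> (k + l)" for k l by (simp add: monom_monom)
  have pow: "h (monom \<one> k \<odot>\<^bsub>M\<^esub> u) = monom \<one> k \<odot>\<^bsub>N\<^esub> h u" for k
  proof (induction k rule: int_induct[where k = 0])
    case base
    show ?case using const[OF one_closed u] .
  next
    case (step2 i)
    have "monom \<one> (i - 1) = monom \<one> (- 1) \<otimes>\<^bsub>P\<^esub> monom \<one> i" by (simp add: mm)
    then show ?case using step2 u x by (simp add: M.smult_assoc N.smult_assoc M.smult_closed closed)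
  next
    \<comment> \<open>Going up, the claim for \<open>i + 1\<close> is first obtained after applying
      x^-1, which multiplication by x then removes.\<close>
    case (step1 i)
    have e: "monom \<one> i = monom \<one> (- 1) \<otimes>\<^bsub>P\<^esub> monom \<one> (i + 1)" by (simp add: mm)
    have "monom \<one> (- 1) \<odot>\<^bsub>N\<^esub> h (monom \<one> (i + 1) \<odot>\<^bsub>M\<^esub> u) = monom \<one> (- 1) \<odot>\<^bsub>N\<^esub> (monom \<one> (i + 1) \<odot>\<^bsub>N\<^esub> h u)"
      using step1 u x e by (simp add: M.smult_assoc N.smult_assoc M.smult_closed N.smult_closed closed)
    then have "monom \<one> 1 \<odot>\<^bsub>N\<^esub> (monom \<one> (- 1) \<odot>\<^bsub>N\<^esub> h (monom \<one> (i + 1) \<odot>\<^bsub>M\<^esub> u)) =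
        monom \<one> 1 \<odot>\<^bsub>N\<^esub> (monom \<one> (- 1) \<odot>\<^bsub>N\<^esub> (monom \<one> (i + 1) \<odot>\<^bsub>N\<^esub> h u))" by simp
    then show ?case
      using u closed by (simp add: N.smult_assoc[symmetric] mm M.smult_closed N.smult_closed N.smult_one add.commute[of i 1] P_ops(2)[symmetric])
  qed
  show ?thesis using q
  proof (induction q rule: P_induct)
    case zero
    have "monom \<zero> 0 = \<zero>\<^bsub>P\<^esub>" by (auto simp: monom_def P_ops(1))
    then show ?case using const[OF zero_closed u] by simp
  next
    case (monom a k f)
    have "monom a k = monom a 0 \<otimes>\<^bsub>P\<^esub> monom \<one> k" using monom(1) by (simp add: monom_monom)
    then have "h (monom a k \<odot>\<^bsub>M\<^esub> u) = monom a k \<odot>\<^bsub>N\<^esub> h u"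
      using monom(1) u const pow by (simp add: M.smult_assoc N.smult_assoc M.smult_closed closed)
    then show ?case using monom u by (simp add: M.smult_l_distr N.smult_l_distr add M.smult_closed closed)
  qed
qed

end

section \<open>Similarity and intertwiners of companion maps\<close>

text \<open>Every class of \<open>P/Pf\<close> has a unique representative with exponents in \<open>{1..d}\<close>. This window,
  rather than \<open>{0..d-1}\<close>, makes multiplication by \<open>x\<^sup>-\<^sup>1\<close> act as \<open>companion_div\<close> after \<open>\<tau>\<^sup>-\<^sup>1\<close>.\<close>

locale skew_laurent_companion = companion_field K d \<alpha> + skew_laurent_field K \<tau>
  for K (structure) and d \<alpha> \<tau>
begin

abbreviation f :: "int \<Rightarrow> 'a" where "f \<equiv> skew_poly K d \<alpha>"
abbreviation Q :: "(int \<Rightarrow> 'a, (int \<Rightarrow> 'a) set) module" where "Q \<equiv> quotient_module P (PIdl\<^bsub>P\<^esub> f)"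

definition tail_poly :: "(nat \<Rightarrow> 'a) \<Rightarrow> int \<Rightarrow> 'a" where
  "tail_poly c = (\<lambda>n. if 1 \<le> n \<and> n \<le> int d then c (nat n) else \<zero>)"

definition tail_class :: "(nat \<Rightarrow> 'a) \<Rightarrow> (int \<Rightarrow> 'a) set" where
  "tail_class c = PIdl\<^bsub>P\<^esub> f +>\<^bsub>P\<^esub> tail_poly c"

definition etaP :: "(nat \<Rightarrow> 'a) \<Rightarrow> nat \<Rightarrow> 'a" where
  "etaP c = companion_div K d \<alpha> (\<lambda>i\<in>{1..d}. inv_into (carrier K) \<tau> (c i))"

lemma f_closed [simp]: "f \<in> carrier P"
proof -
  have "supp f \<subseteq> {0..int d}" by (auto simp: supp_def skew_poly_def)
  then have "finite (supp f)" by (rule finite_subset) simp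
  then show ?thesis unfolding P_carrier by (simp add: skew_poly_def nat_le_iff)
qed

lemma tail_poly_closed [simp]: "c \<in> Kd \<Longrightarrow> tail_poly c \<in> carrier P"
proof -
  assume c: "c \<in> Kd"
  have "supp (tail_poly c) \<subseteq> {0..int d}" by (auto simp: supp_def tail_poly_def)
  then have "finite (supp (tail_poly c))" by (rule finite_subset) simp
  moreover have "c (nat n) \<in> carrier K" if "1 \<le> n" "n \<le> int d" for n
    using Kd_nth[OF c, of "nat n"] that by simp
  ultimately show ?thesis unfolding P_carrier by (simp add: tail_poly_def)
qed

lemma taui_closed: "a \<in> carrier K \<Longrightarrow> inv_into (carrier K) \<tau> a \<in> carrier K"
  using z.hom_closed[of a "- 1"] by simp

lemma etaP_closed [simp]: "c \<in> Kd \<Longrightarrow> etaP c \<in> Kd"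
  unfolding etaP_def by (intro companion_div_closed) (auto intro!: taui_closed Kd_nth)

text \<open>The preimage applies the companion matrix and then \<open>\<tau>\<close>, written
  \<open>z 1\<close> to use the additivity of exponents.\<close>

lemma etaP_surj:
  assumes c: "c \<in> Kd" shows "\<exists>b\<in>Kd. etaP b = c"
proof (intro bexI)
  let ?b = "\<lambda>i\<in>{1..d}. z 1 (companion_mul K d \<alpha> c i)"
  have m: "companion_mul K d \<alpha> c \<in> Kd" using c by simp
  show "?b \<in> Kd" using Kd_nth[OF m] by (auto simp del: zpow_1)
  have "inv_into (carrier K) \<tau> (?b i) = companion_mul K d \<alpha> c i" if "i \<in> {1..d}" for i
    using that Kd_nth[OF m, of i] z_add[of "companion_mul K d \<alpha> c i" "- 1" 1] by simp
  then have "(\<lambda>i\<in>{1..d}. inv_into (carrier K) \<tau> (?b i)) = (\<lambda>i\<in>{1..d}. companion_mul K d \<alpha> c i)"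
    by (intro restrict_ext)
  also have "\<dots> = companion_mul K d \<alpha> c" using m by (simp add: PiE_restrict)
  finally show "etaP ?b = c" using c by (simp add: etaP_def)
qed

text \<open>A degree argument. If a nonzero g times f has support in {1..d}, then the lowest term,
  with coefficient from alpha_0, forces the least exponent of g to be at least 1, and the highest,
  with alpha_d, forces the greatest to be at most 0.\<close>

lemma tail_poly_inj_mod:
  assumes c: "c \<in> Kd" and b: "b \<in> Kd" and eq: "tail_class c = tail_class b"
  shows "c = b"
proof -
  have "tail_poly c \<ominus>\<^bsub>P\<^esub> tail_poly b \<in> PIdl\<^bsub>P\<^esub> f"
    using eq c b PR.quotient_module_ops(4)[OF f_closed] by (simp add: tail_class_def)
  then obtain g where g: "g \<in> carrier P" and gf: "tail_poly c \<ominus>\<^bsub>P\<^esub> tail_poly b = g \<otimes>\<^bsub>P\<^esub> f"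
    by (auto simp: cgenideal_def)
  have nth: "(g \<otimes>\<^bsub>P\<^esub> f) n = tail_poly c n \<ominus> tail_poly b n" for n
    using P_minus_nth c b by (simp flip: gf)
  have mult: "(g \<otimes>\<^bsub>P\<^esub> f) n = (\<Oplus>i\<in>supp g. g i \<otimes> z i (f (n - i)))" for n
    using P_mult[OF g f_closed P_supp[OF g] order_refl] .
  have single: "(g \<otimes>\<^bsub>P\<^esub> f) n = g i \<otimes> z i (f (n - i))"
    if i: "i \<in> supp g" and 0: "\<And>l. l \<in> supp g \<Longrightarrow> l \<noteq> i \<Longrightarrow> f (n - l) = \<zero>" for n i
  proof -
    have "(\<Oplus>l\<in>supp g. g l \<otimes> z l (f (n - l))) = (\<Oplus>l\<in>supp g. if i = l then g l \<otimes> z l (f (n - l)) else \<zero>)"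
      using g 0 by (intro finsum_cong') auto
    also have "\<dots> = g i \<otimes> z i (f (n - i))"
      using g i by (intro add.finprod_singleton) auto
    finally show ?thesis unfolding mult .
  qed
  have "supp g = {}"
  proof (rule ccontr)
    assume ne: "supp g \<noteq> {}"
    have fin: "finite (supp g)" using g by simp
    let ?i = "Min (supp g)" and ?j = "Max (supp g)"
    have ij: "?i \<in> supp g" "?j \<in> supp g" using fin ne by simp_all
    \<comment> \<open>A twist has an inverse twist, so it keeps coefficients nonzero.\<close>
    have nz: "g l \<otimes> z l a \<noteq> \<zero>" if "l \<in> supp g" "a \<in> carrier K" "a \<noteq> \<zero>" for l a
    proof -
      have "z l a \<noteq> \<zero>"
      proof
        assume "z l a = \<zero>"
        then have "z (- l + l) a = \<zero>" using z_add[OF that(2), of "- l" l] by simp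
        then show False using that by simp
      qed
      then show ?thesis using that g by (simp add: integral_iff supp_def)
    qed
    have "(g \<otimes>\<^bsub>P\<^esub> f) ?i = g ?i \<otimes> z ?i (f (?i - ?i))"
    proof (rule single[OF ij(1)])
      fix l assume "l \<in> supp g" "l \<noteq> ?i"
      then have "?i < l" using Min_le[OF fin, of l] by simp
      then show "f (?i - l) = \<zero>" by (simp add: skew_poly_def)
    qed
    also have "\<dots> \<noteq> \<zero>" using nz[OF ij(1)] alpha_0 by (simp add: skew_poly_def)
    finally have "1 \<le> ?i" unfolding nth by (auto simp: tail_poly_def a_minus_def split: if_splits)
    have "(g \<otimes>\<^bsub>P\<^esub> f) (?j + int d) = g ?j \<otimes> z ?j (f (?j + int d - ?j))"
    proof (rule single[OF ij(2)])
      fix l assume "l \<in> supp g" "l \<noteq> ?j"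
      then have "l < ?j" using Max_ge[OF fin, of l] by simp
      then show "f (?j + int d - l) = \<zero>" by (simp add: skew_poly_def)
    qed
    also have "\<dots> \<noteq> \<zero>" using nz[OF ij(2)] alpha_d by (simp add: skew_poly_def)
    finally have "?j + int d \<le> int d" unfolding nth by (auto simp: tail_poly_def a_minus_def split: if_splits)
    then show False using \<open>1 \<le> ?i\<close> Min_le[OF fin ij(2)] by simp
  qed
  then have "(g \<otimes>\<^bsub>P\<^esub> f) n = \<zero>" for n unfolding mult by simp
  then have diff: "tail_poly c n \<ominus> tail_poly b n = \<zero>" for n unfolding nth .
  show ?thesis
  proof (rule Kd_eqI[OF c b])
    fix i assume i: "1 \<le> i" "i \<le> d"
    have "c i \<ominus> b i = \<zero>" using diff[of "int i"] i by (simp add: tail_poly_def)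
    then show "c i = b i"
      using Kd_nth[OF c i] Kd_nth[OF b i] minus_equality[of "c i" "\<ominus> b i"] by (simp add: a_minus_def)
  qed
qed

lemma tail_class_mem: "c \<in> Kd \<Longrightarrow> tail_class c \<in> carrier Q"
  unfolding PR.quotient_module_ops(1)[OF f_closed] tail_class_def by simp

lemma tail_class_add:
  assumes "c \<in> Kd" "b \<in> Kd"
  shows "tail_class (\<lambda>i\<in>{1..d}. c i \<oplus> b i) = tail_class c \<oplus>\<^bsub>Q\<^esub> tail_class b"
proof -
  have "tail_poly (\<lambda>i\<in>{1..d}. c i \<oplus> b i) = tail_poly c \<oplus>\<^bsub>P\<^esub> tail_poly b"
    by (auto simp: tail_poly_def P_ops(3) fun_eq_iff)
  then show ?thesis using assms PR.quotient_module_ops(2)[OF f_closed] by (simp add: tail_class_def)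
qed

lemma tail_class_scale:
  assumes "c \<in> Kd" "a \<in> carrier K"
  shows "tail_class (\<lambda>i\<in>{1..d}. a \<otimes> c i) = monom a 0 \<odot>\<^bsub>Q\<^esub> tail_class c"
proof -
  have "tail_poly (\<lambda>i\<in>{1..d}. a \<otimes> c i) = monom a 0 \<otimes>\<^bsub>P\<^esub> tail_poly c"
    using assms by (auto simp: monom_mult fun_eq_iff) (auto simp: tail_poly_def)
  then show ?thesis using assms PR.quotient_module_ops(3)[OF f_closed] by (simp add: tail_class_def)
qed

text \<open>In the reductions that follow, two representatives differ by a constant multiple of
  f.\<close>

lemma class_eqI:
  assumes g: "g \<in> carrier P" and h: "h \<in> carrier P" and b: "b \<in> carrier K"
    and eq: "\<And>n. g n = h n \<oplus> b \<otimes> f n"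
  shows "PIdl\<^bsub>P\<^esub> f +>\<^bsub>P\<^esub> g = PIdl\<^bsub>P\<^esub> f +>\<^bsub>P\<^esub> h"
proof -
  have "g \<ominus>\<^bsub>P\<^esub> h = monom b 0 \<otimes>\<^bsub>P\<^esub> f"
  proof
    fix n
    have "(h n \<oplus> b \<otimes> f n) \<ominus> h n = b \<otimes> f n"
      using h b by (simp add: a_minus_def a_comm[of "h n"] a_assoc r_neg)
    then show "(g \<ominus>\<^bsub>P\<^esub> h) n = (monom b 0 \<otimes>\<^bsub>P\<^esub> f) n"
      using g h b eq[of n] by (simp add: P_minus_nth monom_mult)
  qed
  then have "g \<ominus>\<^bsub>P\<^esub> h \<in> PIdl\<^bsub>P\<^esub> f" using b unfolding cgenideal_def by auto
  then show ?thesis using g h PR.quotient_module_ops(4)[OF f_closed] by simp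
qed

text \<open>Multiplication by x^-1 moves the window from 1..d to 0..d-1. Subtracting the multiple of
  f that removes the constant term restores the window 1..d, and this subtraction is the correction
  term of \<open>companion_div\<close>.\<close>

lemma tail_class_eta:
  assumes c: "c \<in> Kd"
  shows "tail_class (etaP c) = monom \<one> (- 1) \<odot>\<^bsub>Q\<^esub> tail_class c"
proof -
  \<comment> \<open>The multiple of f with the same constant term as the shifted polynomial. For
    \<open>d = 0\<close> the window is empty, the polynomial is zero and \<open>c 1\<close> lies
    outside the index set, so the multiple is set to 0.\<close>
  define b where "b = (if d = 0 then \<zero> else inv_into (carrier K) \<tau> (c 1) \<otimes> inv (\<alpha> 0))"
  have c1: "inv_into (carrier K) \<tau> (c 1) \<in> carrier K" if "d \<noteq> 0"
    using that c by (intro taui_closed Kd_nth) auto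
  have b: "b \<in> carrier K" using c1 by (simp add: b_def)
  have "monom \<one> (- 1) \<odot>\<^bsub>Q\<^esub> tail_class c = PIdl\<^bsub>P\<^esub> f +>\<^bsub>P\<^esub> (monom \<one> (- 1) \<otimes>\<^bsub>P\<^esub> tail_poly c)"
    using c PR.quotient_module_ops(3)[OF f_closed] by (simp add: tail_class_def)
  also have "\<dots> = PIdl\<^bsub>P\<^esub> f +>\<^bsub>P\<^esub> tail_poly (etaP c)"
  proof (rule class_eqI[OF _ _ b])
    show "monom \<one> (- 1) \<otimes>\<^bsub>P\<^esub> tail_poly c \<in> carrier P" "tail_poly (etaP c) \<in> carrier P" using c by simp_all
    fix n
    have L: "(monom \<one> (- 1) \<otimes>\<^bsub>P\<^esub> tail_poly c) n = z (- 1) (tail_poly c (n + 1))"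
      using c by (simp add: monom_mult del: zpow_minus_1)
    show "(monom \<one> (- 1) \<otimes>\<^bsub>P\<^esub> tail_poly c) n = tail_poly (etaP c) n \<oplus> b \<otimes> f n"
    proof (cases "d = 0 \<or> n < 0 \<or> int d < n")
      case True
      then have "tail_poly c (n + 1) = \<zero>" "tail_poly (etaP c) n = \<zero>" "b \<otimes> f n = \<zero>"
        using b f_closed by (auto simp: tail_poly_def b_def skew_poly_def)
      then show ?thesis unfolding L by (simp del: zpow_minus_1)
    next
      case False
      define k where "k = nat n"
      have k: "n = int k" "k \<le> d" "d \<noteq> 0" using False by (simp_all add: k_def nat_le_iff)
      let ?t = "inv_into (carrier K) \<tau> (c 1)"
      have t: "?t \<in> carrier K" using c1 k by simp
      show ?thesis
      proof (cases "k = 0")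
        case True
        then have "tail_poly c (n + 1) = c 1" using k by (simp add: tail_poly_def One_nat_def)
        moreover have "tail_poly (etaP c) n = \<zero>" using True k by (simp add: tail_poly_def)
        moreover have "b \<otimes> f n = ?t"
          using True k t by (simp add: b_def skew_poly_def m_assoc)
        ultimately show ?thesis unfolding L using t by simp
      next
        case False
        let ?s = "if k = d then \<zero> else inv_into (carrier K) \<tau> (c (Suc k))"
        have s: "?s \<in> carrier K" using c k by (auto intro!: taui_closed Kd_nth)
        have ak: "\<alpha> k \<in> carrier K" using k by simp
        have "z (- 1) (tail_poly c (n + 1)) = ?s"
          using k False by (auto simp: tail_poly_def nat_add_distrib simp del: z.hom_zero)
            (use z.hom_zero[of "- 1"] in simp)
        moreover have "tail_poly (etaP c) n = ?s \<ominus> (\<alpha> k \<otimes> inv (\<alpha> 0)) \<otimes> ?t"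
          using k False by (auto simp: tail_poly_def etaP_def companion_div_def)
        moreover have "b \<otimes> f n = (\<alpha> k \<otimes> inv (\<alpha> 0)) \<otimes> ?t"
          using k t ak by (simp add: b_def skew_poly_def m_ac)
        ultimately show ?thesis unfolding L using s ak t by (simp add: a_minus_def a_assoc l_neg)
      qed
    qed
  qed
  finally show ?thesis by (simp add: tail_class_def)
qed

text \<open>The class of 1 has a representative in the window; \<open>etaP\<close> and its
  surjectivity reach all powers of x, and K-linear combinations reach the rest.\<close>

lemma tail_class_surj:
  assumes g: "g \<in> carrier P" shows "\<exists>c\<in>Kd. tail_class c = PIdl\<^bsub>P\<^esub> f +>\<^bsub>P\<^esub> g"
proof -
  note ops = PR.quotient_module_ops[OF f_closed]
  have one: "\<exists>c\<in>Kd. tail_class c = PIdl\<^bsub>P\<^esub> f +>\<^bsub>P\<^esub> monom \<one> 0"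
  proof (rule bexI)
    \<comment> \<open>The coefficients of 1 - alpha_0^-1 f, whose constant term cancels.\<close>
    let ?c = "\<lambda>i\<in>{1..d}. \<ominus> (inv (\<alpha> 0) \<otimes> \<alpha> i)"
    show c: "?c \<in> Kd" by auto
    have "PIdl\<^bsub>P\<^esub> f +>\<^bsub>P\<^esub> monom \<one> 0 = PIdl\<^bsub>P\<^esub> f +>\<^bsub>P\<^esub> tail_poly ?c"
    proof (rule class_eqI[of _ _ "inv (\<alpha> 0)"])
      fix n
      show "monom \<one> 0 n = tail_poly ?c n \<oplus> inv (\<alpha> 0) \<otimes> f n"
      proof (cases "1 \<le> n \<and> n \<le> int d")
        case True
        then have "1 \<le> nat n" "nat n \<le> d" by (auto simp: nat_le_iff le_nat_iff)
        moreover from this(2) have "\<alpha> (nat n) \<in> carrier K" by (rule alpha_closed)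
        ultimately show ?thesis using True by (simp add: monom_def tail_poly_def skew_poly_def l_neg)
      next
        case False
        then show ?thesis by (auto simp: monom_def tail_poly_def skew_poly_def)
      qed
    qed (use c in simp_all)
    then show "tail_class ?c = PIdl\<^bsub>P\<^esub> f +>\<^bsub>P\<^esub> monom \<one> 0" by (simp add: tail_class_def)
  qed
  have mm: "monom \<one> k \<otimes>\<^bsub>P\<^esub> monom \<one> l = monom \<one> (k + l)" for k l by (simp add: monom_monom)
  have pow: "\<exists>c\<in>Kd. tail_class c = PIdl\<^bsub>P\<^esub> f +>\<^bsub>P\<^esub> monom \<one> k" for k
  proof (induction k rule: int_induct[where k = 0])
    case base
    show ?case by (rule one)
  next
    case (step2 i)
    then obtain c where c: "c \<in> Kd" "tail_class c = PIdl\<^bsub>P\<^esub> f +>\<^bsub>P\<^esub> monom \<one> i" by blast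
    have "tail_class (etaP c) = PIdl\<^bsub>P\<^esub> f +>\<^bsub>P\<^esub> monom \<one> (i - 1)"
      unfolding tail_class_eta[OF c(1)] c(2) by (simp add: ops(3) mm)
    then show ?case using etaP_closed[OF c(1)] by blast
  next
    \<comment> \<open>A preimage \<open>b\<close> of \<open>c\<close> under \<open>etaP\<close> has
      x^-1 times its class equal to that of \<open>c\<close>; multiplying by x gives the class of
      \<open>b\<close>.\<close>
    case (step1 i)
    then obtain c where c: "c \<in> Kd" "tail_class c = PIdl\<^bsub>P\<^esub> f +>\<^bsub>P\<^esub> monom \<one> i" by blast
    obtain b where b: "b \<in> Kd" "etaP b = c" using etaP_surj[OF c(1)] by blast
    have "monom \<one> 1 \<odot>\<^bsub>Q\<^esub> (monom \<one> (- 1) \<odot>\<^bsub>Q\<^esub> tail_class b) = monom \<one> 1 \<odot>\<^bsub>Q\<^esub> (PIdl\<^bsub>P\<^esub> f +>\<^bsub>P\<^esub> monom \<one> i)"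
      using tail_class_eta[OF b(1)] b(2) c(2) by simp
    moreover have "monom \<one> 1 \<odot>\<^bsub>Q\<^esub> (monom \<one> (- 1) \<odot>\<^bsub>Q\<^esub> tail_class b) = tail_class b"
    proof -
      have "monom \<one> 1 \<otimes>\<^bsub>P\<^esub> (monom \<one> (- 1) \<otimes>\<^bsub>P\<^esub> tail_poly b) = (monom \<one> 1 \<otimes>\<^bsub>P\<^esub> monom \<one> (- 1)) \<otimes>\<^bsub>P\<^esub> tail_poly b"
        using b(1) by (simp add: PR.m_assoc)
      also have "\<dots> = tail_poly b" using b(1) by (simp add: mm flip: P_ops(2))
      finally show ?thesis using b(1) by (simp add: tail_class_def ops(3))
    qed
    ultimately have "tail_class b = PIdl\<^bsub>P\<^esub> f +>\<^bsub>P\<^esub> monom \<one> (i + 1)" by (simp add: ops(3) mm add.commute)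
    then show ?case using b(1) by blast
  qed
  show ?thesis using g
  proof (induction g rule: P_induct)
    case zero
    have "tail_poly (\<lambda>i\<in>{1..d}. \<zero>) = \<zero>\<^bsub>P\<^esub>" by (auto simp: tail_poly_def P_ops(1) fun_eq_iff)
    then have "tail_class (\<lambda>i\<in>{1..d}. \<zero>) = PIdl\<^bsub>P\<^esub> f +>\<^bsub>P\<^esub> \<zero>\<^bsub>P\<^esub>" by (simp only: tail_class_def)
    moreover have "(\<lambda>i\<in>{1..d}. \<zero>) \<in> Kd" by auto
    ultimately show ?case by blast
  next
    case (monom a k g)
    obtain b where b: "b \<in> Kd" "tail_class b = PIdl\<^bsub>P\<^esub> f +>\<^bsub>P\<^esub> g" using monom.IH by blast
    obtain c where c: "c \<in> Kd" "tail_class c = PIdl\<^bsub>P\<^esub> f +>\<^bsub>P\<^esub> monom \<one> k" using pow by blast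
    let ?ac = "\<lambda>i\<in>{1..d}. a \<otimes> c i"
    have ac: "?ac \<in> Kd" using Kd_nth[OF c(1)] monom(1) by auto
    have "tail_class ?ac = PIdl\<^bsub>P\<^esub> f +>\<^bsub>P\<^esub> monom a k"
      unfolding tail_class_scale[OF c(1) monom(1)] c(2) using monom(1) by (simp add: ops(3) monom_monom)
    then have "tail_class (\<lambda>i\<in>{1..d}. ?ac i \<oplus> b i) = PIdl\<^bsub>P\<^esub> f +>\<^bsub>P\<^esub> (monom a k \<oplus>\<^bsub>P\<^esub> g)"
      unfolding tail_class_add[OF ac b(1)] b(2) using monom(1,2) by (simp add: ops(2))
    moreover have "(\<lambda>i\<in>{1..d}. ?ac i \<oplus> b i) \<in> Kd" using Kd_nth[OF ac] Kd_nth[OF b(1)] by auto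
    ultimately show ?case by blast
  qed
qed

lemma tail_class_bij: "bij_betw tail_class Kd (carrier Q)"
  unfolding bij_betw_def
proof
  show "inj_on tail_class Kd" by (rule inj_onI) (rule tail_poly_inj_mod)
  show "tail_class ` Kd = carrier Q"
  proof
    show "carrier Q \<subseteq> tail_class ` Kd"
    proof
      fix w assume "w \<in> carrier Q"
      then obtain g where "g \<in> carrier P" "w = PIdl\<^bsub>P\<^esub> f +>\<^bsub>P\<^esub> g"
        unfolding PR.quotient_module_ops(1)[OF f_closed] by blast
      then show "w \<in> tail_class ` Kd" using tail_class_surj[of g] by blast
    qed
  qed (use tail_class_mem in blast)
qed

lemma left_module_Q: "left_module P Q" by (rule PR.left_module_quotient_module[OF f_closed])

end

text \<open>Transport along \<open>tail_class\<close>: a P-linear bijection of the quotients is a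
  K-linear bijection of K^d that commutes with x^-1, hence with the maps
  \<open>etaP\<close>.\<close>

lemma similar_iff_companion:
  assumes "skew_laurent_companion K d \<alpha> \<tau>" "skew_laurent_companion K d \<beta> \<tau>"
  shows "similar (skew_laurent K \<tau>) (skew_poly K d \<alpha>) (skew_poly K d \<beta>) \<longleftrightarrow>
    (\<exists>S. bij_betw S ({1..d} \<rightarrow>\<^sub>E carrier K) ({1..d} \<rightarrow>\<^sub>E carrier K) \<and>
      (\<forall>u\<in>{1..d} \<rightarrow>\<^sub>E carrier K. \<forall>v\<in>{1..d} \<rightarrow>\<^sub>E carrier K.
        S (\<lambda>i\<in>{1..d}. u i \<oplus>\<^bsub>K\<^esub> v i) = (\<lambda>i\<in>{1..d}. S u i \<oplus>\<^bsub>K\<^esub> S v i)) \<and>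
      (\<forall>a\<in>carrier K. \<forall>u\<in>{1..d} \<rightarrow>\<^sub>E carrier K.
        S (\<lambda>i\<in>{1..d}. a \<otimes>\<^bsub>K\<^esub> u i) = (\<lambda>i\<in>{1..d}. a \<otimes>\<^bsub>K\<^esub> S u i)) \<and>
      (\<forall>u\<in>{1..d} \<rightarrow>\<^sub>E carrier K. S (skew_laurent_companion.etaP K d \<alpha> \<tau> u) = skew_laurent_companion.etaP K d \<beta> \<tau> (S u)))"
    (is "_ \<longleftrightarrow> (\<exists>S. ?lin S)")
proof
  interpret A: skew_laurent_companion K d \<alpha> \<tau> by fact
  interpret B: skew_laurent_companion K d \<beta> \<tau> by fact
  {
    assume "similar (skew_laurent K \<tau>) (skew_poly K d \<alpha>) (skew_poly K d \<beta>)"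
    then obtain g where g: "bij_betw g (carrier A.Q) (carrier B.Q)"
      and add: "\<And>u v. \<lbrakk>u \<in> carrier A.Q; v \<in> carrier A.Q\<rbrakk> \<Longrightarrow> g (u \<oplus>\<^bsub>A.Q\<^esub> v) = g u \<oplus>\<^bsub>B.Q\<^esub> g v"
      and smult: "\<And>a u. \<lbrakk>a \<in> carrier A.P; u \<in> carrier A.Q\<rbrakk> \<Longrightarrow> g (a \<odot>\<^bsub>A.Q\<^esub> u) = a \<odot>\<^bsub>B.Q\<^esub> g u"
      by (auto simp: similar_def module_isomorphic_def)
    define S where "S = inv_into B.Kd B.tail_class \<circ> g \<circ> A.tail_class"
    have bij: "bij_betw S B.Kd B.Kd"
      unfolding S_def comp_assoc
      by (intro bij_betw_trans[OF bij_betw_trans[OF A.tail_class_bij g, unfolded comp_assoc[symmetric]] bij_betw_inv_into[OF B.tail_class_bij], unfolded comp_assoc])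
    have Sc: "S u \<in> B.Kd" if "u \<in> B.Kd" for u using bij_betwE[OF bij] that by blast
    have S: "B.tail_class (S u) = g (A.tail_class u)" if "u \<in> B.Kd" for u
      using bij_betwE[OF g] A.tail_class_mem[OF that] bij_betw_inv_into_right[OF B.tail_class_bij]
      by (simp add: S_def)
    have eqI: "v = w" if "v \<in> B.Kd" "w \<in> B.Kd" "B.tail_class v = B.tail_class w" for v w
      using B.tail_poly_inj_mod that .
    have "?lin S"
    proof (intro conjI ballI)
      show "bij_betw S B.Kd B.Kd" by (rule bij)
      fix u assume u: "u \<in> B.Kd"
      show "S (A.etaP u) = B.etaP (S u)"
        using u Sc A.tail_class_mem
        by (intro eqI) (simp_all add: S A.tail_class_eta B.tail_class_eta smult)
      fix v assume v: "v \<in> B.Kd"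
      have uv: "(\<lambda>i\<in>{1..d}. u i \<oplus>\<^bsub>K\<^esub> v i) \<in> B.Kd" if "u \<in> B.Kd" "v \<in> B.Kd" for u v
        using B.Kd_nth[OF that(1)] B.Kd_nth[OF that(2)] by auto
      show "S (\<lambda>i\<in>{1..d}. u i \<oplus>\<^bsub>K\<^esub> v i) = (\<lambda>i\<in>{1..d}. S u i \<oplus>\<^bsub>K\<^esub> S v i)"
        using u v by (intro eqI Sc uv) (simp_all only: S uv Sc A.tail_class_add B.tail_class_add add A.tail_class_mem)
    next
      fix a u assume a: "a \<in> carrier K" and u: "u \<in> B.Kd"
      have au: "(\<lambda>i\<in>{1..d}. a \<otimes>\<^bsub>K\<^esub> u i) \<in> B.Kd" if "u \<in> B.Kd" for u
        using B.Kd_nth[OF that] a by auto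
      show "S (\<lambda>i\<in>{1..d}. a \<otimes>\<^bsub>K\<^esub> u i) = (\<lambda>i\<in>{1..d}. a \<otimes>\<^bsub>K\<^esub> S u i)"
        using u a by (intro eqI Sc au)
          (simp_all only: S au Sc A.tail_class_scale B.tail_class_scale smult A.tail_class_mem A.monom_closed)
    qed
    then show "\<exists>S. ?lin S" by blast
  }
  assume "\<exists>S. ?lin S"
  then obtain S where S: "?lin S" by blast
  then have bij: "bij_betw S B.Kd B.Kd" by blast
  have Sc: "S u \<in> B.Kd" if "u \<in> B.Kd" for u using bij_betwE[OF bij] that by blast
  define g where "g = B.tail_class \<circ> S \<circ> inv_into B.Kd A.tail_class"
  have g: "bij_betw g (carrier A.Q) (carrier B.Q)"
    unfolding g_def comp_assoc
    by (intro bij_betw_trans[OF bij_betw_trans[OF bij_betw_inv_into[OF A.tail_class_bij] bij] B.tail_class_bij, unfolded comp_assoc])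
  have gA: "g (A.tail_class u) = B.tail_class (S u)" if "u \<in> B.Kd" for u
    using bij_betw_inv_into_left[OF A.tail_class_bij that] by (simp add: g_def)
  have repr: "\<exists>u\<in>B.Kd. w = A.tail_class u" if "w \<in> carrier A.Q" for w
    using that A.tail_class_bij unfolding bij_betw_def by blast
  have add: "g (u \<oplus>\<^bsub>A.Q\<^esub> v) = g u \<oplus>\<^bsub>B.Q\<^esub> g v" if uv: "u \<in> carrier A.Q" "v \<in> carrier A.Q" for u v
  proof -
    obtain a b where ab: "a \<in> B.Kd" "u = A.tail_class a" "b \<in> B.Kd" "v = A.tail_class b"
      using repr uv by metis
    have "(\<lambda>i\<in>{1..d}. a i \<oplus>\<^bsub>K\<^esub> b i) \<in> B.Kd" using B.Kd_nth[OF ab(1)] B.Kd_nth[OF ab(3)] by auto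
    then have "g (u \<oplus>\<^bsub>A.Q\<^esub> v) = B.tail_class (S (\<lambda>i\<in>{1..d}. a i \<oplus>\<^bsub>K\<^esub> b i))"
      unfolding ab(2,4) A.tail_class_add[OF ab(1,3), symmetric] by (rule gA)
    also have "\<dots> = B.tail_class (\<lambda>i\<in>{1..d}. S a i \<oplus>\<^bsub>K\<^esub> S b i)" using S ab(1,3) by simp
    also have "\<dots> = g u \<oplus>\<^bsub>B.Q\<^esub> g v"
      unfolding ab(2,4) gA[OF ab(1)] gA[OF ab(3)] by (rule B.tail_class_add[OF Sc[OF ab(1)] Sc[OF ab(3)]])
    finally show ?thesis .
  qed
  have const: "g (A.monom a 0 \<odot>\<^bsub>A.Q\<^esub> u) = A.monom a 0 \<odot>\<^bsub>B.Q\<^esub> g u" if a: "a \<in> carrier K" and u: "u \<in> carrier A.Q" for a u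
  proof -
    obtain b where b: "b \<in> B.Kd" "u = A.tail_class b" using repr u by metis
    have "(\<lambda>i\<in>{1..d}. a \<otimes>\<^bsub>K\<^esub> b i) \<in> B.Kd" using B.Kd_nth[OF b(1)] a by auto
    then have "g (A.monom a 0 \<odot>\<^bsub>A.Q\<^esub> u) = B.tail_class (S (\<lambda>i\<in>{1..d}. a \<otimes>\<^bsub>K\<^esub> b i))"
      unfolding b(2) A.tail_class_scale[OF b(1) a, symmetric] by (rule gA)
    also have "\<dots> = B.tail_class (\<lambda>i\<in>{1..d}. a \<otimes>\<^bsub>K\<^esub> S b i)" using S b(1) a by simp
    also have "\<dots> = A.monom a 0 \<odot>\<^bsub>B.Q\<^esub> g u"
      unfolding b(2) gA[OF b(1)] by (rule B.tail_class_scale[OF Sc[OF b(1)] a])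
    finally show ?thesis .
  qed
  have x: "g (A.monom \<one>\<^bsub>K\<^esub> (- 1) \<odot>\<^bsub>A.Q\<^esub> u) = A.monom \<one>\<^bsub>K\<^esub> (- 1) \<odot>\<^bsub>B.Q\<^esub> g u" if u: "u \<in> carrier A.Q" for u
  proof -
    obtain b where b: "b \<in> B.Kd" "u = A.tail_class b" using repr u by metis
    have "g (A.monom \<one>\<^bsub>K\<^esub> (- 1) \<odot>\<^bsub>A.Q\<^esub> u) = B.tail_class (S (A.etaP b))"
      unfolding b(2) A.tail_class_eta[OF b(1), symmetric] by (rule gA[OF A.etaP_closed[OF b(1)]])
    also have "\<dots> = B.tail_class (B.etaP (S b))" using S b(1) by simp
    also have "\<dots> = A.monom \<one>\<^bsub>K\<^esub> (- 1) \<odot>\<^bsub>B.Q\<^esub> g u"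
      unfolding b(2) gA[OF b(1)] by (rule B.tail_class_eta[OF Sc[OF b(1)]])
    finally show ?thesis .
  qed
  have gc: "g u \<in> carrier B.Q" if "u \<in> carrier A.Q" for u using bij_betwE[OF g] that by blast
  show "similar (skew_laurent K \<tau>) (skew_poly K d \<alpha>) (skew_poly K d \<beta>)"
    unfolding similar_def module_isomorphic_def
    using A.left_module_Q B.left_module_Q g add
      A.P_linear_extension[OF A.left_module_Q B.left_module_Q gc add const x]
    by (intro conjI exI[of _ g]) blast+
qed

section \<open>Injective linear endomorphisms are surjective\<close>

context skew_companion
begin

definition lin_subspace :: "(nat \<Rightarrow> 'a) set \<Rightarrow> bool" where
  "lin_subspace W \<longleftrightarrow> W \<subseteq> Kd \<and> (\<lambda>i\<in>{1..d}. \<zero>) \<in> W \<and> (\<forall>u\<in>W. \<forall>v\<in>W. vadd u v \<in> W) \<and>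
    (\<forall>a\<in>carrier K. \<forall>u\<in>W. vscale a u \<in> W)"

text \<open>Induction on the number \<open>m\<close> of coordinates that may be nonzero. The
  subspaces where coordinate m + 1 vanishes stabilize by hypothesis; the chain itself can then drop
  at most once more, by losing that coordinate altogether.\<close>

lemma descending_subspaces_stabilize:
  assumes "\<And>n. lin_subspace (W n)" "\<And>n. W (Suc n) \<subseteq> W n" "m \<le> d"
    and "\<And>u i. u \<in> W 0 \<Longrightarrow> m < i \<Longrightarrow> i \<le> d \<Longrightarrow> u i = \<zero>"
  shows "\<exists>N. \<forall>n\<ge>N. W n = W N"
  using assms
proof (induction m arbitrary: W)
  case 0
  have sub0: "W n \<subseteq> W 0" for n using 0(2) by (induction n) auto
  have "u = (\<lambda>i\<in>{1..d}. \<zero>)" if "u \<in> W n" for u n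
  proof (rule Kd_eqI)
    show "u \<in> Kd" "(\<lambda>i\<in>{1..d}. \<zero>) \<in> Kd" using 0(1)[of n] that by (auto simp: lin_subspace_def)
    fix i assume "1 \<le> i" "i \<le> d"
    then show "u i = (\<lambda>i\<in>{1..d}. \<zero>) i" using 0(4)[of u i] sub0[of n] that by auto
  qed
  then have "W n = {\<lambda>i\<in>{1..d}. \<zero>}" for n using 0(1)[of n] unfolding lin_subspace_def by blast
  then show ?case by simp
next
  case (Suc m)
  let ?j = "Suc m"
  have j: "1 \<le> ?j" "?j \<le> d" using Suc.prems(3) by simp_all
  note sub = Suc.prems(1)[unfolded lin_subspace_def]
  have mono: "W b \<subseteq> W a" if "a \<le> b" for a b
    using that Suc.prems(2) by (rule lift_Suc_antimono_le[rotated])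
  define W' where "W' n = {u \<in> W n. u ?j = \<zero>}" for n
  have "\<exists>N. \<forall>n\<ge>N. W' n = W' N"
  proof (rule Suc.IH)
    show "lin_subspace (W' n)" for n
      using sub[of n] j by (auto simp: lin_subspace_def W'_def vadd_nth vscale_nth)
    show "W' (Suc n) \<subseteq> W' n" for n using Suc.prems(2)[of n] by (auto simp: W'_def)
    show "m \<le> d" using j by simp
    fix u i assume "u \<in> W' 0" "m < i" "i \<le> d"
    then show "u i = \<zero>" using Suc.prems(4)[of u i] by (cases "i = ?j") (auto simp: W'_def)
  qed
  then obtain N where N: "\<And>n. N \<le> n \<Longrightarrow> W' n = W' N" by blast
  show ?case
  \<comment> \<open>Either the coordinate vanishes on some later member, and from there on the two
    chains agree, or every later member keeps a vector \<open>u\<close> with a nonzero entry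
    there.\<close>
  proof (cases "\<exists>n\<ge>N. \<forall>u\<in>W n. u ?j = \<zero>")
    case True
    then obtain n where n: "N \<le> n" "\<forall>u\<in>W n. u ?j = \<zero>" by blast
    have "W k = W' k" if "n \<le> k" for k using n(2) mono[OF that] by (auto simp: W'_def)
    then have "W k = W n" if "n \<le> k" for k using N[of k] N[of n] n(1) that by simp
    then show ?thesis by blast
  next
    case False
    have "W n = W N" if n: "N \<le> n" for n
    proof
      show "W n \<subseteq> W N" using mono[OF n] .
      show "W N \<subseteq> W n"
      proof
        fix v assume v: "v \<in> W N"
        obtain u where u: "u \<in> W n" "u ?j \<noteq> \<zero>" using False n by blast
        have uN: "u \<in> W N" using u mono[OF n] by blast
        have vK: "v \<in> Kd" and uK: "u \<in> Kd" using sub[of N] v uN by blast+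
        have cl: "v ?j \<in> carrier K" "u ?j \<in> carrier K" using Kd_nth[OF vK j] Kd_nth[OF uK j] .
        have U: "u ?j \<in> Units K" using u(2) cl by (simp add: field_Units)
        \<comment> \<open>Subtracting \<open>a u\<close> clears entry \<open>?j\<close> of
          \<open>v\<close>, so the difference lies in the stabilized part and thus in
          \<open>W n\<close>. Adding \<open>a u\<close> back stays in \<open>W n\<close>.\<close>
        define a where "a = v ?j \<otimes> inv (u ?j)"
        have a: "a \<in> carrier K" using cl U by (simp add: a_def)
        let ?w = "vadd v (vscale (\<ominus> a) u)"
        have "?w \<in> W N" using sub[of N] v uN a by blast
        moreover have "?w ?j = \<zero>"
          using j cl U by (simp add: vadd_nth vscale_nth a_def l_minus m_assoc r_neg)
        ultimately have "?w \<in> W' N" by (simp add: W'_def)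
        then have "?w \<in> W' n" using N[OF n] by simp
        then have "?w \<in> W n" by (simp add: W'_def)
        then have "vadd ?w (vscale a u) \<in> W n" using sub[of n] u(1) a by blast
        moreover have "vadd ?w (vscale a u) = v"
        proof (rule Kd_eqI)
          fix i assume i: "1 \<le> i" "i \<le> d"
          then show "vadd ?w (vscale a u) i = v i"
            using a Kd_nth[OF vK i] Kd_nth[OF uK i] by (simp add: vadd_nth vscale_nth l_minus a_assoc l_neg)
        qed (use vK uK a in simp_all)
        ultimately show "v \<in> W n" by simp
      qed
    qed
    then show ?thesis by blast
  qed
qed

text \<open>The images of the powers of \<open>S\<close> descend and stabilize at some
  \<open>N\<close>. So the N-th power of \<open>S\<close> at \<open>v\<close> is its (N+1)-st power
  at some \<open>u\<close>, and injectivity of the N-th power gives v = S u.\<close>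

lemma injective_linear_surjective:
  assumes closed: "\<And>u. u \<in> Kd \<Longrightarrow> S u \<in> Kd"
    and add: "\<And>u v. \<lbrakk>u \<in> Kd; v \<in> Kd\<rbrakk> \<Longrightarrow> S (vadd u v) = vadd (S u) (S v)"
    and scale: "\<And>a u. \<lbrakk>a \<in> carrier K; u \<in> Kd\<rbrakk> \<Longrightarrow> S (vscale a u) = vscale a (S u)"
    and inj: "inj_on S Kd"
  shows "bij_betw S Kd Kd"
proof -
  define W where "W n = (S ^^ n) ` Kd" for n
  have pow: "(S ^^ n) u \<in> Kd" if "u \<in> Kd" for n u using that closed by (induction n) auto
  have pow_inj: "u = v" if "u \<in> Kd" "v \<in> Kd" "(S ^^ n) u = (S ^^ n) v" for n u v
    using that
  proof (induction n)
    case (Suc n)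
    then show ?case using inj_onD[OF inj, of "(S ^^ n) u" "(S ^^ n) v"] pow by simp
  qed simp
  have padd: "(S ^^ n) (vadd u v) = vadd ((S ^^ n) u) ((S ^^ n) v)" if "u \<in> Kd" "v \<in> Kd" for n u v
    using that add pow by (induction n) simp_all
  have pscale: "(S ^^ n) (vscale a u) = vscale a ((S ^^ n) u)" if "a \<in> carrier K" "u \<in> Kd" for n a u
    using that scale pow by (induction n) simp_all
  have zero: "vscale \<zero> u = (\<lambda>i\<in>{1..d}. \<zero>)" if "u \<in> Kd" for u
    using Kd_nth[OF that] unfolding vscale_def by (intro restrict_ext) simp
  have z: "(\<lambda>i\<in>{1..d}. \<zero>) \<in> Kd" by auto
  have "lin_subspace (W n)" for n
    unfolding lin_subspace_def
  proof (intro conjI ballI)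
    show "W n \<subseteq> Kd" using pow by (auto simp only: W_def)
    have "(S ^^ n) (\<lambda>i\<in>{1..d}. \<zero>) = (\<lambda>i\<in>{1..d}. \<zero>)"
      using pscale[of \<zero> "\<lambda>i\<in>{1..d}. \<zero>" n] zero[OF z] zero[OF pow[OF z]] z by simp
    then show "(\<lambda>i\<in>{1..d}. \<zero>) \<in> W n" using z unfolding W_def by (metis imageI)
    fix u assume "u \<in> W n"
    then obtain u' where u: "u' \<in> Kd" "u = (S ^^ n) u'" by (auto simp only: W_def)
    show "vscale a u \<in> W n" if "a \<in> carrier K" for a
      unfolding u(2) pscale[OF that u(1), symmetric] W_def using that u(1) by (intro imageI vscale_closed)
    fix v assume "v \<in> W n"
    then obtain v' where v: "v' \<in> Kd" "v = (S ^^ n) v'" by (auto simp only: W_def)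
    show "vadd u v \<in> W n"
      unfolding u(2) v(2) padd[OF u(1) v(1), symmetric] W_def using u(1) v(1) by (intro imageI vadd_closed)
  qed
  moreover have Suc_sub: "W (Suc n) \<subseteq> W n" for n
  proof -
    have "W (Suc n) = (S ^^ n) ` S ` Kd" unfolding W_def funpow_Suc_right image_comp ..
    also have "\<dots> \<subseteq> (S ^^ n) ` Kd" using closed by (intro image_mono) blast
    finally show ?thesis unfolding W_def .
  qed
  ultimately obtain N where N: "\<And>n. N \<le> n \<Longrightarrow> W n = W N"
    using descending_subspaces_stabilize[of W d] by (metis leD order_refl)
  have "Kd \<subseteq> S ` Kd"
  proof
    fix v assume v: "v \<in> Kd"
    have "(S ^^ N) v \<in> W (Suc N)" using N[of "Suc N"] v by (simp only: W_def le_SucI order_refl imageI)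
    then obtain u where "u \<in> Kd" "(S ^^ N) v = (S ^^ N) (S u)" by (auto simp only: W_def funpow_Suc_right comp_apply)
    then show "v \<in> S ` Kd" using pow_inj[OF v closed] by blast
  qed
  then show ?thesis using inj closed by (auto simp only: bij_betw_def)
qed

end

section \<open>Admissible forms\<close>

context gwa_orbit
begin

lemma term_star_terms: "a \<in> T \<Longrightarrow> term_star star a \<in> T"
  by (induction a) simp_all

text \<open>The defining relations are stable under the involution. Since it reverses products and
  exchanges X and Y, left and right unit laws and the two distributive laws change places, and each
  commutation relation becomes the other one read backwards, for a conjugated and shifted
  coefficient.\<close>

lemma term_star_gwa_eq: "geq a b \<Longrightarrow> geq (term_star star a) (term_star star b)"
proof (induction rule: gwa_eq.induct)
  case (coeff_add r s)
  then show ?case using ring_hom_add[OF star_hom] gwa_eq.coeff_add[of "star r" R "star s" \<sigma> t] by simp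
next
  case (coeff_mult r s)
  then show ?case
    using ring_hom_mult[OF star_hom, of s r] gwa_eq.coeff_mult[of "star s" R "star r" \<sigma> t] by (simp add: m_comm)
next
  case YX
  then show ?case using gwa_eq.YX by simp
next
  case XY
  then show ?case using gwa_eq.XY sigma_star[of t] by simp
next
  case (X_coeff r)
  have "sinv (star (\<sigma> r)) = star r" using X_coeff sinv_star[of "\<sigma> r"] by simp
  then show ?case using X_coeff gwa_eq.sym[OF gwa_eq.Y_coeff[of "star (\<sigma> r)" R \<sigma> t]] by simp
next
  case (Y_coeff r)
  have "\<sigma> (star (sinv r)) = star r" using Y_coeff sigma_star[of "sinv r"] by simp
  then show ?case using Y_coeff gwa_eq.sym[OF gwa_eq.X_coeff[of "star (sinv r)" R \<sigma> t]] by simp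
next
  case (sym a b)
  show ?case using sym(2) by (rule gwa_eq.sym)
next
  case (trans a b c)
  then show ?case by (blast intro: gwa_eq.trans)
next
  case (add_zero a)
  then show ?case
    using ring_hom_zero[OF star_hom ring_axioms ring_axioms] gwa_eq.add_zero[OF term_star_terms[OF add_zero]] by simp
next
  case (add_neg a)
  then show ?case
    using ring_hom_zero[OF star_hom ring_axioms ring_axioms] gwa_eq.add_neg[OF term_star_terms[OF add_neg]] by simp
next
  case (mul_one_left a)
  then show ?case using ring_hom_one[OF star_hom] gwa_eq.mul_one_right[OF term_star_terms[OF mul_one_left]] by simp
next
  case (mul_one_right a)
  then show ?case using ring_hom_one[OF star_hom] gwa_eq.mul_one_left[OF term_star_terms[OF mul_one_right]] by simp
next
  case (mul_assoc a b c)
  then show ?case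
    using gwa_eq.sym[OF gwa_eq.mul_assoc[of "term_star star c" R "term_star star b" "term_star star a"]]
      term_star_terms by simp
qed (simp_all add: term_star_terms gwa_eq.refl gwa_eq.add_cong gwa_eq.neg_cong gwa_eq.mul_cong
    gwa_eq.add_assoc gwa_eq.add_comm gwa_eq.distrib_left gwa_eq.distrib_right)

lemma gwa_star_class: "a \<in> T \<Longrightarrow> gwa_star R star \<sigma> t (cls a) = cls (term_star star a)"
proof -
  assume a: "a \<in> T"
  have "cls (term_star star b) = cls (term_star star a)" if "b \<in> cls a" for b
  proof -
    have "geq a b" using that by (simp add: gwa_class_def)
    then show ?thesis by (rule gwa_class_eqI[OF gwa_eq.sym[OF term_star_gwa_eq]])
  qed
  then show ?thesis unfolding gwa_star_def using gwa_class_mem[OF a] by blast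
qed

end

section \<open>Admissible forms as homomorphisms into the dual\<close>

context gwa_orbit_rep
begin

text \<open>Induction on homogeneous terms. For X and Y the degree condition is the definition of
  the action on the dual; for products the shifts add up, while the involution reverses the factors
  as moving them across the form does.\<close>

lemma form_of_dual_hom:
  assumes closed: "\<And>v. v \<in> carrier M \<Longrightarrow> h v \<in> carrier DM"
    and add: "\<And>v w. \<lbrakk>v \<in> carrier M; w \<in> carrier M\<rbrakk> \<Longrightarrow> h (v \<oplus>\<^bsub>M\<^esub> w) = h v \<oplus>\<^bsub>DM\<^esub> h w"
    and smult: "\<And>r v. \<lbrakk>r \<in> carrier R; v \<in> carrier M\<rbrakk> \<Longrightarrow> h (r \<odot>\<^bsub>M\<^esub> v) = r \<odot>\<^bsub>DM\<^esub> h v"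
    and X: "\<And>v. v \<in> carrier M \<Longrightarrow> h (X v) = DX (h v)" and Y: "\<And>v. v \<in> carrier M \<Longrightarrow> h (Y v) = DY (h v)"
  shows "admissible_form R star \<sigma> t \<omega> VV h"
proof -
  interpret O: module R R\<omega> by (rule module_R_omega)
  have c: "h v w \<in> carrier R\<omega>" if "v \<in> carrier M" "w \<in> carrier M" for v w
    using DM_D(1)[OF closed] that by simp
  have a1: "h (v \<oplus>\<^bsub>M\<^esub> v') w = h v w \<oplus>\<^bsub>R\<omega>\<^esub> h v' w" if "v \<in> carrier M" "v' \<in> carrier M" "w \<in> carrier M" for v v' w
    using that by (simp only: add DM_ops)
  have a2: "h v (w \<oplus>\<^bsub>M\<^esub> w') = h v w \<oplus>\<^bsub>R\<omega>\<^esub> h v w'" if "v \<in> carrier M" "w \<in> carrier M" "w' \<in> carrier M" for v w w'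
    using DM_D(2)[OF closed] that by simp
  have s1: "h (r \<odot>\<^bsub>M\<^esub> v) w = r \<odot>\<^bsub>R\<omega>\<^esub> h v w" if "r \<in> carrier R" "v \<in> carrier M" "w \<in> carrier M" for r v w
    using that by (simp only: smult DM_ops closed)
  have s2: "h v (r \<odot>\<^bsub>M\<^esub> w) = star r \<odot>\<^bsub>R\<omega>\<^esub> h v w" if "r \<in> carrier R" "v \<in> carrier M" "w \<in> carrier M" for r v w
    using DM_D(3)[OF closed] that by simp
  \<comment> \<open>Negation is treated as the scalar -1, which conjugation and all shifts
    fix.\<close>
  have m1: "h (\<ominus>\<^bsub>M\<^esub> v) w = (\<ominus> \<one>) \<odot>\<^bsub>R\<omega>\<^esub> h v w" if "v \<in> carrier M" "w \<in> carrier M" for v w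
    using s1[of "\<ominus> \<one>" v w] that smult_l_minus[of \<one> v] by simp
  have st1: "star (\<ominus> \<one>) = \<ominus> \<one>" "sg n (\<ominus> \<one>) = \<ominus> \<one>" for n
  proof -
    interpret st: ring_hom_ring R R star using star_hom ring_axioms by (simp add: ring_hom_ringI2)
    interpret sgr: ring_hom_ring R R "sg n" using sg_hom ring_axioms by (simp add: ring_hom_ringI2)
    show "star (\<ominus> \<one>) = \<ominus> \<one>" "sg n (\<ominus> \<one>) = \<ominus> \<one>" by simp_all
  qed
  have m2: "h v (\<ominus>\<^bsub>M\<^esub> w) = (\<ominus> \<one>) \<odot>\<^bsub>R\<omega>\<^esub> h v w" if "v \<in> carrier M" "w \<in> carrier M" for v w
    using s2[of "\<ominus> \<one>" v w] that smult_l_minus[of \<one> w] st1 by simp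
  have deg: "h (act e v) w = so n (h v (act (term_star star e) w))"
    if "homogeneous_term n e" "e \<in> T" "v \<in> carrier M" "w \<in> carrier M" for n e v w
    using that
  proof (induction arbitrary: v w rule: homogeneous_term.induct)
    case (1 r)
    then show ?case using c by (simp add: s1 s2 so_0)
  next
    case 2
    then show ?case by (simp only: term_act.simps term_star.simps X DM_ops)
  next
    case 3
    then show ?case by (simp only: term_act.simps term_star.simps Y DM_ops)
  next
    case (4 n a b)
    then show ?case using c term_star_terms by (simp add: a1 a2 so_add)
  next
    case (5 n a)
    then show ?case using c term_star_terms by (simp add: m1 m2 so_smult st1)
  next
    case (6 m a n b)
    then show ?case using c term_star_terms by (simp add: so_plus)
  qed
  show ?thesis
    unfolding admissible_form_def
  proof (intro conjI ballI allI)
    fix n a v w assume a: "a \<in> gwa_degree R \<sigma> t n" and v: "v \<in> carrier VV" and w: "w \<in> carrier VV"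
    then obtain e where e: "e \<in> T" "homogeneous_term n e" "a = cls e" by (auto simp: gwa_degree_def)
    show "h (a \<odot>\<^bsub>VV\<^esub> v) w = so n (h v (gwa_star R star \<sigma> t a \<odot>\<^bsub>VV\<^esub> w))"
      using deg[OF e(2,1)] v w e(1) term_star_terms[OF e(1)]
      by (simp add: e(3) gwa_star_class smult_gwa_module)
  qed (simp_all add: c a1 a2 s1)
qed

text \<open>The curried form. The degree condition for X and Y is equivariance once they are seen to
  act on the dual through the other argument.\<close>

lemma dual_hom_of_form:
  assumes F: "admissible_form R star \<sigma> t \<omega> VV F"
  defines "h \<equiv> \<lambda>v. \<lambda>w\<in>carrier M. F v w"
  shows "v \<in> carrier M \<Longrightarrow> h v \<in> carrier DM"
    and "\<lbrakk>v \<in> carrier M; w \<in> carrier M\<rbrakk> \<Longrightarrow> h (v \<oplus>\<^bsub>M\<^esub> w) = h v \<oplus>\<^bsub>DM\<^esub> h w"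
    and "\<lbrakk>r \<in> carrier R; v \<in> carrier M\<rbrakk> \<Longrightarrow> h (r \<odot>\<^bsub>M\<^esub> v) = r \<odot>\<^bsub>DM\<^esub> h v"
    and "v \<in> carrier M \<Longrightarrow> h (Y v) = DY (h v)"
proof -
  interpret O: module R R\<omega> by (rule module_R_omega)
  have c: "F v w \<in> carrier R\<omega>" if "v \<in> carrier M" "w \<in> carrier M" for v w
    using F that by (simp add: admissible_form_def)
  have a1: "F (v \<oplus>\<^bsub>M\<^esub> v') w = F v w \<oplus>\<^bsub>R\<omega>\<^esub> F v' w" if "v \<in> carrier M" "v' \<in> carrier M" "w \<in> carrier M" for v v' w
    using F that by (simp add: admissible_form_def)
  have a2: "F v (w \<oplus>\<^bsub>M\<^esub> w') = F v w \<oplus>\<^bsub>R\<omega>\<^esub> F v w'" if "v \<in> carrier M" "w \<in> carrier M" "w' \<in> carrier M" for v w w'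
    using F that by (simp add: admissible_form_def)
  have "\<forall>r\<in>carrier R. \<forall>v\<in>carrier VV. \<forall>w\<in>carrier VV. F (gwa_coeff R \<sigma> t r \<odot>\<^bsub>VV\<^esub> v) w = r \<odot>\<^bsub>R\<omega>\<^esub> F v w"
    using F unfolding admissible_form_def by blast
  then have s1: "F (r \<odot>\<^bsub>M\<^esub> v) w = r \<odot>\<^bsub>R\<omega>\<^esub> F v w" if "r \<in> carrier R" "v \<in> carrier M" "w \<in> carrier M" for r v w
    using that by force
  have "\<forall>n. \<forall>a\<in>gwa_degree R \<sigma> t n. \<forall>v\<in>carrier VV. \<forall>w\<in>carrier VV.
      F (a \<odot>\<^bsub>VV\<^esub> v) w = so n (F v (gwa_star R star \<sigma> t a \<odot>\<^bsub>VV\<^esub> w))"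
    using F unfolding admissible_form_def by blast
  then have deg: "F (act e v) w = so n (F v (act (term_star star e) w))"
    if "homogeneous_term n e" "e \<in> T" "v \<in> carrier M" "w \<in> carrier M" for n e v w
  proof -
    assume *: "\<forall>n. \<forall>a\<in>gwa_degree R \<sigma> t n. \<forall>v\<in>carrier VV. \<forall>w\<in>carrier VV.
      F (a \<odot>\<^bsub>VV\<^esub> v) w = so n (F v (gwa_star R star \<sigma> t a \<odot>\<^bsub>VV\<^esub> w))"
    have "cls e \<in> gwa_degree R \<sigma> t n" using that by (auto simp: gwa_degree_def)
    then have "F (cls e \<odot>\<^bsub>VV\<^esub> v) w = so n (F v (gwa_star R star \<sigma> t (cls e) \<odot>\<^bsub>VV\<^esub> w))"
      using * that by simp
    then show ?thesis
      using that term_star_terms[OF that(2)] by (simp add: gwa_star_class smult_gwa_module)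
  qed
  \<comment> \<open>Conjugate-linearity in the second argument is the degree condition for the
    coefficient \<open>star r\<close>, which has degree 0 and hence no shift.\<close>
  have s2: "F v (r \<odot>\<^bsub>M\<^esub> w) = star r \<odot>\<^bsub>R\<omega>\<^esub> F v w" if r: "r \<in> carrier R" and v: "v \<in> carrier M" and w: "w \<in> carrier M" for r v w
  proof -
    have "F (star r \<odot>\<^bsub>M\<^esub> v) w = so 0 (F v (r \<odot>\<^bsub>M\<^esub> w))"
      using deg[OF homogeneous_term.intros(1)[of "star r"] _ v w] r by simp
    then show ?thesis using s1[OF star_closed[OF r] v w] so_0 c[OF v] r w by simp
  qed
  have dY: "F (Y v) w = so (- 1) (F v (X w))" if "v \<in> carrier M" "w \<in> carrier M" for v w
    using deg[OF homogeneous_term.intros(3) _ that] by simp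
  have mem: "h v \<in> carrier DM" if "v \<in> carrier M" for v
    unfolding h_def using that by (intro DM_I) (simp_all add: c a2 s2)
  then show "v \<in> carrier M \<Longrightarrow> h v \<in> carrier DM" .
  have hn: "h v w = F v w" if "w \<in> carrier M" for v w using that by (simp add: h_def)
  show "h (v \<oplus>\<^bsub>M\<^esub> w) = h v \<oplus>\<^bsub>DM\<^esub> h w" if "v \<in> carrier M" "w \<in> carrier M"
    using that mem by (intro DM_eqI DM_closed) (simp_all add: DM_ops hn a1)
  show "h (r \<odot>\<^bsub>M\<^esub> v) = r \<odot>\<^bsub>DM\<^esub> h v" if "r \<in> carrier R" "v \<in> carrier M"
    using that mem by (intro DM_eqI DM_closed) (simp_all add: DM_ops hn s1)
  show "h (Y v) = DY (h v)" if v: "v \<in> carrier M"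
  proof (rule DM_eqI)
    show "h (Y v) \<in> carrier DM" "DY (h v) \<in> carrier DM" using v mem DM_closed(5) by simp_all
    fix w assume w: "w \<in> carrier M"
    have "DY (h v) w = so (- 1) (h v (X w))" using w by (simp only: DM_ops)
    then show "h (Y v) w = DY (h v) w" using v w by (simp only: hn dY X_closed)
  qed
qed

end

section \<open>Weight decomposition of V(omega, f), and forms against intertwiners\<close>

context gwa_V
begin

lemma single_outside: "\<mm> \<notin> \<omega> \<Longrightarrow> single \<mm> u = \<zero>\<^bsub>VM\<^esub>"
proof -
  assume "\<mm> \<notin> \<omega>"
  then have "single \<mm> u = (\<lambda>\<nn>\<in>\<omega>. \<zero>\<^bsub>Wd d \<nn>\<^esub>)" unfolding single_def by (intro restrict_ext) auto
  then show ?thesis unfolding VM_eq direct_sum_simps[OF finite_orbit] .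
qed

lemma weight_space_V:
  assumes \<mm>: "maximalideal \<mm> R"
  shows "weight_space R \<sigma> t VR.VV \<mm> = {v \<in> carrier VM. \<forall>r\<in>\<mm>. r \<odot>\<^bsub>VM\<^esub> v = \<zero>\<^bsub>VM\<^esub>}"
proof -
  interpret m: maximalideal \<mm> R by fact
  have "(\<forall>r\<in>\<mm>. gwa_coeff R \<sigma> t r \<odot>\<^bsub>VR.VV\<^esub> v = \<zero>\<^bsub>VR.VV\<^esub>) \<longleftrightarrow> (\<forall>r\<in>\<mm>. r \<odot>\<^bsub>VM\<^esub> v = \<zero>\<^bsub>VM\<^esub>)"
    if "v \<in> carrier VM" for v
    using that m.Icarr by (intro ball_cong HOL.refl) simp
  then show ?thesis unfolding weight_space_def by auto
qed

lemma weight_space_single: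
  assumes \<mm>: "maximalideal \<mm> R" and v: "v \<in> weight_space R \<sigma> t VR.VV \<mm>"
  shows "v = single \<mm> (v \<mm>)"
proof -
  have v: "v \<in> carrier VM" "\<forall>r\<in>\<mm>. r \<odot>\<^bsub>VM\<^esub> v = \<zero>\<^bsub>VM\<^esub>"
    using v unfolding weight_space_V[OF \<mm>] by simp_all
  have off: "v \<nn> = \<zero>\<^bsub>Wd d \<nn>\<^esub>" if "\<nn> \<in> \<omega>" "\<nn> \<noteq> \<mm>" for \<nn>
    using weight_vector_iff[OF v(1) \<mm>] v(2) that by blast
  show ?thesis
  proof (cases "\<mm> \<in> \<omega>")
    case True
    show ?thesis
      using off by (intro VM_eqI[OF v(1) single_closed[OF True VM_nth[OF v(1) True]]]) (simp add: single_nth)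
  next
    case False
    then show ?thesis
      using off by (intro VM_eqI[OF v(1)]) (auto simp: single_outside zero_VM_nth)
  qed
qed

lemma single_weight_space:
  assumes \<mm>: "maximalideal \<mm> R" and u: "\<mm> \<in> \<omega> \<Longrightarrow> u \<in> carrier (Wd d \<mm>)"
  shows "single \<mm> u \<in> weight_space R \<sigma> t VR.VV \<mm>"
proof -
  have c: "single \<mm> u \<in> carrier VM"
    by (cases "\<mm> \<in> \<omega>") (simp_all add: single_closed u single_outside)
  then show ?thesis
    using weight_vector_iff[OF c \<mm>] unfolding weight_space_V[OF \<mm>] by (simp add: single_nth)
qed

lemma finsum_V_nth:
  assumes "finite A" "\<And>\<mm>. \<mm> \<in> A \<Longrightarrow> u \<mm> \<in> carrier VM" and \<nn>: "\<nn> \<in> \<omega>"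
    and off: "\<And>\<mm>. \<mm> \<in> A \<Longrightarrow> \<mm> \<noteq> \<nn> \<Longrightarrow> u \<mm> \<nn> = \<zero>\<^bsub>Wd d \<nn>\<^esub>"
  shows "finsum VR.VV u A \<in> carrier VM \<and> finsum VR.VV u A \<nn> = (if \<nn> \<in> A then u \<nn> \<nn> else \<zero>\<^bsub>Wd d \<nn>\<^esub>)"
  using assms(1,2) off
proof (induction A rule: finite_induct)
  case empty
  interpret VV: abelian_group VR.VV by (rule VR.abelian_group_gwa_module)
  show ?case using \<nn> by (simp add: zero_VM_nth)
next
  case (insert \<mm> A)
  interpret VV: abelian_group VR.VV by (rule VR.abelian_group_gwa_module)
  interpret W: module R "Wd d \<nn>" using \<nn> by (rule module_Wd)
  have IH: "finsum VR.VV u A \<in> carrier VM" "finsum VR.VV u A \<nn> = (if \<nn> \<in> A then u \<nn> \<nn> else \<zero>\<^bsub>Wd d \<nn>\<^esub>)"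
    using insert by simp_all
  have eq: "finsum VR.VV u (insert \<mm> A) = u \<mm> \<oplus>\<^bsub>VM\<^esub> finsum VR.VV u A"
    using insert.hyps insert.prems(1) by (simp add: Pi_def)
  have c: "u \<mm> \<nn> \<in> carrier (Wd d \<nn>)" "finsum VR.VV u A \<nn> \<in> carrier (Wd d \<nn>)"
    using VM_nth[OF _ \<nn>] insert.prems(1) IH(1) by simp_all
  show ?case
  proof
    show "finsum VR.VV u (insert \<mm> A) \<in> carrier VM" unfolding eq using insert.prems(1) IH(1) by simp
    show "finsum VR.VV u (insert \<mm> A) \<nn> = (if \<nn> \<in> insert \<mm> A then u \<nn> \<nn> else \<zero>\<^bsub>Wd d \<nn>\<^esub>)"
    proof (cases "\<mm> = \<nn>")
      case True
      then have "finsum VR.VV u A \<nn> = \<zero>\<^bsub>Wd d \<nn>\<^esub>" using IH(2) insert.hyps(2) by simp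
      then show ?thesis unfolding eq add_VM_nth[OF \<nn>] using True W.M.r_zero[OF c(1)] by (simp only: insert_iff simp_thms if_True)
    next
      case False
      then have "u \<mm> \<nn> = \<zero>\<^bsub>Wd d \<nn>\<^esub>" using insert.prems(2) by simp
      then have "(u \<mm> \<oplus>\<^bsub>VM\<^esub> finsum VR.VV u A) \<nn> = finsum VR.VV u A \<nn>"
        unfolding add_VM_nth[OF \<nn>] using W.M.l_zero[OF c(2)] by (simp only:)
      then show ?thesis unfolding eq IH(2) using False by simp
    qed
  qed
qed

text \<open>A family of weight vectors is known from its diagonal \<open>u \<mm> \<mm>\<close>, and
  its sum at \<open>\<nn>\<close> has value \<open>u \<nn> \<nn>\<close>. This yields the
  decomposition of \<open>v\<close> into the vectors \<open>single \<mm> (v \<mm>)\<close> as well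
  as its uniqueness; outside the orbit weight vectors vanish.\<close>

lemma weight_module_V: "weight_module R \<sigma> t VR.VV"
  unfolding weight_module_def
proof (intro conjI ballI)
  show "left_module (gwa R \<sigma> t) VR.VV" by (rule VR.left_module_gwa_module)
  fix v assume "v \<in> carrier VR.VV"
  then have v: "v \<in> carrier VM" by simp
  have max: "\<mm> \<in> Max_spec R" if "\<mm> \<in> \<omega>" for \<mm> using orbit_max[OF that] by (simp add: Max_spec_def)
  let ?P = "\<lambda>u. u \<in> (\<Pi>\<^sub>E \<mm>\<in>Max_spec R. weight_space R \<sigma> t VR.VV \<mm>) \<and>
    finite {\<mm> \<in> Max_spec R. u \<mm> \<noteq> \<zero>\<^bsub>VR.VV\<^esub>} \<and> v = finsum VR.VV u {\<mm> \<in> Max_spec R. u \<mm> \<noteq> \<zero>\<^bsub>VR.VV\<^esub>}"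
  have comp: "finsum VR.VV u {\<mm> \<in> Max_spec R. u \<mm> \<noteq> \<zero>\<^bsub>VR.VV\<^esub>} \<nn> = u \<nn> \<nn>
      \<and> finsum VR.VV u {\<mm> \<in> Max_spec R. u \<mm> \<noteq> \<zero>\<^bsub>VR.VV\<^esub>} \<in> carrier VM"
    if u: "u \<in> (\<Pi>\<^sub>E \<mm>\<in>Max_spec R. weight_space R \<sigma> t VR.VV \<mm>)"
      and fin: "finite {\<mm> \<in> Max_spec R. u \<mm> \<noteq> \<zero>\<^bsub>VR.VV\<^esub>}" and \<nn>: "\<nn> \<in> \<omega>" for u \<nn>
  proof -
    let ?A = "{\<mm> \<in> Max_spec R. u \<mm> \<noteq> \<zero>\<^bsub>VR.VV\<^esub>}"
    have ws: "u \<mm> \<in> weight_space R \<sigma> t VR.VV \<mm>" if "\<mm> \<in> Max_spec R" for \<mm> using u that by auto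
    have sg: "u \<mm> = single \<mm> (u \<mm> \<mm>)" if "\<mm> \<in> Max_spec R" for \<mm>
      using weight_space_single[OF _ ws[OF that]] that by (simp add: Max_spec_def)
    have "finsum VR.VV u ?A \<in> carrier VM \<and> finsum VR.VV u ?A \<nn> = (if \<nn> \<in> ?A then u \<nn> \<nn> else \<zero>\<^bsub>Wd d \<nn>\<^esub>)"
    proof (rule finsum_V_nth[OF fin _ \<nn>])
      show "u \<mm> \<in> carrier VM" if "\<mm> \<in> ?A" for \<mm> using ws[of \<mm>] that by (simp add: weight_space_def)
      show "u \<mm> \<nn> = \<zero>\<^bsub>Wd d \<nn>\<^esub>" if "\<mm> \<in> ?A" "\<mm> \<noteq> \<nn>" for \<mm>
      proof -
        have "single \<mm> (u \<mm> \<mm>) \<nn> = \<zero>\<^bsub>Wd d \<nn>\<^esub>" using single_nth[OF \<nn>] that(2) by simp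
        then show ?thesis using sg[of \<mm>] that(1) by simp
      qed
    qed
    moreover have "u \<nn> \<nn> = \<zero>\<^bsub>Wd d \<nn>\<^esub>" if "\<nn> \<notin> ?A"
    proof -
      have "u \<nn> = \<zero>\<^bsub>VM\<^esub>" using that max[OF \<nn>] by simp
      then show ?thesis using zero_VM_nth[OF \<nn>] by simp
    qed
    ultimately show ?thesis by auto
  qed
  show "\<exists>!u. ?P u"
  proof (rule ex1I)
    let ?u = "\<lambda>\<mm>\<in>Max_spec R. single \<mm> (v \<mm>)"
    have u: "?u \<in> (\<Pi>\<^sub>E \<mm>\<in>Max_spec R. weight_space R \<sigma> t VR.VV \<mm>)"
      using single_weight_space VM_nth[OF v] by (auto simp: Max_spec_def)
    have "{\<mm> \<in> Max_spec R. ?u \<mm> \<noteq> \<zero>\<^bsub>VR.VV\<^esub>} \<subseteq> \<omega>" using single_outside by auto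
    then have fin: "finite {\<mm> \<in> Max_spec R. ?u \<mm> \<noteq> \<zero>\<^bsub>VR.VV\<^esub>}" using finite_orbit by (rule finite_subset)
    have "v = finsum VR.VV ?u {\<mm> \<in> Max_spec R. ?u \<mm> \<noteq> \<zero>\<^bsub>VR.VV\<^esub>}"
    proof (rule VM_eqI[OF v])
      show "finsum VR.VV ?u {\<mm> \<in> Max_spec R. ?u \<mm> \<noteq> \<zero>\<^bsub>VR.VV\<^esub>} \<in> carrier VM"
        using comp[OF u fin m\<omega>] by blast
      fix \<nn> assume \<nn>: "\<nn> \<in> \<omega>"
      have "finsum VR.VV ?u {\<mm> \<in> Max_spec R. ?u \<mm> \<noteq> \<zero>\<^bsub>VR.VV\<^esub>} \<nn> = ?u \<nn> \<nn>"
        using comp[OF u fin \<nn>] by blast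
      also have "\<dots> = v \<nn>" using max[OF \<nn>] \<nn> by (simp add: single_nth)
      finally show "v \<nn> = finsum VR.VV ?u {\<mm> \<in> Max_spec R. ?u \<mm> \<noteq> \<zero>\<^bsub>VR.VV\<^esub>} \<nn>" by (rule HOL.sym)
    qed
    then show "?P ?u" using u fin by blast
    fix w assume w: "?P w"
    show "w = ?u"
    proof (rule PiE_ext)
      show "w \<in> (\<Pi>\<^sub>E \<mm>\<in>Max_spec R. weight_space R \<sigma> t VR.VV \<mm>)" using w by blast
      show "?u \<in> (\<Pi>\<^sub>E \<mm>\<in>Max_spec R. weight_space R \<sigma> t VR.VV \<mm>)" by (rule u)
      fix \<mm> assume \<mm>: "\<mm> \<in> Max_spec R"
      then have mx: "maximalideal \<mm> R" by (simp add: Max_spec_def)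
      have "w \<mm> \<in> weight_space R \<sigma> t VR.VV \<mm>" using w \<mm> by auto
      from weight_space_single[OF mx this] have s: "w \<mm> = single \<mm> (w \<mm> \<mm>)" .
      show "w \<mm> = ?u \<mm>"
      proof (cases "\<mm> \<in> \<omega>")
        case True
        have "v \<mm> = w \<mm> \<mm>" using w comp[of w \<mm>] True by metis
        then show ?thesis using s \<mm> by simp
      next
        case False
        then show ?thesis using s \<mm> by (simp add: single_outside)
      qed
    qed
  qed
qed

lemma weight_support_V: "weight_support R \<sigma> t VR.VV \<subseteq> \<omega>"
proof
  fix \<mm> assume "\<mm> \<in> weight_support R \<sigma> t VR.VV"
  then have mx: "maximalideal \<mm> R" and ne: "weight_space R \<sigma> t VR.VV \<mm> \<noteq> {\<zero>\<^bsub>VR.VV\<^esub>}"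
    by (simp_all add: weight_support_def Max_spec_def)
  show "\<mm> \<in> \<omega>"
  proof (rule ccontr)
    assume out: "\<mm> \<notin> \<omega>"
    have "v = \<zero>\<^bsub>VM\<^esub>" if "v \<in> weight_space R \<sigma> t VR.VV \<mm>" for v
      using weight_space_single[OF mx that] single_outside[OF out] by metis
    moreover have "\<zero>\<^bsub>VM\<^esub> \<in> weight_space R \<sigma> t VR.VV \<mm>"
      using single_weight_space[OF mx, of undefined] out single_outside[OF out] by simp
    ultimately have "weight_space R \<sigma> t VR.VV \<mm> = {\<zero>\<^bsub>VM\<^esub>}" by blast
    then show False using ne by simp
  qed
qed

text \<open>The conjugate of a nonzero coordinate of \<open>v\<close>, placed in the component of
  its point, is such a functional. It serves the second argument in non-degeneracy.\<close>

lemma dual_separates: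
  assumes v: "v \<in> carrier VM" and nz: "v \<noteq> \<zero>\<^bsub>VM\<^esub>"
  shows "\<exists>\<phi>\<in>carrier VR.DM. \<phi> v \<noteq> \<zero>\<^bsub>R\<omega>\<^esub>"
proof -
  interpret O: module R R\<omega> by (rule module_R_omega)
  have "\<exists>\<mm>\<in>\<omega>. v \<mm> \<noteq> \<zero>\<^bsub>Wd d \<mm>\<^esub>"
  proof (rule ccontr)
    assume "\<not> ?thesis"
    then have "v = \<zero>\<^bsub>VM\<^esub>" using v by (intro VM_eqI) (simp_all add: zero_VM_nth)
    then show False using nz by simp
  qed
  then obtain \<mm> where \<mm>: "\<mm> \<in> \<omega>" "v \<mm> \<noteq> \<zero>\<^bsub>Wd d \<mm>\<^esub>" by blast
  interpret F: field "Km \<mm>" using \<mm>(1) by (rule Km_field)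
  interpret st: ring_hom_ring "Km \<mm>" "Km \<mm>" "(`) star"
    using star_Km_hom[OF \<mm>(1)] F.ring_axioms by (simp add: ring_hom_ringI2)
  have comp: "x \<mm> i \<in> carrier (Km \<mm>)" if "x \<in> carrier VM" "i \<in> {1..d}" for x i
    using VM_nth[OF that(1) \<mm>(1)] that(2) unfolding Wd_simps by (rule PiE_mem)
  have "\<exists>i\<in>{1..d}. v \<mm> i \<noteq> \<zero>\<^bsub>Km \<mm>\<^esub>"
  proof (rule ccontr)
    assume "\<not> ?thesis"
    moreover have "v \<mm> \<in> {1..d} \<rightarrow>\<^sub>E carrier (Km \<mm>)" using VM_nth[OF v \<mm>(1)] unfolding Wd_simps .
    ultimately have "v \<mm> = (\<lambda>i\<in>{1..d}. \<zero>\<^bsub>Km \<mm>\<^esub>)" by (intro PiE_ext) auto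
    then show False using \<mm>(2) unfolding Wd_simps by simp
  qed
  then obtain i where i: "i \<in> {1..d}" "v \<mm> i \<noteq> \<zero>\<^bsub>Km \<mm>\<^esub>" by blast
  define g where "g x = (\<lambda>\<nn>\<in>\<omega>. if \<nn> = \<mm> then star ` x \<mm> i else \<zero>\<^bsub>Km \<nn>\<^esub>)" for x :: "'a set \<Rightarrow> nat \<Rightarrow> 'a set"
  have zn: "\<zero>\<^bsub>R\<omega>\<^esub> \<nn> = \<zero>\<^bsub>Km \<nn>\<^esub>" if "\<nn> \<in> \<omega>" for \<nn> using that by (simp add: R_omega_simps)
  have gc: "g x \<in> carrier R\<omega>" if "x \<in> carrier VM" for x
  proof -
    have "\<zero>\<^bsub>Km \<nn>\<^esub> \<in> carrier (Km \<nn>)" if "\<nn> \<in> \<omega>" for \<nn>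
      using R_omega_nth[OF O.M.zero_closed that] zn[OF that] by simp
    then show ?thesis using comp[OF that i(1)] by (simp add: g_def R_omega_simps(1))
  qed
  have mem: "(\<lambda>x\<in>carrier VM. g x) \<in> carrier VR.DM"
  proof (rule VR.DM_I)
    fix x y assume x: "x \<in> carrier VM" and y: "y \<in> carrier VM"
    show "g (x \<oplus>\<^bsub>VM\<^esub> y) = g x \<oplus>\<^bsub>R\<omega>\<^esub> g y"
    proof (rule R_omega_eqI)
      fix \<nn> assume \<nn>: "\<nn> \<in> \<omega>"
      interpret N: field "Km \<nn>" using \<nn> by (rule Km_field)
      show "g (x \<oplus>\<^bsub>VM\<^esub> y) \<nn> = (g x \<oplus>\<^bsub>R\<omega>\<^esub> g y) \<nn>"
        using \<nn> i(1) comp[OF x i(1)] comp[OF y i(1)]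
        by (cases "\<nn> = \<mm>") (simp_all add: g_def R_omega_simps(3) add_VM_nth Wd_simps(3))
    qed (use x y gc in simp_all)
  next
    fix r x assume r: "r \<in> carrier R" and x: "x \<in> carrier VM"
    show "g (r \<odot>\<^bsub>VM\<^esub> x) = star r \<odot>\<^bsub>R\<omega>\<^esub> g x"
    proof (rule R_omega_eqI)
      fix \<nn> assume \<nn>: "\<nn> \<in> \<omega>"
      interpret N: field "Km \<nn>" using \<nn> by (rule Km_field)
      show "g (r \<odot>\<^bsub>VM\<^esub> x) \<nn> = (star r \<odot>\<^bsub>R\<omega>\<^esub> g x) \<nn>"
        using \<nn> i(1) comp[OF x i(1)] coset_closed[OF \<nn>, of r] coset_closed[OF \<nn>, of "star r"] r star_coset[OF \<nn> r]
        by (cases "\<nn> = \<mm>") (simp_all add: g_def R_omega_simps(4) smult_VM_nth Wd_simps(4))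
    qed (use r x gc in simp_all)
  qed (rule gc)
  have sub: "v \<mm> i \<subseteq> carrier R" using Km_subset[OF \<mm>(1) comp[OF v i(1)]] .
  have "star ` star ` v \<mm> i = v \<mm> i"
  proof -
    have "(\<lambda>x. star (star x)) ` v \<mm> i = (\<lambda>x. x) ` v \<mm> i" using sub by (intro image_cong) auto
    then show ?thesis by (simp add: image_image)
  qed
  then have "star ` v \<mm> i \<noteq> \<zero>\<^bsub>Km \<mm>\<^esub>" using i(2) st.hom_zero by metis
  then have "g v \<mm> \<noteq> \<zero>\<^bsub>R\<omega>\<^esub> \<mm>" using \<mm>(1) zn by (simp add: g_def)
  then have "g v \<noteq> \<zero>\<^bsub>R\<omega>\<^esub>" by metis
  then show ?thesis using mem v by (intro bexI[of _ "\<lambda>x\<in>carrier VM. g x"]) simp_all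
qed

lemma skew_laurent_companion_V: "skew_laurent_companion (R Quot \<mm>\<omega>) d \<alpha> (tau \<sigma> \<omega>)"
  using K.companion_field_axioms K.field_axioms tau_ring_iso
  by (simp add: skew_laurent_companion_def skew_laurent_field_def skew_laurent_field_axioms_def)

lemma etaP_V: "u \<in> K.Kd \<Longrightarrow> skew_laurent_companion.etaP (R Quot \<mm>\<omega>) d \<alpha> (tau \<sigma> \<omega>) u = eta u"
  using eta_eq skew_laurent_companion.etaP_def[OF skew_laurent_companion_V] by simp

text \<open>An isomorphism from the fibre data of V(omega, f) to those of its dual.\<close>

definition intertwiner :: "((nat \<Rightarrow> 'a set) \<Rightarrow> nat \<Rightarrow> 'a set) \<Rightarrow> bool" where
  "intertwiner S \<longleftrightarrow> bij_betw S K.Kd K.Kd \<and>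
    (\<forall>u\<in>K.Kd. \<forall>v\<in>K.Kd. S (S.vadd u v) = S.vadd (S u) (S v)) \<and>
    (\<forall>a\<in>carrier (R Quot \<mm>\<omega>). \<forall>u\<in>K.Kd. S (S.vscale a u) = S.vscale a (S u)) \<and>
    (\<forall>u\<in>K.Kd. S (eta u) = eta_sharp (S u))"

lemma similar_iff_intertwiner:
  "similar (skew_laurent (R Quot \<mm>\<omega>) (tau \<sigma> \<omega>)) (skew_poly (R Quot \<mm>\<omega>) d \<alpha>) (skew_poly (R Quot \<mm>\<omega>) d \<alpha>\<^sub>s) \<longleftrightarrow>
    (\<exists>S. intertwiner S)"
proof -
  interpret V': gwa_V R \<sigma> t star \<omega> \<mm>\<omega> d \<alpha>\<^sub>s by (rule gwa_V_sharp)
  have "(\<forall>u\<in>K.Kd. S (skew_laurent_companion.etaP (R Quot \<mm>\<omega>) d \<alpha> (tau \<sigma> \<omega>) u) =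
        skew_laurent_companion.etaP (R Quot \<mm>\<omega>) d \<alpha>\<^sub>s (tau \<sigma> \<omega>) (S u)) \<longleftrightarrow>
      (\<forall>u\<in>K.Kd. S (eta u) = eta_sharp (S u))"
    if "bij_betw S K.Kd K.Kd" for S
    using etaP_V V'.etaP_V bij_betwE[OF that] by (intro ball_cong HOL.refl) simp
  then show ?thesis
    unfolding similar_iff_companion[OF skew_laurent_companion_V V'.skew_laurent_companion_V]
      intertwiner_def S.vadd_def S.vscale_def
    by (intro ex_cong1) blast
qed

text \<open>Through \<open>S\<close>, V becomes a model for the fibre data of its dual, and the
  resulting isomorphism \<open>h\<close> is the form. Its injectivity gives non-degeneracy in the
  first argument; surjectivity and \<open>dual_separates\<close> give it in the second.\<close>

lemma pseudo_unitarizable_of_intertwiner: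
  assumes S: "intertwiner S" shows "pseudo_unitarizable R star \<sigma> t \<omega> VR.VV"
proof -
  note S = S[unfolded intertwiner_def]
  have model: "gwa_orbit_model R \<sigma> t star \<omega> \<mm>\<omega> VM VX VY (Wd d \<mm>\<omega>) (S \<circ> (\<lambda>v. v \<mm>\<omega>)) eta_sharp"
  proof (rule gwa_orbit_model_transfer[OF gwa_orbit_model_V module_Wd[OF m\<omega>]])
    show "bij_betw S (carrier (Wd d \<mm>\<omega>)) (carrier (Wd d \<mm>\<omega>))" unfolding Wd_simps using S by blast
    fix u assume u: "u \<in> carrier (Wd d \<mm>\<omega>)"
    then have u': "u \<in> K.Kd" by (simp only: Wd_simps)
    show "S (eta u) = eta_sharp (S u)" using S u' by blast
    show "S (r \<odot>\<^bsub>Wd d \<mm>\<omega>\<^esub> u) = r \<odot>\<^bsub>Wd d \<mm>\<omega>\<^esub> S u" if "r \<in> carrier R" for r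
      unfolding smult_eq_vscale using S u' coset_closed[OF m\<omega> that] by blast
    fix v assume "v \<in> carrier (Wd d \<mm>\<omega>)"
    then have "v \<in> K.Kd" by (simp only: Wd_simps)
    then show "S (u \<oplus>\<^bsub>Wd d \<mm>\<omega>\<^esub> v) = S u \<oplus>\<^bsub>Wd d \<mm>\<omega>\<^esub> S v"
      using S u' unfolding Wd_simps(3) S.vadd_def by blast
  qed
  obtain h where bij: "bij_betw h (carrier VM) (carrier VR.DM)"
    and h: "\<And>v w. \<lbrakk>v \<in> carrier VM; w \<in> carrier VM\<rbrakk> \<Longrightarrow> h (v \<oplus>\<^bsub>VM\<^esub> w) = h v \<oplus>\<^bsub>VR.DM\<^esub> h w"
    "\<And>r v. \<lbrakk>r \<in> carrier R; v \<in> carrier VM\<rbrakk> \<Longrightarrow> h (r \<odot>\<^bsub>VM\<^esub> v) = r \<odot>\<^bsub>VR.DM\<^esub> h v"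
    "\<And>v. v \<in> carrier VM \<Longrightarrow> h (VX v) = VR.DX (h v)" "\<And>v. v \<in> carrier VM \<Longrightarrow> h (VY v) = VR.DY (h v)"
    using gwa_orbit_model_isomorphic[OF model gwa_orbit_model_dual] by blast
  have hc: "h v \<in> carrier VR.DM" if "v \<in> carrier VM" for v using bij_betwE[OF bij] that by blast
  have "admissible_form R star \<sigma> t \<omega> VR.VV h"
    by (rule VR.form_of_dual_hom[OF hc h])
  moreover have "nondegenerate_form R \<omega> VR.VV h"
    unfolding nondegenerate_form_def
  proof (intro ballI impI)
    interpret D: module R VR.DM by (rule VR.module_DM)
    fix v assume "v \<in> carrier VR.VV" and "v \<noteq> \<zero>\<^bsub>VR.VV\<^esub>"
    then have v: "v \<in> carrier VM" and nz: "v \<noteq> \<zero>\<^bsub>VM\<^esub>" by simp_all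
    obtain \<phi> where \<phi>: "\<phi> \<in> carrier VR.DM" "\<phi> v \<noteq> \<zero>\<^bsub>R\<omega>\<^esub>" using dual_separates[OF v nz] by blast
    have "\<phi> \<in> h ` carrier VM" using bij_betw_imp_surj_on[OF bij] \<phi>(1) by simp
    then obtain w1 where w1: "w1 \<in> carrier VM" "h w1 = \<phi>" by (rule imageE) simp
    have h0: "h \<zero>\<^bsub>VM\<^esub> = \<zero>\<^bsub>VR.DM\<^esub>"
      using h(1)[of "\<zero>\<^bsub>VM\<^esub>" "\<zero>\<^bsub>VM\<^esub>"] hc[of "\<zero>\<^bsub>VM\<^esub>"] D.M.add.r_cancel_one'[of "h \<zero>\<^bsub>VM\<^esub>" "h \<zero>\<^bsub>VM\<^esub>"] by simp
    have "h v \<noteq> \<zero>\<^bsub>VR.DM\<^esub>"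
    proof
      assume "h v = \<zero>\<^bsub>VR.DM\<^esub>"
      then have "h v = h \<zero>\<^bsub>VM\<^esub>" using h0 by simp
      then have "v = \<zero>\<^bsub>VM\<^esub>" using inj_onD[OF bij_betw_imp_inj_on[OF bij]] v by simp
      then show False using nz by simp
    qed
    then obtain w2 where w2: "w2 \<in> carrier VM" "h v w2 \<noteq> \<zero>\<^bsub>R\<omega>\<^esub>"
      using VR.DM_eqI[OF hc[OF v] D.M.zero_closed] VR.DM_ops(2) by metis
    show "\<exists>w1\<in>carrier VR.VV. \<exists>w2\<in>carrier VR.VV. h w1 v \<noteq> \<zero>\<^bsub>R\<omega>\<^esub> \<and> h v w2 \<noteq> \<zero>\<^bsub>R\<omega>\<^esub>"
      using w1 w2 \<phi>(2) by auto
  qed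
  ultimately show ?thesis
    unfolding pseudo_unitarizable_def using weight_module_V weight_support_V by blast
qed

text \<open>\<open>S\<close> reads off the coordinates of the functional F(v, -) for
  \<open>v\<close> of weight \<open>\<mm>\<omega>\<close>. Non-degeneracy makes it injective, and on
  K^d this suffices for a bijection.\<close>

lemma intertwiner_of_form:
  assumes F: "admissible_form R star \<sigma> t \<omega> VR.VV F" and nd: "nondegenerate_form R \<omega> VR.VV F"
  shows "\<exists>S. intertwiner S"
proof -
  define h where "h v = (\<lambda>w\<in>carrier VM. F v w)" for v
  note h = VR.dual_hom_of_form[OF F, folded h_def]
  interpret D: gwa_orbit_model R \<sigma> t star \<omega> \<mm>\<omega> VR.DM VR.DX VR.DY "Wd d \<mm>\<omega>" kappa_sharp eta_sharp
    by (rule gwa_orbit_model_dual)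
  define S where "S u = kappa_sharp (h (single \<mm>\<omega> u))" for u
  have hs: "h (single \<mm>\<omega> u) \<in> carrier VR.DM" if "u \<in> K.Kd" for u
    using h(1)[OF single_mem[OF that]] .
  have closed: "S u \<in> K.Kd" if "u \<in> K.Kd" for u
    using D.kappa_closed[OF hs[OF that]] unfolding S_def Wd_simps .
  have add: "S (S.vadd u v) = S.vadd (S u) (S v)" if "u \<in> K.Kd" "v \<in> K.Kd" for u v
  proof -
    have "S (S.vadd u v) = S u \<oplus>\<^bsub>Wd d \<mm>\<omega>\<^esub> S v"
      unfolding S_def single_add[OF that] h(2)[OF single_mem[OF that(1)] single_mem[OF that(2)]]
      by (rule D.kappa_add[OF hs[OF that(1)] hs[OF that(2)]])
    then show ?thesis by (simp only: S.vadd_def Wd_simps(3))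
  qed
  have smult: "S (S.vscale (\<mm>\<omega> +> r) u) = S.vscale (\<mm>\<omega> +> r) (S u)" if "r \<in> carrier R" "u \<in> K.Kd" for r u
  proof -
    have "S (S.vscale (\<mm>\<omega> +> r) u) = r \<odot>\<^bsub>Wd d \<mm>\<omega>\<^esub> S u"
      unfolding S_def single_smult[OF that(2,1)] h(3)[OF that(1) single_mem[OF that(2)]]
      by (rule D.kappa_smult[OF that(1) hs[OF that(2)]])
    then show ?thesis by (simp only: smult_eq_vscale)
  qed
  have scale: "S (S.vscale a u) = S.vscale a (S u)" if "a \<in> carrier (R Quot \<mm>\<omega>)" "u \<in> K.Kd" for a u
    using Km_repr[OF that(1)] smult that(2) by blast
  have hY: "h ((VY ^^ k) v) = (VR.DY ^^ k) (h v)" if "v \<in> carrier VM" for k v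
  proof (induction k)
    case (Suc k)
    then show ?case using h(4)[of "(VY ^^ k) v"] that by (simp only: funpow.simps comp_apply VR.Y_pow_closed)
  qed simp
  have eta: "S (eta u) = eta_sharp (S u)" if u: "u \<in> K.Kd" for u
    unfolding S_def VY_pow_single[OF u, symmetric] hY[OF single_mem[OF u]] by (rule D.kappa_Y[OF hs[OF u]])
  \<comment> \<open>The functional of \<open>single \<mm>\<omega> u\<close> has weight
    \<open>\<mm>\<omega>\<close>, so zero coordinates make it zero, and non-degeneracy makes the
    vector zero.\<close>
  have ker: "u = (\<lambda>i\<in>{1..d}. \<zero>\<^bsub>R Quot \<mm>\<omega>\<^esub>)"
    if u: "u \<in> K.Kd" and 0: "S u = (\<lambda>i\<in>{1..d}. \<zero>\<^bsub>R Quot \<mm>\<omega>\<^esub>)" for u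
  proof -
    have "h (single \<mm>\<omega> u) = \<zero>\<^bsub>VR.DM\<^esub>"
    proof (rule D.kappa_ker[OF hs[OF u]])
      show "kappa_sharp (h (single \<mm>\<omega> u)) = \<zero>\<^bsub>Wd d \<mm>\<omega>\<^esub>" using 0 unfolding S_def Wd_simps .
      fix r assume r: "r \<in> \<mm>\<omega>"
      then have rc: "r \<in> carrier R" using orbit_subset[OF m\<omega>] by blast
      have "h \<zero>\<^bsub>VM\<^esub> = \<zero>\<^bsub>VR.DM\<^esub>"
        using h(2)[of "\<zero>\<^bsub>VM\<^esub>" "\<zero>\<^bsub>VM\<^esub>"] h(1)[of "\<zero>\<^bsub>VM\<^esub>"]
          D.M.add.r_cancel_one'[of "h \<zero>\<^bsub>VM\<^esub>" "h \<zero>\<^bsub>VM\<^esub>"] by simp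
      then show "r \<odot>\<^bsub>VR.DM\<^esub> h (single \<mm>\<omega> u) = \<zero>\<^bsub>VR.DM\<^esub>"
        using h(3)[OF rc single_mem[OF u]] single_weight[OF u r] by metis
    qed
    then have h0: "h (single \<mm>\<omega> u) w = \<zero>\<^bsub>R\<omega>\<^esub>" if "w \<in> carrier VM" for w
      by (simp only: VR.DM_ops(2)[OF that])
    have "F (single \<mm>\<omega> u) w = \<zero>\<^bsub>R\<omega>\<^esub>" if w: "w \<in> carrier VM" for w
    proof -
      have "F (single \<mm>\<omega> u) w = h (single \<mm>\<omega> u) w" using w by (simp add: h_def)
      then show ?thesis unfolding h0[OF w] .
    qed
    then have "single \<mm>\<omega> u = \<zero>\<^bsub>VM\<^esub>"
      using nd single_mem[OF u] unfolding nondegenerate_form_def by auto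
    then have "single \<mm>\<omega> u \<mm>\<omega> = \<zero>\<^bsub>VM\<^esub> \<mm>\<omega>" by simp
    then show ?thesis unfolding single_nth[OF m\<omega>] zero_VM_nth[OF m\<omega>] Wd_simps by simp
  qed
  have "inj_on S K.Kd"
  proof (rule inj_onI)
    fix u v assume u: "u \<in> K.Kd" and v: "v \<in> K.Kd" and eq: "S u = S v"
    \<comment> \<open>Differences are written with the scalar -1, because \<open>S\<close> is known
      to respect \<open>vadd\<close> and \<open>vscale\<close>.\<close>
    let ?m = "\<ominus>\<^bsub>R Quot \<mm>\<omega>\<^esub> \<one>\<^bsub>R Quot \<mm>\<omega>\<^esub>"
    let ?w = "S.vadd u (S.vscale ?m v)"
    have m: "?m \<in> carrier (R Quot \<mm>\<omega>)" by simp
    have w: "?w \<in> K.Kd" using u v m by simp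
    have diff: "S.vadd x (S.vscale ?m y) i = x i \<ominus>\<^bsub>R Quot \<mm>\<omega>\<^esub> y i"
      if "x \<in> K.Kd" "y \<in> K.Kd" "1 \<le> i" "i \<le> d" for x y i
      using K.Kd_nth[OF that(2-4)] that by (simp add: S.vadd_nth S.vscale_nth K.l_minus K.minus_eq)
    have "S ?w = S.vadd (S u) (S.vscale ?m (S v))" using u v m by (simp add: add scale)
    also have "\<dots> = (\<lambda>i\<in>{1..d}. \<zero>\<^bsub>R Quot \<mm>\<omega>\<^esub>)"
    proof (rule K.Kd_eqI)
      fix i assume i: "1 \<le> i" "i \<le> d"
      show "S.vadd (S u) (S.vscale ?m (S v)) i = (\<lambda>i\<in>{1..d}. \<zero>\<^bsub>R Quot \<mm>\<omega>\<^esub>) i"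
        using diff[OF closed[OF u] closed[OF v] i] eq K.Kd_nth[OF closed[OF v] i] i by (simp add: K.minus_eq K.r_neg)
    qed (use closed u v m in auto)
    finally have z: "?w = (\<lambda>i\<in>{1..d}. \<zero>\<^bsub>R Quot \<mm>\<omega>\<^esub>)" by (rule ker[OF w])
    show "u = v"
    proof (rule K.Kd_eqI[OF u v])
      fix i assume i: "1 \<le> i" "i \<le> d"
      have "u i \<ominus>\<^bsub>R Quot \<mm>\<omega>\<^esub> v i = \<zero>\<^bsub>R Quot \<mm>\<omega>\<^esub>" using diff[OF u v i] fun_cong[OF z, of i] i by simp
      then show "u i = v i"
        using K.Kd_nth[OF u i] K.Kd_nth[OF v i] K.minus_equality[of "u i" "\<ominus>\<^bsub>R Quot \<mm>\<omega>\<^esub> v i"]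
        by (simp add: K.minus_eq)
    qed
  qed
  then have "bij_betw S K.Kd K.Kd"
    using S.injective_linear_surjective[of S] closed add scale by blast
  then have "intertwiner S" unfolding intertwiner_def using add scale eta by blast
  then show ?thesis by blast
qed

lemma pseudo_unitarizable_iff_similar:
  "pseudo_unitarizable R star \<sigma> t \<omega> VR.VV \<longleftrightarrow>
    similar (skew_laurent (R Quot \<mm>\<omega>) (tau \<sigma> \<omega>)) (skew_poly (R Quot \<mm>\<omega>) d \<alpha>) (skew_poly (R Quot \<mm>\<omega>) d \<alpha>\<^sub>s)"
  unfolding similar_iff_intertwiner
  using pseudo_unitarizable_of_intertwiner intertwiner_of_form unfolding pseudo_unitarizable_def by blast

end

theorem theorem5p6:
  fixes R :: "('a, 'c) ring_scheme"
    and star \<sigma> :: "'a \<Rightarrow> 'a" and t :: 'a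
    and \<omega> :: "'a set set" and \<mm>\<omega> :: "'a set"
    and d :: nat and \<alpha> :: "nat \<Rightarrow> 'a set"
  assumes "cring R"
    and "star \<in> ring_iso R R" and "\<forall>r\<in>carrier R. star (star r) = r"
    and "\<sigma> \<in> ring_iso R R" and "\<forall>r\<in>carrier R. \<sigma> (star r) = star (\<sigma> r)"
    and "t \<in> carrier R" and "star t = t"
    and "\<omega> \<in> Orbits R \<sigma>" and "finite \<omega>" and "real_orbit star \<omega>" and "breaks t \<omega> = {}"
    and "\<mm>\<omega> \<in> \<omega>"
  defines "A \<equiv> gwa R \<sigma> t"
    and "K \<equiv> R Quot \<mm>\<omega>"
    and "\<tau> \<equiv> tau \<sigma> \<omega>"
    and "bar \<equiv> (\<lambda>c. star ` c)"
    and "\<xi> \<equiv> xi R \<sigma> t \<omega> \<mm>\<omega>"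
  defines "P \<equiv> skew_laurent K \<tau>"
    and "\<alpha>' \<equiv> sharp_coeff K \<tau> bar \<xi> d \<alpha>"
  defines "f \<equiv> skew_poly K d \<alpha>"
    and "f' \<equiv> skew_poly K d \<alpha>'"
    and "V \<equiv> V_omega R \<sigma> t \<omega> \<mm>\<omega> d \<alpha>"
    and "V' \<equiv> V_omega R \<sigma> t \<omega> \<mm>\<omega> d \<alpha>'"
  assumes "\<forall>k\<le>d. \<alpha> k \<in> carrier K"
    and "\<alpha> 0 \<noteq> \<zero>\<^bsub>K\<^esub>" and "\<alpha> d \<noteq> \<zero>\<^bsub>K\<^esub>"
    and "indecomposable_elem P f"
  shows "module_isomorphic A (finitistic_dual R star \<sigma> t \<omega> V) V' \<and>
    (pseudo_unitarizable R star \<sigma> t \<omega> V \<longleftrightarrow> similar P f f')"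
proof -
  interpret gwa_V R \<sigma> t star \<omega> \<mm>\<omega> d \<alpha>
    using assms unfolding K_def
    by (simp add: gwa_V_def gwa_V_axioms_def gwa_orbit_def gwa_orbit_axioms_def gwa_ring_def gwa_ring_axioms_def)
  show ?thesis
    unfolding A_def V_def V'_def f_def f'_def P_def \<alpha>'_def K_def \<tau>_def bar_def \<xi>_def V_omega_eq
    using dual_isomorphic pseudo_unitarizable_iff_similar by blast
qed

end
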